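(* Assume $\mathcal{D}$ is local. Let $(K,\partial)$ be a $\mathcal{D}$-field with $K$ a large field. The following are equivalent: (1) $(K,\partial)\models\mathrm{UC}_{\mathcal{D}}$; (2) whenever $(V,s)$ is an affine, $K$-irreducible D-variety such that $V$ has a smooth $K$-rational point, the set of $K$-rational sharp points of $(V,s)$ is Zariski dense in $V$; (3) whenever $(V,s)$ is an affine, $K$-irreducible D-variety such that $V$ has a smooth $K$-rational point, $(V,s)$ has a $K$-rational sharp point; (4) whenever $(V,s)$ is a smooth, affine, $K$-irreducible D-variety such that $V$ has a $K$-rational point, $(V,s)$ has a $K$-rational sharp point; (5) whenever $(L,\delta)$ is a $\mathcal{D}$-field extension of $(K,\partial)$ such that $K$ is existentially closed in $L$ as a field, $(K,\partial)$ is existentially closed in $(L,\delta)$ as a $\mathcal{D}$-field.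
   Context: All fields have characteristic $0$. Fix a field $k$ of characteristic $0$ and a finite-dimensional local $k$-algebra $\mathcal{D}$ with $k$-basis $\varepsilon_0,\dots,\varepsilon_l$ and the residue map $\pi:\mathcal{D}\to k$, $\pi(\varepsilon_0)=1$, $\pi(\varepsilon_i)=0$ for $i\ge1$. A $\mathcal{D}$-ring is a $k$-algebra $R$ with a $k$-algebra homomorphism $\partial:R\to R\otimes_k\mathcal{D}$, $(\mathrm{id}_R\otimes\pi)\circ\partial=\mathrm{id}_R$; $\partial(r)=r\otimes\varepsilon_0+\sum_{i\ge1}\partial_i(r)\otimes\varepsilon_i$ defines operators $\partial_1,\dots,\partial_l$; language $\mathcal{L}_{\mathrm{ring}}(\partial)=\{+,-,\cdot,0,1,(c_a)_{a\in k},\partial_1,\dots,\partial_l\}$. A field $K$ is large if every $K$-irreducible variety with a smooth $K$-rational point has a Zariski dense set of $K$-rational points. Prolongation: for a $\mathcal{D}$-field $(K,\partial)$ and affine $X=\mathrm{Spec}\,K[x]/I$, $\tau X=\mathrm{Spec}\,K[x^0,\dots,x^l]/I'$ with $I'$ generated by all $f^{(j)}$, where for $f\in I$, $f^\partial$ is $f$ with $\partial$ applied to its coefficients and $f^\partial(\sum_jx^j\varepsilon_j)=\sum_jf^{(j)}(x^0,\dots,x^l)\varepsilon_j$; $\hat\pi:\tau X\to X$ is the projection to $x^0$; for a $\mathcal{D}$-field extension $(L,\delta)$, $\nabla:X(L)\to\tau X(L)$, $a\mapsto(a,\delta_1(a),\dots,\delta_l(a))$. $\mathrm{UC}_{\mathcal{D}}$: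 the theory of $\mathcal{D}$-fields $(K,\partial)$ such that whenever $X$ is a $K$-irreducible affine variety, $Y\subseteq\tau X$ is a $K$-irreducible affine variety with $\hat\pi(Y)$ Zariski dense in $X$ and $Y$ having a smooth $K$-rational point, every nonempty Zariski open $U\subseteq Y$ over $K$ contains $\nabla(a)$ for some $a\in X(K)$. A D-variety over $(K,\partial)$ is a pair $(V,s)$ with $V$ a $K$-variety and $s:V\to\tau V$ a morphism over $K$ with $\hat\pi\circ s=\mathrm{id}_V$; it is affine, $K$-irreducible, smooth if $V$ is. For a $\mathcal{D}$-field extension $(L,\delta)$, the $L$-rational sharp points are $\{a\in V(L):\nabla a=s(a)\}$. *)

theory Defs
  imports
    "HOL-Algebra.Algebraic_Closure_Type"
    "HOL-Library.Poly_Mapping"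
    "HOL-Library.Function_Algebras"
    "HOL-Analysis.Abstract_Topology"
begin

section \<open>Multivariate polynomials\<close>

type_synonym ('v, 'a) mpol = "('v \<Rightarrow>\<^sub>0 nat) \<Rightarrow>\<^sub>0 'a"

definition mconst :: "'a::zero \<Rightarrow> ('v, 'a) mpol" where
  "mconst c = Poly_Mapping.single 0 c"

definition mvar :: "'v \<Rightarrow> ('v, 'a::zero_neq_one) mpol" where
  "mvar v = Poly_Mapping.single (Poly_Mapping.single v 1) 1"

text \<open>Evaluation at \<open>x\<close>, the coefficients being transported by \<open>c\<close>. With \<open>c = mconst\<close> this is
  substitution of polynomials for the variables.\<close>

definition mp_eval :: "('a::zero \<Rightarrow> 'b::comm_ring_1) \<Rightarrow> ('v \<Rightarrow> 'b) \<Rightarrow> ('v, 'a) mpol \<Rightarrow> 'b" where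
  "mp_eval c x p = (\<Sum>m\<in>Poly_Mapping.keys p. c (Poly_Mapping.lookup p m) *
      (\<Prod>v\<in>Poly_Mapping.keys m. x v ^ Poly_Mapping.lookup m v))"

definition mp_deriv :: "'v \<Rightarrow> ('v, 'a::comm_ring_1) mpol \<Rightarrow> ('v, 'a) mpol" where
  "mp_deriv v p = (\<Sum>m\<in>Poly_Mapping.keys p.
      Poly_Mapping.single (m - Poly_Mapping.single v 1)
        (of_nat (Poly_Mapping.lookup m v) * Poly_Mapping.lookup p m))"

definition mpols :: "'v set \<Rightarrow> ('v, 'a::zero) mpol set" where
  "mpols N = {p. \<forall>m\<in>Poly_Mapping.keys p. Poly_Mapping.keys m \<subseteq> N}"

text \<open>The ring \<open>K[x\<^sub>v : v \<in> N]\<close>.\<close>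

definition mpol_ring :: "'v set \<Rightarrow> ('v, 'a::comm_ring_1) mpol ring" where
  "mpol_ring N = \<lparr>carrier = mpols N, monoid.mult = (*), one = 1, ring.zero = 0, add = (+)\<rparr>"

lemma mpols_0 [simp]: "0 \<in> mpols N"
  by (simp add: mpols_def)

lemma mpols_1 [simp]: "(1 :: ('v, 'a::comm_ring_1) mpol) \<in> mpols N"
  by (simp add: mpols_def)

lemma mpols_add: "p \<in> mpols N \<Longrightarrow> q \<in> mpols N \<Longrightarrow> p + q \<in> mpols N"
  using Poly_Mapping.keys_add[of p q] by (auto simp: mpols_def)

lemma mpols_uminus: "(p :: ('v, 'a::comm_ring_1) mpol) \<in> mpols N \<Longrightarrow> - p \<in> mpols N"
  by (auto simp: mpols_def in_keys_iff)

lemma mpols_mult: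
  fixes p q :: "('v, 'a::comm_ring_1) mpol"
  assumes "p \<in> mpols N" "q \<in> mpols N"
  shows "p * q \<in> mpols N"
proof -
  have "Poly_Mapping.keys m \<subseteq> N" if "m \<in> Poly_Mapping.keys (p * q)" for m
  proof -
    from that Poly_Mapping.keys_mult[of p q] obtain a b
      where "m = a + b" "a \<in> Poly_Mapping.keys p" "b \<in> Poly_Mapping.keys q"
      by blast
    with assms Poly_Mapping.keys_add[of a b] show ?thesis
      unfolding mpols_def by blast
  qed
  then show ?thesis by (auto simp: mpols_def)
qed

lemma cring_mpol_ring: "cring (mpol_ring N :: ('v, 'a::comm_ring_1) mpol ring)"
proof (rule cringI)
  show "abelian_group (mpol_ring N :: ('v, 'a) mpol ring)"
  proof (rule abelian_groupI)
    fix x :: "('v, 'a) mpol" assume "x \<in> carrier (mpol_ring N)"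
    then show "\<exists>y\<in>carrier (mpol_ring N). y \<oplus>\<^bsub>mpol_ring N\<^esub> x = \<zero>\<^bsub>mpol_ring N\<^esub>"
      by (intro bexI[of _ "- x"]) (auto simp: mpol_ring_def mpols_uminus)
  qed (auto simp: mpol_ring_def mpols_add algebra_simps)
  show "Group.comm_monoid (mpol_ring N :: ('v, 'a) mpol ring)"
    by (rule comm_monoidI) (auto simp: mpol_ring_def mpols_mult algebra_simps)
qed (auto simp: mpol_ring_def algebra_simps)


section \<open>Affine varieties\<close>

text \<open>A set \<open>N\<close> of variables and an ideal \<open>I\<close> of \<open>K[N]\<close> represent \<open>Spec K[N]/I\<close>, whose
  points are taken to be the primes of \<open>K[N]\<close> containing \<open>I\<close>.\<close>

definition zariski :: "'v set \<Rightarrow> ('v, 'a::comm_ring_1) mpol set \<Rightarrow> ('v, 'a) mpol set topology" where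
  "zariski N I = topology (\<lambda>U. \<exists>S \<subseteq> mpols N.
      U = {p. primeideal p (mpol_ring N) \<and> I \<subseteq> p \<and> \<not> S \<subseteq> p})"

lemma openin_zariski:
  fixes I :: "('v, 'a::comm_ring_1) mpol set"
  shows "openin (zariski N I) U \<longleftrightarrow>
    (\<exists>S \<subseteq> mpols N. U = {p. primeideal p (mpol_ring N) \<and> I \<subseteq> p \<and> \<not> S \<subseteq> p})"
proof -
  define D where "D S = {p. primeideal p (mpol_ring N) \<and> I \<subseteq> p \<and> \<not> S \<subseteq> p}" for S
  have "istopology (\<lambda>U. \<exists>S \<subseteq> mpols N. U = D S)"
    unfolding istopology_def
  proof (intro conjI allI impI)
    fix U V assume "\<exists>S\<subseteq>mpols N. U = D S" "\<exists>S\<subseteq>mpols N. V = D S"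
    then obtain S T where S: "S \<subseteq> mpols N" "U = D S" and T: "T \<subseteq> mpols N" "V = D T"
      by blast
    have "U \<inter> V = D {s * t | s t. s \<in> S \<and> t \<in> T}"
    proof (intro equalityI subsetI)
      fix p assume "p \<in> U \<inter> V"
      then obtain s t where st: "s \<in> S" "s \<notin> p" "t \<in> T" "t \<notin> p"
        and p: "primeideal p (mpol_ring N)" "I \<subseteq> p"
        using S T by (auto simp: D_def)
      with primeideal.I_prime[OF p(1), of s t] S(1) T(1) have "s * t \<notin> p"
        by (auto simp: mpol_ring_def)
      with st p show "p \<in> D {s * t | s t. s \<in> S \<and> t \<in> T}"
        by (auto simp: D_def)
    next
      fix p assume "p \<in> D {s * t | s t. s \<in> S \<and> t \<in> T}"
      then obtain s t where st: "s \<in> S" "t \<in> T" "s * t \<notin> p"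
        and p: "primeideal p (mpol_ring N)" "I \<subseteq> p"
        by (auto simp: D_def)
      have i: "ideal p (mpol_ring N)"
        using p(1) by (rule primeideal.axioms(1))
      from ideal.I_l_closed[OF i, of t s] ideal.I_r_closed[OF i, of s t] st S(1) T(1)
      have "s \<notin> p" "t \<notin> p"
        by (auto simp: mpol_ring_def)
      with st p show "p \<in> U \<inter> V"
        using S T by (auto simp: D_def)
    qed
    moreover have "{s * t | s t. s \<in> S \<and> t \<in> T} \<subseteq> mpols N"
      using S T by (auto intro: mpols_mult)
    ultimately show "\<exists>S\<subseteq>mpols N. U \<inter> V = D S"
      by blast
  next
    fix \<K> assume "\<forall>K\<in>\<K>. \<exists>S\<subseteq>mpols N. K = D S"
    then obtain f where f: "\<And>K. K \<in> \<K> \<Longrightarrow> f K \<subseteq> mpols N \<and> K = D (f K)"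
      by metis
    have "\<Union>\<K> = D (\<Union>K\<in>\<K>. f K)"
    proof (intro equalityI subsetI)
      fix p assume "p \<in> \<Union>\<K>"
      then obtain K where K: "K \<in> \<K>" "p \<in> K" by blast
      then have "p \<in> D (f K)" using f by blast
      with K(1) show "p \<in> D (\<Union>K\<in>\<K>. f K)"
        by (auto simp: D_def)
    next
      fix p assume "p \<in> D (\<Union>K\<in>\<K>. f K)"
      then obtain K where "K \<in> \<K>" "p \<in> D (f K)"
        by (auto simp: D_def)
      then show "p \<in> \<Union>\<K>" using f by blast
    qed
    moreover have "(\<Union>K\<in>\<K>. f K) \<subseteq> mpols N"
      using f by blast
    ultimately show "\<exists>S\<subseteq>mpols N. \<Union>\<K> = D S"
      by blast
  qed
  then show ?thesis
    by (simp add: zariski_def topology_inverse' D_def)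
qed

definition irreducible_space :: "'a topology \<Rightarrow> bool" where
  "irreducible_space T \<longleftrightarrow> topspace T \<noteq> {} \<and>
     (\<forall>A B. closedin T A \<and> closedin T B \<and> A \<union> B = topspace T \<longrightarrow>
        A = topspace T \<or> B = topspace T)"

text \<open>Varieties are reduced, hence the radicality condition.\<close>

definition affine_variety :: "'v set \<Rightarrow> ('v, 'a::field) mpol set \<Rightarrow> bool" where
  "affine_variety N I \<longleftrightarrow> finite N \<and> ideal I (mpol_ring N) \<and>
     (\<forall>f\<in>mpols N. \<forall>r::nat. f ^ r \<in> I \<longrightarrow> f \<in> I)"

definition irreducible_variety :: "'v set \<Rightarrow> ('v, 'a::field) mpol set \<Rightarrow> bool" where
  "irreducible_variety N I \<longleftrightarrow> affine_variety N I \<and> irreducible_space (zariski N I)"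

text \<open>The points with coordinates in an extension \<open>c : K \<rightarrow> F\<close>; \<open>c = id\<close> gives \<open>X(K)\<close> and
  \<open>c = to_ac\<close> gives the points over the algebraic closure.\<close>

definition points :: "('a::field \<Rightarrow> 'b::field) \<Rightarrow> 'v set \<Rightarrow> ('v, 'a) mpol set \<Rightarrow> ('v \<Rightarrow> 'b) set" where
  "points c N I = {x \<in> N \<rightarrow>\<^sub>E UNIV. \<forall>f\<in>I. mp_eval c x f = 0}"

definition rational_points :: "'v set \<Rightarrow> ('v, 'a::field) mpol set \<Rightarrow> ('v \<Rightarrow> 'a) set" where
  "rational_points N I = points id N I"

definition point_ideal :: "'v set \<Rightarrow> ('v \<Rightarrow> 'a::field) \<Rightarrow> ('v, 'a) mpol set" where
  "point_ideal N x = {f \<in> mpols N. mp_eval id x f = 0}"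

definition zariski_dense_in ::
    "'v set \<Rightarrow> ('v, 'a::field) mpol set \<Rightarrow> ('v, 'a) mpol set set \<Rightarrow> bool" where
  "zariski_dense_in N I P \<longleftrightarrow> zariski N I closure_of P = topspace (zariski N I)"

text \<open>The dimension of an irreducible variety is the transcendence degree over \<open>K\<close> of its
  coordinate ring.\<close>

definition alg_independent_mod ::
    "('v, 'a::field) mpol set \<Rightarrow> nat \<Rightarrow> (nat \<Rightarrow> ('v, 'a) mpol) \<Rightarrow> bool" where
  "alg_independent_mod I d g \<longleftrightarrow> (\<forall>F\<in>mpols {..<d}. F \<noteq> 0 \<longrightarrow> mp_eval mconst g F \<notin> I)"

definition variety_dim :: "'v set \<Rightarrow> ('v, 'a::field) mpol set \<Rightarrow> nat" where
  "variety_dim N I = Max {d. \<exists>g. g ` {..<d} \<subseteq> mpols N \<and> alg_independent_mod I d g}"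

text \<open>Smoothness of an irreducible variety at a point: the Jacobian matrix of (the equations in)
  \<open>I\<close> has rank \<open>card N - dim\<close>.\<close>

definition smooth_at ::
    "('a::field \<Rightarrow> 'b::field) \<Rightarrow> 'v set \<Rightarrow> ('v, 'a) mpol set \<Rightarrow> ('v \<Rightarrow> 'b) \<Rightarrow> bool" where
  "smooth_at c N I x \<longleftrightarrow>
     vector_space.dim (\<lambda>(a::'b) (u :: 'v \<Rightarrow> 'b). (\<lambda>v. a * u v))
       ((\<lambda>f v. mp_eval c x (mp_deriv v f)) ` I) + variety_dim N I = card N"

definition has_smooth_rational_point :: "'v set \<Rightarrow> ('v, 'a::field) mpol set \<Rightarrow> bool" where
  "has_smooth_rational_point N I \<longleftrightarrow> (\<exists>x\<in>rational_points N I. smooth_at id N I x)"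

definition smooth_variety :: "'v set \<Rightarrow> ('v, 'a::field) mpol set \<Rightarrow> bool" where
  "smooth_variety N I \<longleftrightarrow> (\<forall>x\<in>points to_ac N I. smooth_at to_ac N I x)"

text \<open>Affine varieties suffice here: a smooth rational point of an arbitrary irreducible variety
  has an affine open neighbourhood, which is dense.\<close>

definition large_field :: "'a::field itself \<Rightarrow> bool" where
  "large_field _ \<longleftrightarrow> (\<forall>n (I :: (nat, 'a) mpol set).
     irreducible_variety {..<n} I \<and> has_smooth_rational_point {..<n} I \<longrightarrow>
     zariski_dense_in {..<n} I (point_ideal {..<n} ` rational_points {..<n} I))"


section \<open>The algebra \<open>\<D>\<close> and \<open>\<D>\<close>-rings\<close>

record ('k, 'd) based_algebra =
  smul :: "'k \<Rightarrow> 'd \<Rightarrow> 'd"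
  eps :: "nat \<Rightarrow> 'd"
  len :: nat
  resid :: "'d \<Rightarrow> 'k"

definition finite_local_algebra :: "('k::field_char_0, 'd::comm_ring_1) based_algebra \<Rightarrow> bool" where
  "finite_local_algebra \<D> \<longleftrightarrow>
     vector_space (smul \<D>) \<and>
     (\<forall>a x y. smul \<D> a (x * y) = smul \<D> a x * y) \<and>
     inj_on (eps \<D>) {..len \<D>} \<and>
     \<not> Modules.module.dependent (smul \<D>) (eps \<D> ` {..len \<D>}) \<and>
     Modules.module.span (smul \<D>) (eps \<D> ` {..len \<D>}) = UNIV \<and>
     (\<exists>!M. maximalideal M (ring_of_type_algebra :: 'd ring)) \<and>
     resid \<D> \<in> ring_hom ring_of_type_algebra ring_of_type_algebra \<and>
     (\<forall>a x. resid \<D> (smul \<D> a x) = a * resid \<D> x) \<and>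
     resid \<D> (eps \<D> 0) = 1 \<and>
     (\<forall>i\<in>{1..len \<D>}. resid \<D> (eps \<D> i) = 0)"

definition coord :: "('k::field, 'd::comm_ring_1) based_algebra \<Rightarrow> 'd \<Rightarrow> nat \<Rightarrow> 'k" where
  "coord \<D> x m = Modules.module.representation (smul \<D>) (eps \<D> ` {..len \<D>}) x (eps \<D> m)"

text \<open>\<open>R \<otimes>\<^sub>k \<D>\<close> for a \<open>k\<close>-algebra \<open>R\<close> with structure map \<open>\<iota>\<close>: the function \<open>u\<close> stands for
  \<open>\<Sum>\<^sub>j u j \<otimes> \<epsilon>\<^sub>j\<close>.\<close>

definition base_change ::
    "('k::field, 'd::comm_ring_1) based_algebra \<Rightarrow> 'r ring \<Rightarrow> ('k \<Rightarrow> 'r) \<Rightarrow> (nat \<Rightarrow> 'r) ring" where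
  "base_change \<D> R \<iota> = \<lparr>
     carrier = {..len \<D>} \<rightarrow>\<^sub>E carrier R,
     monoid.mult = (\<lambda>u v. \<lambda>m\<in>{..len \<D>}. \<Oplus>\<^bsub>R\<^esub>i\<in>{..len \<D>}. \<Oplus>\<^bsub>R\<^esub>j\<in>{..len \<D>}.
        \<iota> (coord \<D> (eps \<D> i * eps \<D> j) m) \<otimes>\<^bsub>R\<^esub> (u i \<otimes>\<^bsub>R\<^esub> v j)),
     one = (\<lambda>m\<in>{..len \<D>}. \<iota> (coord \<D> 1 m)),
     ring.zero = (\<lambda>m\<in>{..len \<D>}. \<zero>\<^bsub>R\<^esub>),
     add = (\<lambda>u v. \<lambda>m\<in>{..len \<D>}. u m \<oplus>\<^bsub>R\<^esub> v m)\<rparr>"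

text \<open>\<open>\<Delta> r j\<close> is \<open>\<partial>\<^sub>j(r)\<close>, the coefficient of \<open>\<epsilon>\<^sub>j\<close> in \<open>\<partial>(r)\<close>. The last condition is
  \<open>(id \<otimes> \<pi>) \<circ> \<partial> = id\<close>, that is, \<open>\<partial>\<^sub>0 = id\<close>.\<close>

definition D_ring ::
    "('k::field, 'd::comm_ring_1) based_algebra \<Rightarrow> 'r ring \<Rightarrow> ('k \<Rightarrow> 'r) \<Rightarrow> ('r \<Rightarrow> nat \<Rightarrow> 'r) \<Rightarrow> bool" where
  "D_ring \<D> R \<iota> \<Delta> \<longleftrightarrow>
     cring R \<and>
     \<iota> \<in> ring_hom ring_of_type_algebra R \<and>
     \<Delta> \<in> ring_hom R (base_change \<D> R \<iota>) \<and>
     (\<forall>a. \<forall>r\<in>carrier R. \<Delta> (\<iota> a \<otimes>\<^bsub>R\<^esub> r) = (\<lambda>j\<in>{..len \<D>}. \<iota> a \<otimes>\<^bsub>R\<^esub> \<Delta> r j)) \<and>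
     (\<forall>r\<in>carrier R. (\<Oplus>\<^bsub>R\<^esub>j\<in>{..len \<D>}. \<Delta> r j \<otimes>\<^bsub>R\<^esub> \<iota> (resid \<D> (eps \<D> j))) = r)"

definition D_field ::
    "('k::field, 'd::comm_ring_1) based_algebra \<Rightarrow> 'r ring \<Rightarrow> ('k \<Rightarrow> 'r) \<Rightarrow> ('r \<Rightarrow> nat \<Rightarrow> 'r) \<Rightarrow> bool" where
  "D_field \<D> R \<iota> \<Delta> \<longleftrightarrow> field R \<and> D_ring \<D> R \<iota> \<Delta>"

definition D_field_extension ::
    "('k::field, 'd::comm_ring_1) based_algebra \<Rightarrow> 'r ring \<Rightarrow> ('k \<Rightarrow> 'r) \<Rightarrow> ('r \<Rightarrow> nat \<Rightarrow> 'r)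
      \<Rightarrow> 's ring \<Rightarrow> ('s \<Rightarrow> nat \<Rightarrow> 's) \<Rightarrow> ('r \<Rightarrow> 's) \<Rightarrow> bool" where
  "D_field_extension \<D> R \<iota> \<Delta> S \<delta> e \<longleftrightarrow>
     D_field \<D> R \<iota> \<Delta> \<and> D_field \<D> S (e \<circ> \<iota>) \<delta> \<and> e \<in> ring_hom R S \<and>
     (\<forall>r\<in>carrier R. \<forall>j\<in>{..len \<D>}. \<delta> (e r) j = e (\<Delta> r j))"


section \<open>Prolongations, \<open>UC\<^sub>\<D>\<close> and D-varieties\<close>

text \<open>The variable \<open>(j, i)\<close> is the coordinate \<open>x\<^sup>j\<^sub>i\<close> on the prolongation.\<close>

definition prol_vars :: "('k, 'd) based_algebra \<Rightarrow> nat \<Rightarrow> (nat \<times> nat) set" where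
  "prol_vars \<D> n = {..len \<D>} \<times> {..<n}"

text \<open>\<open>f\<^sup>\<partial>(\<Sum>\<^sub>j x\<^sup>j \<epsilon>\<^sub>j)\<close>, computed in \<open>K[x\<^sup>0,\<dots>,x\<^sup>l] \<otimes>\<^sub>k \<D>\<close>; its coefficient at \<open>j\<close> is \<open>f\<^sup>(\<^sup>j\<^sup>)\<close>.\<close>

definition prol_poly ::
    "('k::field, 'd::comm_ring_1) based_algebra \<Rightarrow> ('k \<Rightarrow> 'a::field) \<Rightarrow> ('a \<Rightarrow> nat \<Rightarrow> 'a) \<Rightarrow> nat
      \<Rightarrow> (nat, 'a) mpol \<Rightarrow> nat \<Rightarrow> (nat \<times> nat, 'a) mpol" where
  "prol_poly \<D> \<iota> \<Delta> n f =
     (let T = base_change \<D> (mpol_ring (prol_vars \<D> n)) (mconst \<circ> \<iota>) in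
      \<Oplus>\<^bsub>T\<^esub>m\<in>Poly_Mapping.keys f.
        (\<lambda>j\<in>{..len \<D>}. mconst (\<Delta> (Poly_Mapping.lookup f m) j)) \<otimes>\<^bsub>T\<^esub>
        (\<Otimes>\<^bsub>T\<^esub>i\<in>Poly_Mapping.keys m. (\<lambda>j\<in>{..len \<D>}. mvar (j, i)) [^]\<^bsub>T\<^esub> Poly_Mapping.lookup m i))"

definition prol_ideal ::
    "('k::field, 'd::comm_ring_1) based_algebra \<Rightarrow> ('k \<Rightarrow> 'a::field) \<Rightarrow> ('a \<Rightarrow> nat \<Rightarrow> 'a) \<Rightarrow> nat
      \<Rightarrow> (nat, 'a) mpol set \<Rightarrow> (nat \<times> nat, 'a) mpol set" where
  "prol_ideal \<D> \<iota> \<Delta> n I =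
     Idl\<^bsub>mpol_ring (prol_vars \<D> n)\<^esub> {prol_poly \<D> \<iota> \<Delta> n f j | f j. f \<in> I \<and> j \<in> {..len \<D>}}"

text \<open>\<open>\<pi>\<close>-hat on points: contraction of primes along \<open>x\<^sub>i \<mapsto> x\<^sup>0\<^sub>i\<close>.\<close>

definition prol_proj :: "nat \<Rightarrow> (nat \<times> nat, 'a::field) mpol set \<Rightarrow> (nat, 'a) mpol set" where
  "prol_proj n p = {f \<in> mpols {..<n}. mp_eval mconst (\<lambda>i. mvar (0, i)) f \<in> p}"

definition nabla ::
    "('k, 'd) based_algebra \<Rightarrow> ('a \<Rightarrow> nat \<Rightarrow> 'a) \<Rightarrow> nat \<Rightarrow> (nat \<Rightarrow> 'a) \<Rightarrow> nat \<times> nat \<Rightarrow> 'a" where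
  "nabla \<D> \<Delta> n a = (\<lambda>(j, i)\<in>prol_vars \<D> n. if j = 0 then a i else \<Delta> (a i) j)"

definition UC ::
    "('k::field, 'd::comm_ring_1) based_algebra \<Rightarrow> ('k \<Rightarrow> 'a::field) \<Rightarrow> ('a \<Rightarrow> nat \<Rightarrow> 'a) \<Rightarrow> bool" where
  "UC \<D> \<iota> \<Delta> \<longleftrightarrow> D_field \<D> ring_of_type_algebra \<iota> \<Delta> \<and>
     (\<forall>n I J.
        irreducible_variety {..<n} I \<and>
        irreducible_variety (prol_vars \<D> n) J \<and>
        prol_ideal \<D> \<iota> \<Delta> n I \<subseteq> J \<and>
        zariski_dense_in {..<n} I (prol_proj n ` topspace (zariski (prol_vars \<D> n) J)) \<and>
        has_smooth_rational_point (prol_vars \<D> n) J \<longrightarrow>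
        (\<forall>U. openin (zariski (prol_vars \<D> n) J) U \<and> U \<noteq> {} \<longrightarrow>
           (\<exists>a\<in>rational_points {..<n} I. point_ideal (prol_vars \<D> n) (nabla \<D> \<Delta> n a) \<in> U)))"

text \<open>A morphism \<open>s : V \<rightarrow> \<tau>V\<close> is given by polynomials \<open>s (j, i)\<close>, the images of the coordinates
  \<open>x\<^sup>j\<^sub>i\<close> under the comorphism; the last condition says that it is a section of the projection.\<close>

definition affine_D_variety ::
    "('k::field, 'd::comm_ring_1) based_algebra \<Rightarrow> ('k \<Rightarrow> 'a::field) \<Rightarrow> ('a \<Rightarrow> nat \<Rightarrow> 'a) \<Rightarrow> nat
      \<Rightarrow> (nat, 'a) mpol set \<Rightarrow> (nat \<times> nat \<Rightarrow> (nat, 'a) mpol) \<Rightarrow> bool" where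
  "affine_D_variety \<D> \<iota> \<Delta> n I s \<longleftrightarrow>
     affine_variety {..<n} I \<and>
     s ` prol_vars \<D> n \<subseteq> mpols {..<n} \<and>
     (\<forall>g\<in>prol_ideal \<D> \<iota> \<Delta> n I. mp_eval mconst s g \<in> I) \<and>
     (\<forall>i<n. s (0, i) - mvar i \<in> I)"

definition irreducible_D_variety ::
    "('k::field, 'd::comm_ring_1) based_algebra \<Rightarrow> ('k \<Rightarrow> 'a::field) \<Rightarrow> ('a \<Rightarrow> nat \<Rightarrow> 'a) \<Rightarrow> nat
      \<Rightarrow> (nat, 'a) mpol set \<Rightarrow> (nat \<times> nat \<Rightarrow> (nat, 'a) mpol) \<Rightarrow> bool" where
  "irreducible_D_variety \<D> \<iota> \<Delta> n I s \<longleftrightarrow>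
     affine_D_variety \<D> \<iota> \<Delta> n I s \<and> irreducible_variety {..<n} I"

definition sharp_points ::
    "('k, 'd) based_algebra \<Rightarrow> ('a::field \<Rightarrow> nat \<Rightarrow> 'a) \<Rightarrow> nat
      \<Rightarrow> (nat, 'a) mpol set \<Rightarrow> (nat \<times> nat \<Rightarrow> (nat, 'a) mpol) \<Rightarrow> (nat \<Rightarrow> 'a) set" where
  "sharp_points \<D> \<Delta> n I s =
     {a \<in> rational_points {..<n} I. nabla \<D> \<Delta> n a = (\<lambda>v\<in>prol_vars \<D> n. mp_eval id a (s v))}"


section \<open>Existential closedness\<close>

text \<open>Terms and quantifier-free formulas in the ring operations, constants \<open>c\<^sub>a\<close> and unary
  operators.\<close>

datatype ('k, 'o) rterm =
    TVar nat
  | TZero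
  | TOne
  | TConst 'k
  | TPlus "('k, 'o) rterm" "('k, 'o) rterm"
  | TMinus "('k, 'o) rterm" "('k, 'o) rterm"
  | TTimes "('k, 'o) rterm" "('k, 'o) rterm"
  | TOp 'o "('k, 'o) rterm"

datatype (qf_consts: 'k, qf_ops: 'o) qf_formula =
    QEq "('k, 'o) rterm" "('k, 'o) rterm"
  | QNot "('k, 'o) qf_formula"
  | QAnd "('k, 'o) qf_formula" "('k, 'o) qf_formula"

primrec term_val ::
    "'r ring \<Rightarrow> ('k \<Rightarrow> 'r) \<Rightarrow> ('o \<Rightarrow> 'r \<Rightarrow> 'r) \<Rightarrow> (nat \<Rightarrow> 'r) \<Rightarrow> ('k, 'o) rterm \<Rightarrow> 'r" where
  "term_val R \<iota> F \<rho> (TVar v) = \<rho> v"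
| "term_val R \<iota> F \<rho> TZero = \<zero>\<^bsub>R\<^esub>"
| "term_val R \<iota> F \<rho> TOne = \<one>\<^bsub>R\<^esub>"
| "term_val R \<iota> F \<rho> (TConst a) = \<iota> a"
| "term_val R \<iota> F \<rho> (TPlus s t) = term_val R \<iota> F \<rho> s \<oplus>\<^bsub>R\<^esub> term_val R \<iota> F \<rho> t"
| "term_val R \<iota> F \<rho> (TMinus s t) = term_val R \<iota> F \<rho> s \<ominus>\<^bsub>R\<^esub> term_val R \<iota> F \<rho> t"
| "term_val R \<iota> F \<rho> (TTimes s t) = term_val R \<iota> F \<rho> s \<otimes>\<^bsub>R\<^esub> term_val R \<iota> F \<rho> t"
| "term_val R \<iota> F \<rho> (TOp f t) = F f (term_val R \<iota> F \<rho> t)"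

primrec qf_sat ::
    "'r ring \<Rightarrow> ('k \<Rightarrow> 'r) \<Rightarrow> ('o \<Rightarrow> 'r \<Rightarrow> 'r) \<Rightarrow> (nat \<Rightarrow> 'r) \<Rightarrow> ('k, 'o) qf_formula \<Rightarrow> bool" where
  "qf_sat R \<iota> F \<rho> (QEq s t) \<longleftrightarrow> term_val R \<iota> F \<rho> s = term_val R \<iota> F \<rho> t"
| "qf_sat R \<iota> F \<rho> (QNot \<phi>) \<longleftrightarrow> \<not> qf_sat R \<iota> F \<rho> \<phi>"
| "qf_sat R \<iota> F \<rho> (QAnd \<phi> \<psi>) \<longleftrightarrow> qf_sat R \<iota> F \<rho> \<phi> \<and> qf_sat R \<iota> F \<rho> \<psi>"

text \<open>\<open>R\<close> is existentially closed in \<open>S\<close> along \<open>e\<close>, for the language with constants in \<open>A\<close> and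
  operators in \<open>Q\<close>: an existential formula \<open>\<exists>(x\<^sub>v)\<^bsub>v\<in>V\<^esub>. \<phi>\<close>, with parameters from \<open>R\<close> (the values
  \<open>\<rho> v\<close>, \<open>v \<notin> V\<close>), that holds in \<open>S\<close> holds in \<open>R\<close>.\<close>

definition ex_closed ::
    "'k set \<Rightarrow> 'o set \<Rightarrow> 'r ring \<Rightarrow> ('k \<Rightarrow> 'r) \<Rightarrow> ('o \<Rightarrow> 'r \<Rightarrow> 'r)
      \<Rightarrow> 's ring \<Rightarrow> ('k \<Rightarrow> 's) \<Rightarrow> ('o \<Rightarrow> 's \<Rightarrow> 's) \<Rightarrow> ('r \<Rightarrow> 's) \<Rightarrow> bool" where
  "ex_closed A Q R \<iota> F S \<kappa> G e \<longleftrightarrow>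
     (\<forall>\<phi> V \<rho>. qf_consts \<phi> \<subseteq> A \<and> qf_ops \<phi> \<subseteq> Q \<and> finite V \<and> range \<rho> \<subseteq> carrier R \<and>
        (\<exists>\<sigma>. range \<sigma> \<subseteq> carrier S \<and> (\<forall>v. v \<notin> V \<longrightarrow> \<sigma> v = e (\<rho> v)) \<and> qf_sat S \<kappa> G \<sigma> \<phi>) \<longrightarrow>
        (\<exists>\<tau>. range \<tau> \<subseteq> carrier R \<and> (\<forall>v. v \<notin> V \<longrightarrow> \<tau> v = \<rho> v) \<and> qf_sat R \<iota> F \<tau> \<phi>))"

text \<open>The language of rings has no constants \<open>c\<^sub>a\<close> and no operators, so that their
  interpretations are irrelevant.\<close>

definition ex_closed_field :: "'r ring \<Rightarrow> 's ring \<Rightarrow> ('r \<Rightarrow> 's) \<Rightarrow> bool" where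
  "ex_closed_field R S e \<longleftrightarrow>
     ex_closed ({} :: unit set) ({} :: unit set) R (\<lambda>_. \<zero>\<^bsub>R\<^esub>) (\<lambda>_ r. r) S (\<lambda>_. \<zero>\<^bsub>S\<^esub>) (\<lambda>_ r. r) e"

definition ex_closed_D_field ::
    "('k, 'd) based_algebra \<Rightarrow> 'r ring \<Rightarrow> ('k \<Rightarrow> 'r) \<Rightarrow> ('r \<Rightarrow> nat \<Rightarrow> 'r)
      \<Rightarrow> 's ring \<Rightarrow> ('s \<Rightarrow> nat \<Rightarrow> 's) \<Rightarrow> ('r \<Rightarrow> 's) \<Rightarrow> bool" where
  "ex_closed_D_field \<D> R \<iota> \<Delta> S \<delta> e \<longleftrightarrow>
     ex_closed UNIV {1..len \<D>} R \<iota> (\<lambda>j r. \<Delta> r j) S (e \<circ> \<iota>) (\<lambda>j r. \<delta> r j) e"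

end

theory Submission
  imports
    Defs
    "HOL-Algebra.Weak_Morphisms"
    "HOL-Computational_Algebra.Polynomial"
    "HOL-Computational_Algebra.Fraction_Field"
    "HOL-Algebra.Free_Abelian_Groups"
begin

text \<open>Every prime of \<open>K[x]\<close> has a triangular presentation: after inverting one polynomial \<open>h\<close> it is
  generated by polynomials \<open>P\<^sub>v\<close>, each separable in its own variable \<open>v\<close>. Points with \<open>h \<noteq> 0\<close> and
  \<open>P\<^sub>v = 0\<close> are therefore smooth, and being such a point is a quantifier-free condition.

  (4) implies (1): a generic point of \<open>Y \<subseteq> \<tau>X\<close> is a homomorphism from \<open>K[X]\<close> to \<open>K[Y] \<otimes> \<D>\<close>. Since the
  kernel of the residue map is nilpotent, Hensel's lemma, applied to the \<open>P\<^sub>v\<close> one after the other,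
  extends it to a \<open>\<D>\<close>-structure on \<open>K[Y][1/h]\<close>, which is thus a smooth D-variety; it has a rational
  point because \<open>K\<close> is large, and a sharp point of it gives \<open>\<nabla>(a) \<in> U\<close>. (1) implies (2): apply \<open>UC\<^sub>\<D>\<close>
  to the graph of \<open>s\<close>. (3) implies (4), because Jacobian ranks do not change under field extension.
  (1) implies (5): a quantifier-free formula only sees the finitely many values of its subterms, and
  \<open>UC\<^sub>\<D>\<close>, applied to the locus over \<open>K\<close> of these values and of their images under \<open>\<nabla>\<close>, maps them to \<open>K\<close>
  injectively and compatibly with all operations. (5) implies (3): the section \<open>s\<close> makes \<open>K(V)\<close> a
  \<open>\<D>\<close>-field whose generic point is sharp, and largeness gives such partial embeddings of \<open>K(V)\<close> as a
  field; as \<open>K(V)\<close> has the cardinality of \<open>K\<close>, it can be moved into the type \<open>'a + 'l\<close> over which (5)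
  quantifies.\<close>

hide_const (open) UnivPoly.coeff UnivPoly.monom

alias keys = Poly_Mapping.keys
alias lookup = Poly_Mapping.lookup
alias single = Poly_Mapping.single

section \<open>Polynomials\<close>

lemma ring_of_type_sel [simp]:
  "carrier (ring_of_type_algebra :: 'a::ring_1 ring) = UNIV"
  "x \<otimes>\<^bsub>ring_of_type_algebra\<^esub> y = (x * y :: 'a)"
  "x \<oplus>\<^bsub>ring_of_type_algebra\<^esub> y = (x + y :: 'a)"
  "\<one>\<^bsub>ring_of_type_algebra\<^esub> = (1 :: 'a)"
  "\<zero>\<^bsub>ring_of_type_algebra\<^esub> = (0 :: 'a)"
  by (simp_all add: ring_of_type_algebra_def)

lemma mpol_ring_sel [simp]:
  "carrier (mpol_ring N :: ('v, 'a::comm_ring_1) mpol ring) = mpols N"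
  "f \<otimes>\<^bsub>mpol_ring N\<^esub> g = (f * g :: ('v, 'a) mpol)"
  "f \<oplus>\<^bsub>mpol_ring N\<^esub> g = (f + g :: ('v, 'a) mpol)"
  "\<one>\<^bsub>mpol_ring N\<^esub> = (1 :: ('v, 'a) mpol)"
  "\<zero>\<^bsub>mpol_ring N\<^esub> = (0 :: ('v, 'a) mpol)"
  by (simp_all add: mpol_ring_def)

lemma mpols_UNIV [simp]: "mpols UNIV = UNIV"
  by (simp add: mpols_def)

lemma mpols_mono: "A \<subseteq> B \<Longrightarrow> mpols A \<subseteq> mpols B"
  by (auto simp: mpols_def)

lemma mpols_minus: "(p :: ('v, 'a::comm_ring_1) mpol) \<in> mpols N \<Longrightarrow> q \<in> mpols N \<Longrightarrow> p - q \<in> mpols N"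
  using mpols_add[of p N "- q"] mpols_uminus[of q N] by simp

lemma mpols_single: "keys m \<subseteq> N \<Longrightarrow> single m c \<in> mpols N"
  by (simp add: mpols_def)

lemma mpols_const [simp]: "mconst c \<in> mpols N"
  by (simp add: mconst_def mpols_single)

lemma mpols_var: "v \<in> N \<Longrightarrow> mvar v \<in> mpols N"
  by (simp add: mvar_def mpols_single)

lemma mpols_sum: "(\<And>i. i \<in> A \<Longrightarrow> f i \<in> mpols N) \<Longrightarrow> (\<Sum>i\<in>A. f i) \<in> mpols N"
  by (induction A rule: infinite_finite_induct) (auto intro: mpols_add)

lemma mpols_prod:
  "(\<And>i. i \<in> A \<Longrightarrow> f i \<in> mpols N) \<Longrightarrow> (\<Prod>i\<in>A. f i) \<in> (mpols N :: ('v, 'a::comm_ring_1) mpol set)"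
  by (induction A rule: infinite_finite_induct) (auto intro: mpols_mult)

lemma mpols_power: "f \<in> mpols N \<Longrightarrow> f ^ k \<in> (mpols N :: ('v, 'a::comm_ring_1) mpol set)"
  by (induction k) (auto intro: mpols_mult)

lemma mconst_simps [simp]:
  "mconst 0 = 0" "mconst 1 = (1 :: ('v, 'a::comm_ring_1) mpol)"
  "mconst (a + b) = (mconst a + mconst b :: ('v, 'a) mpol)"
  "mconst (a * b) = (mconst a * mconst b :: ('v, 'a) mpol)"
  "mconst (- a) = (- mconst a :: ('v, 'a) mpol)"
  by (simp_all add: mconst_def single_add mult_single single_uminus)

lemma mconst_hom [simp]: "mconst \<in> ring_hom ring_of_type_algebra (mpol_ring N)"
  by (simp add: ring_hom_def)

lemma mconst_of_nat: "mconst (of_nat n) = (of_nat n :: ('v, 'a::comm_ring_1) mpol)"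
  by (induction n) auto

lemma poly_mapping_sum_singles:
  "f = (\<Sum>m\<in>keys f. single m (lookup f m))"
proof (rule poly_mapping_eqI)
  fix k
  have "(\<Sum>x\<in>keys f. lookup f x when x = k) = lookup f k"
  proof (cases "k \<in> keys f")
    case True
    then show ?thesis
      by (subst sum.remove[of _ k]) (auto simp: when_def intro!: sum.neutral)
  qed (auto simp: when_def in_keys_iff intro!: sum.neutral)
  then show "lookup f k =
    lookup (\<Sum>m\<in>keys f. single m (lookup f m)) k"
    by (simp add: lookup_sum lookup_single)
qed

lemma mvar_power:
  "mvar v ^ e = (single (single v e) 1 :: ('v, 'a::comm_ring_1) mpol)"
  by (induction e) (auto simp: mvar_def mult_single simp flip: single_add)

lemma single_eq_prod:
  "(single m c :: ('v, 'a::comm_ring_1) mpol) =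
     mconst c * (\<Prod>v\<in>keys m. mvar v ^ lookup m v)"
proof -
  have "finite A \<Longrightarrow> (\<Prod>v\<in>A. mvar v ^ lookup m v) =
    (single (\<Sum>v\<in>A. single v (lookup m v)) 1 :: ('v, 'a) mpol)" for A
    by (induction A rule: finite_induct) (auto simp: mvar_power mult_single)
  then show ?thesis
    using poly_mapping_sum_singles[of m] by (simp add: mconst_def mult_single)
qed

lemma mpol_induct_single [consumes 1, case_names zero single add]:
  fixes f :: "('v, 'a::comm_ring_1) mpol"
  assumes "f \<in> mpols N"
    and "P 0"
    and "\<And>m c. keys m \<subseteq> N \<Longrightarrow> P (single m c)"
    and "\<And>f g. f \<in> mpols N \<Longrightarrow> g \<in> mpols N \<Longrightarrow> P f \<Longrightarrow> P g \<Longrightarrow> P (f + g)"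
  shows "P f"
proof -
  have "A \<subseteq> keys f \<Longrightarrow> (\<Sum>m\<in>A. single m (lookup f m)) \<in> mpols N \<and>
      P (\<Sum>m\<in>A. single m (lookup f m))" if "finite A" for A
    using that
  proof (induction A rule: finite_induct)
    case (insert m A)
    then have "keys m \<subseteq> N"
      using assms(1) by (auto simp: mpols_def)
    with insert assms(3) show ?case
      by (auto intro!: assms(4) mpols_single mpols_add)
  qed (use assms in auto)
  from this[of "keys f"] show ?thesis
    using poly_mapping_sum_singles[of f] by simp
qed

lemma mpol_induct [consumes 1, case_names const var add mult]:
  fixes f :: "('v, 'a::comm_ring_1) mpol"
  assumes "f \<in> mpols N"
    and const: "\<And>c. P (mconst c)"
    and var: "\<And>v. v \<in> N \<Longrightarrow> P (mvar v)"
    and add: "\<And>f g. f \<in> mpols N \<Longrightarrow> g \<in> mpols N \<Longrightarrow> P f \<Longrightarrow> P g \<Longrightarrow> P (f + g)"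
    and mult: "\<And>f g. f \<in> mpols N \<Longrightarrow> g \<in> mpols N \<Longrightarrow> P f \<Longrightarrow> P g \<Longrightarrow> P (f * g)"
  shows "P f"
  using assms(1)
proof (induction rule: mpol_induct_single)
  case zero
  then show ?case using const[of 0] by simp
next
  case (single m c)
  have power: "P (mvar v ^ e)" if "v \<in> N" for v e
  proof (induction e)
    case 0
    then show ?case using const[of 1] by simp
  next
    case (Suc e)
    then show ?case
      using mult[of "mvar v" "mvar v ^ e"] var that by (auto intro: mpols_var mpols_power)
  qed
  have "P (\<Prod>v\<in>A. mvar v ^ lookup m v)" if "finite A" "A \<subseteq> N" for A
    using that
  proof (induction A rule: finite_induct)
    case empty
    then show ?case using const[of 1] by simp
  next
    case (insert v A)
    then show ?case
      using power by (auto intro!: mult mpols_power mpols_var mpols_prod)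
  qed
  with single have "P (mconst c * (\<Prod>v\<in>keys m. mvar v ^ lookup m v))"
    by (auto intro!: mult const mpols_prod mpols_power mpols_var)
  then show ?case by (simp add: single_eq_prod)
qed (rule add)

section \<open>Evaluation in a commutative ring\<close>

definition mp_eval_in :: "('r, 'm) ring_scheme \<Rightarrow> ('a::zero \<Rightarrow> 'r) \<Rightarrow> ('v \<Rightarrow> 'r) \<Rightarrow> ('v, 'a) mpol \<Rightarrow> 'r" where
  "mp_eval_in R c x f = (\<Oplus>\<^bsub>R\<^esub>m\<in>keys f. c (lookup f m) \<otimes>\<^bsub>R\<^esub>
      (\<Otimes>\<^bsub>R\<^esub>v\<in>keys m. x v [^]\<^bsub>R\<^esub> lookup m v))"

lemma ring_hom_zero_of_type:
  fixes c :: "'a::comm_ring_1 \<Rightarrow> 'r"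
  assumes "ring R" "c \<in> ring_hom ring_of_type_algebra R"
  shows "c 0 = \<zero>\<^bsub>R\<^esub>"
  using Ring.ring_hom_zero[OF assms(2) ring_from_type_algebra assms(1)] by simp

locale mp_evaluation = cring R for R :: "('b, 'm) ring_scheme" (structure) +
  fixes c :: "'a::comm_ring_1 \<Rightarrow> 'b" and x :: "'v \<Rightarrow> 'b" and N :: "'v set"
  assumes c_hom: "c \<in> ring_hom ring_of_type_algebra R"
    and x_closed: "x \<in> N \<rightarrow> carrier R"
begin

lemma c_closed [simp]: "c a \<in> carrier R"
  using c_hom by (auto simp: ring_hom_def)

lemma c_zero [simp]: "c 0 = \<zero>"
  using c_hom ring_axioms by (rule ring_hom_zero_of_type[rotated])

lemma c_simps [simp]: "c 1 = \<one>" "c (a + b) = c a \<oplus> c b" "c (a * b) = c a \<otimes> c b"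
  using c_hom by (auto simp: ring_hom_def)

abbreviation mon :: "('v \<Rightarrow>\<^sub>0 nat) \<Rightarrow> 'b" where
  "mon m \<equiv> (\<Otimes>v\<in>keys m. x v [^] lookup m v)"

lemma pow_closed: "v \<in> N \<Longrightarrow> x v [^] (e::nat) \<in> carrier R"
  using x_closed by auto

lemma mon_closed [simp]: "keys m \<subseteq> N \<Longrightarrow> mon m \<in> carrier R"
  by (auto intro!: finprod_closed pow_closed)

lemma mon_superset:
  assumes "finite A" "keys m \<subseteq> A" "A \<subseteq> N"
  shows "mon m = (\<Otimes>v\<in>A. x v [^] lookup m v)"
  using assms
  by (intro finprod_mono_neutral_cong_left) (auto intro!: pow_closed simp: in_keys_iff)

lemma mon_add:
  assumes "keys m \<subseteq> N" "keys m' \<subseteq> N"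
  shows "mon (m + m') = mon m \<otimes> mon m'"
proof -
  let ?A = "keys m \<union> keys m'"
  have A: "?A \<subseteq> N" using assms by auto
  have "mon (m + m') = (\<Otimes>v\<in>?A. x v [^] lookup (m + m') v)"
    using A Poly_Mapping.keys_add[of m m'] by (intro mon_superset) auto
  also have "\<dots> = (\<Otimes>v\<in>?A. x v [^] lookup m v \<otimes> x v [^] lookup m' v)"
    using A pow_closed x_closed
    by (intro finprod_cong') (auto simp: lookup_add nat_pow_mult Pi_iff subset_iff)
  also have "\<dots> = (\<Otimes>v\<in>?A. x v [^] lookup m v) \<otimes> (\<Otimes>v\<in>?A. x v [^] lookup m' v)"
    using A pow_closed by (intro finprod_multf) auto
  also have "\<dots> = mon m \<otimes> mon m'"
    using A by (simp add: mon_superset[of ?A])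
  finally show ?thesis .
qed

abbreviation ev :: "('v, 'a) mpol \<Rightarrow> 'b" where "ev \<equiv> mp_eval_in R c x"

lemma ev_superset:
  assumes "finite A" "keys f \<subseteq> A" "\<And>m. m \<in> A \<Longrightarrow> keys m \<subseteq> N"
  shows "ev f = (\<Oplus>m\<in>A. c (lookup f m) \<otimes> mon m)"
  unfolding mp_eval_in_def using assms
  by (intro add.finprod_mono_neutral_cong_left) (auto intro!: mon_closed simp: in_keys_iff)

lemma ev_closed: "f \<in> mpols N \<Longrightarrow> ev f \<in> carrier R"
  unfolding mp_eval_in_def by (auto intro!: finsum_closed mon_closed simp: mpols_def)

lemma ev_single: "keys m \<subseteq> N \<Longrightarrow> ev (single m a) = c a \<otimes> mon m"
  using mon_closed[of m] by (subst ev_superset[of "{m}"]) auto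

lemma ev_zero [simp]: "ev 0 = \<zero>"
  by (simp add: mp_eval_in_def)

lemma ev_add:
  assumes "f \<in> mpols N" "g \<in> mpols N"
  shows "ev (f + g) = ev f \<oplus> ev g"
proof -
  let ?A = "keys f \<union> keys g"
  have A: "\<And>m. m \<in> ?A \<Longrightarrow> keys m \<subseteq> N" using assms by (auto simp: mpols_def)
  have "ev (f + g) = (\<Oplus>m\<in>?A. c (lookup (f + g) m) \<otimes> mon m)"
    using A Poly_Mapping.keys_add[of f g] by (intro ev_superset) auto
  also have "\<dots> = (\<Oplus>m\<in>?A. c (lookup f m) \<otimes> mon m \<oplus> c (lookup g m) \<otimes> mon m)"
    using A by (intro finsum_cong') (auto simp: lookup_add l_distr mon_closed)
  also have "\<dots> = (\<Oplus>m\<in>?A. c (lookup f m) \<otimes> mon m) \<oplus> (\<Oplus>m\<in>?A. c (lookup g m) \<otimes> mon m)"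
    using A by (intro finsum_addf) (auto simp: mon_closed)
  also have "(\<Oplus>m\<in>?A. c (lookup f m) \<otimes> mon m) = ev f"
    by (rule ev_superset[symmetric]) (use A in auto)
  also have "(\<Oplus>m\<in>?A. c (lookup g m) \<otimes> mon m) = ev g"
    by (rule ev_superset[symmetric]) (use A in auto)
  finally show ?thesis .
qed

lemma ev_mult:
  assumes "f \<in> mpols N" "g \<in> mpols N"
  shows "ev (f * g) = ev f \<otimes> ev g"
  using assms(1)
proof (induction rule: mpol_induct_single)
  case zero
  then show ?case using assms ev_closed by simp
next
  case (single m a)
  show ?case using assms(2)
  proof (induction rule: mpol_induct_single)
    case zero
    then show ?case using single ev_closed[OF mpols_single] by simp
  next
    case inner: (single m' b)
    have "keys (m + m') \<subseteq> N"
      using Poly_Mapping.keys_add[of m m'] single inner by auto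
    then show ?case
      using single inner mon_closed[of m] mon_closed[of m']
      by (simp add: mult_single ev_single mon_add m_ac)
  next
    case (add f g)
    then show ?case using single ev_closed[OF mpols_single]
      by (simp add: distrib_left ev_add mpols_mult mpols_single ev_closed r_distr)
  qed
next
  case (add f f')
  then show ?case using assms
    by (simp add: distrib_right ev_add mpols_mult ev_closed l_distr)
qed

lemma ev_const [simp]: "ev (mconst a) = c a"
  unfolding mconst_def by (subst ev_single) auto

lemma ev_one [simp]: "ev 1 = \<one>"
  using ev_const[of 1] by simp

lemma ev_var [simp]: "v \<in> N \<Longrightarrow> ev (mvar v) = x v"
  unfolding mvar_def using x_closed funcset_mem[OF x_closed, of v]
  by (subst ev_single) (auto simp: finprod_insert)

lemma ev_hom: "ev \<in> ring_hom (mpol_ring N) R"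
  by (simp add: ring_hom_def ev_closed ev_add ev_mult)

lemma ev_unique:
  assumes \<phi>: "\<phi> \<in> ring_hom (mpol_ring N) R" and "\<And>a. \<phi> (mconst a) = c a"
    and "\<And>v. v \<in> N \<Longrightarrow> \<phi> (mvar v) = x v" and "f \<in> mpols N"
  shows "\<phi> f = ev f"
  using assms(4)
proof (induction rule: mpol_induct)
  case (add f g)
  then show ?case using \<phi> by (simp add: ring_hom_def ev_add)
next
  case (mult f g)
  then show ?case using \<phi> by (simp add: ring_hom_def ev_mult)
qed (use assms in auto)

end

lemma mp_evaluationI:
  assumes "cring R" "c \<in> ring_hom ring_of_type_algebra R" "x \<in> N \<rightarrow> carrier R"
  shows "mp_evaluation R c x N"
  using assms by (intro mp_evaluation.intro mp_evaluation_axioms.intro)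

lemma mp_eval_in_compose_hom:
  assumes "mp_evaluation R c x N" and S: "cring S" and h: "h \<in> ring_hom R S" and f: "f \<in> mpols N"
  shows "h (mp_eval_in R c x f) = mp_eval_in S (h \<circ> c) (h \<circ> x) f"
proof -
  interpret e: mp_evaluation R c x N by fact
  interpret S: mp_evaluation S "h \<circ> c" "h \<circ> x" N
    using e.c_hom e.x_closed h S by (intro mp_evaluationI) (auto simp: ring_hom_def)
  have "(h \<circ> mp_eval_in R c x) f = S.ev f"
  proof (rule S.ev_unique)
    show "h \<circ> mp_eval_in R c x \<in> ring_hom (mpol_ring N) S"
      using e.ev_hom h by (auto simp: ring_hom_def Pi_def)
  qed (use f in auto)
  then show ?thesis by simp
qed

lemma mp_eval_in_cong:
  fixes c :: "'a::comm_ring_1 \<Rightarrow> 'r"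
  assumes "\<And>v. v \<in> N \<Longrightarrow> x v = y v" "f \<in> mpols N" "cring R" "x \<in> N \<rightarrow> carrier R"
    and "c \<in> ring_hom ring_of_type_algebra R"
  shows "mp_eval_in R c x f = mp_eval_in R c y f"
proof -
  interpret e: mp_evaluation R c x N by (intro mp_evaluationI) (use assms in auto)
  have "y \<in> N \<rightarrow> carrier R"
    using assms(1,4) unfolding Pi_iff by metis
  then interpret e': mp_evaluation R c y N by (intro mp_evaluationI) (use assms in auto)
  show ?thesis
    by (rule e'.ev_unique[OF e.ev_hom]) (use assms in auto)
qed

lemma finsum_of_type: "finsum (ring_of_type_algebra :: 'a::comm_ring_1 ring) f A = sum f A"
proof (induction A rule: infinite_finite_induct)
  case (infinite A)
  then show ?case by (simp add: finsum_def finprod_def)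
next
  case empty
  interpret cring "ring_of_type_algebra :: 'a ring" by (rule cring_from_type_algebra)
  show ?case by simp
next
  case (insert a A)
  interpret cring "ring_of_type_algebra :: 'a ring" by (rule cring_from_type_algebra)
  from insert show ?case by simp
qed

lemma finprod_of_type: "finprod (ring_of_type_algebra :: 'a::comm_ring_1 ring) f A = prod f A"
proof (induction A rule: infinite_finite_induct)
  case (infinite A)
  then show ?case by (simp add: finprod_def)
next
  case empty
  interpret cring "ring_of_type_algebra :: 'a ring" by (rule cring_from_type_algebra)
  show ?case by simp
next
  case (insert a A)
  interpret cring "ring_of_type_algebra :: 'a ring" by (rule cring_from_type_algebra)
  from insert show ?case by simp
qed

lemma pow_of_type: "(a :: 'a::comm_ring_1) [^]\<^bsub>ring_of_type_algebra\<^esub> (n::nat) = a ^ n"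
proof (induction n)
  interpret cring "ring_of_type_algebra :: 'a ring" by (rule cring_from_type_algebra)
  case 0
  show ?case by simp
next
  interpret cring "ring_of_type_algebra :: 'a ring" by (rule cring_from_type_algebra)
  case (Suc n)
  then show ?case by (simp add: mult.commute)
qed

lemma mp_eval_eq_in: "mp_eval c x f = mp_eval_in ring_of_type_algebra c x f"
  by (simp add: mp_eval_def mp_eval_in_def finsum_of_type finprod_of_type pow_of_type)

abbreviation type_hom :: "('a::comm_ring_1 \<Rightarrow> 'b::comm_ring_1) \<Rightarrow> bool" where
  "type_hom c \<equiv> c \<in> ring_hom ring_of_type_algebra ring_of_type_algebra"

lemma type_homD:
  assumes "type_hom c"
  shows "c 0 = 0" "c 1 = 1" "c (a + b) = c a + c b" "c (a * b) = c a * c b" "c (- a) = - c a"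
    "c (a - b) = c a - c b" "c (of_nat n) = of_nat n" "c (a ^ n) = c a ^ n"
proof -
  have hom: "c 1 = 1" "\<And>a b. c (a + b) = c a + c b" "\<And>a b. c (a * b) = c a * c b"
    using assms by (auto simp: ring_hom_def)
  then have zero: "c 0 = 0"
    by (metis add_cancel_right_left)
  have uminus: "c (- a) = - c a" for a
    using hom(2)[of a "- a"] zero by (metis add.right_inverse add_eq_0_iff2 minus_unique)
  show "c 0 = 0" "c 1 = 1" "c (a + b) = c a + c b" "c (a * b) = c a * c b" "c (- a) = - c a"
    by (fact zero hom uminus)+
  show "c (a - b) = c a - c b"
    using hom(2)[of a "- b"] uminus by simp
  show "c (of_nat n) = of_nat n"
    by (induction n) (auto simp: hom zero)
  show "c (a ^ n) = c a ^ n"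
    by (induction n) (auto simp: hom)
qed

lemma type_hom_sum: "type_hom c \<Longrightarrow> c (sum f A) = (\<Sum>a\<in>A. c (f a))"
  by (induction A rule: infinite_finite_induct) (auto simp: type_homD)

lemma type_hom_id [simp]: "type_hom id" "type_hom (\<lambda>x. x)"
  by (auto simp: ring_hom_def)

lemma type_hom_to_ac [simp]: "type_hom to_ac"
  by (auto simp: ring_hom_def)

lemma type_hom_mconst [simp]: "type_hom mconst"
  by (auto simp: ring_hom_def)

lemma mp_evaluation_type: "type_hom c \<Longrightarrow> mp_evaluation ring_of_type_algebra c x N"
  by (intro mp_evaluationI) auto

context
  fixes c :: "'a::comm_ring_1 \<Rightarrow> 'b::comm_ring_1"
  assumes hom: "type_hom c"
begin

interpretation mp_evaluation ring_of_type_algebra c x UNIV for x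
  by (rule mp_evaluation_type[OF hom])

lemma mp_eval_add: "mp_eval c x (f + g) = mp_eval c x f + mp_eval c x g"
  by (simp add: mp_eval_eq_in ev_add)

lemma mp_eval_mult: "mp_eval c x (f * g) = mp_eval c x f * mp_eval c x g"
  by (simp add: mp_eval_eq_in ev_mult)

lemma mp_eval_const: "mp_eval c x (mconst a) = c a"
  by (simp add: mp_eval_eq_in)

lemma mp_eval_var: "mp_eval c x (mvar v) = x v"
  by (simp add: mp_eval_eq_in)

lemma mp_eval_hom: "type_hom (mp_eval c x)"
  using mp_eval_add mp_eval_mult mp_eval_const[of x 1] by (auto simp: ring_hom_def)

lemmas mp_eval_ring_simps = type_homD[OF mp_eval_hom] mp_eval_const mp_eval_var

lemma mp_eval_sum: "mp_eval c x (sum f A) = (\<Sum>a\<in>A. mp_eval c x (f a))"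
  by (rule type_hom_sum[OF mp_eval_hom])

lemma mp_eval_prod: "mp_eval c x (prod f A) = (\<Prod>a\<in>A. mp_eval c x (f a))"
  by (induction A rule: infinite_finite_induct) (auto simp: mp_eval_ring_simps)

lemma mp_eval_compose:
  fixes d :: "'b \<Rightarrow> 'e::comm_ring_1"
  assumes "type_hom d"
  shows "d (mp_eval c x f) = mp_eval (d \<circ> c) (d \<circ> x) f"
  unfolding mp_eval_eq_in
  using mp_eval_in_compose_hom[OF mp_evaluation_axioms cring_from_type_algebra assms] by simp

end

lemma mp_eval_cong:
  "type_hom c \<Longrightarrow> f \<in> mpols N \<Longrightarrow> (\<And>v. v \<in> N \<Longrightarrow> x v = y v) \<Longrightarrow> mp_eval c x f = mp_eval c y f"
  unfolding mp_eval_eq_in by (rule mp_eval_in_cong[of N]) auto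

lemma mp_eval_subst:
  assumes "type_hom c"
  shows "mp_eval c x (mp_eval mconst s f) = mp_eval c (\<lambda>v. mp_eval c x (s v)) f"
  using mp_eval_compose[OF type_hom_mconst mp_eval_hom[OF assms], of x s f]
  by (simp add: comp_def mp_eval_const[OF assms])

lemma mp_eval_mconst_mvar: "mp_eval mconst mvar f = (f :: ('v, 'a::comm_ring_1) mpol)"
proof -
  interpret mp_evaluation "mpol_ring UNIV :: ('v, 'a) mpol ring" mconst mvar UNIV
    by (intro mp_evaluationI cring_mpol_ring) auto
  have "f \<in> mpols UNIV" by simp
  then show ?thesis
    by (induction rule: mpol_induct) (simp_all add: mp_eval_ring_simps)
qed

lemma mp_eval_mpol_ring:
  fixes s :: "'v \<Rightarrow> ('w, 'a::comm_ring_1) mpol"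
  assumes f: "f \<in> mpols N" and s: "s \<in> N \<rightarrow> mpols M"
  shows "mp_eval_in (mpol_ring M) mconst s f = mp_eval mconst s f"
proof -
  interpret mp_evaluation "mpol_ring M" mconst s N
    by (intro mp_evaluationI cring_mpol_ring) (use s in auto)
  show ?thesis using f
    by (induction rule: mpol_induct) (simp_all add: mp_eval_ring_simps ev_add ev_mult)
qed

lemma mpols_subst:
  fixes s :: "'v \<Rightarrow> ('w, 'a::comm_ring_1) mpol"
  assumes f: "f \<in> mpols N" and s: "\<And>v. v \<in> N \<Longrightarrow> s v \<in> mpols M"
  shows "mp_eval mconst s f \<in> mpols M"
  using f by (induction rule: mpol_induct) (auto simp: mp_eval_ring_simps mpols_add mpols_mult s)

section \<open>Derivatives\<close>

lemma mp_deriv_superset: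
  assumes "finite A" "keys f \<subseteq> A"
  shows "mp_deriv v f = (\<Sum>m\<in>A. single (m - single v 1)
        (of_nat (lookup m v) * lookup f m))"
  unfolding mp_deriv_def by (rule sum.mono_neutral_left) (use assms in \<open>auto simp: in_keys_iff\<close>)

lemma mp_deriv_add: "mp_deriv v (f + g) = mp_deriv v f + mp_deriv v g"
proof -
  let ?A = "keys f \<union> keys g"
  show ?thesis
    using Poly_Mapping.keys_add[of f g]
    by (simp add: mp_deriv_superset[of ?A] lookup_add distrib_left single_add sum.distrib)
qed

lemma mp_deriv_zero [simp]: "mp_deriv v 0 = 0"
  by (simp add: mp_deriv_def)

lemma mp_deriv_single:
  "mp_deriv v (single m a) =
     single (m - single v 1) (of_nat (lookup m v) * a)"
  by (subst mp_deriv_superset[of "{m}"]) auto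

lemma mp_deriv_mult_single:
  fixes v :: 'v and a b :: "'a::comm_ring_1"
  shows "mp_deriv v (single m a * single m' b) =
    mp_deriv v (single m a) * single m' b + single m a * mp_deriv v (single m' b)"
proof -
  have shift: "lookup m v \<noteq> 0 \<Longrightarrow> m - single v 1 + m' = m + m' - single v 1" for m m' :: "'v \<Rightarrow>\<^sub>0 nat"
    by (rule poly_mapping_eqI) (auto simp: lookup_add lookup_minus lookup_single when_def)
  have "mp_deriv v (single m a) * single m' b = single (m + m' - single v 1) (of_nat (lookup m v) * a * b)"
    using shift[of m m'] by (cases "lookup m v = 0") (auto simp: mp_deriv_single mult_single)
  moreover have "single m a * mp_deriv v (single m' b) = single (m + m' - single v 1) (of_nat (lookup m' v) * a * b)"
    using shift[of m' m] by (cases "lookup m' v = 0") (auto simp: mp_deriv_single mult_single add.commute mult_ac)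
  ultimately show ?thesis
    by (simp add: mp_deriv_single mult_single lookup_add algebra_simps single_add)
qed

lemma mp_deriv_mult:
  fixes f g :: "('v, 'a::comm_ring_1) mpol"
  shows "mp_deriv v (f * g) = mp_deriv v f * g + f * mp_deriv v g"
proof -
  have "f \<in> mpols UNIV" "g \<in> mpols UNIV" by simp_all
  then show ?thesis
  proof (induction rule: mpol_induct_single)
    case (single m c)
    show ?case using \<open>g \<in> mpols UNIV\<close>
      by (induction rule: mpol_induct_single)
        (simp_all add: mp_deriv_mult_single distrib_left mp_deriv_add algebra_simps)
  qed (simp_all add: distrib_right mp_deriv_add algebra_simps)
qed

lemma mp_deriv_const [simp]: "mp_deriv v (mconst a) = 0"
  by (simp add: mconst_def mp_deriv_single)

lemma mp_deriv_var: "mp_deriv v (mvar w :: ('v, 'a::comm_ring_1) mpol) = (if v = w then 1 else 0)"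
  by (auto simp: mvar_def mp_deriv_single lookup_single)

lemma mp_deriv_one [simp]: "mp_deriv v 1 = 0"
  using mp_deriv_const[of v 1] by simp

lemma mp_deriv_uminus: "mp_deriv v (- f) = - mp_deriv v (f :: ('v, 'a::comm_ring_1) mpol)"
  using mp_deriv_add[of v f "- f"] by (simp add: eq_neg_iff_add_eq_0 add.commute)

lemma mp_deriv_minus: "mp_deriv v (f - g) = mp_deriv v f - mp_deriv v (g :: ('v, 'a::comm_ring_1) mpol)"
  using mp_deriv_add[of v f "- g"] by (simp add: mp_deriv_uminus)

lemma mp_deriv_sum: "mp_deriv v (sum f A) = (\<Sum>a\<in>A. mp_deriv v (f a))"
  by (induction A rule: infinite_finite_induct) (auto simp: mp_deriv_add)

lemma mpols_deriv: "f \<in> mpols N \<Longrightarrow> mp_deriv v f \<in> (mpols N :: ('v, 'a::comm_ring_1) mpol set)"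
  by (induction rule: mpol_induct) (auto simp: mp_deriv_add mp_deriv_mult mp_deriv_var mpols_add mpols_mult)

lemma mp_deriv_outside: "f \<in> mpols N \<Longrightarrow> v \<notin> N \<Longrightarrow> mp_deriv v (f :: ('v, 'a::comm_ring_1) mpol) = 0"
  by (induction rule: mpol_induct) (auto simp: mp_deriv_add mp_deriv_mult mp_deriv_var)

lemma mp_deriv_subst:
  fixes s :: "'v \<Rightarrow> ('w, 'a::comm_ring_1) mpol"
  assumes "finite N" "f \<in> mpols N"
  shows "mp_deriv w (mp_eval mconst s f) =
    (\<Sum>v\<in>N. mp_eval mconst s (mp_deriv v f) * mp_deriv w (s v))"
  using assms(2)
proof (induction rule: mpol_induct)
  case (var u)
  have "(\<Sum>v\<in>N. mp_eval mconst s (mp_deriv v (mvar u)) * mp_deriv w (s v)) =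
      (\<Sum>v\<in>N. if v = u then mp_deriv w (s v) else 0)"
    by (intro sum.cong) (auto simp: mp_deriv_var mp_eval_ring_simps)
  with var assms(1) show ?case by (simp add: mp_eval_ring_simps)
next
  case (mult f g)
  then show ?case
    by (simp add: mp_eval_ring_simps mp_deriv_mult mp_deriv_add sum.distrib sum_distrib_left
        sum_distrib_right algebra_simps)
qed (simp_all add: mp_eval_ring_simps mp_deriv_add sum.distrib algebra_simps)

definition (in cring) first_order_expansion :: "'a \<Rightarrow> 'a \<Rightarrow> 'a \<Rightarrow> 'a \<Rightarrow> bool" where
  "first_order_expansion z F F' G \<longleftrightarrow> (\<exists>r\<in>carrier R. G = F \<oplus> z \<otimes> F' \<oplus> z \<otimes> z \<otimes> r)"

lemma (in cring) first_order_expansion_add: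
  assumes carrier: "z \<in> carrier R" "F \<in> carrier R" "F' \<in> carrier R" "H \<in> carrier R" "H' \<in> carrier R"
    and "first_order_expansion z F F' G" "first_order_expansion z H H' K"
  shows "first_order_expansion z (F \<oplus> H) (F' \<oplus> H') (G \<oplus> K)"
proof -
  obtain r s where remainders: "r \<in> carrier R" "s \<in> carrier R"
    and G: "G = F \<oplus> z \<otimes> F' \<oplus> z \<otimes> z \<otimes> r" and K: "K = H \<oplus> z \<otimes> H' \<oplus> z \<otimes> z \<otimes> s"
    using assms(6,7) by (auto simp: first_order_expansion_def)
  have "G \<oplus> K = (F \<oplus> H) \<oplus> z \<otimes> (F' \<oplus> H') \<oplus> z \<otimes> z \<otimes> (r \<oplus> s)"
    unfolding G K using carrier remainders by (simp add: r_distr a_ac)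
  with remainders show ?thesis by (auto simp: first_order_expansion_def)
qed

lemma (in cring) first_order_expansion_mult:
  assumes carrier: "z \<in> carrier R" "F \<in> carrier R" "F' \<in> carrier R" "H \<in> carrier R" "H' \<in> carrier R"
    and "first_order_expansion z F F' G" "first_order_expansion z H H' K"
  shows "first_order_expansion z (F \<otimes> H) (F' \<otimes> H \<oplus> F \<otimes> H') (G \<otimes> K)"
proof -
  obtain r s where remainders: "r \<in> carrier R" "s \<in> carrier R"
    and G: "G = F \<oplus> z \<otimes> F' \<oplus> z \<otimes> z \<otimes> r" and K: "K = H \<oplus> z \<otimes> H' \<oplus> z \<otimes> z \<otimes> s"
    using assms(6,7) by (auto simp: first_order_expansion_def)
  let ?t = "F' \<otimes> H' \<oplus> F \<otimes> s \<oplus> r \<otimes> H \<oplus> z \<otimes> (F' \<otimes> s \<oplus> r \<otimes> H') \<oplus> z \<otimes> z \<otimes> r \<otimes> s"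
  have "G \<otimes> K = F \<otimes> H \<oplus> z \<otimes> (F' \<otimes> H \<oplus> F \<otimes> H') \<oplus> z \<otimes> z \<otimes> ?t"
    unfolding G K using carrier remainders by (simp add: r_distr l_distr a_ac m_ac)
  moreover have "?t \<in> carrier R" using carrier remainders by simp
  ultimately show ?thesis by (auto simp: first_order_expansion_def)
qed

lemma mp_taylor:
  fixes f :: "('v, 'a::comm_ring_1) mpol"
  assumes R: "cring R" and hom: "c \<in> ring_hom ring_of_type_algebra R" and x: "x \<in> N \<rightarrow> carrier R"
    and z: "z \<in> carrier R" and v: "v \<in> N" and f: "f \<in> mpols N"
  shows "cring.first_order_expansion R z (mp_eval_in R c x f) (mp_eval_in R c x (mp_deriv v f))
    (mp_eval_in R c (x(v := x v \<oplus>\<^bsub>R\<^esub> z)) f)"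
proof -
  interpret cring R by (rule R)
  define y where "y = x(v := x v \<oplus>\<^bsub>R\<^esub> z)"
  interpret X: mp_evaluation R c x N by (intro mp_evaluationI R hom x)
  interpret Y: mp_evaluation R c y N
    by (intro mp_evaluationI R hom) (use x v z in \<open>auto simp: Pi_iff y_def\<close>)
  have trivial: "first_order_expansion z F F' (F \<oplus>\<^bsub>R\<^esub> z \<otimes>\<^bsub>R\<^esub> F')" if "F \<in> carrier R" "F' \<in> carrier R" for F F'
    unfolding first_order_expansion_def by (rule bexI[of _ "\<zero>\<^bsub>R\<^esub>"]) (use z that in simp_all)
  have "first_order_expansion z (X.ev f) (X.ev (mp_deriv v f)) (Y.ev f)" using f
  proof (induction rule: mpol_induct)
    case (const a)
    show ?case using trivial[of "c a" "\<zero>\<^bsub>R\<^esub>"] z by simp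
  next
    case (var u)
    have "Y.ev (mvar u) = X.ev (mvar u) \<oplus>\<^bsub>R\<^esub> z \<otimes>\<^bsub>R\<^esub> X.ev (mp_deriv v (mvar u))"
      unfolding X.ev_var[OF var] Y.ev_var[OF var]
      using z v funcset_mem[OF x var] by (auto simp: mp_deriv_var y_def)
    then show ?case
      using trivial[of "X.ev (mvar u)"] var by (metis X.ev_closed mpols_deriv mpols_var)
  next
    case (add f g)
    then show ?case using z
      by (simp add: X.ev_add Y.ev_add mp_deriv_add mpols_deriv X.ev_closed first_order_expansion_add)
  next
    case (mult f g)
    then show ?case using z
      by (simp add: X.ev_add X.ev_mult Y.ev_mult mp_deriv_mult mpols_mult mpols_deriv X.ev_closed
          first_order_expansion_mult)
  qed
  then show ?thesis by (simp add: y_def)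
qed

section \<open>Primes and irreducible varieties\<close>

lemma (in cring) exists_ideal_maximal_avoiding_powers:
  assumes I: "ideal I R" and f: "f \<in> carrier R" and avoid: "\<And>n::nat. f [^] n \<notin> I"
  obtains P where "ideal P R" "I \<subseteq> P" "\<And>n::nat. f [^] n \<notin> P"
    "\<And>Q. ideal Q R \<Longrightarrow> P \<subset> Q \<Longrightarrow> \<exists>n::nat. f [^] n \<in> Q"
proof -
  define A where "A = {Q. ideal Q R \<and> I \<subseteq> Q \<and> (\<forall>n::nat. f [^] n \<notin> Q)}"
  have "\<exists>M\<in>A. \<forall>Q\<in>A. M \<subseteq> Q \<longrightarrow> Q = M"
  proof (rule subset_Zorn_nonempty)
    show "A \<noteq> {}" using I avoid by (auto simp: A_def)
    fix C assume C: "C \<noteq> {}" "subset.chain A C"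
    then have "subset.chain {I. ideal I R} C"
      by (auto simp: subset.chain_def A_def)
    from chain_Union_is_ideal[OF this] C have "ideal (\<Union>C) R" by simp
    moreover have "I \<subseteq> \<Union>C" using C by (fastforce simp: subset.chain_def A_def)
    ultimately show "\<Union>C \<in> A"
      using C by (auto simp: subset.chain_def A_def)
  qed
  then obtain M where M: "M \<in> A" "\<And>Q. Q \<in> A \<Longrightarrow> M \<subseteq> Q \<Longrightarrow> Q = M" by blast
  show ?thesis
  proof (rule that[of M])
    fix Q assume Q: "ideal Q R" "M \<subset> Q"
    then have "Q \<notin> A" using M(2)[of Q] by blast
    then show "\<exists>n::nat. f [^] n \<in> Q"
      using Q M(1) by (auto simp: A_def)
  qed (use M(1) in \<open>auto simp: A_def\<close>)
qed

lemma (in cring) ideal_add_principal: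
  assumes "ideal P R" "a \<in> carrier R"
  shows "ideal (P <+>\<^bsub>R\<^esub> PIdl a) R" "P \<subseteq> P <+>\<^bsub>R\<^esub> PIdl a" "a \<in> P <+>\<^bsub>R\<^esub> PIdl a"
    "\<And>z. z \<in> P <+>\<^bsub>R\<^esub> PIdl a \<Longrightarrow> \<exists>p\<in>P. \<exists>x\<in>carrier R. z = p \<oplus> x \<otimes> a"
proof -
  interpret P: ideal P R by fact
  show "ideal (P <+>\<^bsub>R\<^esub> PIdl a) R"
    using assms by (intro add_ideals cgenideal_ideal)
  show "P \<subseteq> P <+>\<^bsub>R\<^esub> PIdl a"
  proof
    fix p assume p: "p \<in> P"
    then have "p = p \<oplus> \<zero> \<otimes> a" using assms P.a_Hcarr by auto
    with p show "p \<in> P <+>\<^bsub>R\<^esub> PIdl a"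
      unfolding set_add_def' cgenideal_def by blast
  qed
  have "a = \<zero> \<oplus> \<one> \<otimes> a" using assms by auto
  then show "a \<in> P <+>\<^bsub>R\<^esub> PIdl a"
    unfolding set_add_def' cgenideal_def using P.zero_closed by blast
qed (auto simp: set_add_def' cgenideal_def)

lemma (in cring) exists_prime_avoiding:
  assumes I: "ideal I R" and f: "f \<in> carrier R" and avoid: "\<And>n::nat. f [^] n \<notin> I"
  obtains P where "primeideal P R" "I \<subseteq> P" "f \<notin> P"
proof -
  obtain P where P: "ideal P R" "I \<subseteq> P" "\<And>n::nat. f [^] n \<notin> P"
    and max: "\<And>Q. ideal Q R \<Longrightarrow> P \<subset> Q \<Longrightarrow> \<exists>n::nat. f [^] n \<in> Q"
    using exists_ideal_maximal_avoiding_powers[OF assms] by metis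
  interpret P: ideal P R by fact
  have "primeideal P R"
  proof (rule primeidealI)
    show "ideal P R" "cring R" by fact (rule cring_axioms)
    show "carrier R \<noteq> P" using P(3)[of 0] by auto
    fix a b assume ab: "a \<in> carrier R" "b \<in> carrier R" "a \<otimes> b \<in> P"
    show "a \<in> P \<or> b \<in> P"
    proof (rule ccontr)
      assume neither: "\<not> (a \<in> P \<or> b \<in> P)"
      have "\<exists>n::nat. f [^] n \<in> P <+>\<^bsub>R\<^esub> PIdl a"
        using ideal_add_principal[OF P(1) ab(1)] neither by (intro max) auto
      moreover have "\<exists>n::nat. f [^] n \<in> P <+>\<^bsub>R\<^esub> PIdl b"
        using ideal_add_principal[OF P(1) ab(2)] neither by (intro max) auto
      ultimately obtain n m :: nat and p q x y where
        n: "f [^] n = p \<oplus> x \<otimes> a" "p \<in> P" "x \<in> carrier R" and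
        m: "f [^] m = q \<oplus> y \<otimes> b" "q \<in> P" "y \<in> carrier R"
        using ideal_add_principal(4)[OF P(1) ab(1)] ideal_add_principal(4)[OF P(1) ab(2)] by metis
      have pq: "p \<in> carrier R" "q \<in> carrier R"
        using n m P.a_Hcarr by auto
      have "f [^] (n + m) = f [^] n \<otimes> f [^] m"
        using f by (simp add: nat_pow_mult)
      also have "\<dots> = (q \<oplus> y \<otimes> b) \<otimes> p \<oplus> (x \<otimes> a \<otimes> q \<oplus> x \<otimes> y \<otimes> (a \<otimes> b))"
        unfolding n m using n(3) m(3) ab pq by (simp add: r_distr l_distr a_ac m_ac)
      also have "\<dots> \<in> P"
        using n m ab pq
        by (intro P.a_closed P.I_l_closed[of p] P.I_l_closed[of q] P.I_l_closed[of "a \<otimes> b"]) auto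
      finally show False using P(3) by blast
    qed
  qed
  then show ?thesis using that P(2) P(3)[of 1] f by auto
qed

lemma ideal_mpolD:
  fixes J :: "('v, 'a::comm_ring_1) mpol set"
  assumes "ideal J (mpol_ring N)"
  shows "J \<subseteq> mpols N" "0 \<in> J" "f \<in> J \<Longrightarrow> g \<in> J \<Longrightarrow> f + g \<in> J"
    "f \<in> J \<Longrightarrow> p \<in> mpols N \<Longrightarrow> p * f \<in> J" "f \<in> J \<Longrightarrow> p \<in> mpols N \<Longrightarrow> f * p \<in> J"
    "f \<in> J \<Longrightarrow> - f \<in> J" "f \<in> J \<Longrightarrow> g \<in> J \<Longrightarrow> f - g \<in> J"
proof -
  interpret ideal J "mpol_ring N" by fact
  show "J \<subseteq> mpols N" using a_subset by simp
  show "0 \<in> J" using additive_subgroup.zero_closed[OF is_additive_subgroup] by simp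
  have add: "f + g \<in> J" if "f \<in> J" "g \<in> J" for f g
    using that additive_subgroup.a_closed[OF is_additive_subgroup, of f g] by simp
  then show "f \<in> J \<Longrightarrow> g \<in> J \<Longrightarrow> f + g \<in> J" .
  have mult: "p * f \<in> J" if "f \<in> J" "p \<in> mpols N" for f p using that I_l_closed by simp
  then show "f \<in> J \<Longrightarrow> p \<in> mpols N \<Longrightarrow> p * f \<in> J" .
  show "f * p \<in> J" if "f \<in> J" "p \<in> mpols N" using that I_r_closed by simp
  have uminus: "- f \<in> J" if "f \<in> J" for f using mult[OF that, of "- 1"] by (simp add: mpols_uminus)
  then show "f \<in> J \<Longrightarrow> - f \<in> J" .
  show "f - g \<in> J" if "f \<in> J" "g \<in> J"
    using add[OF that(1) uminus[OF that(2)]] by simp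
qed

lemma ideal_mpolI:
  fixes J :: "('v, 'a::comm_ring_1) mpol set"
  assumes "J \<subseteq> mpols N" "0 \<in> J" "\<And>f g. f \<in> J \<Longrightarrow> g \<in> J \<Longrightarrow> f + g \<in> J"
    "\<And>f p. f \<in> J \<Longrightarrow> p \<in> mpols N \<Longrightarrow> p * f \<in> J"
  shows "ideal J (mpol_ring N)"
proof -
  interpret R: cring "mpol_ring N :: ('v, 'a) mpol ring" by (rule cring_mpol_ring)
  have a_inv: "\<ominus>\<^bsub>mpol_ring N\<^esub> f = - f" if "f \<in> mpols N" for f :: "('v, 'a) mpol"
    by (rule R.minus_equality) (use that in \<open>auto simp: mpols_uminus\<close>)
  have uminus: "- f \<in> J" if "f \<in> J" for f
    using assms(4)[OF that, of "- 1"] by (simp add: mpols_uminus)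
  show ?thesis
  proof (rule idealI)
    show "ring (mpol_ring N :: ('v, 'a) mpol ring)" by (rule R.ring_axioms)
    show "subgroup J (add_monoid (mpol_ring N))"
    proof (rule R.add.subgroupI)
      fix f assume "f \<in> J"
      then show "\<ominus>\<^bsub>mpol_ring N\<^esub> f \<in> J"
        using uminus a_inv assms(1) by auto
    qed (use assms in auto)
  qed (use assms(4) in \<open>auto simp: mult.commute\<close>)
qed

lemma primeideal_mpolD:
  fixes J :: "('v, 'a::comm_ring_1) mpol set"
  assumes "primeideal J (mpol_ring N)"
  shows "ideal J (mpol_ring N)" "1 \<notin> J"
    "f \<in> mpols N \<Longrightarrow> g \<in> mpols N \<Longrightarrow> f * g \<in> J \<Longrightarrow> f \<in> J \<or> g \<in> J"
    "f \<in> mpols N \<Longrightarrow> f ^ k \<in> J \<Longrightarrow> f \<in> J"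
proof -
  interpret primeideal J "mpol_ring N" by fact
  show "ideal J (mpol_ring N)" by (rule is_ideal)
  show one: "1 \<notin> J"
    using I_notcarr one_imp_carrier by auto
  have prime: "f \<in> J \<or> g \<in> J" if "f \<in> mpols N" "g \<in> mpols N" "f * g \<in> J" for f g
    using I_prime that by simp
  then show "f \<in> mpols N \<Longrightarrow> g \<in> mpols N \<Longrightarrow> f * g \<in> J \<Longrightarrow> f \<in> J \<or> g \<in> J" .
  show "f \<in> J" if "f \<in> mpols N" "f ^ k \<in> J"
    using that(2)
  proof (induction k)
    case (Suc k)
    then show ?case using prime[of f "f ^ k"] that(1) mpols_power by auto
  qed (use one in auto)
qed

lemma primeideal_mpolI:
  fixes J :: "('v, 'a::comm_ring_1) mpol set"
  assumes "ideal J (mpol_ring N)" "1 \<notin> J"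
    "\<And>f g. f \<in> mpols N \<Longrightarrow> g \<in> mpols N \<Longrightarrow> f * g \<in> J \<Longrightarrow> f \<in> J \<or> g \<in> J"
  shows "primeideal J (mpol_ring N)"
proof (rule primeidealI)
  show "carrier (mpol_ring N) \<noteq> J" using assms(2) by auto
qed (use assms cring_mpol_ring in auto)

lemma topspace_zariski:
  fixes I :: "('v, 'a::comm_ring_1) mpol set"
  shows "topspace (zariski N I) = {p. primeideal p (mpol_ring N) \<and> I \<subseteq> p}"
proof
  let ?V = "{p. primeideal p (mpol_ring N) \<and> I \<subseteq> p}"
  have "1 \<notin> p" if "primeideal p (mpol_ring N)" for p :: "('v, 'a) mpol set"
    using primeideal_mpolD(2)[OF that] .
  then have "?V = {p. primeideal p (mpol_ring N) \<and> I \<subseteq> p \<and> \<not> {1} \<subseteq> p}"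
    by auto
  moreover have "{1 :: ('v, 'a) mpol} \<subseteq> mpols N" by simp
  ultimately have "openin (zariski N I) ?V"
    unfolding openin_zariski by (intro exI[of _ "{1}"] conjI)
  then show "?V \<subseteq> topspace (zariski N I)"
    by (rule openin_subset)
  show "topspace (zariski N I) \<subseteq> ?V"
  proof
    fix p assume "p \<in> topspace (zariski N I)"
    then obtain U where U: "p \<in> U" "openin (zariski N I) U"
      unfolding topspace_def by auto
    from U(2)[unfolded openin_zariski]
    obtain S where "U = {p. primeideal p (mpol_ring N) \<and> I \<subseteq> p \<and> \<not> S \<subseteq> p}"
      by (elim exE conjE)
    with U(1) show "p \<in> ?V" by simp
  qed
qed

lemma closedin_zariski_hypersurface:
  fixes I :: "('v, 'a::comm_ring_1) mpol set"
  assumes "f \<in> mpols N"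
  shows "closedin (zariski N I) {p. primeideal p (mpol_ring N) \<and> I \<subseteq> p \<and> f \<in> p}"
proof -
  have "topspace (zariski N I) - {p. primeideal p (mpol_ring N) \<and> I \<subseteq> p \<and> f \<in> p} =
      {p. primeideal p (mpol_ring N) \<and> I \<subseteq> p \<and> \<not> {f} \<subseteq> p}"
    by (auto simp: topspace_zariski)
  then show ?thesis
    unfolding closedin_def openin_zariski using assms
    by (auto simp: topspace_zariski intro!: exI[of _ "{f}"])
qed

lemma pow_mpol_ring: "f [^]\<^bsub>mpol_ring N\<^esub> (k::nat) = (f ^ k :: ('v, 'a::comm_ring_1) mpol)"
proof -
  interpret cring "mpol_ring N :: ('v, 'a) mpol ring" by (rule cring_mpol_ring)
  show ?thesis by (induction k) (auto simp: mult.commute)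
qed

lemma prime_of_irreducible_variety:
  fixes I :: "('v, 'a::field) mpol set"
  assumes "irreducible_variety N I"
  shows "primeideal I (mpol_ring N)"
proof -
  have ideal: "ideal I (mpol_ring N)" and radical: "\<And>f r. f \<in> mpols N \<Longrightarrow> f ^ r \<in> I \<Longrightarrow> f \<in> I"
    and irreducible: "irreducible_space (zariski N I)"
    using assms by (auto simp: irreducible_variety_def affine_variety_def)
  interpret R: cring "mpol_ring N :: ('v, 'a) mpol ring" by (rule cring_mpol_ring)
  let ?V = "\<lambda>f. {p. primeideal p (mpol_ring N) \<and> I \<subseteq> p \<and> f \<in> p}"
  have separating_prime: "\<exists>p. primeideal p (mpol_ring N) \<and> I \<subseteq> p \<and> f \<notin> p" if "f \<in> mpols N" "f \<notin> I" for f
    using R.exists_prime_avoiding[OF ideal, of f] radical that by (simp add: pow_mpol_ring) metis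
  show ?thesis
  proof (rule primeideal_mpolI[OF ideal])
    obtain p where "primeideal p (mpol_ring N)" "I \<subseteq> p"
      using irreducible by (auto simp: irreducible_space_def topspace_zariski)
    then show "1 \<notin> I" using primeideal_mpolD(2) by blast
    fix f g assume fg: "f \<in> mpols N" "g \<in> mpols N" "f * g \<in> I"
    have "?V f \<union> ?V g = topspace (zariski N I)"
      unfolding topspace_zariski using fg primeideal_mpolD(3)[of _ N f g] by blast
    then have "?V f = topspace (zariski N I) \<or> ?V g = topspace (zariski N I)"
      using irreducible closedin_zariski_hypersurface[of f N I] closedin_zariski_hypersurface[of g N I] fg
      unfolding irreducible_space_def by blast
    then show "f \<in> I \<or> g \<in> I"
      using separating_prime[of f] separating_prime[of g] fg unfolding topspace_zariski by blast
  qed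
qed

lemma closedin_zariski_containing_generic:
  assumes "closedin (zariski N I) A" "I \<in> A"
  shows "A = topspace (zariski N (I :: ('v, 'a::comm_ring_1) mpol set))"
proof -
  obtain S where S: "topspace (zariski N I) - A = {p. primeideal p (mpol_ring N) \<and> I \<subseteq> p \<and> \<not> S \<subseteq> p}"
    using assms(1) by (auto simp: closedin_def openin_zariski)
  have "primeideal I (mpol_ring N)"
    using closedin_subset[OF assms(1)] assms(2) by (auto simp: topspace_zariski)
  with S assms(2) have "S \<subseteq> I" by auto
  with S have "topspace (zariski N I) - A = {}" by auto
  with assms(1) show ?thesis by (auto dest: closedin_subset)
qed

lemma irreducible_variety_iff_prime:
  fixes I :: "('v, 'a::field) mpol set"
  shows "irreducible_variety N I \<longleftrightarrow> finite N \<and> primeideal I (mpol_ring N)"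
proof
  assume "irreducible_variety N I"
  then show "finite N \<and> primeideal I (mpol_ring N)"
    using prime_of_irreducible_variety by (auto simp: irreducible_variety_def affine_variety_def)
next
  assume "finite N \<and> primeideal I (mpol_ring N)"
  then have finite: "finite N" and prime: "primeideal I (mpol_ring N)" by auto
  then have generic: "I \<in> topspace (zariski N I)" by (simp add: topspace_zariski)
  have "irreducible_space (zariski N I)"
    unfolding irreducible_space_def
  proof (intro conjI allI impI)
    show "topspace (zariski N I) \<noteq> {}" using generic by blast
    fix A B assume "closedin (zariski N I) A \<and> closedin (zariski N I) B \<and> A \<union> B = topspace (zariski N I)"
    then show "A = topspace (zariski N I) \<or> B = topspace (zariski N I)"
      using generic closedin_zariski_containing_generic by blast
  qed
  then show "irreducible_variety N I"
    unfolding irreducible_variety_def affine_variety_def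
    by (intro conjI ballI allI impI finite primeideal_mpolD(1)[OF prime]) (rule primeideal_mpolD(4)[OF prime])
qed

lemma zariski_dense_in_iff:
  fixes I :: "('v, 'a::field) mpol set"
  assumes I: "primeideal I (mpol_ring N)"
  shows "zariski_dense_in N I P \<longleftrightarrow>
    (\<forall>f\<in>mpols N. f \<notin> I \<longrightarrow> (\<exists>p\<in>P. primeideal p (mpol_ring N) \<and> I \<subseteq> p \<and> f \<notin> p))"
proof
  assume dense: "zariski_dense_in N I P"
  show "\<forall>f\<in>mpols N. f \<notin> I \<longrightarrow> (\<exists>p\<in>P. primeideal p (mpol_ring N) \<and> I \<subseteq> p \<and> f \<notin> p)"
  proof (intro ballI impI)
    fix f assume f: "f \<in> mpols N" "f \<notin> I"
    let ?U = "{p. primeideal p (mpol_ring N) \<and> I \<subseteq> p \<and> \<not> {f} \<subseteq> p}"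
    have "openin (zariski N I) ?U"
      unfolding openin_zariski using f by (intro exI[of _ "{f}"]) auto
    moreover have "I \<in> ?U" using f I by auto
    moreover have "I \<in> zariski N I closure_of P"
      using dense I by (simp add: zariski_dense_in_def topspace_zariski)
    ultimately have "\<exists>p. p \<in> P \<and> p \<in> ?U" by (simp add: in_closure_of del: mem_Collect_eq)
    then show "\<exists>p\<in>P. primeideal p (mpol_ring N) \<and> I \<subseteq> p \<and> f \<notin> p" by auto
  qed
next
  assume separated: "\<forall>f\<in>mpols N. f \<notin> I \<longrightarrow> (\<exists>p\<in>P. primeideal p (mpol_ring N) \<and> I \<subseteq> p \<and> f \<notin> p)"
  have "x \<in> zariski N I closure_of P" if x: "x \<in> topspace (zariski N I)" for x
    unfolding in_closure_of
  proof (intro conjI allI impI x)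
    fix U assume U: "x \<in> U \<and> openin (zariski N I) U"
    then obtain S where S: "S \<subseteq> mpols N" "U = {p. primeideal p (mpol_ring N) \<and> I \<subseteq> p \<and> \<not> S \<subseteq> p}"
      by (auto simp: openin_zariski)
    with U obtain f where "f \<in> S" "f \<notin> x" "I \<subseteq> x" by auto
    with S(1) separated obtain p where "p \<in> P" "primeideal p (mpol_ring N)" "I \<subseteq> p" "f \<notin> p"
      by blast
    with S(2) \<open>f \<in> S\<close> show "\<exists>y. y \<in> P \<and> y \<in> U" by auto
  qed
  then show "zariski_dense_in N I P"
    unfolding zariski_dense_in_def by (auto simp: in_closure_of)
qed

definition vanishing_ideal :: "('a::field \<Rightarrow> 'b::field) \<Rightarrow> 'v set \<Rightarrow> ('v \<Rightarrow> 'b) \<Rightarrow> ('v, 'a) mpol set" where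
  "vanishing_ideal c N b = {f \<in> mpols N. mp_eval c b f = 0}"

lemma point_ideal_eq: "point_ideal N x = vanishing_ideal id N x"
  by (simp add: point_ideal_def vanishing_ideal_def)

lemma primeideal_vanishing_ideal:
  assumes hom: "type_hom c"
  shows "primeideal (vanishing_ideal c N b) (mpol_ring N)"
proof (rule primeideal_mpolI)
  show "ideal (vanishing_ideal c N b) (mpol_ring N)"
    by (rule ideal_mpolI)
      (auto simp: vanishing_ideal_def mp_eval_ring_simps[OF hom] mpols_add mpols_mult)
qed (auto simp: vanishing_ideal_def mp_eval_ring_simps[OF hom])

lemma rational_points_alt:
  fixes I :: "('v, 'a::field) mpol set"
  assumes "I \<subseteq> mpols N"
  shows "x \<in> rational_points N I \<longleftrightarrow> x \<in> N \<rightarrow>\<^sub>E UNIV \<and> I \<subseteq> point_ideal N x"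
  using assms by (auto simp: rational_points_def points_def point_ideal_def)

lemma rational_points_dense_iff:
  fixes I :: "('v, 'a::field) mpol set"
  assumes I: "primeideal I (mpol_ring N)" and A: "A \<subseteq> rational_points N I"
  shows "zariski_dense_in N I (point_ideal N ` A) \<longleftrightarrow>
    (\<forall>f\<in>mpols N. f \<notin> I \<longrightarrow> (\<exists>x\<in>A. mp_eval id x f \<noteq> 0))"
proof -
  have "I \<subseteq> mpols N"
    using ideal_mpolD(1) primeideal_mpolD(1)[OF I] by blast
  then have "I \<subseteq> point_ideal N x" if "x \<in> A" for x
    using A that rational_points_alt by blast
  moreover have "primeideal (point_ideal N x) (mpol_ring N)" for x :: "'v \<Rightarrow> 'a"
    unfolding point_ideal_eq by (rule primeideal_vanishing_ideal) simp
  ultimately show ?thesis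
    unfolding zariski_dense_in_iff[OF I] by (auto simp: point_ideal_def)
qed

section \<open>Jacobian ranks\<close>

interpretation fun_vs: vector_space "\<lambda>(a::'b::field) (u :: 'v \<Rightarrow> 'b). (\<lambda>v. a * u v)"
  by unfold_locales (auto simp: fun_eq_iff algebra_simps)

lemma sum_fun_apply: "(\<Sum>a\<in>A. f a) x = (\<Sum>a\<in>A. f a x)"
  by (induction A rule: infinite_finite_induct) auto

lemma fun_vs_independent_family:
  fixes g :: "'i \<Rightarrow> 'v \<Rightarrow> 'b::field"
  assumes S: "finite S"
    and trivial_relations: "\<And>a. (\<And>v. (\<Sum>i\<in>S. a i * g i v) = 0) \<Longrightarrow> \<forall>i\<in>S. a i = 0"
  shows "inj_on g S" "fun_vs.independent (g ` S)"
proof -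
  show inj: "inj_on g S"
  proof (rule inj_onI, rule ccontr)
    fix i j assume ij: "i \<in> S" "j \<in> S" "g i = g j" "i \<noteq> j"
    define a where "a = (\<lambda>k. if k = i then 1 else if k = j then - 1 else (0::'b))"
    have "(\<Sum>k\<in>S. a k * g k v) = 0" for v
    proof -
      have "(\<Sum>k\<in>S. a k * g k v) = (\<Sum>k\<in>{i, j}. a k * g k v)"
        by (rule sum.mono_neutral_right) (use ij S in \<open>auto simp: a_def\<close>)
      also have "\<dots> = 0" using ij by (simp add: a_def)
      finally show ?thesis .
    qed
    then have "a i = 0" using trivial_relations[of a] ij by blast
    then show False by (simp add: a_def)
  qed
  show "fun_vs.independent (g ` S)"
  proof (rule fun_vs.independent_if_scalars_zero)
    fix a u assume "(\<Sum>w\<in>g ` S. (\<lambda>v. a w * w v)) = 0" "u \<in> g ` S"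
    moreover from this(1) have "(\<Sum>i\<in>S. a (g i) * g i v) = 0" for v
      by (simp add: fun_eq_iff sum_fun_apply sum.reindex[OF inj])
    ultimately show "a u = 0" using trivial_relations[of "\<lambda>i. a (g i)"] by auto
  qed (use S in simp)
qed

lemma fun_vs_span_family:
  fixes g :: "'i \<Rightarrow> 'v \<Rightarrow> 'b::field"
  shows "(\<lambda>v. \<Sum>i\<in>S. a i * g i v) \<in> fun_vs.span (g ` S)"
proof -
  have "(\<Sum>i\<in>S. (\<lambda>v. a i * g i v)) \<in> fun_vs.span (g ` S)"
    by (intro fun_vs.span_sum fun_vs.span_scale fun_vs.span_base) auto
  moreover have "(\<Sum>i\<in>S. (\<lambda>v. a i * g i v)) = (\<lambda>v. \<Sum>i\<in>S. a i * g i v)"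
    by (rule ext) (simp add: sum_fun_apply)
  ultimately show ?thesis by simp
qed

lemma fun_vs_dim_triangular:
  fixes g :: "'v \<Rightarrow> 'v \<Rightarrow> 'b::field" and ord :: "'v \<Rightarrow> nat"
  assumes S: "finite S" and ord: "inj_on ord S"
    and diagonal: "\<And>v. v \<in> S \<Longrightarrow> g v v \<noteq> 0"
    and triangular: "\<And>v w. v \<in> S \<Longrightarrow> w \<in> S \<Longrightarrow> ord v < ord w \<Longrightarrow> g v w = 0"
    and "g ` S \<subseteq> W" and "W \<subseteq> fun_vs.span (g ` S)"
  shows "fun_vs.dim W = card S"
proof -
  have trivial_relations: "\<forall>i\<in>S. a i = 0" if relation: "\<And>v. (\<Sum>i\<in>S. a i * g i v) = 0" for a
  proof (rule ccontr)
    assume "\<not> (\<forall>i\<in>S. a i = 0)"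
    then have support: "finite (ord ` {i \<in> S. a i \<noteq> 0})" "ord ` {i \<in> S. a i \<noteq> 0} \<noteq> {}" using S by auto
    from Max_in[OF this] obtain v where v: "v \<in> S" "a v \<noteq> 0" "ord v = Max (ord ` {i \<in> S. a i \<noteq> 0})"
      by force
    have "a i * g i v = 0" if i: "i \<in> S" "i \<noteq> v" for i
    proof (cases "a i = 0")
      case False
      then have "ord i \<le> ord v" using v(3) support(1) i by auto
      with i v(1) ord have "ord i < ord v" by (metis inj_onD le_neq_implies_less)
      then show ?thesis using triangular[of i v] i v by simp
    qed simp
    then have "(\<Sum>i\<in>S - {v}. a i * g i v) = 0"
      by (intro sum.neutral) auto
    then have "(\<Sum>i\<in>S. a i * g i v) = a v * g v v"
      using S v(1) by (subst sum.remove[of _ v]) auto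
    then show False using relation[of v] diagonal v by simp
  qed
  note family = fun_vs_independent_family[where g = g, OF S trivial_relations]
  show ?thesis
    by (rule fun_vs.dim_unique[of "g ` S"]) (use assms family in \<open>auto simp: card_image\<close>)
qed

definition supported :: "'v set \<Rightarrow> ('v \<Rightarrow> 'b::field) set" where
  "supported N = {u. \<forall>v. v \<notin> N \<longrightarrow> u v = 0}"

definition unit_fun :: "'v \<Rightarrow> 'v \<Rightarrow> 'b::field" where
  "unit_fun w = (\<lambda>v. if v = w then 1 else 0)"

lemma sum_unit_fun:
  "finite N \<Longrightarrow> (\<Sum>w\<in>N. a w * unit_fun w v) = (if v \<in> N then a v else (0 :: 'b::field))"
  by (simp add: unit_fun_def if_distrib cong: if_cong)

lemma supported_eq_span:
  assumes "finite N"
  shows "supported N = fun_vs.span (unit_fun ` N :: ('v \<Rightarrow> 'b::field) set)"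
proof
  have subspace: "fun_vs.subspace (supported N :: ('v \<Rightarrow> 'b) set)"
    by (auto simp: supported_def intro!: fun_vs.subspaceI)
  show "fun_vs.span (unit_fun ` N) \<subseteq> (supported N :: ('v \<Rightarrow> 'b) set)"
    by (rule fun_vs.span_minimal[OF _ subspace]) (auto simp: supported_def unit_fun_def)
  show "supported N \<subseteq> fun_vs.span (unit_fun ` N :: ('v \<Rightarrow> 'b) set)"
  proof
    fix u :: "'v \<Rightarrow> 'b" assume "u \<in> supported N"
    then have "u = (\<lambda>v. \<Sum>w\<in>N. u w * unit_fun w v)"
      using assms by (auto simp: sum_unit_fun supported_def fun_eq_iff)
    then show "u \<in> fun_vs.span (unit_fun ` N)"
      using fun_vs_span_family[where S = N and a = u and g = unit_fun] by simp
  qed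
qed

lemma finite_independent_supported:
  assumes "finite N" "B \<subseteq> supported N" "fun_vs.independent B"
  shows "finite B"
  using fun_vs.independent_span_bound[of "unit_fun ` N" B] assms supported_eq_span by blast

lemma dim_supported:
  assumes "finite N"
  shows "fun_vs.dim (supported N :: ('v \<Rightarrow> 'b::field) set) = card N"
proof -
  have "\<forall>i\<in>N. a i = 0" if "\<And>v. (\<Sum>i\<in>N. a i * unit_fun i v) = (0::'b)" for a
    using that assms by (auto simp: sum_unit_fun) (metis (full_types))
  note family = fun_vs_independent_family[where g = unit_fun, OF assms this]
  show ?thesis
    by (rule fun_vs.dim_unique[of "unit_fun ` N"])
      (use assms family in \<open>auto simp: supported_eq_span card_image fun_vs.span_base\<close>)
qed

interpretation fun_vs_pair: vector_space_pair "\<lambda>(a::'b::field) (u :: 'w \<Rightarrow> 'b). (\<lambda>v. a * u v)"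
  "\<lambda>(a::'b::field) (u :: 'v \<Rightarrow> 'b). (\<lambda>v. a * u v)"
  by unfold_locales

text \<open>\<open>A\<close> induces a surjection from the quotient by \<open>W'\<close> to the quotient by \<open>W\<close>, with section \<open>B\<close>.\<close>

lemma fun_vs_codim_le:
  fixes W :: "('v \<Rightarrow> 'b::field) set" and W' :: "('w \<Rightarrow> 'b) set"
  assumes N: "finite N" and N': "finite N'"
    and W: "W \<subseteq> supported N" and W': "W' \<subseteq> supported N'"
    and linear: "Vector_Spaces.linear (\<lambda>a u v. a * u v) (\<lambda>a u v. a * u v) A"
    and image: "A ` W' \<subseteq> fun_vs.span W"
    and B: "\<And>u. u \<in> supported N \<Longrightarrow> B u \<in> supported N'"
    and section_mod: "\<And>u. u \<in> supported N \<Longrightarrow> A (B u) - u \<in> fun_vs.span W"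
  shows "card N + fun_vs.dim W' \<le> card N' + fun_vs.dim W"
proof -
  obtain basis where basis: "basis \<subseteq> W" "fun_vs.independent basis" "W \<subseteq> fun_vs.span basis"
      "card basis = fun_vs.dim W"
    using fun_vs.basis_exists[of W] by metis
  obtain basis' where basis': "basis' \<subseteq> W'" "fun_vs.independent basis'" "W' \<subseteq> fun_vs.span basis'"
      "card basis' = fun_vs.dim W'"
    using fun_vs.basis_exists[of W'] by metis
  obtain E where E: "basis' \<subseteq> E" "E \<subseteq> supported N'" "fun_vs.independent E" "supported N' \<subseteq> fun_vs.span E"
    using fun_vs.maximal_independent_subset_extend[of basis' "supported N'"] basis' W' by blast
  have finite: "finite basis" "finite E"
    using finite_independent_supported[OF N order_trans[OF basis(1) W] basis(2)]
      finite_independent_supported[OF N' E(2,3)] .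
  have "card E = card N'"
    using fun_vs.dim_unique[OF E(2,4,3) refl] dim_supported[OF N', where 'b = 'b] by simp
  then have complement: "card (E - basis') + fun_vs.dim W' = card N'"
    using E(1) finite basis'(4) card_mono[of E basis'] finite_subset[of basis' E]
    by (simp add: card_Diff_subset)
  let ?G = "basis \<union> A ` (E - basis')"
  have span_W: "fun_vs.span W \<subseteq> fun_vs.span ?G"
    using basis(3) fun_vs.span_mono[OF Un_upper1] by (intro fun_vs.span_minimal fun_vs.subspace_span) (rule order_trans)
  have "supported N \<subseteq> fun_vs.span ?G"
  proof
    fix u :: "'v \<Rightarrow> 'b" assume u: "u \<in> supported N"
    have "A ` basis' \<subseteq> fun_vs.span ?G" using image_mono[OF basis'(1)] image span_W by (meson order_trans)
    moreover have "A ` (E - basis') \<subseteq> fun_vs.span ?G" using fun_vs.span_superset[of ?G] by (rule order_trans[rotated]) simp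
    ultimately have "A ` E \<subseteq> fun_vs.span ?G" by blast
    then have "fun_vs.span (A ` E) \<subseteq> fun_vs.span ?G"
      by (rule fun_vs.span_minimal[OF _ fun_vs.subspace_span])
    moreover have "A (B u) \<in> fun_vs.span (A ` E)"
      using B[OF u] E(4) fun_vs_pair.linear_span_image[OF linear, of E] by blast
    ultimately have "A (B u) \<in> fun_vs.span ?G" by blast
    moreover have "A (B u) - u \<in> fun_vs.span ?G" using section_mod[OF u] span_W by blast
    ultimately show "u \<in> fun_vs.span ?G" using fun_vs.span_diff[of "A (B u)" ?G "A (B u) - u"] by simp
  qed
  then have "card N \<le> card ?G"
    using fun_vs.dim_le_card[of "supported N" ?G] finite by (simp add: dim_supported[OF N])
  also have "\<dots> \<le> fun_vs.dim W + card (E - basis')"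
    using card_Un_le[of basis "A ` (E - basis')"] card_image_le[of "E - basis'" A] finite basis(4) by simp
  finally show ?thesis using complement by linarith
qed

definition gradient :: "('a::field \<Rightarrow> 'b::field) \<Rightarrow> ('v \<Rightarrow> 'b) \<Rightarrow> ('v, 'a) mpol \<Rightarrow> 'v \<Rightarrow> 'b" where
  "gradient c x f = (\<lambda>v. mp_eval c x (mp_deriv v f))"

lemma gradient_minus: "type_hom c \<Longrightarrow> gradient c x (f - g) = gradient c x f - gradient c x g"
  by (simp add: gradient_def fun_eq_iff mp_deriv_minus mp_eval_ring_simps)

lemma gradient_mvar: "type_hom c \<Longrightarrow> gradient c x (mvar v) = unit_fun v"
  by (auto simp: gradient_def unit_fun_def fun_eq_iff mp_deriv_var mp_eval_ring_simps)

lemma smooth_at_iff: "smooth_at c N I x \<longleftrightarrow> fun_vs.dim (gradient c x ` I) + variety_dim N I = card N"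
  by (simp add: smooth_at_def gradient_def[abs_def])

lemma gradient_supported: "type_hom c \<Longrightarrow> f \<in> mpols N \<Longrightarrow> gradient c x f \<in> supported N"
  by (auto simp: gradient_def supported_def mp_deriv_outside mp_eval_ring_simps)

lemma gradient_subst:
  fixes s :: "'v \<Rightarrow> ('w, 'a::field) mpol"
  assumes hom: "type_hom c" and N: "finite N" and f: "f \<in> mpols N"
    and y: "\<And>v. v \<in> N \<Longrightarrow> y v = mp_eval c x (s v)"
  shows "gradient c x (mp_eval mconst s f) w = (\<Sum>v\<in>N. gradient c y f v * gradient c x (s v) w)"
proof -
  have "mp_eval c x (mp_eval mconst s (mp_deriv v f)) = mp_eval c y (mp_deriv v f)" for v
    unfolding mp_eval_subst[OF hom] using y by (intro mp_eval_cong[OF hom, of _ N] mpols_deriv f) auto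
  then show ?thesis
    unfolding gradient_def mp_deriv_subst[OF N f] by (simp add: mp_eval_sum[OF hom] mp_eval_mult[OF hom])
qed

text \<open>Two tuples generating the same \<open>K\<close>-algebra: \<open>b' = \<phi>(b)\<close> and \<open>b = \<psi>(b')\<close>.\<close>

locale interdefinable =
  fixes c :: "'a::field \<Rightarrow> 'f::field" and N :: "'v set" and N' :: "'w set"
    and b :: "'v \<Rightarrow> 'f" and b' :: "'w \<Rightarrow> 'f"
    and \<phi> :: "'w \<Rightarrow> ('v, 'a) mpol" and \<psi> :: "'v \<Rightarrow> ('w, 'a) mpol"
  assumes hom: "type_hom c" and finite_vars: "finite N" and finite_vars': "finite N'"
    and \<phi>_closed: "\<And>v. v \<in> N' \<Longrightarrow> \<phi> v \<in> mpols N" and \<psi>_closed: "\<And>v. v \<in> N \<Longrightarrow> \<psi> v \<in> mpols N'"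
    and b'_eq: "\<And>v. v \<in> N' \<Longrightarrow> b' v = mp_eval c b (\<phi> v)"
    and b_eq: "\<And>v. v \<in> N \<Longrightarrow> b v = mp_eval c b' (\<psi> v)"
begin

abbreviation "I \<equiv> vanishing_ideal c N b"
abbreviation "I' \<equiv> vanishing_ideal c N' b'"

lemma eval_\<phi>: "f \<in> mpols N' \<Longrightarrow> mp_eval c b (mp_eval mconst \<phi> f) = mp_eval c b' f"
  unfolding mp_eval_subst[OF hom] using b'_eq by (intro mp_eval_cong[OF hom, of _ N']) auto

lemma pullback_in: "f \<in> I' \<Longrightarrow> mp_eval mconst \<phi> f \<in> I"
  using \<phi>_closed by (auto simp: vanishing_ideal_def eval_\<phi> intro: mpols_subst)

lemma swap: "interdefinable c N' N b' b \<psi> \<phi>"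
  by unfold_locales (use hom finite_vars finite_vars' \<phi>_closed \<psi>_closed b_eq b'_eq in auto)

lemma retraction_in: "v \<in> N \<Longrightarrow> mp_eval mconst \<phi> (\<psi> v) - mvar v \<in> I"
  using b_eq[of v] \<phi>_closed \<psi>_closed eval_\<phi>[of "\<psi> v"]
  by (auto simp: vanishing_ideal_def mp_eval_ring_simps[OF hom] intro!: mpols_minus mpols_subst[of _ N'] mpols_var)

lemma image_point:
  assumes d: "type_hom d" and x: "x \<in> points d N I"
  defines "y \<equiv> \<lambda>v\<in>N'. mp_eval d x (\<phi> v)"
  shows "y \<in> points d N' I'" "\<And>v. v \<in> N \<Longrightarrow> mp_eval d y (\<psi> v) = x v"
proof -
  have y: "mp_eval d y f = mp_eval d x (mp_eval mconst \<phi> f)" if "f \<in> mpols N'" for f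
    unfolding mp_eval_subst[OF d] by (rule mp_eval_cong[OF d that]) (auto simp: y_def)
  have "mp_eval d y f = 0" if "f \<in> I'" for f
    using x pullback_in[OF that] y[of f] that by (auto simp: points_def vanishing_ideal_def)
  then show "y \<in> points d N' I'"
    by (auto simp: points_def y_def)
  fix v assume v: "v \<in> N"
  then have "mp_eval d x (mp_eval mconst \<phi> (\<psi> v) - mvar v) = 0"
    using x retraction_in by (auto simp: points_def)
  then show "mp_eval d y (\<psi> v) = x v"
    using y[OF \<psi>_closed[OF v]] by (simp add: mp_eval_ring_simps[OF d])
qed

definition pullback_differential :: "('a \<Rightarrow> 'e::field) \<Rightarrow> ('v \<Rightarrow> 'e) \<Rightarrow> ('w \<Rightarrow> 'e) \<Rightarrow> 'v \<Rightarrow> 'e" where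
  "pullback_differential d x u = (\<lambda>v. \<Sum>w\<in>N'. u w * gradient d x (\<phi> w) v)"

lemma linear_pullback_differential:
  "Vector_Spaces.linear (\<lambda>a u v. a * u v) (\<lambda>a u v. a * u v) (pullback_differential d x)"
  by unfold_locales
    (auto simp: pullback_differential_def fun_eq_iff sum.distrib sum_distrib_left algebra_simps)

lemma gradient_pullback:
  assumes "type_hom d" "f \<in> mpols N'" "\<And>w. w \<in> N' \<Longrightarrow> y w = mp_eval d x (\<phi> w)"
  shows "gradient d x (mp_eval mconst \<phi> f) = pullback_differential d x (gradient d y f)"
  using gradient_subst[OF assms(1) finite_vars' assms(2), of y x \<phi>] assms(3)
  by (simp add: pullback_differential_def fun_eq_iff)

lemma codim_le:
  fixes d :: "'a \<Rightarrow> 'e::field"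
  assumes d: "type_hom d" and y: "\<And>v. v \<in> N' \<Longrightarrow> y v = mp_eval d x (\<phi> v)"
  shows "card N + fun_vs.dim (gradient d y ` I') \<le> card N' + fun_vs.dim (gradient d x ` I)"
proof -
  interpret swapped: interdefinable c N' N b' b \<psi> \<phi> by (rule swap)
  let ?A = "pullback_differential d x" and ?B = "swapped.pullback_differential d y"
  have I_sub: "I \<subseteq> mpols N" "I' \<subseteq> mpols N'" by (auto simp: vanishing_ideal_def)
  show ?thesis
  proof (rule fun_vs_codim_le[OF finite_vars finite_vars' _ _ linear_pullback_differential[of d x], where B = ?B])
    show "gradient d x ` I \<subseteq> supported N" "gradient d y ` I' \<subseteq> supported N'"
      using gradient_supported[OF d] I_sub by fastforce+
    show "?A ` gradient d y ` I' \<subseteq> fun_vs.span (gradient d x ` I)"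
      using gradient_pullback[OF d _ y] I_sub(2) pullback_in by (force intro!: fun_vs.span_base)
    fix u :: "'v \<Rightarrow> 'e" assume u: "u \<in> supported N"
    show "?B u \<in> supported N'"
      using gradient_supported[OF d \<psi>_closed]
      by (auto simp: supported_def swapped.pullback_differential_def intro!: sum.neutral)
    have "?B u = (\<Sum>v\<in>N. (\<lambda>w. u v * gradient d y (\<psi> v) w))"
      by (simp add: swapped.pullback_differential_def fun_eq_iff sum_fun_apply)
    then have "?A (?B u) = (\<Sum>v\<in>N. (\<lambda>w. u v * ?A (gradient d y (\<psi> v)) w))"
      using linear_pullback_differential[of d x]
      by (simp add: fun_vs_pair.linear_sum fun_vs_pair.linear_scale)
    also have "\<dots> = (\<lambda>w. \<Sum>v\<in>N. u v * gradient d x (mp_eval mconst \<phi> (\<psi> v)) w)"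
      using gradient_pullback[OF d \<psi>_closed y] by (simp add: fun_eq_iff sum_fun_apply)
    finally have "?A (?B u) w - u w = (\<Sum>v\<in>N. u v * gradient d x (mp_eval mconst \<phi> (\<psi> v) - mvar v) w)" for w
      using u finite_vars by (simp add: gradient_minus[OF d] gradient_mvar[OF d] right_diff_distrib sum_subtractf
          sum_unit_fun supported_def)
    then have "?A (?B u) - u = (\<lambda>w. \<Sum>v\<in>N. u v * gradient d x (mp_eval mconst \<phi> (\<psi> v) - mvar v) w)"
      by (simp add: fun_eq_iff)
    also have "\<dots> \<in> fun_vs.span ((\<lambda>v. gradient d x (mp_eval mconst \<phi> (\<psi> v) - mvar v)) ` N)"
      by (rule fun_vs_span_family)
    also have "\<dots> \<subseteq> fun_vs.span (gradient d x ` I)"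
      using retraction_in by (intro fun_vs.span_mono) auto
    finally show "?A (?B u) - u \<in> fun_vs.span (gradient d x ` I)" .
  qed
qed

lemma codim_eq:
  assumes d: "type_hom d" and x: "x \<in> points d N I"
  defines "y \<equiv> \<lambda>v\<in>N'. mp_eval d x (\<phi> v)"
  shows "card N + fun_vs.dim (gradient d y ` I') = card N' + fun_vs.dim (gradient d x ` I)"
proof -
  interpret swapped: interdefinable c N' N b' b \<psi> \<phi> by (rule swap)
  show ?thesis
    using codim_le[OF d, of y x] swapped.codim_le[OF d, of x y] image_point(2)[OF d x, folded y_def]
    by (force simp: y_def)
qed

lemma dim_set_subset:
  "{d. \<exists>g. g ` {..<d} \<subseteq> mpols N \<and> alg_independent_mod I d g} \<subseteq>
   {d. \<exists>g. g ` {..<d} \<subseteq> mpols N' \<and> alg_independent_mod I' d g}"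
proof safe
  interpret swapped: interdefinable c N' N b' b \<psi> \<phi> by (rule swap)
  fix d g assume g: "g ` {..<d} \<subseteq> mpols N" "alg_independent_mod I d g"
  let ?g = "\<lambda>i. mp_eval mconst \<psi> (g i)"
  have "?g ` {..<d} \<subseteq> mpols N'"
    using g(1) \<psi>_closed by (auto intro!: mpols_subst[of _ N])
  moreover have "alg_independent_mod I' d ?g"
    unfolding alg_independent_mod_def
  proof (intro ballI impI notI)
    fix F :: "(nat, 'a) mpol" assume F: "F \<in> mpols {..<d}" "F \<noteq> 0" "mp_eval mconst ?g F \<in> I'"
    have "mp_eval c b' (mp_eval mconst ?g F) = mp_eval c b (mp_eval mconst g F)"
      unfolding mp_eval_subst[OF hom]
      using g(1) swapped.eval_\<phi> by (intro mp_eval_cong[OF hom F(1)]) (auto simp: mp_eval_subst[OF hom, symmetric])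
    moreover have "mp_eval mconst g F \<in> mpols N"
      using F(1) g(1) by (intro mpols_subst[of _ "{..<d}"]) auto
    ultimately have "mp_eval mconst g F \<in> I"
      using F(3) by (auto simp: vanishing_ideal_def)
    with g(2) F show False by (auto simp: alg_independent_mod_def)
  qed
  ultimately show "\<exists>g. g ` {..<d} \<subseteq> mpols N' \<and> alg_independent_mod I' d g" by blast
qed

lemma variety_dim_eq: "variety_dim N I = variety_dim N' I'"
proof -
  interpret swapped: interdefinable c N' N b' b \<psi> \<phi> by (rule swap)
  show ?thesis
    unfolding variety_dim_def using dim_set_subset swapped.dim_set_subset by (simp add: subset_antisym)
qed

lemma smooth_image:
  assumes d: "type_hom d" and x: "x \<in> points d N I" and sm: "smooth_at d N I x"
  shows "smooth_at d N' I' (\<lambda>v\<in>N'. mp_eval d x (\<phi> v))"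
  using codim_eq[OF d x] sm variety_dim_eq unfolding smooth_at_iff by linarith

lemma has_smooth_rational_point_image:
  assumes "has_smooth_rational_point N I"
  shows "has_smooth_rational_point N' I'"
proof -
  obtain x where x: "x \<in> points id N I" "smooth_at id N I x"
    using assms by (auto simp: has_smooth_rational_point_def rational_points_def)
  show ?thesis
    unfolding has_smooth_rational_point_def rational_points_def
    using smooth_image[OF _ x] image_point(1)[OF _ x(1)] by auto
qed

end

section \<open>Triangular presentations of primes\<close>

definition coeffs_in :: "'v set \<Rightarrow> ('v, 'a::comm_ring_1) mpol poly \<Rightarrow> bool" where
  "coeffs_in A p \<longleftrightarrow> (\<forall>i. coeff p i \<in> mpols A)"

lemma coeffs_in_0 [simp]: "coeffs_in A 0"
  by (simp add: coeffs_in_def)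

lemma coeffs_in_pCons [simp]: "coeffs_in A (pCons a p) \<longleftrightarrow> a \<in> mpols A \<and> coeffs_in A p"
  unfolding coeffs_in_def by (metis coeff_pCons_0 coeff_pCons_Suc not0_implies_Suc)

lemma coeffs_in_add: "coeffs_in A p \<Longrightarrow> coeffs_in A q \<Longrightarrow> coeffs_in A (p + q)"
  by (simp add: coeffs_in_def mpols_add)

lemma coeffs_in_diff: "coeffs_in A p \<Longrightarrow> coeffs_in A q \<Longrightarrow> coeffs_in A (p - q)"
  by (simp add: coeffs_in_def mpols_minus)

lemma coeffs_in_mult: "coeffs_in A p \<Longrightarrow> coeffs_in A q \<Longrightarrow> coeffs_in A (p * q)"
  by (simp add: coeffs_in_def coeff_mult mpols_sum mpols_mult)

lemma coeffs_in_smult: "a \<in> mpols A \<Longrightarrow> coeffs_in A p \<Longrightarrow> coeffs_in A (smult a p)"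
  by (simp add: coeffs_in_def mpols_mult)

lemma coeffs_in_monom: "a \<in> mpols A \<Longrightarrow> coeffs_in A (monom a n)"
  by (simp add: coeffs_in_def)

lemma mpols_of_nat: "(of_nat n :: ('v, 'a::comm_ring_1) mpol) \<in> mpols A"
  unfolding mconst_of_nat[symmetric] by (rule mpols_const)

text \<open>The library's \<open>pderiv\<close> is only available over rings without zero divisors, hence not over
  \<open>('v, 'a) mpol\<close> for an unordered type \<open>'v\<close>.\<close>

definition formal_deriv :: "'b::comm_ring_1 poly \<Rightarrow> 'b poly" where
  "formal_deriv p = (\<Sum>i<degree p. monom (of_nat (Suc i) * coeff p (Suc i)) i)"

lemma coeff_formal_deriv:
  "coeff (formal_deriv p) n = of_nat (Suc n) * coeff p (Suc n)"
proof -
  have "coeff (formal_deriv p) n =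
      (\<Sum>i<degree p. if i = n then of_nat (Suc n) * coeff p (Suc n) else 0)"
    unfolding formal_deriv_def coeff_sum by (intro sum.cong) (auto simp del: of_nat_Suc)
  then show ?thesis by (auto simp: coeff_eq_0 simp del: of_nat_Suc)
qed

lemma coeffs_in_formal_deriv: "coeffs_in A p \<Longrightarrow> coeffs_in A (formal_deriv p)"
  unfolding coeffs_in_def coeff_formal_deriv by (auto intro!: mpols_mult mpols_of_nat simp del: of_nat_Suc)

lemma mpols_poly: "coeffs_in A p \<Longrightarrow> x \<in> mpols A \<Longrightarrow> poly p x \<in> mpols A"
  by (induction p) (auto intro: mpols_add mpols_mult)

lemma coeffs_in_mono: "A \<subseteq> B \<Longrightarrow> coeffs_in A p \<Longrightarrow> coeffs_in B p"
  unfolding coeffs_in_def using mpols_mono by blast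

lemma mpol_as_poly:
  assumes "f \<in> mpols (insert v A)"
  obtains p where "coeffs_in A p" "f = poly p (mvar v)"
proof -
  have "\<exists>p. coeffs_in A p \<and> f = poly p (mvar v)" using assms
  proof (induction rule: mpol_induct)
    case (const c)
    show ?case by (rule exI[of _ "[:mconst c:]"]) auto
  next
    case (var u)
    show ?case
    proof (cases "u = v")
      case True
      then show ?thesis by (intro exI[of _ "[:0, 1:]"]) auto
    next
      case False
      then show ?thesis using var by (intro exI[of _ "[:mvar u:]"]) (auto intro: mpols_var)
    qed
  next
    case (add f g)
    then show ?case by (metis coeffs_in_add poly_add)
  next
    case (mult f g)
    then show ?case by (metis coeffs_in_mult poly_mult)
  qed
  then show ?thesis using that by blast
qed

lemma mp_deriv_var_power:
  "mp_deriv v (mvar v ^ Suc n) = of_nat (Suc n) * (mvar v ^ n :: ('v, 'a::comm_ring_1) mpol)"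
  by (induction n) (simp_all add: mp_deriv_mult mp_deriv_var algebra_simps)

lemma mp_deriv_poly:
  assumes "coeffs_in A p" "v \<notin> A"
  shows "mp_deriv v (poly p (mvar v)) = poly (formal_deriv p) (mvar v)"
proof -
  have coeff_deriv: "mp_deriv v (coeff p i) = 0" for i
    using assms by (intro mp_deriv_outside) (auto simp: coeffs_in_def)
  have "mp_deriv v (poly p (mvar v)) =
      (\<Sum>i\<le>degree p. coeff p i * mp_deriv v (mvar v ^ i))"
    unfolding poly_altdef mp_deriv_sum by (simp add: mp_deriv_mult coeff_deriv)
  also have "\<dots> = (\<Sum>i<degree p. coeff p (Suc i) * mp_deriv v (mvar v ^ Suc i))"
    unfolding lessThan_Suc_atMost[symmetric] sum.lessThan_Suc_shift by simp
  also have "\<dots> = poly (formal_deriv p) (mvar v)"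
    unfolding formal_deriv_def poly_sum
    by (intro sum.cong) (simp_all add: poly_monom mp_deriv_var_power mult_ac del: of_nat_Suc power_Suc)
  finally show ?thesis .
qed

lemma pseudo_division:
  assumes p: "coeffs_in A p" "degree p > 0" and q: "coeffs_in A q"
  shows "\<exists>k a r. coeffs_in A a \<and> coeffs_in A r \<and> degree a \<le> degree q - degree p \<and> degree r < degree p \<and>
    smult (lead_coeff p ^ k) q = a * p + r"
  using q
proof (induction "degree q" arbitrary: q rule: less_induct)
  case less
  define l where "l = lead_coeff p"
  have l: "l \<in> mpols A" using p by (simp add: l_def coeffs_in_def)
  show ?case
  proof (cases "degree q < degree p")
    case True
    then show ?thesis using less.prems by (intro exI[of _ 0] exI[of _ q]) auto
  next
    case False
    define m where "m = monom (lead_coeff q) (degree q - degree p)"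
    have m: "coeffs_in A m" "degree m \<le> degree q - degree p"
      using less.prems by (simp_all add: m_def coeffs_in_monom coeffs_in_def degree_monom_le)
    let ?q = "smult l q - m * p"
    have coeffs: "coeffs_in A ?q"
      using less.prems p l m by (intro coeffs_in_diff coeffs_in_smult coeffs_in_mult)
    have "degree (m * p) \<le> degree q"
      using degree_mult_le[of m p] m(2) False by simp
    then have degree_le: "degree ?q \<le> degree q"
      using degree_smult_le[of l q] by (intro degree_diff_le)
    have "coeff ?q (degree q) = 0"
      unfolding m_def l_def using False by (simp add: coeff_monom_mult)
    then have degree_less: "degree ?q < degree q"
      using degree_le False p(2)
      by (metis (no_types, lifting) degree_0 leading_coeff_0_iff le_neq_implies_less linorder_not_less neq0_conv)
    from less.hyps[OF this coeffs] obtain k a r where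
      ar: "coeffs_in A a" "coeffs_in A r" "degree a \<le> degree ?q - degree p" "degree r < degree p"
      and division: "smult (l ^ k) ?q = a * p + r" unfolding l_def by blast
    let ?a = "a + smult (l ^ k) m"
    have "smult (l ^ Suc k) q = smult (l ^ k) ?q + smult (l ^ k) m * p"
      by (simp add: smult_diff_right mult.commute)
    also have "\<dots> = ?a * p + r"
      unfolding division by (simp add: algebra_simps)
    finally have "smult (l ^ Suc k) q = ?a * p + r" .
    moreover have "degree ?a \<le> degree q - degree p"
      using ar(3) degree_less m(2) degree_smult_le[of "l ^ k" m] by (intro degree_add_le) linarith+
    moreover have "coeffs_in A ?a"
      using ar(1) m(1) l by (intro coeffs_in_add coeffs_in_smult mpols_power)
    ultimately show ?thesis using ar(2,4) unfolding l_def by blast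
  qed
qed

definition transcendental_mod :: "('v, 'a::comm_ring_1) mpol set \<Rightarrow> 'v set \<Rightarrow> 'v \<Rightarrow> bool" where
  "transcendental_mod J A v \<longleftrightarrow>
     (\<forall>p. coeffs_in A p \<and> poly p (mvar v) \<in> J \<longrightarrow> (\<forall>i. coeff p i \<in> J))"

definition min_poly_mod ::
    "('v, 'a::comm_ring_1) mpol set \<Rightarrow> 'v set \<Rightarrow> 'v \<Rightarrow> ('v, 'a) mpol poly \<Rightarrow> bool" where
  "min_poly_mod J A v p \<longleftrightarrow> coeffs_in A p \<and> poly p (mvar v) \<in> J \<and> lead_coeff p \<notin> J \<and> degree p > 0 \<and>
     (\<forall>q. coeffs_in A q \<and> degree q < degree p \<and> poly q (mvar v) \<in> J \<longrightarrow> (\<forall>i. coeff q i \<in> J))"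

lemma min_poly_modD:
  assumes "min_poly_mod J A v p"
  shows "coeffs_in A p" "poly p (mvar v) \<in> J" "lead_coeff p \<notin> J" "degree p > 0"
    "coeffs_in A q \<Longrightarrow> degree q < degree p \<Longrightarrow> poly q (mvar v) \<in> J \<Longrightarrow> coeff q i \<in> J"
  using assms by (auto simp: min_poly_mod_def)

lemma ideal_mpol_sum:
  assumes "ideal J (mpol_ring N)" "\<And>i. i \<in> A \<Longrightarrow> f i \<in> J"
  shows "(\<Sum>i\<in>A. f i) \<in> (J :: ('v, 'a::comm_ring_1) mpol set)"
  using assms(2) ideal_mpolD(2,3)[OF assms(1)] by (induction A rule: infinite_finite_induct) auto

lemma degree_diff_lead_less:
  "degree p > 0 \<Longrightarrow> degree (p - monom (lead_coeff p) (degree p)) < degree (p :: 'b::comm_ring_1 poly)"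
proof -
  let ?q = "p - monom (lead_coeff p) (degree p)"
  assume "degree p > 0"
  moreover have "degree ?q \<le> degree p"
    by (intro degree_diff_le degree_monom_le) auto
  moreover have "coeff ?q (degree p) = 0" by simp
  ultimately show ?thesis by (metis degree_0 leading_coeff_0_iff le_neq_implies_less)
qed

lemma poly_lead_monom_in:
  assumes J: "ideal J (mpol_ring N)" and "v \<in> N" "lead_coeff p \<in> J"
  shows "poly (monom (lead_coeff p) (degree p)) (mvar v) \<in> J"
  using assms ideal_mpolD(5)[OF J] by (auto simp: poly_monom intro: mpols_power mpols_var)

lemma exists_min_poly_mod:
  assumes J: "ideal J (mpol_ring N)" and v: "v \<in> N" and algebraic: "\<not> transcendental_mod J A v"
  obtains p where "min_poly_mod J A v p"
proof -
  note ideal = ideal_mpolD[OF J]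
  let ?Q = "\<lambda>p. coeffs_in A p \<and> poly p (mvar v) \<in> J \<and> (\<exists>i. coeff p i \<notin> J)"
  obtain p where p: "?Q p" and minimal: "\<And>q. ?Q q \<Longrightarrow> degree p \<le> degree q"
    using algebraic ex_has_least_nat[of ?Q _ degree] unfolding transcendental_mod_def by blast
  have smaller: "coeff q i \<in> J" if "coeffs_in A q" "degree q < degree p" "poly q (mvar v) \<in> J" for q i
    using minimal[of q] that by force
  have degree: "degree p > 0"
  proof (rule ccontr)
    assume "\<not> degree p > 0"
    then obtain a where a: "p = [:a:]" using degree_eq_zeroE by blast
    with p have "a \<in> J" by simp
    moreover have "coeff p i = (if i = 0 then a else 0)" for i
      using a by (cases i) auto
    ultimately show False using p ideal(2) by (metis (full_types))
  qed
  have "lead_coeff p \<notin> J"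
  proof
    assume lead: "lead_coeff p \<in> J"
    let ?m = "monom (lead_coeff p) (degree p)"
    have "coeffs_in A (p - ?m)"
      using p by (intro coeffs_in_diff coeffs_in_monom) (auto simp: coeffs_in_def)
    moreover have "poly (p - ?m) (mvar v) \<in> J"
      using p ideal(7) poly_lead_monom_in[OF J v lead] by simp
    ultimately have "coeff (p - ?m) i \<in> J" for i
      using smaller degree_diff_lead_less[OF degree] by blast
    then have "coeff p i \<in> J" for i
      using lead by (cases "i = degree p") (auto dest: meta_spec[of _ i])
    with p show False by blast
  qed
  with p degree smaller have "min_poly_mod J A v p" by (auto simp: min_poly_mod_def)
  then show ?thesis by (rule that)
qed

lemma degree_formal_deriv_less: "degree p > 0 \<Longrightarrow> degree (formal_deriv p) < degree p"
proof -
  assume "degree p > 0"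
  moreover have "degree (formal_deriv p) \<le> degree p - 1"
    by (rule degree_le) (simp add: coeff_formal_deriv coeff_eq_0)
  ultimately show ?thesis by linarith
qed

lemma min_poly_mod_separable:
  fixes J :: "('v, 'a::field_char_0) mpol set"
  assumes J: "ideal J (mpol_ring N)" and p: "min_poly_mod J A v p"
  shows "poly (formal_deriv p) (mvar v) \<notin> J"
proof
  let ?n = "degree p"
  assume "poly (formal_deriv p) (mvar v) \<in> J"
  then have "coeff (formal_deriv p) (?n - 1) \<in> J"
    using min_poly_modD(5)[OF p] coeffs_in_formal_deriv[OF min_poly_modD(1)[OF p]]
      degree_formal_deriv_less[OF min_poly_modD(4)[OF p]] by blast
  then have "of_nat ?n * lead_coeff p \<in> J"
    using min_poly_modD(4)[OF p] by (simp add: coeff_formal_deriv)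
  then have "mconst (inverse (of_nat ?n)) * (of_nat ?n * lead_coeff p) \<in> J"
    by (rule ideal_mpolD(4)[OF J]) simp
  moreover have "mconst (inverse (of_nat ?n)) * of_nat ?n = (1 :: ('v, 'a) mpol)"
    using min_poly_modD(4)[OF p] by (simp flip: mconst_of_nat mconst_simps(4))
  ultimately show False using min_poly_modD(3)[OF p] by (simp flip: mult.assoc)
qed

lemma min_poly_mod_reduce:
  assumes J: "ideal J (mpol_ring N)" and A: "A \<subseteq> N" and v: "v \<in> N"
    and p: "min_poly_mod J A v p" and f: "f \<in> mpols (insert v A)"
  obtains k a r where "coeffs_in A a" "coeffs_in A r" "degree r < degree p"
    "lead_coeff p ^ k * f = poly a (mvar v) * poly p (mvar v) + poly r (mvar v)"
    "poly a (mvar v) * poly p (mvar v) \<in> J" "f \<in> J \<Longrightarrow> (\<And>i. coeff r i \<in> J)"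
proof -
  note p = min_poly_modD[OF p]
  obtain q where q: "coeffs_in A q" "f = poly q (mvar v)"
    using mpol_as_poly[OF f] by metis
  obtain k a r where ar: "coeffs_in A a" "coeffs_in A r" "degree r < degree p"
    and division: "smult (lead_coeff p ^ k) q = a * p + r"
    using pseudo_division[OF p(1,4) q(1)] by blast
  have equation: "lead_coeff p ^ k * f = poly a (mvar v) * poly p (mvar v) + poly r (mvar v)"
    using arg_cong[OF division, of "\<lambda>p. poly p (mvar v)"] by (simp add: q)
  have "poly a (mvar v) \<in> mpols N"
    using coeffs_in_mono[OF A ar(1)] v by (intro mpols_poly mpols_var)
  then have multiple: "poly a (mvar v) * poly p (mvar v) \<in> J" using p(2) ideal_mpolD(4)[OF J] by blast
  have "coeff r i \<in> J" if "f \<in> J" for i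
  proof -
    have "lead_coeff p \<in> mpols N" using p(1) mpols_mono[OF A] by (auto simp: coeffs_in_def)
    then have "lead_coeff p ^ k * f \<in> J"
      using that ideal_mpolD(4)[OF J] mpols_power by blast
    then have "poly r (mvar v) \<in> J"
      using equation multiple ideal_mpolD(7)[OF J, of "lead_coeff p ^ k * f" "poly a (mvar v) * poly p (mvar v)"]
      by simp
    then show ?thesis using p(5)[OF ar(2,3)] by blast
  qed
  then show ?thesis using that ar equation multiple by blast
qed

definition in_saturation :: "('v, 'a::comm_ring_1) mpol \<Rightarrow> ('v \<Rightarrow> ('v, 'a) mpol) \<Rightarrow> 'v set \<Rightarrow> ('v, 'a) mpol \<Rightarrow> bool" where
  "in_saturation h P S f \<longleftrightarrow> (\<exists>k q. h ^ k * f = (\<Sum>v\<in>S. q v * P v))"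

lemma in_saturation_0: "in_saturation h P S 0"
  unfolding in_saturation_def by (intro exI[of _ 0] exI[of _ "\<lambda>_. 0"]) auto

lemma in_saturationI: "h ^ k * f = (\<Sum>v\<in>S. q v * P v) \<Longrightarrow> in_saturation h P S f"
  unfolding in_saturation_def by blast

lemma in_saturation_add:
  assumes "in_saturation h P S f" "in_saturation h P S g"
  shows "in_saturation h P S (f + g)"
proof -
  obtain k q where f: "h ^ k * f = (\<Sum>v\<in>S. q v * P v)" using assms by (auto simp: in_saturation_def)
  obtain l r where g: "h ^ l * g = (\<Sum>v\<in>S. r v * P v)" using assms by (auto simp: in_saturation_def)
  have "h ^ (k + l) * (f + g) = h ^ l * (h ^ k * f) + h ^ k * (h ^ l * g)"
    by (simp add: power_add algebra_simps)
  also have "\<dots> = (\<Sum>v\<in>S. (h ^ l * q v + h ^ k * r v) * P v)"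
    unfolding f g by (simp add: sum_distrib_left sum.distrib algebra_simps)
  finally show ?thesis by (rule in_saturationI)
qed

lemma in_saturation_mult:
  assumes "in_saturation h P S f"
  shows "in_saturation h P S (g * f)"
proof -
  obtain k q where f: "h ^ k * f = (\<Sum>v\<in>S. q v * P v)" using assms by (auto simp: in_saturation_def)
  have "h ^ k * (g * f) = g * (h ^ k * f)" by (simp add: algebra_simps)
  also have "\<dots> = (\<Sum>v\<in>S. (g * q v) * P v)"
    unfolding f by (simp add: sum_distrib_left algebra_simps)
  finally show ?thesis by (rule in_saturationI)
qed

lemma in_saturation_base:
  assumes "finite S" "v \<in> S"
  shows "in_saturation h P S (P v)"
proof -
  have "h ^ 0 * P v = (\<Sum>w\<in>S. (if w = v then 1 else 0) * P w)"
    using assms by (simp add: if_distrib[of "\<lambda>c. c * _"] cong: if_cong)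
  then show ?thesis by (rule in_saturationI)
qed

lemma in_saturation_dvd:
  assumes "in_saturation h P S f" "h dvd h'"
  shows "in_saturation h' P S f"
proof -
  obtain k q where f: "h ^ k * f = (\<Sum>v\<in>S. q v * P v)" using assms by (auto simp: in_saturation_def)
  obtain g where h': "h' = h * g" using assms by auto
  have "h' ^ k * f = g ^ k * (h ^ k * f)" unfolding h' by (simp add: power_mult_distrib algebra_simps)
  also have "\<dots> = (\<Sum>v\<in>S. (g ^ k * q v) * P v)"
    unfolding f by (simp add: sum_distrib_left algebra_simps)
  finally show ?thesis by (rule in_saturationI)
qed

lemma in_saturation_cancel:
  assumes "in_saturation h P S (g ^ l * f)" "g dvd h"
  shows "in_saturation h P S f"
proof -
  obtain k q where gf: "h ^ k * (g ^ l * f) = (\<Sum>v\<in>S. q v * P v)" using assms by (auto simp: in_saturation_def)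
  obtain g' where h: "h = g * g'" using assms by auto
  have "h ^ (k + l) * f = g' ^ l * (h ^ k * (g ^ l * f))"
    by (simp add: power_add h power_mult_distrib algebra_simps)
  also have "\<dots> = (\<Sum>v\<in>S. (g' ^ l * q v) * P v)"
    unfolding gf by (simp add: sum_distrib_left algebra_simps)
  finally show ?thesis by (rule in_saturationI)
qed

lemma in_saturation_superset:
  assumes "in_saturation h P S f" "S \<subseteq> S'" "finite S'" "\<And>v. v \<in> S \<Longrightarrow> P v = P' v"
  shows "in_saturation h P' S' f"
proof -
  obtain k q where f: "h ^ k * f = (\<Sum>v\<in>S. q v * P v)" using assms by (auto simp: in_saturation_def)
  have "(\<Sum>v\<in>S'. (if v \<in> S then q v else 0) * P' v) = (\<Sum>v\<in>S. q v * P v)"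
    using assms by (intro sum.mono_neutral_cong_right) auto
  with f have "h ^ k * f = (\<Sum>v\<in>S'. (if v \<in> S then q v else 0) * P' v)" by simp
  then show ?thesis by (rule in_saturationI)
qed

lemma in_saturation_poly:
  assumes "\<And>i. in_saturation h P S (coeff p i)"
  shows "in_saturation h P S (poly p x)"
  using assms
proof (induction p)
  case 0
  then show ?case by (simp add: in_saturation_0)
next
  case (pCons a p)
  have "in_saturation h P S a" using pCons.prems[of 0] by simp
  moreover have "in_saturation h P S (poly p x)"
    using pCons.prems[of "Suc _"] by (intro pCons.IH) simp
  ultimately show ?case by (simp add: in_saturation_add in_saturation_mult)
qed

definition predecessors :: "'v list \<Rightarrow> 'v \<Rightarrow> 'v set" where
  "predecessors vs v = set (takeWhile (\<lambda>w. w \<noteq> v) vs)"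

lemma predecessors_append [simp]: "v \<in> set vs \<Longrightarrow> predecessors (vs @ ws) v = predecessors vs v"
  by (auto simp: predecessors_def takeWhile_append)

lemma predecessors_last [simp]: "v \<notin> set vs \<Longrightarrow> predecessors (vs @ [v]) v = set vs"
  by (auto simp: predecessors_def takeWhile_append)

lemma predecessors_subset: "predecessors vs v \<subseteq> set vs"
  by (auto simp: predecessors_def dest: set_takeWhileD)

definition algebraic_vars :: "('v, 'a::comm_ring_1) mpol set \<Rightarrow> 'v list \<Rightarrow> 'v set" where
  "algebraic_vars J vs = {v \<in> set vs. \<not> transcendental_mod J (predecessors vs v) v}"

lemma algebraic_vars_append1:
  assumes "v \<notin> set vs"
  shows "algebraic_vars J (vs @ [v]) = algebraic_vars J vs \<union> (if transcendental_mod J (set vs) v then {} else {v})"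
  using assms by (auto simp: algebraic_vars_def)

lemma mpols_empty: "f \<in> mpols {} \<Longrightarrow> \<exists>c. f = mconst c"
proof -
  assume "f \<in> mpols {}"
  then have "keys f \<subseteq> {0}" by (auto simp: mpols_def)
  then have "f = mconst (lookup f 0)"
    by (intro poly_mapping_eqI) (auto simp: mconst_def lookup_single when_def in_keys_iff subset_iff)
  then show ?thesis by blast
qed

lemma primeideal_mpols_empty:
  fixes J :: "('v, 'a::field) mpol set"
  assumes J: "primeideal J (mpol_ring N)" and f: "f \<in> J" "f \<in> mpols {}"
  shows "f = 0"
proof -
  obtain c where c: "f = mconst c" using mpols_empty[OF f(2)] by blast
  have "mconst (inverse c) * f \<in> J"
    using f(1) ideal_mpolD(4)[OF primeideal_mpolD(1)[OF J]] by auto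
  then have "c = 0"
    using primeideal_mpolD(2)[OF J] by (cases "c = 0") (auto simp: c simp flip: mconst_simps(4))
  with c show ?thesis by simp
qed

definition partial_triangular ::
    "('v, 'a::comm_ring_1) mpol set \<Rightarrow> 'v list \<Rightarrow> ('v \<Rightarrow> ('v, 'a) mpol) \<Rightarrow> ('v, 'a) mpol \<Rightarrow> bool" where
  "partial_triangular J vs P h \<longleftrightarrow> h \<in> mpols (set vs) \<and> h \<notin> J \<and>
    (\<forall>v\<in>algebraic_vars J vs. P v \<in> J \<and> P v \<in> mpols (insert v (predecessors vs v)) \<and> mp_deriv v (P v) dvd h) \<and>
    (\<forall>f\<in>J. f \<in> mpols (set vs) \<longrightarrow> in_saturation h P (algebraic_vars J vs) f)"

lemma partial_triangularD:
  assumes "partial_triangular J vs P h"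
  shows "h \<in> mpols (set vs)" "h \<notin> J"
    "v \<in> algebraic_vars J vs \<Longrightarrow> P v \<in> J \<and> P v \<in> mpols (insert v (predecessors vs v)) \<and> mp_deriv v (P v) dvd h"
    "f \<in> J \<Longrightarrow> f \<in> mpols (set vs) \<Longrightarrow> in_saturation h P (algebraic_vars J vs) f"
  using assms by (auto simp: partial_triangular_def)

lemma finite_algebraic_vars: "finite (algebraic_vars J vs)"
  by (simp add: algebraic_vars_def)

lemma predecessors_append_algebraic:
  "v \<in> algebraic_vars J vs \<Longrightarrow> predecessors (vs @ ws) v = predecessors vs v"
  by (simp add: algebraic_vars_def)

lemma partial_triangular_Nil:
  fixes J :: "('v, 'a::field) mpol set"
  assumes "primeideal J (mpol_ring N)"
  shows "partial_triangular J [] P 1"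
  using primeideal_mpolD(2)[OF assms] primeideal_mpols_empty[OF assms] in_saturation_0
  by (force simp: partial_triangular_def algebraic_vars_def)

lemma partial_triangular_snoc_transcendental:
  assumes P: "partial_triangular J vs P h" and v: "v \<notin> set vs" "transcendental_mod J (set vs) v"
  shows "partial_triangular J (vs @ [v]) P h"
proof -
  note P = partial_triangularD[OF P]
  have S: "algebraic_vars J (vs @ [v]) = algebraic_vars J vs"
    unfolding algebraic_vars_append1[OF v(1)] using v(2) by simp
  have "in_saturation h P (algebraic_vars J vs) f" if f: "f \<in> J" "f \<in> mpols (set (vs @ [v]))" for f
  proof -
    obtain p where p: "coeffs_in (set vs) p" "f = poly p (mvar v)"
      using mpol_as_poly[of f v "set vs"] f(2) by auto
    with v(2) f(1) have "\<And>i. coeff p i \<in> J" by (auto simp: transcendental_mod_def)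
    with p show ?thesis
      by (auto simp: coeffs_in_def intro!: in_saturation_poly P(4))
  qed
  moreover have "mpols (set vs) \<subseteq> mpols (set (vs @ [v]))" by (rule mpols_mono) auto
  ultimately show ?thesis
    unfolding partial_triangular_def S using P(1-3) by (auto simp: predecessors_append_algebraic)
qed

lemma in_saturation_min_poly:
  assumes J: "ideal J (mpol_ring N)" and A: "A \<subseteq> N" and v: "v \<in> N" "v \<notin> S" and S: "finite S"
    and p: "min_poly_mod J A v p"
    and saturated: "\<And>f. f \<in> J \<Longrightarrow> f \<in> mpols A \<Longrightarrow> in_saturation h P S f"
    and h': "h dvd h'" "lead_coeff p dvd h'"
    and f: "f \<in> J" "f \<in> mpols (insert v A)"
  shows "in_saturation h' (P(v := poly p (mvar v))) (insert v S) f"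
proof -
  let ?sat = "in_saturation h' (P(v := poly p (mvar v))) (insert v S)"
  obtain k a r where r: "coeffs_in A r" "\<And>i. coeff r i \<in> J"
    and reduction: "lead_coeff p ^ k * f = poly a (mvar v) * poly p (mvar v) + poly r (mvar v)"
    using min_poly_mod_reduce[OF J A v(1) p f(2)] f(1) by metis
  have "?sat g" if "g \<in> J" "g \<in> mpols A" for g
    by (rule in_saturation_superset[OF in_saturation_dvd[OF saturated[OF that] h'(1)]]) (use v(2) S in auto)
  then have "?sat (poly r (mvar v))"
    using r by (intro in_saturation_poly) (auto simp: coeffs_in_def)
  moreover have "?sat (poly p (mvar v))"
    using in_saturation_base[of "insert v S" v h' "P(v := poly p (mvar v))"] S by simp
  ultimately have "?sat (lead_coeff p ^ k * f)"
    unfolding reduction by (intro in_saturation_add in_saturation_mult)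
  then show ?thesis using h'(2) by (rule in_saturation_cancel)
qed

lemma partial_triangular_snoc_algebraic:
  fixes J :: "('v, 'a::field_char_0) mpol set"
  assumes J: "primeideal J (mpol_ring N)" and vs: "set vs \<subseteq> N" and v: "v \<in> N" "v \<notin> set vs"
    and P: "partial_triangular J vs P h" and p: "min_poly_mod J (set vs) v p"
  shows "partial_triangular J (vs @ [v]) (P(v := poly p (mvar v)))
    (h * lead_coeff p * poly (formal_deriv p) (mvar v))"
proof -
  let ?A = "set (vs @ [v])" and ?s = "poly (formal_deriv p) (mvar v)"
  let ?h = "h * lead_coeff p * ?s" and ?P = "P(v := poly p (mvar v))"
  note prime = primeideal_mpolD[OF J] and P = partial_triangularD[OF P]
  have mono: "mpols (set vs) \<subseteq> mpols ?A" "mpols ?A \<subseteq> mpols N" using vs v by (auto intro!: mpols_mono)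
  have "transcendental_mod J (set vs) v \<Longrightarrow> False"
    using min_poly_modD(1,2,3)[OF p] by (auto simp: transcendental_mod_def)
  then have S: "algebraic_vars J (vs @ [v]) = insert v (algebraic_vars J vs)" and "v \<notin> algebraic_vars J vs"
    using v(2) by (auto simp: algebraic_vars_append1[OF v(2)] algebraic_vars_def)
  have coeffs: "coeffs_in ?A p"
    using coeffs_in_mono[OF _ min_poly_modD(1)[OF p]] by auto
  then have lead: "lead_coeff p \<in> mpols ?A" by (simp add: coeffs_in_def)
  have factors: "h \<in> mpols ?A" "lead_coeff p \<in> mpols ?A" "?s \<in> mpols ?A" "poly p (mvar v) \<in> mpols ?A"
    using P(1) mono(1) coeffs lead by (auto intro!: mpols_poly coeffs_in_formal_deriv mpols_var)
  then have h: "?h \<in> mpols ?A" "?h \<notin> J"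
    using prime(3)[of "h * lead_coeff p" ?s] prime(3)[of h "lead_coeff p"] P(2) min_poly_modD(3)[OF p]
      min_poly_mod_separable[OF prime(1) p] mono(2) by (auto intro: mpols_mult)
  have "in_saturation ?h ?P (insert v (algebraic_vars J vs)) f" if "f \<in> J" "f \<in> mpols ?A" for f
    by (rule in_saturation_min_poly[OF prime(1) vs v(1) _ finite_algebraic_vars p P(4)])
      (use that \<open>v \<notin> algebraic_vars J vs\<close> in auto)
  moreover have "?P w \<in> J \<and> ?P w \<in> mpols (insert w (predecessors (vs @ [v]) w)) \<and> mp_deriv w (?P w) dvd ?h"
    if w: "w \<in> insert v (algebraic_vars J vs)" for w
  proof (cases "w = v")
    case True
    then show ?thesis
      using min_poly_modD(2)[OF p] v(2) factors(4) mp_deriv_poly[OF min_poly_modD(1)[OF p] v(2)] by simp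
  next
    case False
    then show ?thesis using w P(3)[of w] predecessors_append_algebraic[of w J vs "[v]"] by auto
  qed
  ultimately show ?thesis unfolding partial_triangular_def S using h by blast
qed

lemma exists_partial_triangular:
  fixes J :: "('v, 'a::field_char_0) mpol set"
  assumes J: "primeideal J (mpol_ring N)" and vs: "set vs \<subseteq> N" "distinct vs"
  shows "\<exists>P h. partial_triangular J vs P h"
  using vs
proof (induction vs rule: rev_induct)
  case Nil
  then show ?case using partial_triangular_Nil[OF J] by blast
next
  case (snoc v vs)
  then obtain P h where P: "partial_triangular J vs P h" and v: "v \<in> N" "v \<notin> set vs" and vs: "set vs \<subseteq> N"
    by auto
  show ?case
  proof (cases "transcendental_mod J (set vs) v")
    case True
    then show ?thesis using partial_triangular_snoc_transcendental[OF P v(2)] by blast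
  next
    case False
    then obtain p where "min_poly_mod J (set vs) v p"
      by (rule exists_min_poly_mod[OF primeideal_mpolD(1)[OF J] v(1)])
    then show ?thesis using partial_triangular_snoc_algebraic[OF J vs v P] by blast
  qed
qed

definition triangular :: "'v set \<Rightarrow> ('v, 'a::field) mpol set \<Rightarrow> ('v \<Rightarrow> nat) \<Rightarrow> 'v set
    \<Rightarrow> ('v \<Rightarrow> ('v, 'a) mpol) \<Rightarrow> ('v, 'a) mpol \<Rightarrow> bool" where
  "triangular N J ord S P h \<longleftrightarrow> S \<subseteq> N \<and> inj_on ord S \<and> h \<in> mpols N \<and> h \<notin> J \<and>
     (\<forall>v\<in>S. P v \<in> J \<and> mp_deriv v (P v) dvd h \<and> (\<forall>w\<in>S. ord v < ord w \<longrightarrow> mp_deriv w (P v) = 0)) \<and>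
     (\<forall>f\<in>J. in_saturation h P S f)"

lemma triangularD:
  assumes "triangular N J ord S P h"
  shows "S \<subseteq> N" "inj_on ord S" "h \<in> mpols N" "h \<notin> J"
    "v \<in> S \<Longrightarrow> P v \<in> J" "v \<in> S \<Longrightarrow> mp_deriv v (P v) dvd h"
    "v \<in> S \<Longrightarrow> w \<in> S \<Longrightarrow> ord v < ord w \<Longrightarrow> mp_deriv w (P v) = 0"
    "f \<in> J \<Longrightarrow> in_saturation h P S f"
  using assms by (auto simp: triangular_def)

definition list_position :: "'v list \<Rightarrow> 'v \<Rightarrow> nat" where
  "list_position vs v = length (takeWhile (\<lambda>w. w \<noteq> v) vs)"

lemma list_position_less: "w \<in> predecessors vs v \<Longrightarrow> list_position vs w < list_position vs v"
  unfolding predecessors_def list_position_def by (induction vs) (auto split: if_splits)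

lemma inj_on_list_position: "inj_on (list_position vs) (set vs)"
proof (induction vs)
  case (Cons a vs)
  then show ?case by (auto simp: list_position_def inj_on_def)
qed simp

lemma exists_triangular_list:
  fixes J :: "('v, 'a::field_char_0) mpol set"
  assumes J: "primeideal J (mpol_ring (set vs))" and vs: "distinct vs"
  obtains P h where "triangular (set vs) J (list_position vs) (algebraic_vars J vs) P h"
    "\<And>v. v \<in> algebraic_vars J vs \<Longrightarrow> P v \<in> mpols (insert v (predecessors vs v))"
proof -
  obtain P h where "partial_triangular J vs P h"
    using exists_partial_triangular[OF J order_refl vs] by blast
  note P = partial_triangularD[OF this]
  have S: "algebraic_vars J vs \<subseteq> set vs" by (auto simp: algebraic_vars_def)
  have "mp_deriv w (P v) = 0"
    if "v \<in> algebraic_vars J vs" "list_position vs v < list_position vs w" for v w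
  proof (rule mp_deriv_outside)
    show "P v \<in> mpols (insert v (predecessors vs v))" using P(3) that by blast
    show "w \<notin> insert v (predecessors vs v)" using that list_position_less[of w vs v] by auto
  qed
  then have "triangular (set vs) J (list_position vs) (algebraic_vars J vs) P h"
    unfolding triangular_def using P S inj_on_subset[OF inj_on_list_position S]
      ideal_mpolD(1)[OF primeideal_mpolD(1)[OF J]] by blast
  then show ?thesis using that P(3) by blast
qed

lemma exists_triangular:
  fixes J :: "('v, 'a::field_char_0) mpol set"
  assumes "primeideal J (mpol_ring N)" "finite N"
  obtains ord S P h where "triangular N J ord S P h"
  using exists_triangular_list finite_distinct_list[OF assms(2)] assms(1) by metis

lemma triangular_zero:
  assumes P: "triangular N J ord S P h" and hom: "type_hom c" and h: "mp_eval c x h \<noteq> 0"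
    and zeros: "\<And>v. v \<in> S \<Longrightarrow> mp_eval c x (P v) = (0 :: 'b::field)" and f: "f \<in> J"
  shows "mp_eval c x f = 0"
proof -
  obtain k q where "h ^ k * f = (\<Sum>v\<in>S. q v * P v)"
    using triangularD(8)[OF P f] by (auto simp: in_saturation_def)
  from arg_cong[OF this, of "mp_eval c x"] zeros have "mp_eval c x h ^ k * mp_eval c x f = 0"
    by (simp add: mp_eval_ring_simps[OF hom] mp_eval_sum[OF hom])
  then show ?thesis using h by simp
qed

lemma triangular_gradient_in_span:
  fixes c :: "'a::field \<Rightarrow> 'b::field"
  assumes P: "triangular N J ord S P h" and hom: "type_hom c"
    and x: "\<And>f. f \<in> J \<Longrightarrow> mp_eval c x f = 0" and h: "mp_eval c x h \<noteq> 0" and f: "f \<in> J"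
  shows "gradient c x f \<in> fun_vs.span ((\<lambda>v. gradient c x (P v)) ` S)"
proof -
  note ev = mp_eval_ring_simps[OF hom] mp_eval_sum[OF hom]
  obtain k q where q: "h ^ k * f = (\<Sum>v\<in>S. q v * P v)"
    using triangularD(8)[OF P f] by (auto simp: in_saturation_def)
  let ?a = "\<lambda>v. mp_eval c x (q v) / mp_eval c x h ^ k"
  have "gradient c x f w = (\<Sum>v\<in>S. ?a v * gradient c x (P v) w)" for w
  proof -
    have "mp_eval c x (mp_deriv w (h ^ k * f)) = mp_eval c x (\<Sum>v\<in>S. mp_deriv w (q v * P v))"
      unfolding q by (simp add: mp_deriv_sum)
    then have "mp_eval c x h ^ k * gradient c x f w = (\<Sum>v\<in>S. mp_eval c x (q v) * gradient c x (P v) w)"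
      using x[OF f] x[OF triangularD(5)[OF P]] by (simp add: mp_deriv_mult ev gradient_def)
    then have "gradient c x f w = (\<Sum>v\<in>S. mp_eval c x (q v) * gradient c x (P v) w) / mp_eval c x h ^ k"
      using h by (simp add: field_simps)
    then show ?thesis by (simp add: sum_divide_distrib)
  qed
  then have "gradient c x f = (\<lambda>w. \<Sum>v\<in>S. ?a v * gradient c x (P v) w)" by (rule ext)
  then show ?thesis
    using fun_vs_span_family[where S = S and a = ?a and g = "\<lambda>v. gradient c x (P v)"] by simp
qed

lemma triangular_rank:
  fixes c :: "'a::field \<Rightarrow> 'b::field"
  assumes P: "triangular N J ord S P h" and N: "finite N" and hom: "type_hom c"
    and x: "\<And>f. f \<in> J \<Longrightarrow> mp_eval c x f = 0" and h: "mp_eval c x h \<noteq> 0"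
  shows "fun_vs.dim (gradient c x ` J) = card S"
proof (rule fun_vs_dim_triangular[where ord = ord and g = "\<lambda>v. gradient c x (P v)"])
  note ev = mp_eval_ring_simps[OF hom]
  show "finite S" using triangularD(1)[OF P] N finite_subset by blast
  show "gradient c x (P v) v \<noteq> 0" if v: "v \<in> S" for v
    using h triangularD(6)[OF P v] by (auto simp: gradient_def ev elim!: dvdE)
  show "gradient c x (P v) w = 0" if "v \<in> S" "w \<in> S" "ord v < ord w" for v w
    using triangularD(7)[OF P that] by (simp add: gradient_def ev)
  show "gradient c x ` J \<subseteq> fun_vs.span ((\<lambda>v. gradient c x (P v)) ` S)"
    using triangular_gradient_in_span[OF P hom x h] by blast
qed (use triangularD(2,5)[OF P] in auto)

lemma triangular_multiple:
  assumes "triangular N J ord S P h" "h dvd h'" "h' \<in> mpols N" "h' \<notin> J"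
  shows "triangular N J ord S P h'"
  using assms in_saturation_dvd[of h P S _ h'] unfolding triangular_def by (meson dvd_trans)

section \<open>Generic points\<close>

text \<open>A universal domain: an algebraically closed extension of infinite transcendence degree.\<close>

type_synonym 'a univ_dom = "((nat, 'a) mpol fract) alg_closure"

definition to_univ :: "'a::field \<Rightarrow> 'a univ_dom" where
  "to_univ a = to_ac (Fract (mconst a) 1)"

definition univ_var :: "nat \<Rightarrow> 'a::field univ_dom" where
  "univ_var i = to_ac (Fract (mvar i) 1)"

lemma type_hom_to_univ [simp]: "type_hom to_univ"
  by (auto simp: ring_hom_def to_univ_def One_fract_def[symmetric] simp flip: to_ac_add to_ac_mult)

lemma mp_eval_univ_var: "mp_eval to_univ univ_var f = to_ac (Fract f 1)"
proof -
  have "f \<in> mpols UNIV" by simp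
  then show ?thesis
  proof (induction rule: mpol_induct)
    case (const c)
    show ?case unfolding mp_eval_const[OF type_hom_to_univ] by (simp add: to_univ_def)
  next
    case (var v)
    show ?case unfolding mp_eval_var[OF type_hom_to_univ] by (simp add: univ_var_def)
  qed (simp_all add: mp_eval_ring_simps flip: to_ac_add to_ac_mult)
qed

lemma mp_eval_univ_var_eq_0: "mp_eval to_univ univ_var f = 0 \<longleftrightarrow> f = 0"
  unfolding mp_eval_univ_var by (simp add: Zero_fract_def eq_fract)

lemma rename_rename:
  fixes f :: "('v, 'a::comm_ring_1) mpol"
  assumes "f \<in> mpols A" "inj_on r A"
  shows "mp_eval mconst (\<lambda>w. mvar (inv_into A r w)) (mp_eval mconst (\<lambda>v. mvar (r v)) f) = f"
proof -
  have "mp_eval mconst (\<lambda>w. mvar (inv_into A r w)) (mp_eval mconst (\<lambda>v. mvar (r v)) f) =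
      mp_eval mconst (\<lambda>v. mvar (inv_into A r (r v))) f"
    by (simp add: mp_eval_subst[OF type_hom_mconst] mp_eval_ring_simps)
  also have "\<dots> = mp_eval mconst mvar f"
    using assms by (intro mp_eval_cong[of _ _ A]) auto
  finally show ?thesis by (simp add: mp_eval_mconst_mvar)
qed

lemma rename_eq_0:
  fixes f :: "('v, 'a::comm_ring_1) mpol"
  assumes "f \<in> mpols A" "inj_on r A" "mp_eval mconst (\<lambda>v. mvar (r v)) f = 0"
  shows "f = 0"
  using rename_rename[OF assms(1,2)] by (simp add: assms(3) mp_eval_ring_simps)

lemma poly_mvar_eq_0:
  assumes "coeffs_in A p" "v \<notin> A" "poly p (mvar v) = 0"
  shows "p = (0 :: ('v, 'a::comm_ring_1) mpol poly)"
proof -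
  define const where "const = (\<lambda>a::'a. [:mconst a :: ('v, 'a) mpol:])"
  define y where "y = (\<lambda>w. if w = v then [:0, 1:] else [:mvar w :: ('v, 'a) mpol:])"
  have hom: "type_hom const" by (auto simp: ring_hom_def const_def one_pCons)
  have eval_coeff: "mp_eval const y a = [:a:]" if "a \<in> mpols A" for a
    using that
  proof (induction rule: mpol_induct)
    case (var w)
    then have "y w = [:mvar w:]" using assms(2) by (auto simp: y_def)
    then show ?case by (simp add: mp_eval_var[OF hom])
  qed (simp_all add: mp_eval_ring_simps[OF hom], simp add: const_def)
  have "mp_eval const y (poly p (mvar v)) = p" using assms(1)
  proof (induction p)
    case 0
    then show ?case by (simp add: mp_eval_ring_simps[OF hom])
  next
    case (pCons a p)
    then show ?case by (simp add: mp_eval_ring_simps[OF hom] eval_coeff) (simp add: y_def)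
  qed
  then show ?thesis using assms(3) by (simp add: mp_eval_ring_simps[OF hom])
qed

lemma type_hom_poly:
  assumes "type_hom h"
  shows "h (poly p x) = poly (map_poly h p) (h x)"
  by (induction p) (use type_homD[OF assms] in \<open>auto simp: map_poly_pCons\<close>)

lemma coeff_mult_in:
  assumes J: "ideal J (mpol_ring N)" and "\<And>i. coeff a i \<in> J" "coeffs_in N q"
  shows "coeff (a * q) n \<in> J"
  unfolding coeff_mult
  by (rule ideal_mpol_sum[OF J]) (use assms ideal_mpolD(5)[OF J] in \<open>auto simp: coeffs_in_def\<close>)

lemma pseudo_remainder_notin:
  fixes J :: "('v, 'a::comm_ring_1) mpol set"
  assumes J: "primeideal J (mpol_ring N)" and A: "A \<subseteq> N" and v: "v \<in> N" and p: "min_poly_mod J A v p"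
    and q: "coeffs_in A q" "degree q > 0" "degree q < degree p" "lead_coeff q \<notin> J" "poly q (mvar v) \<notin> J"
    and a: "coeffs_in A a" and r: "coeffs_in A r" and degree_a: "degree a \<le> degree p - degree q" and degree_r: "degree r < degree q"
    and division: "smult (lead_coeff q ^ k) p = a * q + r"
  shows "poly r (mvar v) \<notin> J"
proof
  note ideal = ideal_mpolD[OF primeideal_mpolD(1)[OF J]] and prime = primeideal_mpolD[OF J]
    and p = min_poly_modD[OF p]
  let ?ev = "\<lambda>q. poly q (mvar v)" and ?l = "lead_coeff q" and ?n = "degree p"
  have base: "mpols A \<subseteq> mpols N" by (rule mpols_mono[OF A])
  have poly_in: "?ev f \<in> mpols N" if "coeffs_in A f" for f
    using coeffs_in_mono[OF A that] v by (intro mpols_poly mpols_var)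
  have lead: "?l \<in> mpols N" "lead_coeff p \<in> mpols N" using q(1) p(1) base by (auto simp: coeffs_in_def)
  assume "?ev r \<in> J"
  moreover have "?ev a * ?ev q = ?l ^ k * ?ev p - ?ev r"
    using arg_cong[OF division, of ?ev] by (simp add: algebra_simps)
  ultimately have "?ev a * ?ev q \<in> J" using ideal(7)[OF ideal(4)[OF p(2)]] mpols_power[OF lead(1)] by metis
  then have "?ev a \<in> J" using prime(3) poly_in[OF a] poly_in[OF q(1)] q(5) by blast
  then have "coeff a i \<in> J" for i using p(5)[OF a] degree_a q(2) p(4) by (metis diff_less le_less_trans)
  then have "coeff (a * q) ?n \<in> J" by (rule coeff_mult_in[OF prime(1) _ coeffs_in_mono[OF A q(1)]])
  moreover have "coeff (a * q) ?n = ?l ^ k * lead_coeff p"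
    using arg_cong[OF division, of "\<lambda>p. coeff p ?n"] coeff_eq_0[of r ?n] degree_r q(3) by simp
  ultimately have "?l ^ k * lead_coeff p \<in> J" by simp
  then show False using prime(3)[OF mpols_power[OF lead(1)] lead(2)] prime(4)[OF lead(1)] q(4) p(3) by blast
qed

definition multiple_in_base_mod :: "('v, 'a::comm_ring_1) mpol set \<Rightarrow> 'v set \<Rightarrow> 'v \<Rightarrow> ('v, 'a) mpol \<Rightarrow> bool" where
  "multiple_in_base_mod J A v f \<longleftrightarrow> (\<exists>u w. u \<in> mpols (insert v A) \<and> w \<in> mpols A \<and> w \<notin> J \<and> u * f - w \<in> J)"

lemma multiple_in_base_mod_of_congruent:
  assumes J: "ideal J (mpol_ring N)" and A: "insert v A \<subseteq> N" and a: "a \<in> mpols (insert v A)"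
    and g: "multiple_in_base_mod J A v g" "g - a * f \<in> J"
  shows "multiple_in_base_mod J A v f"
proof -
  obtain u w where u: "u \<in> mpols (insert v A)" and w: "w \<in> mpols A" "w \<notin> J" "u * g - w \<in> J"
    using g(1) by (auto simp: multiple_in_base_mod_def)
  have "u \<in> mpols N" using u mpols_mono[OF A] by blast
  then have "(u * g - w) - u * (g - a * f) \<in> J" by (intro ideal_mpolD(4,7)[OF J] w g(2))
  then have "(u * a) * f - w \<in> J" by (simp add: algebra_simps)
  then show ?thesis unfolding multiple_in_base_mod_def using mpols_mult[OF u a] w(1,2) by blast
qed

text \<open>The Euclidean algorithm of \<open>q\<close> and the minimal polynomial: modulo \<open>J\<close>, every element of
  \<open>K[A, v]\<close> is algebraic over \<open>K[A]\<close>, hence divides an element of \<open>K[A]\<close> that is not in \<open>J\<close>.\<close>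

lemma poly_multiple_in_base_mod:
  fixes J :: "('v, 'a::comm_ring_1) mpol set"
  assumes J: "primeideal J (mpol_ring N)" and A: "A \<subseteq> N" and v: "v \<in> N" and p: "min_poly_mod J A v p"
    and q: "coeffs_in A q" "degree q < degree p" "poly q (mvar v) \<notin> J"
  shows "multiple_in_base_mod J A v (poly q (mvar v))"
  using q
proof (induction "degree q" arbitrary: q rule: less_induct)
  case less
  note prime = primeideal_mpolD[OF J] and ideal = ideal_mpolD[OF primeideal_mpolD(1)[OF J]]
  let ?ev = "\<lambda>q. poly q (mvar v)" and ?l = "lead_coeff q"
  have vA: "insert v A \<subseteq> N" using A v by simp
  consider (degree_zero) "degree q = 0" | (lead_in) "degree q > 0" "?l \<in> J" | (lead_notin) "degree q > 0" "?l \<notin> J"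
    by blast
  then show ?case
  proof cases
    case degree_zero
    then obtain a where "q = [:a:]" using degree_eq_zeroE by blast
    then show ?thesis
      using less.prems ideal(2) unfolding multiple_in_base_mod_def by (intro exI[of _ 1] exI[of _ a]) auto
  next
    case lead_in
    let ?m = "monom ?l (degree q)"
    note degree_less = degree_diff_lead_less[OF lead_in(1)]
    have m: "?ev ?m \<in> J" by (rule poly_lead_monom_in[OF prime(1) v lead_in(2)])
    then have "?ev (q - ?m) \<notin> J" using less.prems(3) ideal(3)[OF _ m, of "?ev (q - ?m)"] by auto
    moreover have "coeffs_in A (q - ?m)"
      using less.prems(1) by (intro coeffs_in_diff coeffs_in_monom) (auto simp: coeffs_in_def)
    ultimately have remainder: "multiple_in_base_mod J A v (?ev (q - ?m))"
      using less.hyps[OF degree_less] less_trans[OF degree_less less.prems(2)] by blast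
    show ?thesis
      using multiple_in_base_mod_of_congruent[OF prime(1) vA _ remainder, of 1] ideal(6)[OF m] by simp
  next
    case lead_notin
    obtain k a r where ar: "coeffs_in A a" "coeffs_in A r" "degree a \<le> degree p - degree q" "degree r < degree q"
      and division: "smult (?l ^ k) p = a * q + r"
      using pseudo_division[OF less.prems(1) lead_notin(1) min_poly_modD(1)[OF p]] by blast
    have "?ev r \<notin> J"
      by (rule pseudo_remainder_notin[OF J A v p less.prems(1) lead_notin(1) less.prems(2) lead_notin(2) less.prems(3) ar division])
    then have "multiple_in_base_mod J A v (?ev r)"
      using less.hyps[OF ar(4,2)] less_trans[OF ar(4) less.prems(2)] by blast
    moreover have "- ?ev a \<in> mpols (insert v A)"
      using coeffs_in_mono[OF _ ar(1), of "insert v A"] by (intro mpols_uminus mpols_poly mpols_var) auto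
    moreover have "?l ^ k \<in> mpols N" using less.prems(1) mpols_mono[OF A] by (auto simp: coeffs_in_def intro!: mpols_power)
    from ideal(4)[OF min_poly_modD(2)[OF p] this] have "?ev r - (- ?ev a) * ?ev q \<in> J"
      using arg_cong[OF division, of ?ev] by (simp add: add.commute)
    ultimately show ?thesis using multiple_in_base_mod_of_congruent[OF prime(1) vA] by blast
  qed
qed

lemma multiple_in_base_mod_prime:
  fixes J :: "('v, 'a::comm_ring_1) mpol set"
  assumes J: "primeideal J (mpol_ring N)" and A: "A \<subseteq> N" and v: "v \<in> N" and p: "min_poly_mod J A v p"
    and f: "f \<in> mpols (insert v A)" "f \<notin> J"
  shows "multiple_in_base_mod J A v f"
proof -
  note ideal = ideal_mpolD[OF primeideal_mpolD(1)[OF J]] and prime = primeideal_mpolD[OF J]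
  let ?l = "lead_coeff p"
  have vA: "insert v A \<subseteq> N" using A v by simp
  obtain k a r where r: "coeffs_in A r" "degree r < degree p"
    and reduction: "?l ^ k * f = poly a (mvar v) * poly p (mvar v) + poly r (mvar v)"
    and multiple: "poly a (mvar v) * poly p (mvar v) \<in> J"
    by (rule min_poly_mod_reduce[OF prime(1) A v p f(1)]) (rule that)
  have lead: "?l \<in> mpols (insert v A)"
    using min_poly_modD(1)[OF p] mpols_mono[of A "insert v A"] by (auto simp: coeffs_in_def)
  then have "?l ^ k * f \<notin> J"
    using prime(3)[of "?l ^ k" f] prime(4)[of ?l k] mpols_power[OF lead, of k] f min_poly_modD(3)[OF p] mpols_mono[OF vA]
    by blast
  then have "poly r (mvar v) \<notin> J" using ideal(3)[OF multiple] by (auto simp: reduction)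
  then have "multiple_in_base_mod J A v (poly r (mvar v))" by (rule poly_multiple_in_base_mod[OF J A v p r])
  moreover have "poly r (mvar v) - ?l ^ k * f \<in> J" unfolding reduction using ideal(6)[OF multiple] by simp
  ultimately show ?thesis
    using multiple_in_base_mod_of_congruent[OF prime(1) vA mpols_power[OF lead]] by blast
qed

definition generic_over :: "('a::field \<Rightarrow> 'f::field) \<Rightarrow> ('v, 'a) mpol set \<Rightarrow> 'v set \<Rightarrow> ('v \<Rightarrow> 'f) \<Rightarrow> bool" where
  "generic_over c J A b \<longleftrightarrow> (\<forall>f\<in>mpols A. f \<in> J \<longleftrightarrow> mp_eval c b f = 0)"

lemma mp_eval_poly_mvar:
  assumes hom: "type_hom c" and v: "v \<notin> A" and q: "coeffs_in A q"
  shows "mp_eval c (b(v := \<beta>)) (poly q (mvar v)) = poly (map_poly (mp_eval c b) q) \<beta>"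
proof -
  have "mp_eval c (b(v := \<beta>)) f = mp_eval c b f" if "f \<in> mpols A" for f
    using that v by (intro mp_eval_cong[OF hom]) auto
  then have "map_poly (mp_eval c (b(v := \<beta>))) q = map_poly (mp_eval c b) q"
    using q by (intro poly_eqI) (simp add: coeff_map_poly mp_eval_ring_simps[OF hom] coeffs_in_def)
  then show ?thesis by (simp add: type_hom_poly[OF mp_eval_hom[OF hom]] mp_eval_ring_simps[OF hom])
qed

lemma generic_point_step:
  fixes J :: "('v, 'a::field) mpol set" and b :: "'v \<Rightarrow> 'f::alg_closed_field"
  assumes J: "primeideal J (mpol_ring N)" and A: "A \<subseteq> N" and v: "v \<in> N" "v \<notin> A"
    and algebraic: "\<not> transcendental_mod J A v" and hom: "type_hom c" and b: "generic_over c J A b"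
  shows "\<exists>b'. generic_over c J (insert v A) b'"
proof -
  note ideal = ideal_mpolD[OF primeideal_mpolD(1)[OF J]]
  note ev = mp_eval_ring_simps[OF hom]
  obtain p where p: "min_poly_mod J A v p"
    using exists_min_poly_mod[OF primeideal_mpolD(1)[OF J] v(1) algebraic] .
  note pD = min_poly_modD[OF p]
  have zero_iff: "mp_eval c b f = 0 \<longleftrightarrow> f \<in> J" if "f \<in> mpols A" for f
    using b that by (simp add: generic_over_def)
  let ?p = "map_poly (mp_eval c b) p"
  have lead: "mp_eval c b (lead_coeff p) \<noteq> 0"
    using pD(1,3) zero_iff by (auto simp: coeffs_in_def)
  then have "degree ?p > 0" using pD(4) le_degree[of ?p "degree p"] by (simp add: coeff_map_poly ev)
  then obtain \<beta> where \<beta>: "poly ?p \<beta> = 0" using alg_closed_imp_poly_has_root by blast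
  define b' where "b' = b(v := \<beta>)"
  have b'_base: "mp_eval c b' f = mp_eval c b f" if "f \<in> mpols A" for f
    using that v by (intro mp_eval_cong[OF hom]) (auto simp: b'_def)
  note eval_poly = mp_eval_poly_mvar[OF hom v(2), of _ b \<beta>, folded b'_def]
  have vanishing: "mp_eval c b' f = 0" if f: "f \<in> mpols (insert v A)" "f \<in> J" for f
  proof -
    obtain k a r where r: "coeffs_in A r" "\<And>i. coeff r i \<in> J"
      and reduction: "lead_coeff p ^ k * f = poly a (mvar v) * poly p (mvar v) + poly r (mvar v)"
      using min_poly_mod_reduce[OF primeideal_mpolD(1)[OF J] A v(1) p f(1)] f(2) by metis
    have "map_poly (mp_eval c b) r = 0"
      using r zero_iff by (intro poly_eqI) (simp add: coeff_map_poly ev coeffs_in_def)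
    then have "mp_eval c b (lead_coeff p) ^ k * mp_eval c b' f = 0"
      using arg_cong[OF reduction, of "mp_eval c b'"] eval_poly[OF r(1)] eval_poly[OF pD(1)] \<beta> pD(1) b'_base
      by (simp add: ev coeffs_in_def)
    with lead show ?thesis by simp
  qed
  have "f \<in> J" if f: "f \<in> mpols (insert v A)" "mp_eval c b' f = 0" for f
  proof (rule ccontr)
    assume "f \<notin> J"
    then obtain u w where u: "u \<in> mpols (insert v A)" and w: "w \<in> mpols A" "w \<notin> J" "u * f - w \<in> J"
      using multiple_in_base_mod_prime[OF J A v(1) p f(1)] unfolding multiple_in_base_mod_def by blast
    moreover have "w \<in> mpols (insert v A)" using w(1) mpols_mono[of A "insert v A"] by blast
    ultimately have "mp_eval c b' (u * f - w) = 0"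
      using f(1) by (intro vanishing mpols_minus mpols_mult)
    then show False using f(2) w b'_base zero_iff by (simp add: ev)
  qed
  with vanishing show ?thesis unfolding generic_over_def by blast
qed

definition independent_vars_mod :: "('v, 'a::zero) mpol set \<Rightarrow> 'v set \<Rightarrow> bool" where
  "independent_vars_mod J T \<longleftrightarrow> (\<forall>f\<in>J. f \<in> mpols T \<longrightarrow> f = 0)"

lemma independent_vars_transcendental:
  fixes J :: "('v, 'a::comm_ring_1) mpol set"
  assumes "0 \<in> J" "independent_vars_mod J T" and v: "v \<in> T" and A: "A \<subseteq> T - {v}"
  shows "transcendental_mod J A v"
  unfolding transcendental_mod_def
proof (intro allI impI)
  fix p i assume p: "coeffs_in A p \<and> poly p (mvar v) \<in> J"
  then have "poly p (mvar v) \<in> mpols T"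
    using v A by (intro mpols_poly mpols_var) (auto intro: coeffs_in_mono[of A])
  then have "poly p (mvar v) = 0" using assms(2) p by (auto simp: independent_vars_mod_def)
  then have "p = 0" using p A by (intro poly_mvar_eq_0[of A p v]) auto
  then show "coeff p i \<in> J" using assms(1) by simp
qed

lemma maximal_independent_vars:
  fixes J :: "('v, 'a::field) mpol set"
  assumes J: "primeideal J (mpol_ring N)" and N: "finite N"
  obtains T where "T \<subseteq> N" "independent_vars_mod J T"
    "\<And>v A. v \<in> N - T \<Longrightarrow> T \<subseteq> A \<Longrightarrow> \<not> transcendental_mod J A v"
proof -
  let ?Q = "\<lambda>T. T \<subseteq> N \<and> independent_vars_mod J T"
  have "?Q {}" using primeideal_mpols_empty[OF J] by (simp add: independent_vars_mod_def)
  moreover have "?Q T \<Longrightarrow> card T < Suc (card N)" for T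
    using card_mono[OF N] by (simp add: less_Suc_eq_le)
  ultimately obtain T where T: "?Q T" and maximal: "\<And>T'. ?Q T' \<Longrightarrow> card T' \<le> card T"
    using ex_has_greatest_nat[of ?Q "{}" card "Suc (card N)"] by blast
  have "\<not> transcendental_mod J A v" if v: "v \<in> N - T" "T \<subseteq> A" for v A
  proof
    assume transcendental: "transcendental_mod J A v"
    have "finite T" using T N finite_subset by blast
    then have "card (insert v T) > card T" using v by simp
    then have "\<not> ?Q (insert v T)" using maximal[of "insert v T"] by linarith
    then obtain f where f: "f \<in> J" "f \<in> mpols (insert v T)" "f \<noteq> 0"
      using T v by (auto simp: independent_vars_mod_def)
    then obtain p where p: "coeffs_in T p" "f = poly p (mvar v)" using mpol_as_poly by metis
    then have "coeff p i \<in> J" for i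
      using transcendental f(1) coeffs_in_mono[OF v(2)] by (auto simp: transcendental_mod_def)
    then have "p = 0" using T p(1) by (intro poly_eqI) (auto simp: coeffs_in_def independent_vars_mod_def)
    with p f(3) show False by simp
  qed
  then show ?thesis using that T by blast
qed

lemma generic_point_independent:
  fixes J :: "('v, 'a::field) mpol set"
  assumes "0 \<in> J" "independent_vars_mod J T" "finite T"
  obtains b :: "'v \<Rightarrow> 'a univ_dom" where "generic_over to_univ J T b"
proof -
  obtain r :: "'v \<Rightarrow> nat" where r: "inj_on r T"
    using finite_imp_inj_to_nat_seg[OF assms(3)] by metis
  have "f \<in> J \<longleftrightarrow> mp_eval to_univ (\<lambda>v. univ_var (r v)) f = 0" if f: "f \<in> mpols T" for f
  proof -
    have "mp_eval to_univ (\<lambda>v. univ_var (r v)) f =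
        mp_eval to_univ univ_var (mp_eval mconst (\<lambda>v. mvar (r v)) f)"
      by (simp add: mp_eval_subst mp_eval_var)
    then have "mp_eval to_univ (\<lambda>v. univ_var (r v)) f = 0 \<longleftrightarrow> f = 0"
      using rename_eq_0[OF f r] by (auto simp: mp_eval_univ_var_eq_0 mp_eval_ring_simps)
    then show ?thesis using assms(1,2) f by (auto simp: independent_vars_mod_def)
  qed
  then have "generic_over to_univ J T (\<lambda>v. univ_var (r v))" by (simp add: generic_over_def)
  then show ?thesis by (rule that)
qed

theorem generic_point:
  fixes J :: "('v, 'a::field) mpol set"
  assumes J: "primeideal J (mpol_ring N)" and N: "finite N"
  obtains b :: "'v \<Rightarrow> 'a univ_dom" where "J = vanishing_ideal to_univ N b"
proof -
  obtain T where T: "T \<subseteq> N" "independent_vars_mod J T"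
    "\<And>v A. v \<in> N - T \<Longrightarrow> T \<subseteq> A \<Longrightarrow> \<not> transcendental_mod J A v"
    using maximal_independent_vars[OF assms] by metis
  have "\<exists>b :: 'v \<Rightarrow> 'a univ_dom. generic_over to_univ J (T \<union> B) b" if "finite B" "B \<subseteq> N - T" for B
    using that
  proof (induction B rule: finite_induct)
    case empty
    have "finite T" using T(1) N finite_subset by blast
    then show ?case
      using generic_point_independent[OF _ T(2)] ideal_mpolD(2)[OF primeideal_mpolD(1)[OF J]] by (metis Un_empty_right)
  next
    case (insert v B)
    then obtain b :: "'v \<Rightarrow> 'a univ_dom" where "generic_over to_univ J (T \<union> B) b" by auto
    then have "\<exists>b' :: 'v \<Rightarrow> 'a univ_dom. generic_over to_univ J (insert v (T \<union> B)) b'"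
      using insert T by (intro generic_point_step[OF J]) auto
    then show ?case by simp
  qed
  from this[of "N - T"] N T(1) obtain b :: "'v \<Rightarrow> 'a univ_dom" where "generic_over to_univ J N b"
    by (auto simp: Un_absorb1)
  then have "J = vanishing_ideal to_univ N b"
    using ideal_mpolD(1)[OF primeideal_mpolD(1)[OF J]] by (auto simp: vanishing_ideal_def generic_over_def)
  then show ?thesis by (rule that)
qed

section \<open>Dimension\<close>

lemma vanishing_ideal_cong:
  "type_hom c \<Longrightarrow> (\<And>v. v \<in> N \<Longrightarrow> b v = b' v) \<Longrightarrow> vanishing_ideal c N b = vanishing_ideal c N b'"
  by (auto simp: vanishing_ideal_def cong: mp_eval_cong)

lemma algebraic_vars_avoid_independent:
  fixes J :: "('v, 'a::comm_ring_1) mpol set"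
  assumes "0 \<in> J" "independent_vars_mod J (set ts)"
  shows "algebraic_vars J (ts @ rs) \<inter> set ts = {}"
proof -
  have "transcendental_mod J (predecessors (ts @ rs) v) v" if "v \<in> set ts" for v
    using that predecessors_subset[of ts v]
    by (intro independent_vars_transcendental[OF assms]) (auto simp: predecessors_def dest: set_takeWhileD)
  then show ?thesis by (auto simp: algebraic_vars_def)
qed

lemma triangular_rank_generic:
  assumes P: "triangular N (vanishing_ideal c N b) ord S P h" and "finite N" "type_hom c"
  shows "fun_vs.dim (gradient c b ` vanishing_ideal c N b) = card S"
  by (rule triangular_rank[OF assms]) (use triangularD(3,4)[OF P] in \<open>auto simp: vanishing_ideal_def\<close>)

lemma independent_vars_image:
  fixes g :: "nat \<Rightarrow> ('v, 'a::field) mpol" and b :: "'v \<Rightarrow> 'f::field"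
  assumes hom: "type_hom c" and g: "g ` {..<d} \<subseteq> mpols N" "alg_independent_mod (vanishing_ideal c N b) d g"
  shows "independent_vars_mod (vanishing_ideal c N' (case_sum b (\<lambda>i. mp_eval c b (g i)))) (Inr ` {..<d})"
  unfolding independent_vars_mod_def
proof (intro ballI impI)
  let ?b = "case_sum b (\<lambda>i. mp_eval c b (g i))"
  fix f :: "('v + nat, 'a) mpol" assume f: "f \<in> vanishing_ideal c N' ?b" "f \<in> mpols (Inr ` {..<d})"
  define index :: "'v + nat \<Rightarrow> nat" where "index = case_sum (\<lambda>_. 0) (\<lambda>i. i)"
  let ?F = "mp_eval mconst (\<lambda>v. mvar (index v)) f"
  have F: "?F \<in> mpols {..<d}"
    using f(2) by (rule mpols_subst) (auto simp: index_def intro: mpols_var)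
  have "mp_eval c b (mp_eval mconst g ?F) = mp_eval c (\<lambda>v. mp_eval c b (g (index v))) f"
    by (simp add: mp_eval_subst hom mp_eval_var)
  also have "\<dots> = mp_eval c ?b f"
    by (rule mp_eval_cong[OF hom f(2)]) (auto simp: index_def)
  also have "\<dots> = 0" using f(1) by (simp add: vanishing_ideal_def)
  finally have "mp_eval mconst g ?F \<in> vanishing_ideal c N b"
    using mpols_subst[OF F, of g N] g(1) by (auto simp: vanishing_ideal_def)
  then have "?F = 0" using g(2) F by (auto simp: alg_independent_mod_def)
  then show "f = 0"
    by (rule rename_eq_0[OF f(2), rotated]) (auto simp: inj_on_def index_def)
qed

text \<open>Adjoin the \<open>g i\<close> as new variables, and present the resulting prime with these variables first:
  they are transcendental, so at most the \<open>card N\<close> old variables are algebraic.\<close>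

lemma independent_bound:
  fixes J :: "('v, 'a::field_char_0) mpol set"
  assumes P: "triangular N J ord S P h" and J: "primeideal J (mpol_ring N)" and N: "finite N"
    and g: "g ` {..<d} \<subseteq> mpols N" "alg_independent_mod J d g"
  shows "d + card S \<le> card N"
proof -
  obtain b :: "'v \<Rightarrow> 'a univ_dom" where b: "J = vanishing_ideal to_univ N b"
    using generic_point[OF J N] .
  define N' where "N' = Inl ` N \<union> Inr ` {..<d}"
  define b' where "b' = case_sum b (\<lambda>i. mp_eval to_univ b (g i))"
  define J' where "J' = vanishing_ideal to_univ N' b'"
  have N': "finite N'" "card N' = card N + d"
    using N by (auto simp: N'_def card_image intro: trans[OF card_Un_disjoint])
  interpret extension: interdefinable to_univ N' N b' b "\<lambda>v. mvar (Inl v)" "case_sum mvar g"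
    by unfold_locales
      (use N N' g in \<open>auto simp: N'_def b'_def mp_eval_var intro!: mpols_var\<close>)
  have J': "primeideal J' (mpol_ring N')" unfolding J'_def by (rule primeideal_vanishing_ideal) simp
  have "independent_vars_mod J' (Inr ` {..<d})"
    unfolding J'_def b'_def by (rule independent_vars_image[where N = N]) (use g in \<open>simp_all flip: b\<close>)
  moreover obtain ns where ns: "set ns = N" "distinct ns" using N finite_distinct_list by metis
  let ?vs = "map Inr [0..<d] @ map Inl ns"
  have vs: "set ?vs = N'" "distinct ?vs"
    using ns by (auto simp: N'_def distinct_map inj_on_def atLeast0LessThan)
  ultimately have "algebraic_vars J' ?vs \<inter> set (map Inr [0..<d]) = {}"
    using ideal_mpolD(2)[OF primeideal_mpolD(1)[OF J']]
    by (intro algebraic_vars_avoid_independent) (auto simp: atLeast0LessThan)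
  moreover have "algebraic_vars J' ?vs \<subseteq> set ?vs" by (auto simp: algebraic_vars_def)
  ultimately have "algebraic_vars J' ?vs \<subseteq> Inl ` N" using ns(1) by auto
  then have algebraic: "card (algebraic_vars J' ?vs) \<le> card N"
    using card_mono[of "Inl ` N" "algebraic_vars J' ?vs"] N by (simp add: card_image)
  obtain P' h' where "triangular N' J' (list_position ?vs) (algebraic_vars J' ?vs) P' h'"
    using exists_triangular_list[of J' ?vs] J' vs by metis
  then have "fun_vs.dim (gradient to_univ b' ` J') = card (algebraic_vars J' ?vs)"
    unfolding J'_def by (rule triangular_rank_generic[OF _ N'(1) type_hom_to_univ])
  moreover have "fun_vs.dim (gradient to_univ b ` J) = card S"
    using triangular_rank_generic[OF P[unfolded b] N type_hom_to_univ] by (simp add: b)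
  ultimately show ?thesis
    using extension.codim_le[OF type_hom_to_univ, of b b'] algebraic N'(2)
    by (simp add: b J'_def b'_def mp_eval_var)
qed

lemma triangular_card_unique:
  fixes J :: "('v, 'a::field) mpol set"
  assumes J: "primeideal J (mpol_ring N)" and N: "finite N"
    and "triangular N J ord S P h" "triangular N J ord' S' P' h'"
  shows "card S = card S'"
proof -
  obtain b :: "'v \<Rightarrow> 'a univ_dom" where "J = vanishing_ideal to_univ N b"
    using generic_point[OF J N] .
  with assms(3,4) show ?thesis using triangular_rank_generic[OF _ N type_hom_to_univ] by metis
qed

lemma exists_triangular_independent_complement:
  fixes J :: "('v, 'a::field_char_0) mpol set"
  assumes J: "primeideal J (mpol_ring N)" and N: "finite N"
  obtains T ord P h where "T \<subseteq> N" "independent_vars_mod J T" "triangular N J ord (N - T) P h"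
proof -
  obtain T where T: "T \<subseteq> N" "independent_vars_mod J T"
    "\<And>v A. v \<in> N - T \<Longrightarrow> T \<subseteq> A \<Longrightarrow> \<not> transcendental_mod J A v"
    using maximal_independent_vars[OF J N] by metis
  obtain ts rs where ts: "set ts = T" "distinct ts" and rs: "set rs = N - T" "distinct rs"
    using finite_distinct_list[OF finite_subset[OF T(1) N]] finite_distinct_list[OF finite_Diff[OF N]] by metis
  have vs: "set (ts @ rs) = N" "distinct (ts @ rs)" using ts rs T(1) by auto
  have "algebraic_vars J (ts @ rs) \<inter> set ts = {}"
    by (rule algebraic_vars_avoid_independent)
      (use T(2) ts ideal_mpolD(2)[OF primeideal_mpolD(1)[OF J]] in auto)
  moreover have "v \<in> algebraic_vars J (ts @ rs)" if v: "v \<in> N - T" for v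
  proof -
    have "T \<subseteq> predecessors (ts @ rs) v"
      using ts v by (auto simp: predecessors_def takeWhile_append)
    then show ?thesis using T(3)[OF v] v vs(1) by (auto simp: algebraic_vars_def)
  qed
  ultimately have "algebraic_vars J (ts @ rs) = N - T"
    using vs(1) ts(1) by (auto simp: algebraic_vars_def)
  then obtain P h where "triangular N J (list_position (ts @ rs)) (N - T) P h"
    using exists_triangular_list[of J "ts @ rs"] J vs by metis
  then show ?thesis by (rule that[OF T(1,2)])
qed

lemma alg_independent_of_independent_vars:
  fixes J :: "('v, 'a::comm_ring_1) mpol set"
  assumes "independent_vars_mod J T" and ts: "set ts = T" "distinct ts"
  shows "\<forall>F\<in>mpols {..<length ts}. F \<noteq> 0 \<longrightarrow> mp_eval mconst (\<lambda>i. mvar (ts ! i)) F \<notin> J"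
proof (intro ballI impI notI)
  fix F :: "(nat, 'a) mpol"
  assume F: "F \<in> mpols {..<length ts}" "F \<noteq> 0" "mp_eval mconst (\<lambda>i. mvar (ts ! i)) F \<in> J"
  have "mp_eval mconst (\<lambda>i. mvar (ts ! i)) F \<in> mpols T"
    using F(1) by (rule mpols_subst) (use ts(1) in \<open>auto intro!: mpols_var\<close>)
  then have "mp_eval mconst (\<lambda>i. mvar (ts ! i)) F = 0" using assms(1) F(3) by (auto simp: independent_vars_mod_def)
  then have "F = 0"
    by (rule rename_eq_0[OF F(1), rotated]) (use ts(2) in \<open>auto simp: inj_on_def nth_eq_iff_index_eq\<close>)
  with F(2) show False by simp
qed

theorem triangular_variety_dim:
  fixes J :: "('v, 'a::field_char_0) mpol set"
  assumes P: "triangular N J ord S P h" and J: "primeideal J (mpol_ring N)" and N: "finite N"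
  shows "variety_dim N J + card S = card N"
proof -
  let ?D = "{d. \<exists>g. g ` {..<d} \<subseteq> mpols N \<and> alg_independent_mod J d g}"
  obtain T ord' P' h' where T: "T \<subseteq> N" "independent_vars_mod J T" "triangular N J ord' (N - T) P' h'"
    using exists_triangular_independent_complement[OF J N] .
  have finite: "finite T" using T(1) N by (rule finite_subset)
  have card: "card T + card S = card N"
    using triangular_card_unique[OF J N P T(3)] card_Diff_subset[OF finite T(1)] card_mono[OF N T(1)] by simp
  obtain ts where ts: "set ts = T" "distinct ts" using finite_distinct_list[OF finite] by metis
  then have "(\<lambda>i. mvar (ts ! i) :: ('v, 'a) mpol) ` {..<card T} \<subseteq> mpols N"
    using T(1) distinct_card[OF ts(2)] by (auto intro!: mpols_var)
  then have "card T \<in> ?D"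
    using alg_independent_of_independent_vars[OF T(2) ts] distinct_card[OF ts(2)] ts(1)
    by (auto simp: alg_independent_mod_def)
  moreover have bound: "d \<le> card T" if d: "d \<in> ?D" for d
  proof -
    obtain g where "g ` {..<d} \<subseteq> mpols N" "alg_independent_mod J d g" using d by blast
    then have "d + card S \<le> card N" by (rule independent_bound[OF P J N])
    with card show ?thesis by linarith
  qed
  moreover have "finite ?D" by (rule finite_subset[of _ "{..card T}"]) (use bound in auto)
  ultimately have "Max ?D = card T" by (intro Max_eqI)
  then show ?thesis using card by (simp add: variety_dim_def)
qed

lemma triangular_smooth_at:
  fixes J :: "('v, 'a::field_char_0) mpol set" and c :: "'a \<Rightarrow> 'b::field"
  assumes "triangular N J ord S P h" "primeideal J (mpol_ring N)" "finite N" "type_hom c"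
    and "\<And>f. f \<in> J \<Longrightarrow> mp_eval c x f = 0" "mp_eval c x h \<noteq> 0"
  shows "smooth_at c N J x"
  unfolding smooth_at_iff using triangular_rank[OF assms(1,3-6)] triangular_variety_dim[OF assms(1-3)] by simp

definition inverse_equation :: "('v, 'a::comm_ring_1) mpol \<Rightarrow> 'v \<Rightarrow> ('v, 'a) mpol" where
  "inverse_equation h y = h * mvar y - 1"

lemma eliminate_inverse:
  fixes h :: "('v, 'a::comm_ring_1) mpol"
  assumes h: "h \<in> mpols N" and f: "f \<in> mpols (insert y N)"
  shows "\<exists>k g q. g \<in> mpols N \<and> h ^ k * f = g + q * inverse_equation h y"
proof -
  obtain p where p: "coeffs_in N p" "f = poly p (mvar y)" using mpol_as_poly[OF f] by metis
  have "\<exists>k g q. g \<in> mpols N \<and> h ^ k * poly p (mvar y) = g + q * inverse_equation h y" using p(1)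
  proof (induction p)
    case 0
    then show ?case by (intro exI[of _ 0]) auto
  next
    case (pCons a p)
    then obtain k g q where g: "g \<in> mpols N" "h ^ k * poly p (mvar y) = g + q * inverse_equation h y"
      by auto
    have "h ^ Suc k * poly (pCons a p) (mvar y) = h ^ Suc k * a + h * mvar y * (h ^ k * poly p (mvar y))"
      by (simp add: algebra_simps)
    also have "\<dots> = (h ^ Suc k * a + g) + (g + h * mvar y * q) * inverse_equation h y"
      unfolding g(2) by (simp add: inverse_equation_def algebra_simps)
    finally show ?case
      using mpols_add[OF mpols_mult[OF mpols_power[OF h]] g(1)] pCons.prems by (metis coeffs_in_pCons)
  qed
  with p(2) show ?thesis by simp
qed

lemma in_saturation_localise:
  fixes b :: "'v \<Rightarrow> 'f::field"
  assumes hom: "type_hom c" and S: "finite S" "y \<notin> S" and P: "triangular N (vanishing_ideal c N b) ord S P h"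
    and b_y: "b y = inverse (mp_eval c b h)" and f: "f \<in> vanishing_ideal c (insert y N) b"
  shows "in_saturation h (P(y := inverse_equation h y)) (insert y S) f"
proof -
  let ?P = "P(y := inverse_equation h y)"
  note ev = mp_eval_ring_simps[OF hom]
  have h: "h \<in> mpols N" "mp_eval c b h \<noteq> 0" using triangularD(3,4)[OF P] by (auto simp: vanishing_ideal_def)
  obtain k g q where g: "g \<in> mpols N" "h ^ k * f = g + q * inverse_equation h y"
    using eliminate_inverse[OF h(1), of f y] f by (auto simp: vanishing_ideal_def)
  have "mp_eval c b g = 0"
    using arg_cong[OF g(2), of "mp_eval c b"] f h b_y by (simp add: ev vanishing_ideal_def inverse_equation_def)
  with g(1) have "in_saturation h P S g" using triangularD(8)[OF P] by (auto simp: vanishing_ideal_def)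
  then have "in_saturation h ?P (insert y S) g"
    by (rule in_saturation_superset) (use S in auto)
  moreover have "in_saturation h ?P (insert y S) (?P y)" by (rule in_saturation_base) (use S in auto)
  ultimately have "in_saturation h ?P (insert y S) (h ^ k * f)"
    unfolding g(2) by (intro in_saturation_add in_saturation_mult) auto
  then show ?thesis by (rule in_saturation_cancel) simp
qed

lemma triangular_localise:
  fixes b :: "'v \<Rightarrow> 'f::field"
  assumes hom: "type_hom c" and N: "finite N" and y: "y \<notin> N"
    and P: "triangular N (vanishing_ideal c N b) ord S P h" and b_y: "b y = inverse (mp_eval c b h)"
  shows "triangular (insert y N) (vanishing_ideal c (insert y N) b) (ord(y := Suc (Max (ord ` insert y S))))
    (insert y S) (P(y := inverse_equation h y)) h"
proof -
  let ?ord = "ord(y := Suc (Max (ord ` insert y S)))" and ?P = "P(y := inverse_equation h y)"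
  let ?J = "vanishing_ideal c (insert y N) b"
  note PD = triangularD[OF P]
  have h: "h \<in> mpols (insert y N)" "mp_eval c b h \<noteq> 0"
    using PD(3,4) mpols_mono[of N "insert y N"] by (auto simp: vanishing_ideal_def)
  have S: "finite S" "y \<notin> S" using PD(1) N y finite_subset by auto
  have P_N: "P v \<in> mpols N" "P v \<in> ?J" if "v \<in> S" for v
    using PD(5)[OF that] mpols_mono[of N "insert y N"] by (auto simp: vanishing_ideal_def)
  have last: "?ord v < ?ord y" if "v \<in> S" for v
    using that S by (auto simp: less_Suc_eq_le)
  have "inj_on ?ord S" using PD(2) S(2) by (auto simp: inj_on_def)
  moreover have "?ord y \<notin> ?ord ` (S - {y})" using last by force
  ultimately have "inj_on ?ord (insert y S)" by (simp add: inj_on_insert)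
  moreover have "inverse_equation h y \<in> ?J"
    using h b_y by (auto simp: inverse_equation_def vanishing_ideal_def mp_eval_ring_simps[OF hom]
        intro!: mpols_minus mpols_mult mpols_var)
  moreover have "mp_deriv y (inverse_equation h y) = h"
    using mp_deriv_outside[OF PD(3) y] by (simp add: inverse_equation_def mp_deriv_minus mp_deriv_mult mp_deriv_var)
  moreover have "mp_deriv w (?P v) = 0" if "v \<in> insert y S" "w \<in> insert y S" "?ord v < ?ord w" for v w
  proof (cases "w = y")
    case True
    then show ?thesis using that last mp_deriv_outside[OF P_N(1) y] by (cases "v = y") auto
  next
    case False
    then have "v \<noteq> y" using that last[of w] by auto
    then show ?thesis using False that PD(7)[of v w] by (auto split: if_splits)
  qed
  moreover have "\<forall>f\<in>?J. in_saturation h ?P (insert y S) f"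
    using in_saturation_localise[OF hom S P b_y] by blast
  ultimately show ?thesis
    unfolding triangular_def using PD(1,6) P_N(2) S(2) h by (auto simp: vanishing_ideal_def)
qed

section \<open>Nilpotents, units and Hensel's lemma\<close>

context cring
begin

definition nilpotent :: "'a \<Rightarrow> bool" where
  "nilpotent a \<longleftrightarrow> a \<in> carrier R \<and> (\<exists>n::nat. a [^] n = \<zero>)"

lemma nilpotent_closed: "nilpotent a \<Longrightarrow> a \<in> carrier R"
  by (simp add: nilpotent_def)

lemma prime_mem_of_pow:
  assumes "primeideal P R" and a: "a \<in> carrier R" and "a [^] (n::nat) \<in> P"
  shows "a \<in> P"
proof -
  interpret P: primeideal P R by fact
  show ?thesis
    using assms(3)
  proof (induction n)
    case 0
    then show ?case using P.one_imp_carrier P.I_notcarr by simp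
  next
    case (Suc n)
    then show ?case using a P.I_prime[of "a [^] n" a] by auto
  qed
qed

lemma nilpotent_in_prime:
  assumes "nilpotent a" "primeideal P R"
  shows "a \<in> P"
proof -
  interpret P: primeideal P R by fact
  obtain n :: nat where "a [^] n = \<zero>" using assms(1) by (auto simp: nilpotent_def)
  then show ?thesis
    using prime_mem_of_pow[OF assms(2) nilpotent_closed[OF assms(1)], of n] P.zero_closed by simp
qed

lemma nilpotentI:
  assumes "a \<in> carrier R" "\<And>P. primeideal P R \<Longrightarrow> a \<in> P"
  shows "nilpotent a"
proof (rule ccontr)
  assume "\<not> nilpotent a"
  then have "\<And>n::nat. a [^] n \<notin> {\<zero>}" using assms(1) by (auto simp: nilpotent_def)
  from exists_prime_avoiding[OF zeroideal assms(1) this] obtain P where "primeideal P R" "a \<notin> P" .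
  with assms(2) show False by blast
qed

lemma one_notin_principal_ideal:
  assumes "a \<in> carrier R" "a \<notin> Units R"
  shows "\<one> \<notin> PIdl a"
proof
  assume "\<one> \<in> PIdl a"
  then obtain x where "x \<in> carrier R" "\<one> = x \<otimes> a" by (auto simp: cgenideal_def)
  with assms show False unfolding Units_def by (auto simp: m_comm)
qed

lemma unitI:
  assumes "a \<in> carrier R" "\<And>P. primeideal P R \<Longrightarrow> a \<notin> P"
  shows "a \<in> Units R"
proof (rule ccontr)
  assume "a \<notin> Units R"
  then have "\<one> [^] (n::nat) \<notin> PIdl a" for n
    using one_notin_principal_ideal[OF assms(1)] by simp
  from exists_prime_avoiding[OF cgenideal_ideal[OF assms(1)] one_closed this]
  obtain P where "primeideal P R" "PIdl a \<subseteq> P" .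
  with cgenideal_self[OF assms(1)] assms(2) show False by blast
qed

lemma unit_not_in_prime:
  assumes "a \<in> Units R" "primeideal P R"
  shows "a \<notin> P"
proof
  interpret P: primeideal P R by fact
  assume "a \<in> P"
  then have "inv a \<otimes> a \<in> P" using assms by (intro P.I_l_closed) auto
  then show False using assms(1) P.one_imp_carrier P.I_notcarr by simp
qed

lemma exists_maximal_ideal:
  assumes "ideal I R" "\<one> \<notin> I"
  obtains M where "maximalideal M R" "I \<subseteq> M"
proof -
  have "\<one> [^] (n::nat) \<notin> I" for n using assms(2) by simp
  from exists_ideal_maximal_avoiding_powers[OF assms(1) one_closed this]
  obtain M where M: "ideal M R" "I \<subseteq> M" "\<And>n::nat. \<one> [^] n \<notin> M"
    and above: "\<And>J. ideal J R \<Longrightarrow> M \<subset> J \<Longrightarrow> \<exists>n::nat. \<one> [^] n \<in> J" by metis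
  have "maximalideal M R"
  proof (rule maximalidealI[OF M(1)])
    show "carrier R \<noteq> M" using M(3)[of 0] by auto
    fix J assume J: "ideal J R" "M \<subseteq> J" "J \<subseteq> carrier R"
    then have "M \<subset> J \<Longrightarrow> \<one> \<in> J" using above[of J] by auto
    then show "J = M \<or> J = carrier R" using J ideal.one_imp_carrier by blast
  qed
  then show ?thesis using M(2) by (rule that)
qed

lemma unit_add_nilpotent:
  assumes "u \<in> Units R" "nilpotent e" "z \<in> carrier R"
  shows "u \<oplus> e \<otimes> z \<in> Units R"
proof (rule unitI)
  have closed: "u \<in> carrier R" "e \<in> carrier R" using assms by (auto simp: nilpotent_def)
  then show "u \<oplus> e \<otimes> z \<in> carrier R" using assms by auto
  fix P assume P: "primeideal P R"
  interpret P: primeideal P R by fact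
  show "u \<oplus> e \<otimes> z \<notin> P"
  proof
    assume "u \<oplus> e \<otimes> z \<in> P"
    moreover have "\<ominus> (e \<otimes> z) \<in> P"
      using nilpotent_in_prime[OF assms(2) P] assms(3) by (intro P.a_inv_closed P.I_r_closed)
    ultimately have "(u \<oplus> e \<otimes> z) \<oplus> \<ominus> (e \<otimes> z) \<in> P" by (rule P.a_closed)
    then have "u \<in> P" using closed assms(3) by (simp add: a_assoc r_neg)
    with unit_not_in_prime[OF assms(1) P] show False by blast
  qed
qed

lemma first_order_expansionE:
  assumes "first_order_expansion z F F' G"
  obtains r where "r \<in> carrier R" "G = F \<oplus> z \<otimes> F' \<oplus> z \<otimes> z \<otimes> r"
  using assms by (auto simp: first_order_expansion_def)

lemma newton_step:
  fixes f :: "('v, 'k::comm_ring_1) mpol"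
  assumes hom: "c \<in> ring_hom ring_of_type_algebra R" and x: "x \<in> N \<rightarrow> carrier R"
    and v: "v \<in> N" and f: "f \<in> mpols N"
    and unit: "mp_eval_in R c x (mp_deriv v f) \<in> Units R"
    and e: "e \<in> carrier R" and w: "w \<in> carrier R" and eval: "mp_eval_in R c x f = e \<otimes> w"
  shows "\<exists>t\<in>carrier R. \<exists>s\<in>carrier R. mp_eval_in R c (x(v := x v \<oplus> e \<otimes> t)) f = e \<otimes> e \<otimes> s"
proof -
  define U where "U = mp_eval_in R c x (mp_deriv v f)"
  define t where "t = \<ominus> (inv U \<otimes> w)"
  have U: "U \<in> Units R" "U \<in> carrier R" "inv U \<in> carrier R" using unit by (auto simp: U_def)
  then have t: "t \<in> carrier R" using w by (simp add: t_def)
  have "first_order_expansion (e \<otimes> t) (e \<otimes> w) U (mp_eval_in R c (x(v := x v \<oplus> e \<otimes> t)) f)"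
    using mp_taylor[OF cring_axioms hom x _ v f, of "e \<otimes> t"] e t by (simp add: eval U_def)
  then obtain r where r: "r \<in> carrier R"
    and taylor: "mp_eval_in R c (x(v := x v \<oplus> e \<otimes> t)) f = e \<otimes> w \<oplus> e \<otimes> t \<otimes> U \<oplus> e \<otimes> t \<otimes> (e \<otimes> t) \<otimes> r"
    by (rule first_order_expansionE)
  have "inv U \<otimes> w \<otimes> U = inv U \<otimes> U \<otimes> w" using U w by (simp only: m_assoc m_comm[of w U])
  then have "t \<otimes> U = \<ominus> w" using U w by (simp add: t_def l_minus)
  then have "e \<otimes> t \<otimes> U = \<ominus> (e \<otimes> w)" using e t U w by (simp add: m_assoc r_minus)
  then have "e \<otimes> w \<oplus> e \<otimes> t \<otimes> U = \<zero>" using e w by (simp add: r_neg)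
  then have "mp_eval_in R c (x(v := x v \<oplus> e \<otimes> t)) f = e \<otimes> e \<otimes> (t \<otimes> t \<otimes> r)"
    unfolding taylor using e t r by (simp add: m_ac)
  then show ?thesis using t r by blast
qed

lemma derivative_unit_perturb:
  fixes f :: "('v, 'k::comm_ring_1) mpol"
  assumes hom: "c \<in> ring_hom ring_of_type_algebra R" and x: "x \<in> N \<rightarrow> carrier R"
    and v: "v \<in> N" and f: "f \<in> mpols N"
    and e: "nilpotent e" and z: "z \<in> carrier R" and unit: "mp_eval_in R c x (mp_deriv v f) \<in> Units R"
  shows "mp_eval_in R c (x(v := x v \<oplus> e \<otimes> z)) (mp_deriv v f) \<in> Units R"
proof -
  interpret X: mp_evaluation R c x N by (rule mp_evaluationI[OF cring_axioms hom x])
  let ?f' = "mp_deriv v f" and ?U = "X.ev (mp_deriv v f)" and ?V = "X.ev (mp_deriv v (mp_deriv v f))"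
  note e_closed = nilpotent_closed[OF e]
  have closed: "?U \<in> carrier R" "?V \<in> carrier R" using f by (auto intro!: X.ev_closed mpols_deriv)
  obtain r where r: "r \<in> carrier R"
    and taylor: "mp_eval_in R c (x(v := x v \<oplus> e \<otimes> z)) ?f' = ?U \<oplus> e \<otimes> z \<otimes> ?V \<oplus> e \<otimes> z \<otimes> (e \<otimes> z) \<otimes> r"
    using first_order_expansionE[OF mp_taylor[OF cring_axioms hom x _ v mpols_deriv[OF f], of "e \<otimes> z"]] e_closed z
    by blast
  have "mp_eval_in R c (x(v := x v \<oplus> e \<otimes> z)) ?f' = ?U \<oplus> e \<otimes> (z \<otimes> ?V \<oplus> z \<otimes> (e \<otimes> z) \<otimes> r)"
    unfolding taylor using closed z e_closed r by (simp add: r_distr m_assoc a_assoc)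
  then show ?thesis using unit_add_nilpotent[OF unit e, of "z \<otimes> ?V \<oplus> z \<otimes> (e \<otimes> z) \<otimes> r"] closed z e_closed r by simp
qed

lemma hensel:
  fixes f :: "('v, 'k::comm_ring_1) mpol"
  assumes hom: "c \<in> ring_hom ring_of_type_algebra R" and x: "x \<in> N \<rightarrow> carrier R"
    and v: "v \<in> N" and f: "f \<in> mpols N"
    and nilpotent: "nilpotent (mp_eval_in R c x f)" and unit: "mp_eval_in R c x (mp_deriv v f) \<in> Units R"
  shows "\<exists>z\<in>carrier R. mp_eval_in R c (x(v := x v \<oplus> mp_eval_in R c x f \<otimes> z)) f = \<zero>"
proof -
  define e where "e = mp_eval_in R c x f"
  have e: "nilpotent e" "e \<in> carrier R" using nilpotent by (auto simp: e_def nilpotent_def)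
  have xv: "x v \<in> carrier R" using x v by auto
  have approximation: "\<exists>z\<in>carrier R. \<exists>w\<in>carrier R. mp_eval_in R c (x(v := x v \<oplus> e \<otimes> z)) f = e [^] Suc m \<otimes> w" for m
  proof (induction m)
    case 0
    have "x(v := x v \<oplus> e \<otimes> \<zero>) = x" using xv e by (simp add: fun_upd_idem_iff)
    then show ?case using e by (intro bexI[of _ \<zero>] bexI[of _ \<one>]) (auto simp: e_def)
  next
    case (Suc m)
    then obtain z w where z: "z \<in> carrier R" and w: "w \<in> carrier R"
      and approx: "mp_eval_in R c (x(v := x v \<oplus> e \<otimes> z)) f = e [^] Suc m \<otimes> w" by blast
    define y where "y = x(v := x v \<oplus> e \<otimes> z)"
    have "y \<in> N \<rightarrow> carrier R" using x xv e z by (auto simp: y_def Pi_iff)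
    moreover have "mp_eval_in R c y (mp_deriv v f) \<in> Units R"
      unfolding y_def by (rule derivative_unit_perturb[OF hom x v f e(1) z unit])
    ultimately obtain t s where t: "t \<in> carrier R" and s: "s \<in> carrier R"
      and next_approx: "mp_eval_in R c (y(v := y v \<oplus> e [^] Suc m \<otimes> t)) f = e [^] Suc m \<otimes> e [^] Suc m \<otimes> s"
      using newton_step[OF hom _ v f _ _ w approx[folded y_def]] e(2) by blast
    have "y v \<oplus> e [^] Suc m \<otimes> t = x v \<oplus> e \<otimes> (z \<oplus> e [^] m \<otimes> t)"
      using xv e(2) z t by (simp add: y_def r_distr a_assoc m_ac)
    then have "y(v := y v \<oplus> e [^] Suc m \<otimes> t) = x(v := x v \<oplus> e \<otimes> (z \<oplus> e [^] m \<otimes> t))" by (simp add: y_def)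
    moreover have "e [^] Suc m \<otimes> e [^] Suc m \<otimes> s = e [^] Suc (Suc m) \<otimes> (e [^] m \<otimes> s)"
      using e(2) s by (simp add: m_ac)
    ultimately show ?case using next_approx e(2) z t s by (metis a_closed m_closed nat_pow_closed)
  qed
  obtain n :: nat where n: "e [^] n = \<zero>" using e(1) by (auto simp: nilpotent_def)
  from approximation[of n] obtain z w where "z \<in> carrier R" "w \<in> carrier R"
    "mp_eval_in R c (x(v := x v \<oplus> e \<otimes> z)) f = e [^] Suc n \<otimes> w" by blast
  with n e show ?thesis by (auto simp: e_def)
qed

end

section \<open>Base change to \<open>\<D>\<close>\<close>

locale local_algebra =
  fixes \<D> :: "('k::field_char_0, 'd::comm_ring_1) based_algebra"
  assumes finite_local_algebra: "finite_local_algebra \<D>"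
begin

abbreviation "I\<^sub>\<D> \<equiv> {..len \<D>}"

sublocale vs: finite_dimensional_vector_space "smul \<D>" "eps \<D> ` I\<^sub>\<D>"
  using finite_local_algebra
  by (auto simp: finite_local_algebra_def finite_dimensional_vector_space_def finite_dimensional_vector_space_axioms_def)

lemma inj_on_eps: "inj_on (eps \<D>) I\<^sub>\<D>"
  using finite_local_algebra by (auto simp: finite_local_algebra_def)

lemma smul_mult_left: "smul \<D> a (x * y) = smul \<D> a x * y"
  using finite_local_algebra by (simp add: finite_local_algebra_def)

lemma smul_mult_right: "smul \<D> a (x * y) = x * smul \<D> a y"
  using smul_mult_left[of a y x] by (simp add: mult.commute)

lemma coord_expand: "(\<Sum>m\<in>I\<^sub>\<D>. smul \<D> (coord \<D> x m) (eps \<D> m)) = x"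
proof -
  have "(\<Sum>b\<in>eps \<D> ` I\<^sub>\<D>. smul \<D> (vs.representation (eps \<D> ` I\<^sub>\<D>) x b) b) = x"
    by (rule vs.sum_representation_eq) (use vs.independent_Basis vs.span_Basis in auto)
  then show ?thesis by (simp add: sum.reindex[OF inj_on_eps] coord_def comp_def)
qed

lemma coord_add: "coord \<D> (x + y) m = coord \<D> x m + coord \<D> y m"
  unfolding coord_def using vs.independent_Basis vs.span_Basis by (subst vs.representation_add) auto

lemma coord_smul: "coord \<D> (smul \<D> a x) m = a * coord \<D> x m"
  unfolding coord_def using vs.independent_Basis vs.span_Basis by (subst vs.representation_scale) auto

lemma coord_0: "coord \<D> 0 m = 0"
  using coord_smul[of 0 0 m] by simp

lemma coord_sum: "coord \<D> (sum f A) m = (\<Sum>a\<in>A. coord \<D> (f a) m)"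
  by (induction A rule: infinite_finite_induct) (auto simp: coord_0 coord_add)

lemma coord_eps: "i \<in> I\<^sub>\<D> \<Longrightarrow> m \<in> I\<^sub>\<D> \<Longrightarrow> coord \<D> (eps \<D> i) m = (if m = i then 1 else 0)"
  unfolding coord_def using vs.independent_Basis inj_on_eps
  by (subst vs.representation_basis) (auto dest: inj_onD)

abbreviation struct_const :: "nat \<Rightarrow> nat \<Rightarrow> nat \<Rightarrow> 'k" where
  "struct_const i j m \<equiv> coord \<D> (eps \<D> i * eps \<D> j) m"

lemma coord_mult:
  "coord \<D> (x * y) m = (\<Sum>i\<in>I\<^sub>\<D>. \<Sum>j\<in>I\<^sub>\<D>. coord \<D> x i * coord \<D> y j * struct_const i j m)"
proof -
  have "x * y = (\<Sum>i\<in>I\<^sub>\<D>. smul \<D> (coord \<D> x i) (eps \<D> i)) * (\<Sum>j\<in>I\<^sub>\<D>. smul \<D> (coord \<D> y j) (eps \<D> j))"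
    by (simp only: coord_expand)
  also have "\<dots> = (\<Sum>i\<in>I\<^sub>\<D>. \<Sum>j\<in>I\<^sub>\<D>. smul \<D> (coord \<D> x i * coord \<D> y j) (eps \<D> i * eps \<D> j))"
    unfolding sum_product
    by (intro sum.cong refl)
      (simp add: smul_mult_left[symmetric] smul_mult_right[symmetric] vs.scale_left_commute flip: vs.scale_scale)
  finally show ?thesis by (simp add: coord_sum coord_smul)
qed

lemma resid_hom: "type_hom (resid \<D>)"
  and resid_smul: "resid \<D> (smul \<D> a x) = a * resid \<D> x"
  and resid_eps: "resid \<D> (eps \<D> 0) = 1" "j \<in> I\<^sub>\<D> \<Longrightarrow> j \<noteq> 0 \<Longrightarrow> resid \<D> (eps \<D> j) = 0"
  using finite_local_algebra by (auto simp: finite_local_algebra_def)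

lemma resid_eq_coord: "resid \<D> x = coord \<D> x 0"
proof -
  have "resid \<D> x = (\<Sum>m\<in>I\<^sub>\<D>. coord \<D> x m * resid \<D> (eps \<D> m))"
    using arg_cong[OF coord_expand[of x], of "resid \<D>"]
    by (simp add: type_hom_sum[OF resid_hom] resid_smul)
  also have "\<dots> = (\<Sum>m\<in>I\<^sub>\<D>. if m = 0 then coord \<D> x m else 0)"
    by (intro sum.cong) (auto simp: resid_eps)
  finally show ?thesis by simp
qed

lemma coord_one_0: "coord \<D> 1 0 = 1"
  using type_homD(2)[OF resid_hom] by (simp add: resid_eq_coord)

lemma struct_const_0:
  "i \<in> I\<^sub>\<D> \<Longrightarrow> j \<in> I\<^sub>\<D> \<Longrightarrow> struct_const i j 0 = (if i = 0 \<and> j = 0 then 1 else 0)"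
  unfolding resid_eq_coord[symmetric] type_homD(4)[OF resid_hom] using resid_eps by auto

lemma coord_mult_eps:
  assumes "j \<in> I\<^sub>\<D>"
  shows "coord \<D> (x * eps \<D> j) m = (\<Sum>i\<in>I\<^sub>\<D>. coord \<D> x i * struct_const i j m)"
proof -
  have "coord \<D> (x * eps \<D> j) m = (\<Sum>i\<in>I\<^sub>\<D>. \<Sum>q\<in>I\<^sub>\<D>. if q = j then coord \<D> x i * struct_const i q m else 0)"
    unfolding coord_mult[of x "eps \<D> j"] by (intro sum.cong refl) (use assms in \<open>auto simp: coord_eps\<close>)
  also have "\<dots> = (\<Sum>i\<in>I\<^sub>\<D>. coord \<D> x i * struct_const i j m)"
    using assms by (simp only: sum.delta finite_atMost if_True)
  finally show ?thesis .
qed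

lemma struct_const_one:
  assumes "j \<in> I\<^sub>\<D>" "m \<in> I\<^sub>\<D>"
  shows "(\<Sum>i\<in>I\<^sub>\<D>. coord \<D> 1 i * struct_const i j m) = (if m = j then 1 else 0)"
  using coord_mult_eps[OF assms(1), of 1 m] coord_eps[OF assms] by simp

lemma struct_const_assoc:
  assumes "i \<in> I\<^sub>\<D>" "j \<in> I\<^sub>\<D>" "q \<in> I\<^sub>\<D>"
  shows "(\<Sum>p\<in>I\<^sub>\<D>. struct_const i j p * struct_const p q m) = (\<Sum>p\<in>I\<^sub>\<D>. struct_const j q p * struct_const i p m)"
proof -
  have "(\<Sum>p\<in>I\<^sub>\<D>. struct_const j q p * struct_const i p m) = coord \<D> (eps \<D> j * eps \<D> q * eps \<D> i) m"
    by (subst coord_mult_eps[OF assms(1)]) (simp only: mult.commute[of "eps \<D> i"])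
  also have "\<dots> = coord \<D> (eps \<D> i * eps \<D> j * eps \<D> q) m" by (simp add: mult_ac)
  also have "\<dots> = (\<Sum>p\<in>I\<^sub>\<D>. struct_const i j p * struct_const p q m)" by (rule coord_mult_eps[OF assms(3)])
  finally show ?thesis ..
qed

lemma base_change_sel:
  "carrier (base_change \<D> R \<iota>) = I\<^sub>\<D> \<rightarrow>\<^sub>E carrier R"
  "u \<otimes>\<^bsub>base_change \<D> R \<iota>\<^esub> v = (\<lambda>m\<in>I\<^sub>\<D>. \<Oplus>\<^bsub>R\<^esub>i\<in>I\<^sub>\<D>. \<Oplus>\<^bsub>R\<^esub>j\<in>I\<^sub>\<D>. \<iota> (struct_const i j m) \<otimes>\<^bsub>R\<^esub> (u i \<otimes>\<^bsub>R\<^esub> v j))"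
  "\<one>\<^bsub>base_change \<D> R \<iota>\<^esub> = (\<lambda>m\<in>I\<^sub>\<D>. \<iota> (coord \<D> 1 m))"
  "\<zero>\<^bsub>base_change \<D> R \<iota>\<^esub> = (\<lambda>m\<in>I\<^sub>\<D>. \<zero>\<^bsub>R\<^esub>)"
  "u \<oplus>\<^bsub>base_change \<D> R \<iota>\<^esub> v = (\<lambda>m\<in>I\<^sub>\<D>. u m \<oplus>\<^bsub>R\<^esub> v m)"
  by (simp_all add: base_change_def)

lemma base_change_component: "u \<in> carrier (base_change \<D> R \<iota>) \<Longrightarrow> m \<in> I\<^sub>\<D> \<Longrightarrow> u m \<in> carrier R"
  by (auto simp: base_change_sel)

lemma base_change_eqI:
  assumes "u \<in> carrier (base_change \<D> R \<iota>)" "v \<in> carrier (base_change \<D> R \<iota>)" "\<And>m. m \<in> I\<^sub>\<D> \<Longrightarrow> u m = v m"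
  shows "u = v"
  using assms by (auto simp: base_change_sel intro: PiE_ext)

definition base_change_map :: "('r \<Rightarrow> 's) \<Rightarrow> (nat \<Rightarrow> 'r) \<Rightarrow> nat \<Rightarrow> 's" where
  "base_change_map h u = (\<lambda>m\<in>I\<^sub>\<D>. h (u m))"

lemma (in ring_hom_cring) hom_finsum_eq:
  assumes "f \<in> A \<rightarrow> carrier R" "\<And>a. a \<in> A \<Longrightarrow> h (f a) = g a"
  shows "h (\<Oplus>a\<in>A. f a) = (\<Oplus>\<^bsub>S\<^esub>a\<in>A. g a)"
proof -
  have "(\<Oplus>\<^bsub>S\<^esub>a\<in>A. h (f a)) = (\<Oplus>\<^bsub>S\<^esub>a\<in>A. g a)"
    using assms by (intro S.finsum_cong') (auto simp: Pi_iff simp flip: assms(2))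
  then show ?thesis using assms(1) by (simp add: comp_def)
qed

lemma base_change_map_hom:
  assumes R: "cring R" and S: "cring S" and h: "h \<in> ring_hom R S"
    and \<iota>: "\<iota> \<in> ring_hom ring_of_type_algebra R" and \<iota>': "\<iota>' = h \<circ> \<iota>"
  shows "base_change_map h \<in> ring_hom (base_change \<D> R \<iota>) (base_change \<D> S \<iota>')"
proof -
  interpret R: cring R by fact
  interpret S: cring S by fact
  interpret h: ring_hom_cring R S h
    by (intro ring_hom_cring.intro ring_hom_cring_axioms.intro R S h)
  have \<iota>_closed: "\<iota> a \<in> carrier R" for a using \<iota> by (auto simp: ring_hom_def)
  show ?thesis
  proof (rule ring_hom_memI)
    fix u v assume "u \<in> carrier (base_change \<D> R \<iota>)" "v \<in> carrier (base_change \<D> R \<iota>)"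
    then have closed: "u i \<in> carrier R" "v i \<in> carrier R" if "i \<in> I\<^sub>\<D>" for i
      using that by (auto simp: base_change_sel)
    then show "base_change_map h (u \<oplus>\<^bsub>base_change \<D> R \<iota>\<^esub> v) =
        base_change_map h u \<oplus>\<^bsub>base_change \<D> S \<iota>'\<^esub> base_change_map h v"
      by (auto simp: base_change_map_def base_change_sel restrict_def fun_eq_iff)
    have "h (\<Oplus>\<^bsub>R\<^esub>i\<in>I\<^sub>\<D>. \<Oplus>\<^bsub>R\<^esub>j\<in>I\<^sub>\<D>. \<iota> (struct_const i j m) \<otimes>\<^bsub>R\<^esub> (u i \<otimes>\<^bsub>R\<^esub> v j)) =
       (\<Oplus>\<^bsub>S\<^esub>i\<in>I\<^sub>\<D>. \<Oplus>\<^bsub>S\<^esub>j\<in>I\<^sub>\<D>. \<iota>' (struct_const i j m) \<otimes>\<^bsub>S\<^esub> (base_change_map h u i \<otimes>\<^bsub>S\<^esub> base_change_map h v j))" for m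
      by (intro h.hom_finsum_eq)
        (auto simp: closed \<iota>_closed \<iota>' base_change_map_def intro!: R.finsum_closed h.hom_finsum_eq)
    then show "base_change_map h (u \<otimes>\<^bsub>base_change \<D> R \<iota>\<^esub> v) =
        base_change_map h u \<otimes>\<^bsub>base_change \<D> S \<iota>'\<^esub> base_change_map h v"
      unfolding base_change_sel by (simp add: base_change_map_def restrict_def fun_eq_iff)
  next
    show "base_change_map h \<one>\<^bsub>base_change \<D> R \<iota>\<^esub> = \<one>\<^bsub>base_change \<D> S \<iota>'\<^esub>"
      by (auto simp: base_change_sel base_change_map_def \<iota>' restrict_def fun_eq_iff)
  qed (auto simp: base_change_sel base_change_map_def)
qed

text \<open>\<open>r \<otimes> d\<close>\<close>

definition pure :: "'r ring \<Rightarrow> ('k \<Rightarrow> 'r) \<Rightarrow> 'r \<Rightarrow> 'd \<Rightarrow> nat \<Rightarrow> 'r" where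
  "pure R \<iota> r d = (\<lambda>m\<in>I\<^sub>\<D>. \<iota> (coord \<D> d m) \<otimes>\<^bsub>R\<^esub> r)"

text \<open>Identities in \<open>R \<otimes> \<D>\<close> are first checked for types, where sums are plain sums, and then specialised
  from the polynomial ring over \<open>k\<close> in the coordinates of the elements involved.\<close>

abbreviation type_base_change :: "('k \<Rightarrow> 'r::comm_ring_1) \<Rightarrow> (nat \<Rightarrow> 'r) ring" where
  "type_base_change \<kappa> \<equiv> base_change \<D> ring_of_type_algebra \<kappa>"

context
  fixes \<kappa> :: "'k \<Rightarrow> 'r::comm_ring_1"
  assumes \<kappa>: "type_hom \<kappa>"
begin

lemma type_mult:
  "u \<otimes>\<^bsub>type_base_change \<kappa>\<^esub> v = (\<lambda>m\<in>I\<^sub>\<D>. \<Sum>i\<in>I\<^sub>\<D>. \<Sum>j\<in>I\<^sub>\<D>. \<kappa> (struct_const i j m) * (u i * v j))"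
  by (simp add: base_change_sel finsum_of_type)

lemma type_mult_comm: "u \<otimes>\<^bsub>type_base_change \<kappa>\<^esub> v = v \<otimes>\<^bsub>type_base_change \<kappa>\<^esub> u"
  unfolding type_mult by (rule restrict_ext, subst sum.swap) (simp add: mult_ac)

lemma type_mult_distrib:
  "(u \<oplus>\<^bsub>type_base_change \<kappa>\<^esub> v) \<otimes>\<^bsub>type_base_change \<kappa>\<^esub> w =
    u \<otimes>\<^bsub>type_base_change \<kappa>\<^esub> w \<oplus>\<^bsub>type_base_change \<kappa>\<^esub> v \<otimes>\<^bsub>type_base_change \<kappa>\<^esub> w"
  unfolding type_mult base_change_sel(5)
  by (rule restrict_ext) (simp add: distrib_left distrib_right sum.distrib)

lemma sum_rotate: "(\<Sum>p\<in>A. \<Sum>i\<in>B. \<Sum>j\<in>C. f p i j) = (\<Sum>i\<in>B. \<Sum>j\<in>C. \<Sum>p\<in>A. f p i j)"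
  by (subst sum.swap) (intro sum.cong refl sum.swap)

lemma type_mult_assoc:
  "(u \<otimes>\<^bsub>type_base_change \<kappa>\<^esub> v) \<otimes>\<^bsub>type_base_change \<kappa>\<^esub> w =
    u \<otimes>\<^bsub>type_base_change \<kappa>\<^esub> (v \<otimes>\<^bsub>type_base_change \<kappa>\<^esub> w)"
proof -
  let ?c = "\<lambda>i j m. \<kappa> (struct_const i j m)"
  have "(\<Sum>p\<in>I\<^sub>\<D>. \<Sum>q\<in>I\<^sub>\<D>. ?c p q m * ((\<Sum>i\<in>I\<^sub>\<D>. \<Sum>j\<in>I\<^sub>\<D>. ?c i j p * (u i * v j)) * w q)) =
      (\<Sum>i\<in>I\<^sub>\<D>. \<Sum>p\<in>I\<^sub>\<D>. ?c i p m * (u i * (\<Sum>j\<in>I\<^sub>\<D>. \<Sum>q\<in>I\<^sub>\<D>. ?c j q p * (v j * w q))))" for m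
  proof -
    let ?left = "\<lambda>i j q p. ?c i j p * ?c p q m * (u i * v j * w q)"
      and ?right = "\<lambda>i j q p. ?c j q p * ?c i p m * (u i * v j * w q)"
    have "(\<Sum>p\<in>I\<^sub>\<D>. \<Sum>q\<in>I\<^sub>\<D>. ?c p q m * ((\<Sum>i\<in>I\<^sub>\<D>. \<Sum>j\<in>I\<^sub>\<D>. ?c i j p * (u i * v j)) * w q)) =
        (\<Sum>p\<in>I\<^sub>\<D>. \<Sum>q\<in>I\<^sub>\<D>. \<Sum>i\<in>I\<^sub>\<D>. \<Sum>j\<in>I\<^sub>\<D>. ?left i j q p)"
      by (simp add: sum_distrib_left sum_distrib_right mult_ac)
    also have "\<dots> = (\<Sum>p\<in>I\<^sub>\<D>. \<Sum>i\<in>I\<^sub>\<D>. \<Sum>j\<in>I\<^sub>\<D>. \<Sum>q\<in>I\<^sub>\<D>. ?left i j q p)"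
      by (intro sum.cong refl sum_rotate)
    also have "\<dots> = (\<Sum>i\<in>I\<^sub>\<D>. \<Sum>j\<in>I\<^sub>\<D>. \<Sum>q\<in>I\<^sub>\<D>. \<Sum>p\<in>I\<^sub>\<D>. ?left i j q p)"
      by (subst sum.swap) (intro sum.cong refl sum_rotate)
    also have "\<dots> = (\<Sum>i\<in>I\<^sub>\<D>. \<Sum>j\<in>I\<^sub>\<D>. \<Sum>q\<in>I\<^sub>\<D>. \<kappa> (\<Sum>p\<in>I\<^sub>\<D>. struct_const i j p * struct_const p q m) * (u i * v j * w q))"
      by (simp add: type_hom_sum[OF \<kappa>] type_homD[OF \<kappa>] sum_distrib_right)
    also have "\<dots> = (\<Sum>i\<in>I\<^sub>\<D>. \<Sum>j\<in>I\<^sub>\<D>. \<Sum>q\<in>I\<^sub>\<D>. \<kappa> (\<Sum>p\<in>I\<^sub>\<D>. struct_const j q p * struct_const i p m) * (u i * v j * w q))"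
      by (intro sum.cong refl) (simp only: struct_const_assoc)
    also have "\<dots> = (\<Sum>i\<in>I\<^sub>\<D>. \<Sum>j\<in>I\<^sub>\<D>. \<Sum>q\<in>I\<^sub>\<D>. \<Sum>p\<in>I\<^sub>\<D>. ?right i j q p)"
      by (simp add: type_hom_sum[OF \<kappa>] type_homD[OF \<kappa>] sum_distrib_right)
    also have "\<dots> = (\<Sum>i\<in>I\<^sub>\<D>. \<Sum>p\<in>I\<^sub>\<D>. \<Sum>j\<in>I\<^sub>\<D>. \<Sum>q\<in>I\<^sub>\<D>. ?right i j q p)"
      by (intro sum.cong refl sum_rotate[symmetric])
    also have "\<dots> = (\<Sum>i\<in>I\<^sub>\<D>. \<Sum>p\<in>I\<^sub>\<D>. ?c i p m * (u i * (\<Sum>j\<in>I\<^sub>\<D>. \<Sum>q\<in>I\<^sub>\<D>. ?c j q p * (v j * w q))))"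
      by (simp add: sum_distrib_left mult_ac)
    finally show ?thesis .
  qed
  then show ?thesis unfolding type_mult by (intro restrict_ext) simp
qed

lemma type_pure_1_mult: "pure ring_of_type_algebra \<kappa> r 1 \<otimes>\<^bsub>type_base_change \<kappa>\<^esub> u = (\<lambda>m\<in>I\<^sub>\<D>. r * u m)"
  unfolding type_mult
proof (rule restrict_ext)
  fix m assume m: "m \<in> I\<^sub>\<D>"
  have "(\<Sum>i\<in>I\<^sub>\<D>. \<Sum>j\<in>I\<^sub>\<D>. \<kappa> (struct_const i j m) * (pure ring_of_type_algebra \<kappa> r 1 i * u j)) =
      (\<Sum>j\<in>I\<^sub>\<D>. \<kappa> (\<Sum>i\<in>I\<^sub>\<D>. coord \<D> 1 i * struct_const i j m) * (r * u j))"
    by (subst sum.swap) (simp add: pure_def type_hom_sum[OF \<kappa>] type_homD[OF \<kappa>] sum_distrib_left sum_distrib_right mult_ac)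
  also have "\<dots> = (\<Sum>j\<in>I\<^sub>\<D>. if m = j then r * u j else 0)"
    using m by (intro sum.cong refl) (simp add: struct_const_one type_homD[OF \<kappa>])
  also have "\<dots> = r * u m" using m by simp
  finally show "(\<Sum>i\<in>I\<^sub>\<D>. \<Sum>j\<in>I\<^sub>\<D>. \<kappa> (struct_const i j m) * (pure ring_of_type_algebra \<kappa> r 1 i * u j)) = r * u m" .
qed

lemma type_pure_mult:
  "pure ring_of_type_algebra \<kappa> r d \<otimes>\<^bsub>type_base_change \<kappa>\<^esub> pure ring_of_type_algebra \<kappa> s d' =
    pure ring_of_type_algebra \<kappa> (r * s) (d * d')"
  unfolding type_mult pure_def[of _ _ "r * s"]
  by (rule restrict_ext)
    (simp add: pure_def coord_mult[of d d'] type_hom_sum[OF \<kappa>] type_homD[OF \<kappa>] sum_distrib_right sum_distrib_left mult_ac)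

end

definition generic_elem :: "nat \<Rightarrow> nat \<Rightarrow> (nat \<times> nat, 'k) mpol" where
  "generic_elem a = (\<lambda>i\<in>I\<^sub>\<D>. mvar (a, i))"

lemma generic_elem_closed: "generic_elem a \<in> carrier (type_base_change mconst)"
  by (simp add: generic_elem_def base_change_sel)

lemma type_base_change_closed:
  "u \<otimes>\<^bsub>type_base_change \<kappa>\<^esub> v \<in> carrier (type_base_change \<kappa>)"
  "u \<oplus>\<^bsub>type_base_change \<kappa>\<^esub> v \<in> carrier (type_base_change \<kappa>)"
  "pure ring_of_type_algebra \<kappa> r d \<in> carrier (type_base_change \<kappa>)"
  by (simp_all add: base_change_sel pure_def)

context
  fixes R :: "'r ring" and \<iota> :: "'k \<Rightarrow> 'r"
  assumes R: "cring R" and \<iota>: "\<iota> \<in> ring_hom ring_of_type_algebra R"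
begin

interpretation R: cring R by (rule R)

abbreviation "RD \<equiv> base_change \<D> R \<iota>"

lemma iota_closed: "\<iota> a \<in> carrier R"
  using \<iota> by (auto simp: ring_hom_def)

lemma iota_0: "\<iota> 0 = \<zero>\<^bsub>R\<^esub>"
  using ring_hom_zero_of_type[OF R.ring_axioms \<iota>] .

lemma iota_1: "\<iota> 1 = \<one>\<^bsub>R\<^esub>"
  using \<iota> by (auto simp: ring_hom_def)

lemma specialise:
  assumes "\<And>a. u a \<in> carrier RD"
  obtains E where "E \<in> ring_hom ring_of_type_algebra R"
    "\<And>a i. i \<in> I\<^sub>\<D> \<Longrightarrow> E (mvar (a, i)) = u a i"
    "base_change_map E \<in> ring_hom (type_base_change mconst) RD" "\<And>a. base_change_map E (generic_elem a) = u a"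
    "\<And>r d. base_change_map E (pure ring_of_type_algebra mconst r d) = pure R \<iota> (E r) d"
proof -
  define x where "x = (\<lambda>(a, i). if i \<in> I\<^sub>\<D> then u a i else \<zero>\<^bsub>R\<^esub>)"
  interpret mp_evaluation R \<iota> x UNIV
    using base_change_component[OF assms] by (intro mp_evaluationI R \<iota>) (auto simp: x_def)
  have ev_coord: "ev (mvar (a, i)) = u a i" if "i \<in> I\<^sub>\<D>" for a i
    using that ev_var[of "(a, i)"] by (simp add: x_def)
  have hom: "ev \<in> ring_hom ring_of_type_algebra R"
    using ev_hom by (simp add: ring_hom_def)
  show ?thesis
  proof (rule that[OF hom])
    show "base_change_map ev \<in> ring_hom (type_base_change mconst) RD"
      by (rule base_change_map_hom[OF cring_from_type_algebra R hom type_hom_mconst]) (simp add: fun_eq_iff)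
    show "base_change_map ev (generic_elem a) = u a" for a
      by (rule base_change_eqI[OF _ assms])
        (auto simp: base_change_map_def generic_elem_def base_change_sel ev_coord base_change_component[OF assms] simp del: ev_var)
    show "base_change_map ev (pure ring_of_type_algebra mconst r d) = pure R \<iota> (ev r) d" for r d
      by (auto simp: base_change_map_def pure_def ev_mult restrict_def fun_eq_iff)
  qed (rule ev_coord)
qed

lemma base_change_mult_closed:
  assumes "u \<in> carrier RD" "v \<in> carrier RD"
  shows "u \<otimes>\<^bsub>RD\<^esub> v \<in> carrier RD"
  using assms iota_closed by (auto simp: base_change_sel PiE_iff intro!: R.finsum_closed)

lemma base_change_mult_laws:
  assumes "u \<in> carrier RD" "v \<in> carrier RD" "w \<in> carrier RD"
  shows "u \<otimes>\<^bsub>RD\<^esub> v = v \<otimes>\<^bsub>RD\<^esub> u" (is ?comm)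
    and "(u \<otimes>\<^bsub>RD\<^esub> v) \<otimes>\<^bsub>RD\<^esub> w = u \<otimes>\<^bsub>RD\<^esub> (v \<otimes>\<^bsub>RD\<^esub> w)" (is ?assoc)
    and "(u \<oplus>\<^bsub>RD\<^esub> v) \<otimes>\<^bsub>RD\<^esub> w = u \<otimes>\<^bsub>RD\<^esub> w \<oplus>\<^bsub>RD\<^esub> v \<otimes>\<^bsub>RD\<^esub> w" (is ?distrib)
proof -
  have "(if a = 0 then u else if a = 1 then v else w) \<in> carrier RD" for a :: nat using assms by simp
  from specialise[of "\<lambda>a. if a = 0 then u else if a = 1 then v else w", OF this]
  obtain E where E: "E \<in> ring_hom ring_of_type_algebra R"
    "\<And>a i. i \<in> I\<^sub>\<D> \<Longrightarrow> E (mvar (a, i)) = (if a = 0 then u else if a = 1 then v else w) i"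
    "base_change_map E \<in> ring_hom (type_base_change mconst) RD"
    "\<And>a. base_change_map E (generic_elem a) = (if a = 0 then u else if a = 1 then v else w)"
    "\<And>r d. base_change_map E (pure ring_of_type_algebra mconst r d) = pure R \<iota> (E r) d" by blast
  let ?u = "generic_elem 0" and ?v = "generic_elem 1" and ?w = "generic_elem 2"
  have elems: "base_change_map E ?u = u" "base_change_map E ?v = v" "base_change_map E ?w = w"
    using E(4) by simp_all
  note hom = ring_hom_mult[OF E(3)] ring_hom_add[OF E(3)] generic_elem_closed type_base_change_closed elems
  show ?comm
    using arg_cong[OF type_mult_comm[OF type_hom_mconst, of ?u ?v], of "base_change_map E"] by (simp only: hom)
  show ?assoc
    using arg_cong[OF type_mult_assoc[OF type_hom_mconst, of ?u ?v ?w], of "base_change_map E"] by (simp only: hom)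
  show ?distrib
    using arg_cong[OF type_mult_distrib[OF type_hom_mconst, of ?u ?v ?w], of "base_change_map E"] by (simp only: hom)
qed

lemma pure_closed: "r \<in> carrier R \<Longrightarrow> pure R \<iota> r d \<in> carrier RD"
  using iota_closed by (auto simp: pure_def base_change_sel)

lemma pure_mult:
  assumes "r \<in> carrier R" "s \<in> carrier R"
  shows "pure R \<iota> r d \<otimes>\<^bsub>RD\<^esub> pure R \<iota> s d' = pure R \<iota> (r \<otimes>\<^bsub>R\<^esub> s) (d * d')"
proof -
  have "(\<lambda>i\<in>I\<^sub>\<D>. if a = 0 then r else s) \<in> carrier RD" for a :: nat using assms by (auto simp: base_change_sel)
  from specialise[of "\<lambda>a. \<lambda>i\<in>I\<^sub>\<D>. if a = 0 then r else s", OF this]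
  obtain E where E: "E \<in> ring_hom ring_of_type_algebra R"
    "\<And>a i. i \<in> I\<^sub>\<D> \<Longrightarrow> E (mvar (a, i)) = (\<lambda>i\<in>I\<^sub>\<D>. if a = 0 then r else s) i"
    "base_change_map E \<in> ring_hom (type_base_change mconst) RD"
    "\<And>a. base_change_map E (generic_elem a) = (\<lambda>i\<in>I\<^sub>\<D>. if a = 0 then r else s)"
    "\<And>r d. base_change_map E (pure ring_of_type_algebra mconst r d) = pure R \<iota> (E r) d" by blast
  let ?r = "mvar (0, 0) :: (nat \<times> nat, 'k) mpol" and ?s = "mvar (1, 0) :: (nat \<times> nat, 'k) mpol"
  have vars_eq: "E ?r = r" "E ?s = s" using E(2)[of 0] by simp_all
  then have "E (?r * ?s) = r \<otimes>\<^bsub>R\<^esub> s" using ring_hom_mult[OF E(1), of ?r ?s] by simp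
  then show ?thesis
    using arg_cong[OF type_pure_mult[OF type_hom_mconst, of ?r d ?s d'], of "base_change_map E"]
    by (simp only: ring_hom_mult[OF E(3)] type_base_change_closed E(5) vars_eq)
qed

lemma pure_1_mult:
  assumes "r \<in> carrier R" and u: "u \<in> carrier RD"
  shows "pure R \<iota> r 1 \<otimes>\<^bsub>RD\<^esub> u = (\<lambda>m\<in>I\<^sub>\<D>. r \<otimes>\<^bsub>R\<^esub> u m)"
proof -
  have "(if a = 0 then u else (\<lambda>i\<in>I\<^sub>\<D>. r)) \<in> carrier RD" for a :: nat
    using assms by (auto simp: base_change_sel)
  from specialise[of "\<lambda>a. if a = 0 then u else (\<lambda>i\<in>I\<^sub>\<D>. r)", OF this]
  obtain E where E: "E \<in> ring_hom ring_of_type_algebra R"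
    "\<And>a i. i \<in> I\<^sub>\<D> \<Longrightarrow> E (mvar (a, i)) = (if a = 0 then u else (\<lambda>i\<in>I\<^sub>\<D>. r)) i"
    "base_change_map E \<in> ring_hom (type_base_change mconst) RD"
    "\<And>a. base_change_map E (generic_elem a) = (if a = 0 then u else (\<lambda>i\<in>I\<^sub>\<D>. r))"
    "\<And>r d. base_change_map E (pure ring_of_type_algebra mconst r d) = pure R \<iota> (E r) d" by blast
  let ?r = "mvar (1, 0) :: (nat \<times> nat, 'k) mpol"
  have "pure R \<iota> r 1 \<otimes>\<^bsub>RD\<^esub> u =
      base_change_map E (pure ring_of_type_algebra mconst ?r 1 \<otimes>\<^bsub>type_base_change mconst\<^esub> generic_elem 0)"
    using E(2)[of 0 1] by (simp add: ring_hom_mult[OF E(3)] type_base_change_closed generic_elem_closed E(4,5))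
  also have "\<dots> = (\<lambda>m\<in>I\<^sub>\<D>. E (?r * mvar (0, m)))"
    by (auto simp: type_pure_1_mult[OF type_hom_mconst] base_change_map_def generic_elem_def restrict_def fun_eq_iff)
  also have "\<dots> = (\<lambda>m\<in>I\<^sub>\<D>. r \<otimes>\<^bsub>R\<^esub> u m)"
    using E(2)[of 0 1] E(2)[of _ 0] ring_hom_mult[OF E(1), of ?r] by (intro restrict_ext) simp
  finally show ?thesis .
qed

lemma pure_one: "pure R \<iota> \<one>\<^bsub>R\<^esub> 1 = \<one>\<^bsub>RD\<^esub>"
  using iota_closed by (auto simp: pure_def base_change_sel restrict_def fun_eq_iff)

lemma cring_base_change: "cring RD"
proof (rule cringI)
  show "abelian_group RD"
  proof (rule abelian_groupI)
    fix u assume u: "u \<in> carrier RD"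
    show "\<exists>v\<in>carrier RD. v \<oplus>\<^bsub>RD\<^esub> u = \<zero>\<^bsub>RD\<^esub>"
      using u by (intro bexI[of _ "\<lambda>m\<in>I\<^sub>\<D>. \<ominus>\<^bsub>R\<^esub> u m"])
        (auto simp: base_change_sel PiE_iff R.l_neg restrict_def fun_eq_iff extensional_def)
    show "\<zero>\<^bsub>RD\<^esub> \<oplus>\<^bsub>RD\<^esub> u = u"
      using u by (auto simp: base_change_sel PiE_iff restrict_def fun_eq_iff extensional_def)
  qed (auto simp: base_change_sel PiE_iff R.a_ac restrict_def fun_eq_iff extensional_def)
  show "Group.comm_monoid RD"
  proof (rule comm_monoidI)
    show "\<one>\<^bsub>RD\<^esub> \<in> carrier RD" using iota_closed by (auto simp: base_change_sel)
    fix u assume u: "u \<in> carrier RD"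
    then have "\<one>\<^bsub>RD\<^esub> \<otimes>\<^bsub>RD\<^esub> u = (\<lambda>m\<in>I\<^sub>\<D>. \<one>\<^bsub>R\<^esub> \<otimes>\<^bsub>R\<^esub> u m)"
      unfolding pure_one[symmetric] by (rule pure_1_mult[OF R.one_closed])
    also have "\<dots> = u"
      using u by (auto simp: base_change_sel PiE_iff restrict_def fun_eq_iff extensional_def)
    finally show "\<one>\<^bsub>RD\<^esub> \<otimes>\<^bsub>RD\<^esub> u = u" .
  qed (blast intro: base_change_mult_closed base_change_mult_laws)+
qed (fact base_change_mult_laws)

interpretation RD: cring RD by (rule cring_base_change)

lemma pure_pow: "r \<in> carrier R \<Longrightarrow> pure R \<iota> r d [^]\<^bsub>RD\<^esub> (n::nat) = pure R \<iota> (r [^]\<^bsub>R\<^esub> n) (d ^ n)"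
proof (induction n)
  case (Suc n)
  then show ?case
    unfolding RD.nat_pow_Suc R.nat_pow_Suc power_Suc2 by (simp only: pure_mult R.nat_pow_closed)
qed (simp add: pure_one)

lemma pure_0: "r \<in> carrier R \<Longrightarrow> pure R \<iota> r 0 = \<zero>\<^bsub>RD\<^esub>"
  by (auto simp: pure_def base_change_sel coord_0 iota_0)

lemma zero_base_changeI: "u \<in> carrier RD \<Longrightarrow> (\<And>j. j \<in> I\<^sub>\<D> \<Longrightarrow> u j = \<zero>\<^bsub>R\<^esub>) \<Longrightarrow> u = \<zero>\<^bsub>RD\<^esub>"
  by (rule base_change_eqI[OF _ RD.zero_closed]) (auto simp: base_change_sel)

lemma base_change_residue_hom: "(\<lambda>u. u 0) \<in> ring_hom RD R"
proof (rule ring_hom_memI)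
  fix u v assume uv: "u \<in> carrier RD" "v \<in> carrier RD"
  then have closed: "u i \<in> carrier R" "v i \<in> carrier R" if "i \<in> I\<^sub>\<D>" for i
    using that base_change_component by blast+
  show "u 0 \<in> carrier R" using closed by simp
  show "(u \<oplus>\<^bsub>RD\<^esub> v) 0 = u 0 \<oplus>\<^bsub>R\<^esub> v 0" by (simp add: base_change_sel)
  have "(\<Oplus>\<^bsub>R\<^esub>j\<in>I\<^sub>\<D>. \<iota> (struct_const i j 0) \<otimes>\<^bsub>R\<^esub> (u i \<otimes>\<^bsub>R\<^esub> v j)) = (if 0 = i then u 0 \<otimes>\<^bsub>R\<^esub> v 0 else \<zero>\<^bsub>R\<^esub>)"
    if i: "i \<in> I\<^sub>\<D>" for i
  proof -
    have "(\<Oplus>\<^bsub>R\<^esub>j\<in>I\<^sub>\<D>. \<iota> (struct_const i j 0) \<otimes>\<^bsub>R\<^esub> (u i \<otimes>\<^bsub>R\<^esub> v j)) =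
        (\<Oplus>\<^bsub>R\<^esub>j\<in>I\<^sub>\<D>. if 0 = j then if 0 = i then u i \<otimes>\<^bsub>R\<^esub> v j else \<zero>\<^bsub>R\<^esub> else \<zero>\<^bsub>R\<^esub>)"
      using closed i by (intro R.finsum_cong') (auto simp: struct_const_0 iota_0 iota_1)
    also have "\<dots> = (if 0 = i then u i \<otimes>\<^bsub>R\<^esub> v 0 else \<zero>\<^bsub>R\<^esub>)" using closed i by (subst R.finsum_singleton) auto
    finally show ?thesis by auto
  qed
  then have "(\<Oplus>\<^bsub>R\<^esub>i\<in>I\<^sub>\<D>. \<Oplus>\<^bsub>R\<^esub>j\<in>I\<^sub>\<D>. \<iota> (struct_const i j 0) \<otimes>\<^bsub>R\<^esub> (u i \<otimes>\<^bsub>R\<^esub> v j)) =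
      (\<Oplus>\<^bsub>R\<^esub>i\<in>I\<^sub>\<D>. if 0 = i then u 0 \<otimes>\<^bsub>R\<^esub> v 0 else \<zero>\<^bsub>R\<^esub>)"
    using closed by (intro R.finsum_cong') auto
  also have "\<dots> = u 0 \<otimes>\<^bsub>R\<^esub> v 0" using closed by (subst R.finsum_singleton[where f = "\<lambda>_. u 0 \<otimes>\<^bsub>R\<^esub> v 0"]) auto
  finally show "(u \<otimes>\<^bsub>RD\<^esub> v) 0 = u 0 \<otimes>\<^bsub>R\<^esub> v 0" by (simp add: base_change_sel)
qed (auto simp: base_change_sel coord_one_0 iota_1)

lemma base_change_finsum_component:
  assumes "finite A" "f \<in> A \<rightarrow> carrier RD" "m \<in> I\<^sub>\<D>"
  shows "(\<Oplus>\<^bsub>RD\<^esub>a\<in>A. f a) m = (\<Oplus>\<^bsub>R\<^esub>a\<in>A. f a m)"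
  using assms(1,2)
proof (induction A rule: finite_induct)
  case empty
  then show ?case using assms(3) by (simp add: base_change_sel)
next
  case (insert a A)
  then have "f a m \<in> carrier R" "(\<lambda>a. f a m) \<in> A \<rightarrow> carrier R"
    using base_change_component[OF _ assms(3)] by (auto simp: Pi_iff)
  with insert assms(3) show ?case by (simp add: base_change_sel(5))
qed

lemma base_change_expand:
  assumes u: "u \<in> carrier RD"
  shows "u = (\<Oplus>\<^bsub>RD\<^esub>j\<in>I\<^sub>\<D>. pure R \<iota> (u j) (eps \<D> j))"
proof (rule base_change_eqI[OF u])
  have closed: "(\<lambda>j. pure R \<iota> (u j) (eps \<D> j)) \<in> I\<^sub>\<D> \<rightarrow> carrier RD"
    using base_change_component[OF u] pure_closed by auto
  then show "(\<Oplus>\<^bsub>RD\<^esub>j\<in>I\<^sub>\<D>. pure R \<iota> (u j) (eps \<D> j)) \<in> carrier RD" by (rule RD.finsum_closed)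
  fix m assume m: "m \<in> I\<^sub>\<D>"
  have "(\<Oplus>\<^bsub>RD\<^esub>j\<in>I\<^sub>\<D>. pure R \<iota> (u j) (eps \<D> j)) m = (\<Oplus>\<^bsub>R\<^esub>j\<in>I\<^sub>\<D>. if m = j then u j else \<zero>\<^bsub>R\<^esub>)"
    unfolding base_change_finsum_component[OF finite_atMost closed m]
    using m base_change_component[OF u] by (intro R.finsum_cong') (auto simp: pure_def coord_eps iota_0 iota_1)
  also have "\<dots> = u m" using m base_change_component[OF u] by (subst R.finsum_singleton) auto
  finally show "u m = (\<Oplus>\<^bsub>RD\<^esub>j\<in>I\<^sub>\<D>. pure R \<iota> (u j) (eps \<D> j)) m" ..
qed

end

lemma maximalideal_resid_kernel: "maximalideal {x. resid \<D> x = 0} ring_of_type_algebra"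
proof -
  let ?D = "ring_of_type_algebra :: 'd ring" and ?M = "{x. resid \<D> x = 0}"
  have "ring_hom_ring ?D (ring_of_type_algebra :: 'k ring) (resid \<D>)"
    by (intro ring_hom_ringI2 ring_from_type_algebra resid_hom)
  from ring_hom_ring.kernel_is_ideal[OF this] have ideal: "ideal ?M ?D" by (simp add: a_kernel_def')
  show ?thesis
  proof (rule maximalidealI[OF ideal])
    show "carrier ?D \<noteq> ?M" using type_homD(2)[OF resid_hom] by (auto simp: set_eq_iff intro!: exI[of _ 1])
    fix J assume J: "ideal J ?D" "?M \<subseteq> J"
    interpret J: ideal J ?D by fact
    have "1 \<in> J" if y: "y \<in> J" "y \<notin> ?M" for y
    proof -
      let ?z = "smul \<D> (inverse (resid \<D> y)) 1 * y"
      have "1 - ?z \<in> J" using y J by (auto simp: type_homD[OF resid_hom] resid_smul)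
      moreover have "?z \<in> J" using J.I_l_closed[OF y(1)] by simp
      ultimately show ?thesis using additive_subgroup.a_closed[OF J.additive_subgroup_axioms, of "1 - ?z" ?z] by simp
    qed
    then show "J = ?M \<or> J = carrier ?D" using J(2) J.one_imp_carrier by auto
  qed
qed

lemma unit_of_resid_nonzero:
  assumes "resid \<D> y \<noteq> 0"
  obtains z where "y * z = 1"
proof -
  interpret D: cring "ring_of_type_algebra :: 'd ring" by (rule cring_from_type_algebra)
  have "y \<in> Units ring_of_type_algebra"
  proof (rule ccontr)
    assume "y \<notin> Units ring_of_type_algebra"
    from D.one_notin_principal_ideal[OF _ this] D.exists_maximal_ideal[OF D.cgenideal_ideal]
    obtain M where M: "maximalideal M ring_of_type_algebra" "PIdl\<^bsub>ring_of_type_algebra\<^esub> y \<subseteq> M" by auto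
    moreover have "\<exists>!M. maximalideal M (ring_of_type_algebra :: 'd ring)"
      using finite_local_algebra by (simp add: finite_local_algebra_def)
    ultimately have "M = {x. resid \<D> x = 0}" using maximalideal_resid_kernel by blast
    then show False using M(2) D.cgenideal_self[of y] assms by auto
  qed
  then show ?thesis using that by (auto simp: Units_def)
qed

text \<open>The ideals \<open>x\<^sup>i \<D>\<close> become stationary, so \<open>x\<^sup>i = x\<^bsup>i+1\<^esup> d\<close> for some \<open>i\<close> and \<open>d\<close>, and \<open>1 - x d\<close> is a unit.\<close>

lemma nilpotent_of_resid_0:
  assumes "resid \<D> x = 0"
  shows "\<exists>n. x ^ n = 0"
proof -
  define V where "V i = range (\<lambda>d. x ^ i * d)" for i :: nat
  have subspace: "vs.subspace (V i)" for i
  proof (rule vs.subspaceI)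
    show "0 \<in> V i" unfolding V_def by (rule range_eqI[of _ _ 0]) simp
    show "a + b \<in> V i" if "a \<in> V i" "b \<in> V i" for a b
      using that unfolding V_def by (auto simp flip: distrib_left)
    show "smul \<D> r a \<in> V i" if "a \<in> V i" for r a
      using that unfolding V_def by (auto simp: smul_mult_right)
  qed
  have decreasing: "V (Suc i) \<subseteq> V i" for i
    by (auto simp: V_def mult.assoc mult.left_commute[of x])
  obtain i where "\<And>j. vs.dim (V i) \<le> vs.dim (V j)"
    using ex_has_least_nat[of "\<lambda>_. True" 0 "\<lambda>i. vs.dim (V i)"] by blast
  then have "V (Suc i) = V i"
    using vs.subspace_dim_equal[OF subspace subspace decreasing] by blast
  moreover have "x ^ i \<in> V i" unfolding V_def by (rule range_eqI[of _ _ 1]) simp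
  ultimately obtain d where d: "x ^ i = x ^ Suc i * d" by (auto simp: V_def)
  have "resid \<D> (1 - x * d) \<noteq> 0" using assms by (simp add: type_homD[OF resid_hom])
  then obtain z where z: "(1 - x * d) * z = 1" by (rule unit_of_resid_nonzero)
  have "x ^ i * (1 - x * d) = x ^ i - x ^ Suc i * d" by (simp add: right_diff_distrib mult.assoc power_Suc2)
  also have "\<dots> = 0" by (simp only: d[symmetric] diff_self)
  finally have "x ^ i * ((1 - x * d) * z) = 0" by (simp only: mult.assoc[symmetric] mult_zero_left)
  then have "x ^ i = 0" by (simp only: z mult_1_right)
  then show ?thesis ..
qed

context
  fixes R :: "'r ring" and \<iota> :: "'k \<Rightarrow> 'r"
  assumes R: "cring R" and \<iota>: "\<iota> \<in> ring_hom ring_of_type_algebra R"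
begin

interpretation R: cring R by (rule R)
interpretation RD: cring "base_change \<D> R \<iota>" by (rule cring_base_change[OF R \<iota>])

lemma base_change_nilpotent:
  assumes u: "u \<in> carrier (base_change \<D> R \<iota>)" "u 0 = \<zero>\<^bsub>R\<^esub>"
  shows "RD.nilpotent u"
proof (rule RD.nilpotentI[OF u(1)])
  fix P assume P: "primeideal P (base_change \<D> R \<iota>)"
  interpret P: primeideal P "base_change \<D> R \<iota>" by fact
  have pure_in: "pure R \<iota> (u j) (eps \<D> j) \<in> P" if j: "j \<in> I\<^sub>\<D>" for j
  proof (cases "j = 0")
    case True
    with u(2) have "pure R \<iota> (u j) (eps \<D> j) = \<zero>\<^bsub>base_change \<D> R \<iota>\<^esub>"
      by (simp add: pure_def base_change_sel(4) iota_closed[OF R \<iota>])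
    then show ?thesis using P.zero_closed by simp
  next
    case False
    then obtain n where "eps \<D> j ^ n = 0" using nilpotent_of_resid_0 resid_eps(2) j by blast
    then have "pure R \<iota> (u j) (eps \<D> j) [^]\<^bsub>base_change \<D> R \<iota>\<^esub> n = \<zero>\<^bsub>base_change \<D> R \<iota>\<^esub>"
      using base_change_component[OF u(1) j] by (simp add: pure_pow[OF R \<iota>] pure_0[OF R \<iota>])
    then have "RD.nilpotent (pure R \<iota> (u j) (eps \<D> j))"
      using pure_closed[OF R \<iota> base_change_component[OF u(1) j]] by (auto simp: RD.nilpotent_def)
    then show ?thesis using P by (rule RD.nilpotent_in_prime)
  qed
  have "(\<Oplus>\<^bsub>base_change \<D> R \<iota>\<^esub>j\<in>A. pure R \<iota> (u j) (eps \<D> j)) \<in> P" if "finite A" "A \<subseteq> I\<^sub>\<D>" for A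
    using that
  proof (induction A rule: finite_induct)
    case (insert j A)
    then have "(\<lambda>j. pure R \<iota> (u j) (eps \<D> j)) \<in> insert j A \<rightarrow> carrier (base_change \<D> R \<iota>)"
      using pure_in P.a_Hcarr by blast
    with insert show ?case using pure_in P.a_closed by simp
  qed (simp add: P.zero_closed)
  from this[of "I\<^sub>\<D>"] show "u \<in> P" using base_change_expand[OF R \<iota> u(1)] by simp
qed

lemma base_change_unit:
  assumes u: "u \<in> carrier (base_change \<D> R \<iota>)" "u 0 \<in> Units R"
  shows "u \<in> Units (base_change \<D> R \<iota>)"
proof -
  let ?T = "base_change \<D> R \<iota>"
  have closed: "u 0 \<in> carrier R" "inv\<^bsub>R\<^esub> u 0 \<in> carrier R" using u by auto
  define s where "s = pure R \<iota> (u 0) 1"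
  have s: "s \<in> carrier ?T" "pure R \<iota> (inv\<^bsub>R\<^esub> u 0) 1 \<in> carrier ?T"
    unfolding s_def using closed by (auto intro: pure_closed[OF R \<iota>])
  have "s \<otimes>\<^bsub>?T\<^esub> pure R \<iota> (inv\<^bsub>R\<^esub> u 0) 1 = \<one>\<^bsub>?T\<^esub>"
    unfolding s_def using u closed by (simp add: pure_mult[OF R \<iota>] pure_one[OF R \<iota>])
  then have unit: "s \<in> Units ?T" using RD.m_comm[OF s] s unfolding Units_def by auto
  define e where "e = \<ominus>\<^bsub>?T\<^esub> s \<oplus>\<^bsub>?T\<^esub> u"
  have e: "e \<in> carrier ?T" using u s by (simp add: e_def)
  have u_eq: "u = s \<oplus>\<^bsub>?T\<^esub> e"
    using u(1) s(1) by (simp add: e_def RD.r_neg flip: RD.a_assoc)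
  have "s 0 = u 0" using closed by (simp add: s_def pure_def coord_one_0 iota_1[OF R \<iota>])
  then have "u 0 = u 0 \<oplus>\<^bsub>R\<^esub> e 0"
    using arg_cong[OF u_eq, of "\<lambda>u. u 0"] by (simp add: base_change_sel(5))
  then have "e 0 = \<zero>\<^bsub>R\<^esub>"
    using closed base_change_component[OF e, of 0] by (metis R.add.l_cancel_one' atMost_iff zero_le)
  then have "RD.nilpotent e" by (rule base_change_nilpotent[OF e])
  from RD.unit_add_nilpotent[OF unit this RD.one_closed] show ?thesis
    using e u_eq by simp
qed

end

end

section \<open>Vanishing ideals over rings\<close>

lemma mp_eval_in_subst:
  fixes s :: "'v \<Rightarrow> ('w, 'a::comm_ring_1) mpol"
  assumes R: "cring R" and hom: "c \<in> ring_hom ring_of_type_algebra R" and x: "x \<in> M \<rightarrow> carrier R"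
    and s: "s \<in> N \<rightarrow> mpols M" and f: "f \<in> mpols N"
  shows "mp_eval_in R c x (mp_eval mconst s f) = mp_eval_in R c (\<lambda>v. mp_eval_in R c x (s v)) f"
proof -
  interpret X: mp_evaluation R c x M by (rule mp_evaluationI[OF R hom x])
  have "mp_evaluation (mpol_ring M) mconst s N" using s by (intro mp_evaluationI cring_mpol_ring) auto
  from mp_eval_in_compose_hom[OF this R X.ev_hom f] show ?thesis
    using mp_eval_mpol_ring[OF f s] by (simp add: comp_def)
qed

definition vanishing_ideal_in ::
    "'r ring \<Rightarrow> ('a::comm_ring_1 \<Rightarrow> 'r) \<Rightarrow> 'v set \<Rightarrow> ('v \<Rightarrow> 'r) \<Rightarrow> ('v, 'a) mpol set" where
  "vanishing_ideal_in R c N x = {f \<in> mpols N. mp_eval_in R c x f = \<zero>\<^bsub>R\<^esub>}"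

lemma ideal_vanishing_ideal_in:
  assumes "cring R" "c \<in> ring_hom ring_of_type_algebra R" "x \<in> N \<rightarrow> carrier R"
  shows "ideal (vanishing_ideal_in R c N x) (mpol_ring N)"
proof -
  interpret mp_evaluation R c x N by (rule mp_evaluationI[OF assms])
  show ?thesis
    by (rule ideal_mpolI) (auto simp: vanishing_ideal_in_def ev_add ev_mult ev_closed mpols_add mpols_mult)
qed

lemma primeideal_vanishing_ideal_in:
  assumes R: "domain R" and "c \<in> ring_hom ring_of_type_algebra R" "x \<in> N \<rightarrow> carrier R"
  shows "primeideal (vanishing_ideal_in R c N x) (mpol_ring N)"
proof -
  interpret R: domain R by fact
  interpret mp_evaluation R c x N by (rule mp_evaluationI[OF R.is_cring assms(2,3)])
  show ?thesis
  proof (rule primeideal_mpolI)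
    show "ideal (vanishing_ideal_in R c N x) (mpol_ring N)"
      by (rule ideal_vanishing_ideal_in[OF R.is_cring assms(2,3)])
    fix f g assume "f \<in> mpols N" "g \<in> mpols N" "f * g \<in> vanishing_ideal_in R c N x"
    then show "f \<in> vanishing_ideal_in R c N x \<or> g \<in> vanishing_ideal_in R c N x"
      using R.integral[of "ev f" "ev g"] by (auto simp: vanishing_ideal_in_def ev_mult ev_closed)
  qed (simp add: vanishing_ideal_in_def)
qed

section \<open>\<open>\<D>\<close>-algebras and prolongations\<close>

locale base_D_field = local_algebra \<D> for \<D> :: "('k::field_char_0, 'd::comm_ring_1) based_algebra" +
  fixes \<iota> :: "'k \<Rightarrow> 'a::field_char_0" and \<Delta> :: "'a \<Rightarrow> nat \<Rightarrow> 'a"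
  assumes D_field: "D_field \<D> ring_of_type_algebra \<iota> \<Delta>"
begin

lemma iota_hom: "type_hom \<iota>"
  and Delta_hom: "\<Delta> \<in> ring_hom ring_of_type_algebra (base_change \<D> ring_of_type_algebra \<iota>)"
  and Delta_linear: "\<Delta> (\<iota> a * r) = (\<lambda>j\<in>I\<^sub>\<D>. \<iota> a * \<Delta> r j)"
  using D_field by (auto simp: D_field_def D_ring_def)

lemma resid_sum:
  fixes R :: "'r ring"
  assumes R: "cring R" and \<kappa>: "\<kappa> \<in> ring_hom ring_of_type_algebra R" and u: "\<And>j. j \<in> I\<^sub>\<D> \<Longrightarrow> u j \<in> carrier R"
  shows "(\<Oplus>\<^bsub>R\<^esub>j\<in>I\<^sub>\<D>. u j \<otimes>\<^bsub>R\<^esub> \<kappa> (resid \<D> (eps \<D> j))) = u 0"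
proof -
  interpret R: cring R by fact
  have "(\<Oplus>\<^bsub>R\<^esub>j\<in>I\<^sub>\<D>. u j \<otimes>\<^bsub>R\<^esub> \<kappa> (resid \<D> (eps \<D> j))) = (\<Oplus>\<^bsub>R\<^esub>j\<in>I\<^sub>\<D>. if 0 = j then u j else \<zero>\<^bsub>R\<^esub>)"
    using u resid_eps iota_0[OF R \<kappa>] iota_1[OF R \<kappa>] by (intro R.finsum_cong') auto
  also have "\<dots> = u 0" using u by (subst R.finsum_singleton) auto
  finally show ?thesis .
qed

lemma Delta_0: "\<Delta> r 0 = r"
proof -
  have "(\<Oplus>\<^bsub>ring_of_type_algebra\<^esub>j\<in>I\<^sub>\<D>. \<Delta> r j \<otimes>\<^bsub>ring_of_type_algebra\<^esub> \<iota> (resid \<D> (eps \<D> j))) = r"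
    using D_field by (auto simp: D_field_def D_ring_def)
  then show ?thesis
    using resid_sum[OF cring_from_type_algebra iota_hom, of "\<Delta> r"] by simp
qed

definition twist :: "('a \<Rightarrow> 'r) \<Rightarrow> 'a \<Rightarrow> nat \<Rightarrow> 'r" where
  "twist c a = base_change_map c (\<Delta> a)"

lemma twist_apply: "j \<in> I\<^sub>\<D> \<Longrightarrow> twist c a j = c (\<Delta> a j)"
  by (simp add: twist_def base_change_map_def)

lemma twist_0: "twist c a 0 = c a"
  by (simp add: twist_apply Delta_0)

lemma comp_iota_hom:
  "c \<in> ring_hom ring_of_type_algebra R \<Longrightarrow> c \<circ> \<iota> \<in> ring_hom ring_of_type_algebra R"
  using iota_hom by (auto simp: ring_hom_def)

lemma twist_hom:
  assumes R: "cring R" and hom: "c \<in> ring_hom ring_of_type_algebra R"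
  shows "twist c \<in> ring_hom ring_of_type_algebra (base_change \<D> R (c \<circ> \<iota>))"
proof -
  have "base_change_map c \<in> ring_hom (base_change \<D> ring_of_type_algebra \<iota>) (base_change \<D> R (c \<circ> \<iota>))"
    by (rule base_change_map_hom[OF cring_from_type_algebra R hom iota_hom refl])
  with Delta_hom have "base_change_map c \<circ> \<Delta> \<in> ring_hom ring_of_type_algebra (base_change \<D> R (c \<circ> \<iota>))"
    by (rule ring_hom_trans)
  then show ?thesis by (simp add: twist_def[abs_def] comp_def)
qed

lemma base_change_map_twist: "base_change_map h (twist c a) = twist (h \<circ> c) a"
  by (auto simp: twist_def base_change_map_def restrict_def fun_eq_iff)

lemma twist_iota:
  fixes R :: "'r ring"
  assumes R: "cring R" and hom: "c \<in> ring_hom ring_of_type_algebra R"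
  shows "twist c (\<iota> a) = pure R (c \<circ> \<iota>) (c (\<iota> a)) 1"
proof -
  interpret R: cring R by fact
  have c_closed: "c x \<in> carrier R" for x using hom by (auto simp: ring_hom_def)
  have c_mult: "c (x * y) = c x \<otimes>\<^bsub>R\<^esub> c y" for x y using ring_hom_mult[OF hom, of x y] by simp
  have "\<Delta> 1 = (\<lambda>m\<in>I\<^sub>\<D>. \<iota> (coord \<D> 1 m))"
    using ring_hom_one[OF Delta_hom] by (simp add: base_change_sel)
  then have "\<Delta> (\<iota> a) = (\<lambda>m\<in>I\<^sub>\<D>. \<iota> a * (\<lambda>m\<in>I\<^sub>\<D>. \<iota> (coord \<D> 1 m)) m)"
    using Delta_linear[of a 1] by simp
  then have "c (\<Delta> (\<iota> a) m) = c (\<iota> (coord \<D> 1 m)) \<otimes>\<^bsub>R\<^esub> c (\<iota> a)" if "m \<in> I\<^sub>\<D>" for m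
    using that c_mult[of "\<iota> a" "\<iota> (coord \<D> 1 m)"] R.m_comm[OF c_closed c_closed] by simp
  then show ?thesis by (auto simp: twist_def base_change_map_def pure_def restrict_def fun_eq_iff)
qed

definition D_algebra :: "'r ring \<Rightarrow> ('a \<Rightarrow> 'r) \<Rightarrow> ('r \<Rightarrow> nat \<Rightarrow> 'r) \<Rightarrow> bool" where
  "D_algebra R c \<delta> \<longleftrightarrow> cring R \<and> c \<in> ring_hom ring_of_type_algebra R \<and>
     \<delta> \<in> ring_hom R (base_change \<D> R (c \<circ> \<iota>)) \<and> (\<forall>a. \<delta> (c a) = twist c a) \<and> (\<forall>r\<in>carrier R. \<delta> r 0 = r)"

lemma D_algebraD:
  fixes R :: "'r ring"
  assumes "D_algebra R c \<delta>"
  shows "cring R" "c \<in> ring_hom ring_of_type_algebra R" "\<delta> \<in> ring_hom R (base_change \<D> R (c \<circ> \<iota>))"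
    "\<delta> \<circ> c = twist c" "r \<in> carrier R \<Longrightarrow> \<delta> r 0 = r"
    "r \<in> carrier R \<Longrightarrow> \<delta> r \<in> carrier (base_change \<D> R (c \<circ> \<iota>))"
    "r \<in> carrier R \<Longrightarrow> j \<in> I\<^sub>\<D> \<Longrightarrow> \<delta> r j \<in> carrier R"
proof -
  show "cring R" "c \<in> ring_hom ring_of_type_algebra R" "\<delta> \<in> ring_hom R (base_change \<D> R (c \<circ> \<iota>))"
    "\<delta> \<circ> c = twist c" "r \<in> carrier R \<Longrightarrow> \<delta> r 0 = r"
    using assms by (auto simp: D_algebra_def)
  then show closed: "\<delta> r \<in> carrier (base_change \<D> R (c \<circ> \<iota>))" if "r \<in> carrier R"
    using that by (auto simp: ring_hom_def)
  show "\<delta> r j \<in> carrier R" if "r \<in> carrier R" "j \<in> I\<^sub>\<D>"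
    by (rule base_change_component[OF closed[OF that(1)] that(2)])
qed

lemma D_algebra_linear:
  fixes S :: "'s ring"
  assumes alg: "D_algebra S e \<delta>" and r: "r \<in> carrier S"
  shows "\<delta> (e (\<iota> a) \<otimes>\<^bsub>S\<^esub> r) = (\<lambda>j\<in>I\<^sub>\<D>. e (\<iota> a) \<otimes>\<^bsub>S\<^esub> \<delta> r j)"
proof -
  note S = D_algebraD(1)[OF alg] and e = D_algebraD(2)[OF alg]
  have e_closed: "e a \<in> carrier S" for a using e by (auto simp: ring_hom_def)
  have "\<delta> (e (\<iota> a)) = pure S (e \<circ> \<iota>) (e (\<iota> a)) 1"
    using twist_iota[OF S e, of a] fun_cong[OF D_algebraD(4)[OF alg], of "\<iota> a"] by simp
  then have "\<delta> (e (\<iota> a) \<otimes>\<^bsub>S\<^esub> r) = pure S (e \<circ> \<iota>) (e (\<iota> a)) 1 \<otimes>\<^bsub>base_change \<D> S (e \<circ> \<iota>)\<^esub> \<delta> r"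
    using ring_hom_mult[OF D_algebraD(3)[OF alg] e_closed r] by simp
  also have "\<dots> = (\<lambda>j\<in>I\<^sub>\<D>. e (\<iota> a) \<otimes>\<^bsub>S\<^esub> \<delta> r j)"
    by (rule pure_1_mult[OF S comp_iota_hom[OF e] e_closed D_algebraD(6)[OF alg r]])
  finally show ?thesis .
qed

lemma D_field_extension_iff:
  fixes S :: "'s ring"
  shows "D_field_extension \<D> ring_of_type_algebra \<iota> \<Delta> S \<delta> e \<longleftrightarrow> field S \<and> D_algebra S e \<delta>"
proof
  assume ext: "D_field_extension \<D> ring_of_type_algebra \<iota> \<Delta> S \<delta> e"
  then have S: "field S" and e: "e \<in> ring_hom ring_of_type_algebra S" and ring: "D_ring \<D> S (e \<circ> \<iota>) \<delta>"
    and extends: "\<And>r j. j \<in> I\<^sub>\<D> \<Longrightarrow> \<delta> (e r) j = e (\<Delta> r j)"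
    by (auto simp: D_field_extension_def D_field_def)
  have closed: "\<delta> r \<in> carrier (base_change \<D> S (e \<circ> \<iota>))" if "r \<in> carrier S" for r
    using ring that by (auto simp: D_ring_def ring_hom_def)
  have "\<delta> (e a) = twist e a" for a
  proof (rule base_change_eqI[OF closed])
    show "twist e a \<in> carrier (base_change \<D> S (e \<circ> \<iota>))"
      using twist_hom[OF fieldE(1)[OF S] e] by (auto simp: ring_hom_def)
  qed (use e extends in \<open>auto simp: ring_hom_def twist_apply\<close>)
  moreover have "\<delta> r 0 = r" if "r \<in> carrier S" for r
    using ring that resid_sum[OF fieldE(1)[OF S] comp_iota_hom[OF e], of "\<delta> r"] base_change_component[OF closed[OF that]]
    by (auto simp: D_ring_def)
  ultimately show "field S \<and> D_algebra S e \<delta>" using S e ring by (auto simp: D_algebra_def D_ring_def)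
next
  assume "field S \<and> D_algebra S e \<delta>"
  then have S: "field S" and alg: "D_algebra S e \<delta>" by auto
  note e = D_algebraD(2)[OF alg]
  have "D_ring \<D> S (e \<circ> \<iota>) \<delta>"
    using D_algebraD[OF alg] D_algebra_linear[OF alg] comp_iota_hom[OF e] resid_sum[OF D_algebraD(1)[OF alg] comp_iota_hom[OF e]]
    by (auto simp: D_ring_def)
  moreover have "\<delta> (e r) j = e (\<Delta> r j)" if "j \<in> I\<^sub>\<D>" for r j
    using fun_cong[OF D_algebraD(4)[OF alg], of r] twist_apply[OF that, of e r] by simp
  ultimately show "D_field_extension \<D> ring_of_type_algebra \<iota> \<Delta> S \<delta> e"
    unfolding D_field_extension_def D_field_def[of \<D> S] using S D_field e by auto
qed

lemma D_algebra_image: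
  fixes h :: "'r \<Rightarrow> 's"
  assumes alg: "D_algebra R c \<delta>" and inj: "inj_on h (carrier R)"
  shows "D_algebra (image_ring h R) (h \<circ> c) (\<lambda>x. base_change_map h (\<delta> (inv_into (carrier R) h x)))"
proof -
  interpret R: cring R by (rule D_algebraD(1)[OF alg])
  have iso: "h \<in> ring_iso R (image_ring h R)" by (rule inj_imp_image_ring_iso[OF inj])
  then have h: "h \<in> ring_hom R (image_ring h R)" by (simp add: ring_iso_def)
  have inv: "inv_into (carrier R) h \<in> ring_hom (image_ring h R) R"
    using ring_iso_set_sym[OF R.ring_axioms iso] by (simp add: ring_iso_def)
  have carrier: "carrier (image_ring h R) = h ` carrier R" by (simp add: image_ring_carrier)
  have inv_h: "inv_into (carrier R) h (h r) = r" if "r \<in> carrier R" for r by (rule inv_into_f_f[OF inj that])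
  have S: "cring (image_ring h R)"
    using R.ring_iso_imp_img_cring[OF iso] by (simp add: image_ring_def image_group_def monoid.defs)
  have hc: "h \<circ> c \<in> ring_hom ring_of_type_algebra (image_ring h R)" by (rule ring_hom_trans[OF D_algebraD(2)[OF alg] h])
  have "base_change_map h \<in> ring_hom (base_change \<D> R (c \<circ> \<iota>)) (base_change \<D> (image_ring h R) ((h \<circ> c) \<circ> \<iota>))"
    by (rule base_change_map_hom[OF R.is_cring S h comp_iota_hom[OF D_algebraD(2)[OF alg]]]) (simp add: comp_assoc)
  from ring_hom_trans[OF ring_hom_trans[OF inv D_algebraD(3)[OF alg]] this]
  have "(\<lambda>x. base_change_map h (\<delta> (inv_into (carrier R) h x))) \<in>
      ring_hom (image_ring h R) (base_change \<D> (image_ring h R) ((h \<circ> c) \<circ> \<iota>))" by (simp add: comp_def)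
  moreover have "c a \<in> carrier R" for a using D_algebraD(2)[OF alg] by (auto simp: ring_hom_def)
  then have "base_change_map h (\<delta> (inv_into (carrier R) h ((h \<circ> c) a))) = twist (h \<circ> c) a" for a
    using fun_cong[OF D_algebraD(4)[OF alg], of a] by (simp add: inv_h base_change_map_twist)
  moreover have "base_change_map h (\<delta> (inv_into (carrier R) h x)) 0 = x" if "x \<in> carrier (image_ring h R)" for x
    using that D_algebraD(5)[OF alg] inv_h by (auto simp: carrier base_change_map_def)
  ultimately show ?thesis unfolding D_algebra_def using S hc by blast
qed

lemma prol_poly_eq:
  "prol_poly \<D> \<iota> \<Delta> n f =
    mp_eval_in (base_change \<D> (mpol_ring (prol_vars \<D> n)) (mconst \<circ> \<iota>)) (twist mconst) (\<lambda>i. \<lambda>j\<in>I\<^sub>\<D>. mvar (j, i)) f"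
  by (simp add: prol_poly_def mp_eval_in_def Let_def twist_def base_change_map_def)

lemma prol_evaluation:
  "mp_evaluation (base_change \<D> (mpol_ring (prol_vars \<D> n)) (mconst \<circ> \<iota>)) (twist mconst) (\<lambda>i. \<lambda>j\<in>I\<^sub>\<D>. mvar (j, i)) {..<n}"
  by (intro mp_evaluationI cring_base_change twist_hom cring_mpol_ring comp_iota_hom mconst_hom)
    (auto simp: base_change_sel prol_vars_def intro!: mpols_var split: if_splits)

lemma prol_poly_closed:
  assumes "f \<in> mpols {..<n}" "j \<in> I\<^sub>\<D>"
  shows "prol_poly \<D> \<iota> \<Delta> n f j \<in> mpols (prol_vars \<D> n)"
  using mp_evaluation.ev_closed[OF prol_evaluation assms(1)] assms(2)
  by (auto simp: prol_poly_eq base_change_sel PiE_iff)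

lemma prol_poly_eval:
  assumes R: "cring R" and hom: "c \<in> ring_hom ring_of_type_algebra R"
    and y: "y \<in> prol_vars \<D> n \<rightarrow> carrier R" and f: "f \<in> mpols {..<n}" and j: "j \<in> I\<^sub>\<D>"
  shows "mp_eval_in R c y (prol_poly \<D> \<iota> \<Delta> n f j) =
    mp_eval_in (base_change \<D> R (c \<circ> \<iota>)) (twist c) (\<lambda>i. \<lambda>j\<in>I\<^sub>\<D>. y (j, i)) f j"
proof -
  let ?M = "base_change \<D> (mpol_ring (prol_vars \<D> n)) (mconst \<circ> \<iota>)" and ?T = "base_change \<D> R (c \<circ> \<iota>)"
  interpret Y: mp_evaluation R c y "prol_vars \<D> n" by (rule mp_evaluationI[OF R hom y])
  have base_change_ev: "base_change_map Y.ev \<in> ring_hom ?M ?T"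
    by (rule base_change_map_hom[OF cring_mpol_ring R Y.ev_hom comp_iota_hom[OF mconst_hom]]) (auto simp: fun_eq_iff)
  have T: "cring ?T" by (rule cring_base_change[OF R comp_iota_hom[OF hom]])
  have comp_twist: "base_change_map Y.ev \<circ> twist mconst = twist c"
    by (auto simp: fun_eq_iff twist_def base_change_map_def restrict_def)
  have "base_change_map Y.ev (prol_poly \<D> \<iota> \<Delta> n f) = mp_eval_in ?T (twist c) (base_change_map Y.ev \<circ> (\<lambda>i. \<lambda>j\<in>I\<^sub>\<D>. mvar (j, i))) f"
    unfolding prol_poly_eq using mp_eval_in_compose_hom[OF prol_evaluation T base_change_ev f] by (simp add: comp_twist)
  also have "\<dots> = mp_eval_in ?T (twist c) (\<lambda>i. \<lambda>j\<in>I\<^sub>\<D>. y (j, i)) f"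
  proof (rule mp_eval_in_cong[OF _ f T _ twist_hom[OF R hom]])
    show "(base_change_map Y.ev \<circ> (\<lambda>i. \<lambda>j\<in>I\<^sub>\<D>. mvar (j, i))) v = (\<lambda>j\<in>I\<^sub>\<D>. y (j, v))" if "v \<in> {..<n}" for v
      using that by (auto simp: base_change_map_def restrict_def fun_eq_iff prol_vars_def)
    show "base_change_map Y.ev \<circ> (\<lambda>i. \<lambda>j\<in>I\<^sub>\<D>. mvar (j, i)) \<in> {..<n} \<rightarrow> carrier ?T"
      using y by (auto simp: base_change_map_def base_change_sel prol_vars_def Pi_iff)
  qed
  finally show ?thesis using j by (metis (no_types, lifting) base_change_map_def restrict_apply')
qed

abbreviation proj_pullback :: "(nat, 'a) mpol \<Rightarrow> (nat \<times> nat, 'a) mpol" where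
  "proj_pullback \<equiv> mp_eval mconst (\<lambda>i. mvar (0, i))"

lemma proj_pullback_closed: "f \<in> mpols {..<n} \<Longrightarrow> proj_pullback f \<in> mpols (prol_vars \<D> n)"
  by (erule mpols_subst) (auto simp: prol_vars_def intro!: mpols_var)

lemma prol_poly_0:
  assumes f: "f \<in> mpols {..<n}"
  shows "prol_poly \<D> \<iota> \<Delta> n f 0 = proj_pullback f"
proof -
  let ?M = "base_change \<D> (mpol_ring (prol_vars \<D> n)) (mconst \<circ> \<iota>)"
  have "prol_poly \<D> \<iota> \<Delta> n f 0 =
      mp_eval_in (mpol_ring (prol_vars \<D> n)) ((\<lambda>u. u 0) \<circ> twist mconst) ((\<lambda>u. u 0) \<circ> (\<lambda>i. \<lambda>j\<in>I\<^sub>\<D>. mvar (j, i))) f"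
    unfolding prol_poly_eq
    by (rule mp_eval_in_compose_hom[OF prol_evaluation cring_mpol_ring base_change_residue_hom[OF cring_mpol_ring comp_iota_hom[OF mconst_hom]] f])
  also have "(\<lambda>u. u 0) \<circ> twist mconst = (mconst :: 'a \<Rightarrow> (nat \<times> nat, 'a) mpol)"
    by (simp add: fun_eq_iff twist_0)
  also have "(\<lambda>u. u 0) \<circ> (\<lambda>i. \<lambda>j\<in>I\<^sub>\<D>. mvar (j, i)) = (\<lambda>i. mvar (0, i) :: (nat \<times> nat, 'a) mpol)"
    by (simp add: fun_eq_iff)
  also have "mp_eval_in (mpol_ring (prol_vars \<D> n)) mconst (\<lambda>i. mvar (0, i)) f = mp_eval mconst (\<lambda>i. mvar (0, i)) f"
    by (rule mp_eval_mpol_ring[OF f]) (auto simp: prol_vars_def intro!: mpols_var)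
  finally show ?thesis .
qed

lemma prol_ideal_subset_iff:
  assumes J: "ideal J (mpol_ring (prol_vars \<D> n))" and I: "I \<subseteq> mpols {..<n}"
  shows "prol_ideal \<D> \<iota> \<Delta> n I \<subseteq> J \<longleftrightarrow> (\<forall>f\<in>I. \<forall>j\<in>I\<^sub>\<D>. prol_poly \<D> \<iota> \<Delta> n f j \<in> J)"
proof -
  interpret cring "mpol_ring (prol_vars \<D> n) :: (nat \<times> nat, 'a) mpol ring" by (rule cring_mpol_ring)
  let ?G = "{prol_poly \<D> \<iota> \<Delta> n f j | f j. f \<in> I \<and> j \<in> I\<^sub>\<D>}"
  have "?G \<subseteq> carrier (mpol_ring (prol_vars \<D> n))" using I prol_poly_closed by auto
  from genideal_self[OF this] genideal_minimal[OF J, of ?G]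
  show ?thesis unfolding prol_ideal_def by blast
qed

lemma prol_ideal_eval_zero:
  fixes R :: "'r ring"
  assumes I: "ideal I (mpol_ring {..<n})"
    and R: "cring R" and hom: "c \<in> ring_hom ring_of_type_algebra R" and y: "y \<in> prol_vars \<D> n \<rightarrow> carrier R"
  shows "prol_ideal \<D> \<iota> \<Delta> n I \<subseteq> vanishing_ideal_in R c (prol_vars \<D> n) y \<longleftrightarrow>
    (\<forall>f\<in>I. \<forall>j\<in>I\<^sub>\<D>. mp_eval_in R c y (prol_poly \<D> \<iota> \<Delta> n f j) = \<zero>\<^bsub>R\<^esub>)"
  unfolding prol_ideal_subset_iff[OF ideal_vanishing_ideal_in[OF R hom y] ideal_mpolD(1)[OF I]]
  using ideal_mpolD(1)[OF I] prol_poly_closed by (auto simp: vanishing_ideal_in_def)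

text \<open>The \<open>R\<close>-rational point \<open>\<nabla>(a)\<close> of the prolongation.\<close>

definition prol_point :: "('r \<Rightarrow> nat \<Rightarrow> 'r) \<Rightarrow> (nat \<Rightarrow> 'r) \<Rightarrow> nat \<times> nat \<Rightarrow> 'r" where
  "prol_point \<delta> a = (\<lambda>(j, i). \<delta> (a i) j)"

context
  fixes R :: "'r ring" and c \<delta> and n :: nat and a
  assumes alg: "D_algebra R c \<delta>" and a: "a \<in> {..<n} \<rightarrow> carrier R"
begin

lemma prol_point_closed: "prol_point \<delta> a \<in> prol_vars \<D> n \<rightarrow> carrier R"
  using a D_algebraD(7)[OF alg] by (auto simp: prol_point_def prol_vars_def)

lemma prol_poly_prol_point:
  assumes f: "f \<in> mpols {..<n}" and j: "j \<in> I\<^sub>\<D>"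
  shows "mp_eval_in R c (prol_point \<delta> a) (prol_poly \<D> \<iota> \<Delta> n f j) = \<delta> (mp_eval_in R c a f) j"
proof -
  note R = D_algebraD(1)[OF alg] and hom = D_algebraD(2)[OF alg]
  let ?T = "base_change \<D> R (c \<circ> \<iota>)"
  have T: "cring ?T" by (rule cring_base_change[OF R comp_iota_hom[OF hom]])
  have "mp_eval_in R c (prol_point \<delta> a) (prol_poly \<D> \<iota> \<Delta> n f j) =
      mp_eval_in ?T (twist c) (\<lambda>i. \<lambda>j\<in>I\<^sub>\<D>. prol_point \<delta> a (j, i)) f j"
    by (rule prol_poly_eval[OF R hom prol_point_closed f j])
  also have "mp_eval_in ?T (twist c) (\<lambda>i. \<lambda>j\<in>I\<^sub>\<D>. prol_point \<delta> a (j, i)) f = mp_eval_in ?T (\<delta> \<circ> c) (\<delta> \<circ> a) f"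
    unfolding D_algebraD(4)[OF alg]
  proof (rule mp_eval_in_cong[symmetric, OF _ f T _ twist_hom[OF R hom]])
    show closed: "\<delta> \<circ> a \<in> {..<n} \<rightarrow> carrier ?T" using a D_algebraD(6)[OF alg] by (auto simp: Pi_iff)
    show "(\<delta> \<circ> a) i = (\<lambda>j\<in>I\<^sub>\<D>. prol_point \<delta> a (j, i))" if "i \<in> {..<n}" for i
      using funcset_mem[OF closed that]
      by (auto simp: prol_point_def base_change_sel PiE_iff restrict_def fun_eq_iff extensional_def)
  qed
  also have "\<dots> = \<delta> (mp_eval_in R c a f)"
    by (rule mp_eval_in_compose_hom[OF mp_evaluationI[OF R hom a] T D_algebraD(3)[OF alg] f, symmetric])
  finally show ?thesis .
qed

lemma prol_ideal_prol_point:
  "prol_ideal \<D> \<iota> \<Delta> n (vanishing_ideal_in R c {..<n} a) \<subseteq> vanishing_ideal_in R c (prol_vars \<D> n) (prol_point \<delta> a)"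
proof -
  note R = D_algebraD(1)[OF alg] and hom = D_algebraD(2)[OF alg]
  interpret T: cring "base_change \<D> R (c \<circ> \<iota>)" by (rule cring_base_change[OF R comp_iota_hom[OF hom]])
  have "\<delta> \<zero>\<^bsub>R\<^esub> j = \<zero>\<^bsub>R\<^esub>" if "j \<in> I\<^sub>\<D>" for j
    using Ring.ring_hom_zero[OF D_algebraD(3)[OF alg] cring.axioms(1)[OF R] T.ring_axioms] that
    by (simp add: base_change_sel)
  then show ?thesis
    unfolding prol_ideal_eval_zero[OF ideal_vanishing_ideal_in[OF R hom a] R hom prol_point_closed]
    by (auto simp: vanishing_ideal_in_def prol_poly_prol_point)
qed

lemma prol_proj_prol_point:
  "prol_proj n (vanishing_ideal_in R c (prol_vars \<D> n) (prol_point \<delta> a)) = vanishing_ideal_in R c {..<n} a"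
proof -
  note R = D_algebraD(1)[OF alg] and hom = D_algebraD(2)[OF alg]
  interpret Y: mp_evaluation R c "prol_point \<delta> a" "prol_vars \<D> n" by (rule mp_evaluationI[OF R hom prol_point_closed])
  have coordinates: "(\<lambda>i. mvar (0, i)) \<in> {..<n} \<rightarrow> (mpols (prol_vars \<D> n) :: (nat \<times> nat, 'a) mpol set)"
    by (auto simp: prol_vars_def intro!: mpols_var)
  have "Y.ev (proj_pullback f) = mp_eval_in R c a f" if f: "f \<in> mpols {..<n}" for f
  proof -
    have "a i = Y.ev (mvar (0, i))" if "i \<in> {..<n}" for i
      using that a D_algebraD(5)[OF alg, of "a i"] Y.ev_var[of "(0, i)"] by (auto simp: prol_point_def prol_vars_def Pi_iff)
    then have "mp_eval_in R c a f = mp_eval_in R c (\<lambda>i. Y.ev (mvar (0, i))) f"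
      by (rule mp_eval_in_cong[OF _ f R a hom])
    then show ?thesis using mp_eval_in_subst[OF R hom prol_point_closed coordinates f] by simp
  qed
  then show ?thesis using proj_pullback_closed by (auto simp: prol_proj_def vanishing_ideal_in_def)
qed

end

lemma prol_ideal_mpols: "I \<subseteq> mpols {..<n} \<Longrightarrow> prol_ideal \<D> \<iota> \<Delta> n I \<subseteq> mpols (prol_vars \<D> n)"
proof -
  assume I: "I \<subseteq> mpols {..<n}"
  have "ideal (mpols (prol_vars \<D> n)) (mpol_ring (prol_vars \<D> n) :: (nat \<times> nat, 'a) mpol ring)"
    by (rule ideal_mpolI) (auto intro: mpols_add mpols_mult)
  from prol_ideal_subset_iff[OF this I] show ?thesis using I prol_poly_closed by blast
qed

lemma prol_poly_in_prol_ideal: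
  assumes I: "I \<subseteq> mpols {..<n}" and f: "f \<in> I" "j \<in> I\<^sub>\<D>"
  shows "prol_poly \<D> \<iota> \<Delta> n f j \<in> prol_ideal \<D> \<iota> \<Delta> n I"
proof -
  interpret cring "mpol_ring (prol_vars \<D> n) :: (nat \<times> nat, 'a) mpol ring" by (rule cring_mpol_ring)
  have "{prol_poly \<D> \<iota> \<Delta> n f j | f j. f \<in> I \<and> j \<in> I\<^sub>\<D>} \<subseteq> carrier (mpol_ring (prol_vars \<D> n))"
    using I prol_poly_closed by auto
  from genideal_self[OF this] show ?thesis unfolding prol_ideal_def using f by blast
qed

end

section \<open>Localisations of coordinate rings\<close>

context cring
begin

lemma fraction_eqI:
  assumes "a \<in> carrier R" "a' \<in> carrier R" "u \<in> Units R" "u' \<in> Units R" "a \<otimes> u' = a' \<otimes> u"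
  shows "a \<otimes> inv u = a' \<otimes> inv u'"
proof -
  have closed: "u \<in> carrier R" "u' \<in> carrier R" "inv u \<in> carrier R" "inv u' \<in> carrier R" using assms by auto
  have "a \<otimes> u' \<otimes> inv u' = a" using assms(1,4) closed by (simp add: m_assoc)
  then have "a \<otimes> inv u = a' \<otimes> u \<otimes> inv u' \<otimes> inv u" by (simp only: assms(5)[symmetric])
  also have "\<dots> = a' \<otimes> inv u' \<otimes> (u \<otimes> inv u)" using assms(2) closed by (simp only: m_ac m_closed)
  finally show ?thesis using assms(2,3) closed by simp
qed

lemma fraction_mult:
  assumes "a \<in> carrier R" "a' \<in> carrier R" "u \<in> Units R" "u' \<in> Units R"
  shows "(a \<otimes> inv u) \<otimes> (a' \<otimes> inv u') = a \<otimes> a' \<otimes> inv (u \<otimes> u')"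
proof -
  have closed: "u \<in> carrier R" "u' \<in> carrier R" "inv u \<in> carrier R" "inv u' \<in> carrier R" using assms by auto
  have "u \<otimes> u' \<otimes> (inv u \<otimes> inv u') = u \<otimes> inv u \<otimes> (u' \<otimes> inv u')" using closed by (simp only: m_ac m_closed)
  then have "u \<otimes> u' \<otimes> (inv u \<otimes> inv u') = \<one>" using assms by simp
  then have "inv (u \<otimes> u') = inv u \<otimes> inv u'" using closed by (intro comm_inv_char) auto
  then show ?thesis using assms(1,2) closed by (simp only: m_ac m_closed)
qed

lemma fraction_add:
  assumes "a \<in> carrier R" "a' \<in> carrier R" "u \<in> Units R" "u' \<in> Units R"
  shows "(a \<otimes> inv u) \<oplus> (a' \<otimes> inv u') = (a \<otimes> u' \<oplus> a' \<otimes> u) \<otimes> inv (u \<otimes> u')"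
proof -
  have closed: "u \<in> carrier R" "u' \<in> carrier R" using assms by auto
  have "a \<otimes> inv u = a \<otimes> u' \<otimes> inv (u \<otimes> u')" "a' \<otimes> inv u' = a' \<otimes> u \<otimes> inv (u \<otimes> u')"
    by (rule fraction_eqI; simp add: assms closed m_ac)+
  then show ?thesis using assms closed by (simp add: l_distr)
qed

end

lemma restrict_vars:
  obtains \<rho> :: "('v, 'a::comm_ring_1) mpol \<Rightarrow> ('v, 'a) mpol" where
    "type_hom \<rho>" "\<And>f. f \<in> mpols N \<Longrightarrow> \<rho> f = f" "\<And>f. \<rho> f \<in> mpols N"
proof
  let ?x = "\<lambda>v. if v \<in> N then mvar v else (0 :: ('v, 'a) mpol)"
  show "type_hom (mp_eval mconst ?x)" by (rule mp_eval_hom) simp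
  show "mp_eval mconst ?x f = f" if "f \<in> mpols N" for f
    using mp_eval_cong[of mconst f N ?x mvar] that by (simp add: mp_eval_mconst_mvar)
  show "mp_eval mconst ?x f \<in> mpols N" for f
    by (rule mpols_subst[of f UNIV]) (auto intro: mpols_var)
qed

lemma dvd_mpols:
  fixes s h :: "('v, 'a::comm_ring_1) mpol"
  assumes "s dvd h" "s \<in> mpols N" "h \<in> mpols N"
  obtains q where "q \<in> mpols N" "h = s * q"
proof -
  obtain \<rho> :: "('v, 'a) mpol \<Rightarrow> ('v, 'a) mpol" where \<rho>: "type_hom \<rho>" "\<And>f. f \<in> mpols N \<Longrightarrow> \<rho> f = f" "\<And>f. \<rho> f \<in> mpols N"
    using restrict_vars by metis
  obtain q where "h = s * q" using assms(1) by (rule dvdE)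
  then have "h = s * \<rho> q" using \<rho>(2)[OF assms(2)] \<rho>(2)[OF assms(3)] type_homD(4)[OF \<rho>(1)] by metis
  then show ?thesis using that \<rho>(3) by blast
qed

lemma in_saturation_mpols:
  fixes f h :: "('v, 'a::comm_ring_1) mpol"
  assumes "in_saturation h P S f" "h \<in> mpols N" "f \<in> mpols N" "\<And>v. v \<in> S \<Longrightarrow> P v \<in> mpols N"
  obtains k q where "\<And>v. q v \<in> mpols N" "h ^ k * f = (\<Sum>v\<in>S. q v * P v)"
proof -
  obtain \<rho> :: "('v, 'a) mpol \<Rightarrow> ('v, 'a) mpol" where \<rho>: "type_hom \<rho>" "\<And>f. f \<in> mpols N \<Longrightarrow> \<rho> f = f" "\<And>f. \<rho> f \<in> mpols N"
    using restrict_vars by metis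
  obtain k q where "h ^ k * f = (\<Sum>v\<in>S. q v * P v)" using assms(1) by (auto simp: in_saturation_def)
  from arg_cong[OF this, of \<rho>] have "h ^ k * f = (\<Sum>v\<in>S. \<rho> (q v) * P v)"
    using assms \<rho>(2) by (simp add: type_homD[OF \<rho>(1)] type_hom_sum[OF \<rho>(1)])
  then show ?thesis using that[of "\<lambda>v. \<rho> (q v)" k] \<rho>(3) by blast
qed

lemma triangular_hom_zero:
  fixes T :: "'t ring"
  assumes T: "cring T" and hom: "\<phi> \<in> ring_hom (mpol_ring N) T"
    and tri: "triangular N J ord S P h" and J: "J \<subseteq> mpols N"
    and unit: "\<phi> h \<in> Units T" and zero: "\<And>v. v \<in> S \<Longrightarrow> \<phi> (P v) = \<zero>\<^bsub>T\<^esub>" and f: "f \<in> J"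
  shows "\<phi> f = \<zero>\<^bsub>T\<^esub>"
proof -
  interpret T: cring T by fact
  have closed: "\<phi> g \<in> carrier T" if "g \<in> mpols N" for g using hom that by (auto simp: ring_hom_def)
  have add: "\<phi> (g + g') = \<phi> g \<oplus>\<^bsub>T\<^esub> \<phi> g'" and mult: "\<phi> (g * g') = \<phi> g \<otimes>\<^bsub>T\<^esub> \<phi> g'"
    if "g \<in> mpols N" "g' \<in> mpols N" for g g' using hom that by (auto simp: ring_hom_def)
  have one: "\<phi> 1 = \<one>\<^bsub>T\<^esub>" using hom by (auto simp: ring_hom_def)
  have zero_0: "\<phi> 0 = \<zero>\<^bsub>T\<^esub>" using add[of 0 0] closed[of 0] by (simp add: T.add.r_cancel_one)
  note h = triangularD(3)[OF tri]
  have P: "P v \<in> mpols N" if "v \<in> S" for v using triangularD(5)[OF tri that] J by blast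
  obtain k q where q: "\<And>v. q v \<in> mpols N" "h ^ k * f = (\<Sum>v\<in>S. q v * P v)"
    using in_saturation_mpols[OF triangularD(8)[OF tri f] h subsetD[OF J f] P] by blast
  have "\<phi> (\<Sum>v\<in>A. q v * P v) = \<zero>\<^bsub>T\<^esub>" if "A \<subseteq> S" for A
    using that
  proof (induction A rule: infinite_finite_induct)
    case (insert v A)
    then have "q v * P v \<in> mpols N" "(\<Sum>v\<in>A. q v * P v) \<in> mpols N" "\<phi> (q v * P v) = \<zero>\<^bsub>T\<^esub>"
      using q(1) P by (auto simp: mult zero closed intro!: mpols_mult mpols_sum)
    with insert show ?case by (simp add: add)
  qed (simp_all add: zero_0)
  then have "\<phi> (h ^ k * f) = \<zero>\<^bsub>T\<^esub>" using q(2) by simp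
  moreover have "\<phi> (h ^ k) \<in> Units T"
    by (induction k) (use unit h in \<open>auto simp: one mult mpols_power\<close>)
  ultimately show ?thesis
    using f J closed[of f] by (metis T.Units_l_cancel T.Units_closed T.r_null T.zero_closed h mpols_power mult subsetD)
qed

locale localisation =
  fixes c :: "'a::field \<Rightarrow> 'f::field" and N :: "'v set" and b :: "'v \<Rightarrow> 'f" and M :: "('v, 'a) mpol set"
  assumes hom: "type_hom c" and M_subset: "M \<subseteq> mpols N" and one_in_M: "1 \<in> M"
    and mult_in_M: "\<And>g h. g \<in> M \<Longrightarrow> h \<in> M \<Longrightarrow> g * h \<in> M"
    and M_nonzero: "\<And>g. g \<in> M \<Longrightarrow> mp_eval c b g \<noteq> 0"
begin

abbreviation "evb \<equiv> mp_eval c b"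

lemmas evb_simps = mp_eval_ring_simps[OF hom]

definition Loc :: "'f ring" where
  "Loc = \<lparr>carrier = {evb f / evb g | f g. f \<in> mpols N \<and> g \<in> M},
     monoid.mult = (*), one = 1, ring.zero = 0, add = (+)\<rparr>"

lemma Loc_sel [simp]:
  "x \<otimes>\<^bsub>Loc\<^esub> y = x * y" "x \<oplus>\<^bsub>Loc\<^esub> y = x + y" "\<one>\<^bsub>Loc\<^esub> = 1" "\<zero>\<^bsub>Loc\<^esub> = 0"
  by (simp_all add: Loc_def)

lemma in_LocI: "f \<in> mpols N \<Longrightarrow> g \<in> M \<Longrightarrow> evb f / evb g \<in> carrier Loc"
  by (auto simp: Loc_def)

lemma in_LocE:
  assumes "x \<in> carrier Loc"
  obtains f g where "f \<in> mpols N" "g \<in> M" "g \<in> mpols N" "evb g \<noteq> 0" "x = evb f / evb g"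
  using assms M_subset M_nonzero by (auto simp: Loc_def)

lemma eval_in_Loc: "f \<in> mpols N \<Longrightarrow> evb f \<in> carrier Loc"
  using in_LocI[OF _ one_in_M, of f] by (simp add: evb_simps)

lemma coordinate_in_Loc: "v \<in> N \<Longrightarrow> b v \<in> carrier Loc"
  using eval_in_Loc[OF mpols_var, of v] by (simp add: evb_simps)

lemma inverse_in_Loc: "g \<in> M \<Longrightarrow> inverse (evb g) \<in> carrier Loc"
  using in_LocI[of 1 g] by (simp add: evb_simps divide_inverse)

lemma Loc_mult:
  assumes "x \<in> carrier Loc" "y \<in> carrier Loc"
  shows "x * y \<in> carrier Loc"
proof -
  obtain f g where x: "f \<in> mpols N" "g \<in> M" "x = evb f / evb g" using assms(1) by (rule in_LocE)
  obtain f' g' where y: "f' \<in> mpols N" "g' \<in> M" "y = evb f' / evb g'" using assms(2) by (rule in_LocE)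
  have "x * y = evb (f * f') / evb (g * g')" by (simp add: x y evb_simps)
  then show ?thesis using x y by (auto intro!: in_LocI mpols_mult mult_in_M)
qed

lemma Loc_add:
  assumes "x \<in> carrier Loc" "y \<in> carrier Loc"
  shows "x + y \<in> carrier Loc"
proof -
  obtain f g where x: "f \<in> mpols N" "g \<in> M" "g \<in> mpols N" "evb g \<noteq> 0" "x = evb f / evb g"
    using assms(1) by (rule in_LocE)
  obtain f' g' where y: "f' \<in> mpols N" "g' \<in> M" "g' \<in> mpols N" "evb g' \<noteq> 0" "y = evb f' / evb g'"
    using assms(2) by (rule in_LocE)
  have "x + y = evb (f * g' + f' * g) / evb (g * g')" using x y by (simp add: evb_simps add_frac_eq)
  then show ?thesis using x y by (auto intro!: in_LocI mpols_add mpols_mult mult_in_M)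
qed

lemma cring_Loc: "cring Loc"
proof (rule cringI)
  show "abelian_group Loc"
  proof (rule abelian_groupI)
    fix x assume x: "x \<in> carrier Loc"
    have "- 1 \<in> carrier Loc" using eval_in_Loc[of "- 1"] by (simp add: evb_simps mpols_uminus)
    from Loc_mult[OF this x] have "- x \<in> carrier Loc" by simp
    then show "\<exists>y\<in>carrier Loc. y \<oplus>\<^bsub>Loc\<^esub> x = \<zero>\<^bsub>Loc\<^esub>" by (intro bexI[of _ "- x"]) auto
  next
    show "\<zero>\<^bsub>Loc\<^esub> \<in> carrier Loc" using eval_in_Loc[of 0] by (simp add: evb_simps)
  qed (auto simp: Loc_add algebra_simps)
  show "Group.comm_monoid Loc"
  proof (rule comm_monoidI)
    show "\<one>\<^bsub>Loc\<^esub> \<in> carrier Loc" using eval_in_Loc[of 1] by (simp add: evb_simps)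
  qed (auto simp: Loc_mult algebra_simps)
qed (auto simp: algebra_simps)

sublocale Loc: cring Loc by (rule cring_Loc)

lemma hom_Loc: "c \<in> ring_hom ring_of_type_algebra Loc"
proof (rule ring_hom_memI)
  show "c x \<in> carrier Loc" for x using eval_in_Loc[of "mconst x"] by (simp add: evb_simps)
qed (auto simp: type_homD[OF hom])

lemma mp_eval_in_Loc:
  assumes f: "f \<in> mpols N'" and x: "x \<in> N' \<rightarrow> carrier Loc"
  shows "mp_eval_in Loc c x f = mp_eval c x f"
proof -
  interpret X: mp_evaluation Loc c x N' by (rule mp_evaluationI[OF cring_Loc hom_Loc x])
  show ?thesis
    using f by (induction rule: mpol_induct) (simp_all add: evb_simps X.ev_add X.ev_mult)
qed

lemma vanishing_ideal_in_Loc: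
  "x \<in> N' \<rightarrow> carrier Loc \<Longrightarrow> vanishing_ideal_in Loc c N' x = vanishing_ideal c N' x"
  using mp_eval_in_Loc[of _ N' x] by (auto simp: vanishing_ideal_in_def vanishing_ideal_def)

lemma Loc_unitI: "x \<in> carrier Loc \<Longrightarrow> y \<in> carrier Loc \<Longrightarrow> x * y = 1 \<Longrightarrow> x \<in> Units Loc"
  by (auto simp: Units_def mult.commute[of y] intro!: bexI[of _ y])

lemma unit_Loc:
  assumes "f \<in> mpols N" "g \<in> M" "f dvd g"
  shows "evb f \<in> Units Loc"
proof -
  obtain q where q: "q \<in> mpols N" "g = f * q" using dvd_mpols[OF assms(3,1)] assms(2) M_subset by blast
  then have "evb f * (evb q / evb g) = 1"
    using M_nonzero[OF assms(2)] by (simp add: evb_simps)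
  then show ?thesis
    using Loc_unitI[OF eval_in_Loc[OF assms(1)] in_LocI[OF q(1) assms(2)]] by blast
qed

lemma field_Loc:
  assumes M: "M = {g \<in> mpols N. evb g \<noteq> 0}"
  shows "field Loc"
proof (rule Loc.cring_fieldI)
  have "x \<in> Units Loc" if x: "x \<in> carrier Loc" "x \<noteq> 0" for x
  proof -
    obtain f g where fg: "f \<in> mpols N" "g \<in> mpols N" "evb g \<noteq> 0" "x = evb f / evb g" using x(1) by (rule in_LocE)
    then have "evb g / evb f \<in> carrier Loc" using x(2) by (intro in_LocI) (auto simp: M)
    moreover have "x * (evb g / evb f) = 1" using fg x(2) by auto
    ultimately show ?thesis using Loc_unitI[OF x(1)] by blast
  qed
  moreover have "0 \<notin> Units Loc" unfolding Units_def by auto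
  ultimately show "Units Loc = carrier Loc - {\<zero>\<^bsub>Loc\<^esub>}" using Loc.Units_closed by auto
qed

context
  fixes T :: "'t ring" and \<phi> :: "('v, 'a) mpol \<Rightarrow> 't"
  assumes T: "cring T" and \<phi>: "\<phi> \<in> ring_hom (mpol_ring N) T"
    and kernel: "\<And>f. f \<in> mpols N \<Longrightarrow> evb f = 0 \<Longrightarrow> \<phi> f = \<zero>\<^bsub>T\<^esub>"
    and units: "\<And>g. g \<in> M \<Longrightarrow> \<phi> g \<in> Units T"
begin

interpretation T: cring T by (rule T)

lemma mpol_hom_simps:
  "f \<in> mpols N \<Longrightarrow> \<phi> f \<in> carrier T" "\<phi> 1 = \<one>\<^bsub>T\<^esub>"
  "f \<in> mpols N \<Longrightarrow> g \<in> mpols N \<Longrightarrow> \<phi> (f + g) = \<phi> f \<oplus>\<^bsub>T\<^esub> \<phi> g"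
  "f \<in> mpols N \<Longrightarrow> g \<in> mpols N \<Longrightarrow> \<phi> (f * g) = \<phi> f \<otimes>\<^bsub>T\<^esub> \<phi> g"
  using \<phi> by (auto simp: ring_hom_def)

lemma mpol_hom_eqI:
  assumes "f \<in> mpols N" "g \<in> mpols N" "evb f = evb g"
  shows "\<phi> f = \<phi> g"
proof -
  have "f - g \<in> mpols N" using assms by (auto intro: mpols_minus)
  moreover from this have "\<phi> (f - g) = \<zero>\<^bsub>T\<^esub>" using assms by (intro kernel) (auto simp: evb_simps)
  ultimately show ?thesis using mpol_hom_simps(3)[of "f - g" g] mpol_hom_simps(1) assms by simp
qed

definition fraction_map :: "'f \<Rightarrow> 't" where
  "fraction_map x = (SOME t. \<exists>f\<in>mpols N. \<exists>g\<in>M. x = evb f / evb g \<and> t = \<phi> f \<otimes>\<^bsub>T\<^esub> inv\<^bsub>T\<^esub> \<phi> g)"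

lemma fraction_map_eq:
  assumes f: "f \<in> mpols N" and g: "g \<in> M"
  shows "fraction_map (evb f / evb g) = \<phi> f \<otimes>\<^bsub>T\<^esub> inv\<^bsub>T\<^esub> \<phi> g"
proof -
  have "\<exists>t. \<exists>f'\<in>mpols N. \<exists>g'\<in>M. evb f / evb g = evb f' / evb g' \<and> t = \<phi> f' \<otimes>\<^bsub>T\<^esub> inv\<^bsub>T\<^esub> \<phi> g'"
    using assms by blast
  from someI_ex[OF this] obtain f' g' where f': "f' \<in> mpols N" and g': "g' \<in> M"
    and eq: "evb f / evb g = evb f' / evb g'" "fraction_map (evb f / evb g) = \<phi> f' \<otimes>\<^bsub>T\<^esub> inv\<^bsub>T\<^esub> \<phi> g'"
    unfolding fraction_map_def by blast
  have mpols: "g \<in> mpols N" "g' \<in> mpols N" using g g' M_subset by auto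
  have "evb (f * g') = evb (f' * g)" using eq(1) M_nonzero g g' by (simp add: evb_simps frac_eq_eq)
  then have "\<phi> (f * g') = \<phi> (f' * g)" using f f' mpols by (intro mpol_hom_eqI mpols_mult)
  then have "\<phi> f \<otimes>\<^bsub>T\<^esub> inv\<^bsub>T\<^esub> \<phi> g = \<phi> f' \<otimes>\<^bsub>T\<^esub> inv\<^bsub>T\<^esub> \<phi> g'"
    using f f' mpols units g g' by (intro T.fraction_eqI) (auto simp: mpol_hom_simps)
  then show ?thesis using eq(2) by simp
qed

lemma fraction_map_eval: "f \<in> mpols N \<Longrightarrow> fraction_map (evb f) = \<phi> f"
  using fraction_map_eq[OF _ one_in_M, of f] by (simp add: evb_simps mpol_hom_simps)

lemma fraction_map_hom: "fraction_map \<in> ring_hom Loc T"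
proof (rule ring_hom_memI)
  show "fraction_map \<one>\<^bsub>Loc\<^esub> = \<one>\<^bsub>T\<^esub>" using fraction_map_eval[of 1] by (simp add: evb_simps mpol_hom_simps)
  fix x assume "x \<in> carrier Loc"
  then obtain f g where x: "f \<in> mpols N" "g \<in> M" "g \<in> mpols N" "evb g \<noteq> 0" "x = evb f / evb g" by (rule in_LocE)
  then show "fraction_map x \<in> carrier T" using units by (simp add: fraction_map_eq mpol_hom_simps)
  fix y assume "y \<in> carrier Loc"
  then obtain f' g' where y: "f' \<in> mpols N" "g' \<in> M" "g' \<in> mpols N" "evb g' \<noteq> 0" "y = evb f' / evb g'" by (rule in_LocE)
  note mpols = mpols_mult[OF x(1) y(1)] mpols_add[OF mpols_mult[OF x(1) y(3)] mpols_mult[OF y(1) x(3)]]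
  have "x * y = evb (f * f') / evb (g * g')" by (simp add: x y evb_simps)
  then show "fraction_map (x \<otimes>\<^bsub>Loc\<^esub> y) = fraction_map x \<otimes>\<^bsub>T\<^esub> fraction_map y"
    using x y units mpols T.fraction_mult[of "\<phi> f" "\<phi> f'" "\<phi> g" "\<phi> g'"] fraction_map_eq[OF mpols(1) mult_in_M[OF x(2) y(2)]]
    by (simp add: fraction_map_eq mpol_hom_simps)
  have "x + y = evb (f * g' + f' * g) / evb (g * g')" using x y by (simp add: evb_simps add_frac_eq)
  then show "fraction_map (x \<oplus>\<^bsub>Loc\<^esub> y) = fraction_map x \<oplus>\<^bsub>T\<^esub> fraction_map y"
    using x y units mpols T.fraction_add[of "\<phi> f" "\<phi> f'" "\<phi> g" "\<phi> g'"] fraction_map_eq[OF mpols(2) mult_in_M[OF x(2) y(2)]]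
    by (simp add: fraction_map_eq mpol_hom_simps mpols_mult)
qed

end

end

lemma localisation_powers:
  fixes c :: "'a::field \<Rightarrow> 'f::field"
  assumes hom: "type_hom c" and h: "h \<in> mpols N" "mp_eval c b h \<noteq> 0"
  shows "localisation c N b (range ((^) h))"
proof
  show "1 \<in> range ((^) h)" by (rule range_eqI[of _ _ 0]) simp
  show "g * g' \<in> range ((^) h)" if "g \<in> range ((^) h)" "g' \<in> range ((^) h)" for g g'
    using that by (auto simp flip: power_add)
qed (use hom h mpols_power in \<open>auto simp: mp_eval_ring_simps[OF hom]\<close>)

lemma localisation_function_field:
  fixes c :: "'a::field \<Rightarrow> 'f::field"
  assumes hom: "type_hom c"
  shows "localisation c N b {g \<in> mpols N. mp_eval c b g \<noteq> 0}"
  by unfold_locales (auto simp: hom mpols_mult mp_eval_ring_simps[OF hom])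

section \<open>\<open>\<D>\<close>-structures on localisations\<close>

locale D_localisation = base_D_field \<D> \<iota> \<Delta> + localisation c N b M
  for \<D> :: "('k::field_char_0, 'd::comm_ring_1) based_algebra" and \<iota> :: "'k \<Rightarrow> 'a::field_char_0" and \<Delta>
    and c :: "'a \<Rightarrow> 'f::field" and N :: "'v set" and b M
begin

abbreviation "LD \<equiv> base_change \<D> Loc (c \<circ> \<iota>)"

lemma cring_LD: "cring LD"
  by (rule cring_base_change[OF cring_Loc comp_iota_hom[OF hom_Loc]])

sublocale LD: cring LD by (rule cring_LD)

lemma twist_hom_LD: "twist c \<in> ring_hom ring_of_type_algebra LD"
  by (rule twist_hom[OF cring_Loc hom_Loc])

lemma LD_residue_hom: "(\<lambda>u. u 0) \<in> ring_hom LD Loc"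
  by (rule base_change_residue_hom[OF cring_Loc comp_iota_hom[OF hom_Loc]])

lemma LD_unit: "u \<in> carrier LD \<Longrightarrow> u 0 \<in> Units Loc \<Longrightarrow> u \<in> Units LD"
  by (rule base_change_unit[OF cring_Loc comp_iota_hom[OF hom_Loc]])

lemma LD_nilpotent: "u \<in> carrier LD \<Longrightarrow> u 0 = 0 \<Longrightarrow> LD.nilpotent u"
  using base_change_nilpotent[OF cring_Loc comp_iota_hom[OF hom_Loc], of u] by simp

definition lifts :: "'v set \<Rightarrow> ('v \<Rightarrow> nat \<Rightarrow> 'f) \<Rightarrow> bool" where
  "lifts A Y \<longleftrightarrow> (\<forall>v\<in>A. Y v \<in> carrier LD \<and> Y v 0 = b v)"

lemma lifts_closed: "lifts A Y \<Longrightarrow> Y \<in> A \<rightarrow> carrier LD"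
  by (simp add: lifts_def)

lemma eval_residue:
  assumes Y: "lifts A Y" and A: "A \<subseteq> N" and f: "f \<in> mpols A"
  shows "mp_eval_in LD (twist c) Y f 0 = evb f"
proof -
  have "mp_eval_in LD (twist c) Y f 0 = mp_eval_in Loc ((\<lambda>u. u 0) \<circ> twist c) ((\<lambda>u. u 0) \<circ> Y) f"
    by (rule mp_eval_in_compose_hom[OF mp_evaluationI[OF cring_LD twist_hom_LD lifts_closed[OF Y]]
        cring_Loc LD_residue_hom f])
  also have "(\<lambda>u. u 0) \<circ> twist c = c" by (simp add: fun_eq_iff twist_0)
  also have "mp_eval_in Loc c ((\<lambda>u. u 0) \<circ> Y) f = mp_eval c ((\<lambda>u. u 0) \<circ> Y) f"
    using Y A coordinate_in_Loc by (intro mp_eval_in_Loc[OF f]) (auto simp: lifts_def)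
  also have "\<dots> = evb f" using Y by (intro mp_eval_cong[OF hom f]) (simp add: lifts_def)
  finally show ?thesis .
qed

theorem extend_D_structure:
  assumes Y: "lifts N Y" and kernel: "\<And>f. f \<in> mpols N \<Longrightarrow> evb f = 0 \<Longrightarrow> mp_eval_in LD (twist c) Y f = \<zero>\<^bsub>LD\<^esub>"
  obtains \<delta> where "D_algebra Loc c \<delta>" "\<And>v. v \<in> N \<Longrightarrow> \<delta> (b v) = Y v"
proof -
  interpret Y: mp_evaluation LD "twist c" Y N by (rule mp_evaluationI[OF cring_LD twist_hom_LD lifts_closed[OF Y]])
  have residue: "Y.ev f 0 = evb f" if "f \<in> mpols N" for f by (rule eval_residue[OF Y order_refl that])
  have unit: "Y.ev g \<in> Units LD" if g: "g \<in> M" for g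
  proof (rule LD_unit)
    have "g \<in> mpols N" using g M_subset by blast
    then show "Y.ev g \<in> carrier LD" "Y.ev g 0 \<in> Units Loc"
      using unit_Loc[OF _ g] Y.ev_closed by (auto simp: residue)
  qed
  define \<delta> where "\<delta> = fraction_map LD Y.ev"
  have \<delta>_hom: "\<delta> \<in> ring_hom Loc LD"
    unfolding \<delta>_def by (rule fraction_map_hom[OF cring_LD Y.ev_hom]) (simp_all add: kernel unit)
  have \<delta>_eval: "\<delta> (evb f) = Y.ev f" if "f \<in> mpols N" for f
    unfolding \<delta>_def by (rule fraction_map_eval[OF cring_LD Y.ev_hom _ _ that]) (simp_all add: kernel unit)
  have "\<delta> x 0 = x" if x: "x \<in> carrier Loc" for x
  proof -
    obtain f g where fg: "f \<in> mpols N" "g \<in> mpols N" "evb g \<noteq> 0" "x = evb f / evb g" using x by (rule in_LocE)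
    have residue_hom: "(\<lambda>u. u 0) \<circ> \<delta> \<in> ring_hom Loc Loc" by (rule ring_hom_trans[OF \<delta>_hom LD_residue_hom])
    have "\<delta> x 0 * evb g = \<delta> (x * evb g) 0"
      using ring_hom_mult[OF residue_hom x eval_in_Loc[OF fg(2)]] by (simp add: \<delta>_eval residue fg(2))
    also have "\<dots> = x * evb g" using fg by (simp add: \<delta>_eval residue)
    finally show ?thesis using fg(3) by simp
  qed
  moreover have "\<delta> (c a) = twist c a" for a using \<delta>_eval[of "mconst a"] by (simp add: evb_simps)
  ultimately have "D_algebra Loc c \<delta>" using cring_Loc hom_Loc \<delta>_hom by (simp add: D_algebra_def)
  moreover have "\<delta> (b v) = Y v" if "v \<in> N" for v using \<delta>_eval[OF mpols_var[OF that]] that by (simp add: evb_simps)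
  ultimately show ?thesis by (rule that)
qed

lemma eval_zero_of_prol_poly:
  assumes w: "w \<in> prol_vars \<D> n \<rightarrow> carrier Loc" and f: "f \<in> mpols {..<n}"
    and zero: "\<And>j. j \<in> I\<^sub>\<D> \<Longrightarrow> mp_eval c w (prol_poly \<D> \<iota> \<Delta> n f j) = 0"
  shows "mp_eval_in LD (twist c) (\<lambda>i. \<lambda>j\<in>I\<^sub>\<D>. w (j, i)) f = \<zero>\<^bsub>LD\<^esub>"
proof (rule zero_base_changeI[OF cring_Loc comp_iota_hom[OF hom_Loc]])
  have "(\<lambda>i. \<lambda>j\<in>I\<^sub>\<D>. w (j, i)) \<in> {..<n} \<rightarrow> carrier LD"
    using w by (auto simp: base_change_sel prol_vars_def split: if_splits)
  from mp_evaluation.ev_closed[OF mp_evaluationI[OF cring_LD twist_hom_LD this] f]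
  show "mp_eval_in LD (twist c) (\<lambda>i. \<lambda>j\<in>I\<^sub>\<D>. w (j, i)) f \<in> carrier LD" .
  fix j assume j: "j \<in> I\<^sub>\<D>"
  have "mp_eval_in LD (twist c) (\<lambda>i. \<lambda>j\<in>I\<^sub>\<D>. w (j, i)) f j = mp_eval_in Loc c w (prol_poly \<D> \<iota> \<Delta> n f j)"
    by (rule prol_poly_eval[OF cring_Loc hom_Loc w f j, symmetric])
  also have "\<dots> = mp_eval c w (prol_poly \<D> \<iota> \<Delta> n f j)" by (rule mp_eval_in_Loc[OF prol_poly_closed[OF f j] w])
  finally show "mp_eval_in LD (twist c) (\<lambda>i. \<lambda>j\<in>I\<^sub>\<D>. w (j, i)) f j = \<zero>\<^bsub>Loc\<^esub>" using zero[OF j] by simp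
qed

end
section \<open>Lifting \<open>\<D>\<close>-structures\<close>

context D_localisation
begin

lemma exists_lift:
  assumes "x \<in> carrier Loc"
  obtains y where "y \<in> carrier LD" "y 0 = x"
proof
  show "pure Loc (c \<circ> \<iota>) x 1 \<in> carrier LD" by (rule pure_closed[OF cring_Loc comp_iota_hom[OF hom_Loc] assms])
  show "pure Loc (c \<circ> \<iota>) x 1 0 = x"
    using iota_1[OF cring_Loc comp_iota_hom[OF hom_Loc]] by (simp add: pure_def coord_one_0)
qed

lemma lift_coordinate:
  assumes Y: "lifts A Y" and A: "A \<subseteq> N" and p: "p \<in> N"
    and f: "f \<in> mpols (insert p A)" and zero: "evb f = 0" and unit: "evb (mp_deriv p f) \<in> Units Loc"
  obtains y where "y \<in> carrier LD" "y 0 = b p" "mp_eval_in LD (twist c) (Y(p := y)) f = \<zero>\<^bsub>LD\<^esub>"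
proof -
  obtain y where y: "y \<in> carrier LD" "y 0 = b p" using exists_lift[OF coordinate_in_Loc[OF p]] .
  let ?x = "Y(p := y)"
  have x: "lifts (insert p A) ?x" using Y y by (simp add: lifts_def)
  have vars: "insert p A \<subseteq> N" using A p by simp
  interpret X: mp_evaluation LD "twist c" ?x "insert p A"
    by (rule mp_evaluationI[OF cring_LD twist_hom_LD lifts_closed[OF x]])
  have e: "X.ev f \<in> carrier LD" "X.ev f 0 = 0" using X.ev_closed[OF f] eval_residue[OF x vars f] zero by auto
  have "X.ev (mp_deriv p f) \<in> Units LD"
    using X.ev_closed eval_residue[OF x vars] mpols_deriv[OF f] unit by (intro LD_unit) auto
  from LD.hensel[OF twist_hom_LD lifts_closed[OF x] insertI1 f LD_nilpotent[OF e] this]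
  obtain z where z: "z \<in> carrier LD"
    and root: "mp_eval_in LD (twist c) (?x(p := ?x p \<oplus>\<^bsub>LD\<^esub> X.ev f \<otimes>\<^bsub>LD\<^esub> z)) f = \<zero>\<^bsub>LD\<^esub>" by blast
  let ?y = "y \<oplus>\<^bsub>LD\<^esub> X.ev f \<otimes>\<^bsub>LD\<^esub> z"
  have "?y 0 = b p"
    using ring_hom_add[OF LD_residue_hom, of y "X.ev f \<otimes>\<^bsub>LD\<^esub> z"] ring_hom_mult[OF LD_residue_hom e(1) z] y e z by simp
  then show ?thesis using that[of ?y] y e z root by simp
qed

lemma lift_coordinates:
  assumes Y0: "lifts A Y0" and "A \<union> set vs \<subseteq> N" "distinct vs" "A \<inter> set vs = {}"
    and "\<And>v. v \<in> S \<inter> set vs \<Longrightarrow> P v \<in> mpols (insert v (A \<union> predecessors vs v)) \<and> evb (P v) = 0 \<and>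
      evb (mp_deriv v (P v)) \<in> Units Loc"
  shows "\<exists>Y. lifts (A \<union> set vs) Y \<and> (\<forall>v\<in>A. Y v = Y0 v) \<and>
    (\<forall>v\<in>S \<inter> set vs. mp_eval_in LD (twist c) Y (P v) = \<zero>\<^bsub>LD\<^esub>)"
  using assms(2-5)
proof (induction vs rule: rev_induct)
  case Nil
  then show ?case using Y0 by auto
next
  case (snoc p vs)
  have P: "P v \<in> mpols (insert v (A \<union> predecessors vs v))" if "v \<in> S \<inter> set vs" for v
    using snoc.prems(4)[of v] that by simp
  have "\<exists>Y. lifts (A \<union> set vs) Y \<and> (\<forall>v\<in>A. Y v = Y0 v) \<and>
      (\<forall>v\<in>S \<inter> set vs. mp_eval_in LD (twist c) Y (P v) = \<zero>\<^bsub>LD\<^esub>)"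
    by (rule snoc.IH) (use snoc.prems P in auto)
  then obtain Y where Y: "lifts (A \<union> set vs) Y" and extends: "\<forall>v\<in>A. Y v = Y0 v"
    and zeros: "\<forall>v\<in>S \<inter> set vs. mp_eval_in LD (twist c) Y (P v) = \<zero>\<^bsub>LD\<^esub>" by blast
  have vars: "A \<union> set vs \<subseteq> N" "p \<in> N" "p \<notin> A \<union> set vs" using snoc.prems by auto
  have "\<exists>y\<in>carrier LD. y 0 = b p \<and> (p \<in> S \<longrightarrow> mp_eval_in LD (twist c) (Y(p := y)) (P p) = \<zero>\<^bsub>LD\<^esub>)"
  proof (cases "p \<in> S")
    case True
    then have "P p \<in> mpols (insert p (A \<union> set vs))" "evb (P p) = 0" "evb (mp_deriv p (P p)) \<in> Units Loc"
      using snoc.prems(4)[of p] snoc.prems(2) by auto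
    from lift_coordinate[OF Y vars(1,2) this] show ?thesis by blast
  qed (use exists_lift[OF coordinate_in_Loc[OF vars(2)]] in blast)
  then obtain y where y: "y \<in> carrier LD" "y 0 = b p"
    and root: "p \<in> S \<Longrightarrow> mp_eval_in LD (twist c) (Y(p := y)) (P p) = \<zero>\<^bsub>LD\<^esub>" by blast
  have "mp_eval_in LD (twist c) (Y(p := y)) (P v) = mp_eval_in LD (twist c) Y (P v)" if v: "v \<in> S \<inter> set vs" for v
  proof (rule mp_eval_in_cong[symmetric, OF _ _ cring_LD lifts_closed[OF Y] twist_hom_LD])
    show "P v \<in> mpols (A \<union> set vs)"
      by (rule subsetD[OF mpols_mono P[OF v]]) (use v predecessors_subset[of vs v] in auto)
  qed (use vars(3) in auto)
  with zeros root have "mp_eval_in LD (twist c) (Y(p := y)) (P v) = \<zero>\<^bsub>LD\<^esub>" if "v \<in> S \<inter> set (vs @ [p])" for v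
    using that by auto
  moreover have "lifts (A \<union> set (vs @ [p])) (Y(p := y))" using Y y by (auto simp: lifts_def)
  moreover have "\<forall>v\<in>A. (Y(p := y)) v = Y0 v" using extends vars(3) by auto
  ultimately show ?case by blast
qed

text \<open>Hensel's lemma extends a lift along the equations of a triangular presentation one variable at a time; the
  transcendental variables are lifted arbitrarily.\<close>

theorem lift_D_structure:
  assumes tri: "triangular N (vanishing_ideal c N b) ord S P h" and h: "h \<in> M"
    and Y0: "lifts A Y0" and vs: "N = A \<union> set vs" "distinct vs" "A \<inter> set vs = {}"
    and P_A: "\<And>v. v \<in> S \<inter> A \<Longrightarrow> P v \<in> mpols A"
    and P_vs: "\<And>v. v \<in> S \<inter> set vs \<Longrightarrow> P v \<in> mpols (insert v (A \<union> predecessors vs v))"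
    and kernel: "\<And>f. f \<in> mpols A \<Longrightarrow> evb f = 0 \<Longrightarrow> mp_eval_in LD (twist c) Y0 f = \<zero>\<^bsub>LD\<^esub>"
  obtains \<delta> where "D_algebra Loc c \<delta>" "\<And>v. v \<in> A \<Longrightarrow> \<delta> (b v) = Y0 v"
proof -
  have P: "P v \<in> mpols N" "evb (P v) = 0" if "v \<in> S" for v
    using triangularD(5)[OF tri that] by (simp_all add: vanishing_ideal_def)
  have unit: "evb (mp_deriv v (P v)) \<in> Units Loc" if "v \<in> S" for v
    by (rule unit_Loc[OF mpols_deriv[OF P(1)[OF that]] h triangularD(6)[OF tri that]])
  obtain Y where Y: "lifts N Y" and extends: "\<And>v. v \<in> A \<Longrightarrow> Y v = Y0 v"
    and zeros: "\<And>v. v \<in> S \<inter> set vs \<Longrightarrow> mp_eval_in LD (twist c) Y (P v) = \<zero>\<^bsub>LD\<^esub>"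
    using lift_coordinates[OF Y0 _ vs(2,3), of S P] vs(1) P(2) P_vs unit by auto
  interpret Y: mp_evaluation LD "twist c" Y N by (rule mp_evaluationI[OF cring_LD twist_hom_LD lifts_closed[OF Y]])
  have P_zero: "Y.ev (P v) = \<zero>\<^bsub>LD\<^esub>" if v: "v \<in> S" for v
  proof (cases "v \<in> A")
    case True
    then have "Y.ev (P v) = mp_eval_in LD (twist c) Y0 (P v)"
      using v extends Y0 by (intro mp_eval_in_cong[symmetric, OF _ P_A cring_LD lifts_closed twist_hom_LD]) auto
    then show ?thesis using kernel[OF P_A P(2)] v True by simp
  next
    case False
    then show ?thesis using zeros v triangularD(1)[OF tri] vs(1) by auto
  qed
  have h_unit: "Y.ev h \<in> Units LD"
  proof (rule LD_unit)
    have "h \<in> mpols N" using h M_subset by blast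
    then show "Y.ev h \<in> carrier LD" "Y.ev h 0 \<in> Units Loc"
      using Y.ev_closed eval_residue[OF Y order_refl] unit_Loc[OF _ h dvd_refl] by auto
  qed
  have "Y.ev f = \<zero>\<^bsub>LD\<^esub>" if "f \<in> mpols N" "evb f = 0" for f
    by (rule triangular_hom_zero[OF cring_LD Y.ev_hom tri _ h_unit P_zero])
      (use that in \<open>auto simp: vanishing_ideal_def\<close>)
  then obtain \<delta> where "D_algebra Loc c \<delta>" "\<And>v. v \<in> N \<Longrightarrow> \<delta> (b v) = Y v" using extend_D_structure[OF Y] by blast
  then show ?thesis using that extends vs(1) by auto
qed

end

section \<open>From D-varieties to \<open>UC\<^sub>\<D>\<close>\<close>

lemma predecessors_upt:
  assumes "n \<le> v" "v < m"
  shows "predecessors [n..<m] v = {n..<v}"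
proof -
  have "[n..<m] = [n..<v] @ v # [Suc v..<m]"
    using assms upt_add_eq_append[of n v "m - v"] upt_conv_Cons[of v m] by simp
  then show ?thesis by (simp add: predecessors_def takeWhile_append)
qed

lemma exists_triangular_upt:
  fixes J :: "(nat, 'a::field_char_0) mpol set"
  assumes J: "primeideal J (mpol_ring {..<m})" and t: "t \<in> mpols {..<m}" "t \<notin> J"
  obtains ord S P h where "triangular {..<m} J ord S P (h * t)" "\<And>v. v \<in> S \<Longrightarrow> P v \<in> mpols {..v}"
proof -
  have upt: "set [0..<m] = {..<m}" by auto
  let ?S = "algebraic_vars J [0..<m]"
  obtain P h where tri: "triangular {..<m} J (list_position [0..<m]) ?S P h"
    and P: "\<And>v. v \<in> ?S \<Longrightarrow> P v \<in> mpols (insert v (predecessors [0..<m] v))"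
    using exists_triangular_list[of J "[0..<m]"] J unfolding upt by auto
  have "h * t \<in> mpols {..<m}" "h * t \<notin> J"
    using triangularD(3,4)[OF tri] t primeideal_mpolD(3)[OF J] by (auto intro: mpols_mult)
  then have "triangular {..<m} J (list_position [0..<m]) ?S P (h * t)"
    using triangular_multiple[OF tri dvd_triv_left] by blast
  moreover have "P v \<in> mpols {..v}" if "v \<in> ?S" for v
    by (rule subsetD[OF mpols_mono P[OF that]])
      (use that predecessors_upt[of 0 v m] in \<open>auto simp: algebraic_vars_def\<close>)
  ultimately show ?thesis by (rule that)
qed

lemma irreducible_varietyD:
  assumes "irreducible_variety N (I :: ('v, 'a::field) mpol set)"
  shows "finite N" "primeideal I (mpol_ring N)" "affine_variety N I" "I \<subseteq> mpols N"
  using assms irreducible_variety_iff_prime[of N I] ideal_mpolD(1)[OF primeideal_mpolD(1), of I N]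
  by (auto simp: irreducible_variety_def)

lemma irreducible_vanishing_ideal:
  "finite N \<Longrightarrow> type_hom c \<Longrightarrow> irreducible_variety N (vanishing_ideal c N b)"
  by (simp add: irreducible_variety_iff_prime primeideal_vanishing_ideal)

lemma primeideal_prod_notin:
  fixes J :: "('v, 'a::comm_ring_1) mpol set"
  assumes J: "primeideal J (mpol_ring N)" and "finite A" "\<And>a. a \<in> A \<Longrightarrow> f a \<in> mpols N - J"
  shows "prod f A \<in> mpols N - J"
  using assms(2,3)
proof (induction A rule: finite_induct)
  case (insert a A)
  then show ?case using primeideal_mpolD(3)[OF J, of "f a" "prod f A"] by (auto intro: mpols_mult)
qed (use primeideal_mpolD(2)[OF J] in simp)

lemma large_fieldD:
  assumes "large_field TYPE('a::field)" "irreducible_variety {..<n} (I :: (nat, 'a) mpol set)"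
    "has_smooth_rational_point {..<n} I" "f \<in> mpols {..<n}" "f \<notin> I"
  obtains x where "x \<in> rational_points {..<n} I" "mp_eval id x f \<noteq> 0"
proof -
  have "zariski_dense_in {..<n} I (point_ideal {..<n} ` rational_points {..<n} I)"
    using assms(1-3) by (auto simp: large_field_def)
  then show ?thesis
    using rational_points_dense_iff[OF irreducible_varietyD(2)[OF assms(2)] order_refl] assms(4,5) that by blast
qed

lemma large_field_avoid:
  assumes large: "large_field TYPE('a::field)" and I: "irreducible_variety {..<n} (I :: (nat, 'a) mpol set)"
    and smooth: "has_smooth_rational_point {..<n} I" and H: "finite H" "H \<subseteq> mpols {..<n} - I"
  obtains x where "x \<in> rational_points {..<n} I" "\<And>f. f \<in> H \<Longrightarrow> mp_eval id x f \<noteq> 0"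
proof -
  have "(\<Prod>f\<in>H. f) \<in> mpols {..<n} - I"
    by (rule primeideal_prod_notin[OF irreducible_varietyD(2)[OF I] H(1)]) (use H(2) in blast)
  then obtain x where "x \<in> rational_points {..<n} I" "mp_eval id x (\<Prod>f\<in>H. f) \<noteq> 0"
    using large_fieldD[OF large I smooth] by blast
  then show ?thesis using that H(1) by (auto simp: mp_eval_prod[OF type_hom_id(1)])
qed

lemma rational_pointD: "x \<in> rational_points N I \<Longrightarrow> f \<in> I \<Longrightarrow> mp_eval id x f = 0"
  by (simp add: rational_points_def points_def)

lemma restrict_rational_pointI:
  assumes "I \<subseteq> mpols N" "\<And>f. f \<in> I \<Longrightarrow> mp_eval id x f = 0"
  shows "restrict x N \<in> rational_points N I"
proof -
  have "mp_eval id (restrict x N) f = mp_eval id x f" if "f \<in> I" for f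
    using that assms(1) by (intro mp_eval_cong[OF type_hom_id(1), of _ N]) auto
  then show ?thesis using assms(2) by (simp add: rational_points_def points_def)
qed

context
  fixes c :: "'a::field_char_0 \<Rightarrow> 'f::field" and N :: "'v set" and b :: "'v \<Rightarrow> 'f" and y ord S P h
  assumes hom: "type_hom c" and N: "finite N" and y: "y \<notin> N"
    and tri: "triangular N (vanishing_ideal c N b) ord S P h" and b_y: "b y = inverse (mp_eval c b h)"
begin

lemma localised_unit:
  assumes d: "type_hom d" and "\<And>f. f \<in> vanishing_ideal c (insert y N) b \<Longrightarrow> mp_eval d x f = 0"
  shows "mp_eval d x h * x y = 1"
proof -
  have "inverse_equation h y \<in> vanishing_ideal c (insert y N) b"
    using triangularD(5)[OF triangular_localise[OF hom N y tri b_y], of y] by simp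
  from assms(2)[OF this] show ?thesis by (simp add: inverse_equation_def mp_eval_ring_simps[OF d])
qed

lemma smooth_variety_localise: "smooth_variety (insert y N) (vanishing_ideal c (insert y N) b)"
  unfolding smooth_variety_def
proof
  fix x assume "x \<in> points to_ac (insert y N) (vanishing_ideal c (insert y N) b)"
  then have zero: "mp_eval to_ac x f = 0" if "f \<in> vanishing_ideal c (insert y N) b" for f
    using that by (simp add: points_def)
  show "smooth_at to_ac (insert y N) (vanishing_ideal c (insert y N) b) x"
    using localised_unit[OF type_hom_to_ac zero] N
    by (intro triangular_smooth_at[OF triangular_localise[OF hom N y tri b_y] primeideal_vanishing_ideal[OF hom]
          _ type_hom_to_ac zero]) auto
qed

lemma rational_points_localise:
  assumes x: "x \<in> rational_points N (vanishing_ideal c N b)" and h: "mp_eval id x h \<noteq> 0"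
  shows "x(y := inverse (mp_eval id x h)) \<in> rational_points (insert y N) (vanishing_ideal c (insert y N) b)"
proof -
  let ?x = "x(y := inverse (mp_eval id x h))"
  have eval: "mp_eval id ?x f = mp_eval id x f" if "f \<in> mpols N" for f
    by (rule mp_eval_cong[OF type_hom_id(1) that]) (use y in auto)
  note h_eval = eval[OF triangularD(3)[OF tri]]
  have P_zero: "mp_eval id ?x (P v) = 0" if "v \<in> S" for v
    using triangularD(5)[OF tri that] rational_pointD[OF x] eval by (auto simp: vanishing_ideal_def)
  have "mp_eval id ?x f = 0" if f: "f \<in> vanishing_ideal c (insert y N) b" for f
  proof (rule triangular_zero[OF triangular_localise[OF hom N y tri b_y] type_hom_id(1) _ _ f])
    show "mp_eval id ?x h \<noteq> 0" using h h_eval by simp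
    fix v assume "v \<in> insert y S"
    then show "mp_eval id ?x ((P(y := inverse_equation h y)) v) = 0"
      using P_zero h h_eval by (auto simp: inverse_equation_def mp_eval_ring_simps)
  qed
  moreover have "?x \<in> insert y N \<rightarrow>\<^sub>E UNIV" using x by (auto simp: rational_points_def points_def PiE_iff extensional_def)
  ultimately show ?thesis by (simp add: rational_points_def points_def)
qed

end

context base_D_field
begin

text \<open>The variable \<open>x\<^sup>j\<^sub>i\<close> gets number \<open>j n + i\<close>, so that the variables \<open>x\<^sup>0\<^sub>i\<close> come first.\<close>

definition prol_code :: "nat \<Rightarrow> nat \<times> nat \<Rightarrow> nat" where
  "prol_code n = (\<lambda>(j, i). j * n + i)"

definition prol_decode :: "nat \<Rightarrow> nat \<Rightarrow> nat \<times> nat" where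
  "prol_decode n q = (q div n, q mod n)"

lemma prol_code:
  assumes "v \<in> prol_vars \<D> n"
  shows "prol_code n v < Suc (len \<D>) * n" "prol_decode n (prol_code n v) = v"
proof -
  obtain j i where v: "v = (j, i)" "j \<le> len \<D>" "i < n" using assms by (auto simp: prol_vars_def)
  have "j * n + i < j * n + n" using v by simp
  also have "\<dots> \<le> Suc (len \<D>) * n" using v by (metis Suc_le_mono mult_Suc add.commute mult_le_mono1)
  finally show "prol_code n v < Suc (len \<D>) * n" by (simp add: prol_code_def v)
  show "prol_decode n (prol_code n v) = v" using v by (simp add: prol_code_def prol_decode_def)
qed

lemma prol_decode:
  assumes "q < Suc (len \<D>) * n"
  shows "prol_decode n q \<in> prol_vars \<D> n" "prol_code n (prol_decode n q) = q"
proof -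
  have "n > 0" using assms by (cases n) auto
  then have "q div n \<le> len \<D>" using assms by (metis less_mult_imp_div_less less_Suc_eq_le)
  then show "prol_decode n q \<in> prol_vars \<D> n" using \<open>n > 0\<close> by (simp add: prol_decode_def prol_vars_def)
  show "prol_code n (prol_decode n q) = q" by (simp add: prol_code_def prol_decode_def)
qed

lemma finite_prol_vars: "finite (prol_vars \<D> n)"
  by (simp add: prol_vars_def)

lemma prol_proj_eq_of_dense:
  assumes I: "irreducible_variety {..<n} I" and J: "irreducible_variety (prol_vars \<D> n) J"
    and sub: "prol_ideal \<D> \<iota> \<Delta> n I \<subseteq> J"
  shows "zariski_dense_in {..<n} I (prol_proj n ` topspace (zariski (prol_vars \<D> n) J)) \<longleftrightarrow> prol_proj n J = I"
proof
  assume dense: "zariski_dense_in {..<n} I (prol_proj n ` topspace (zariski (prol_vars \<D> n) J))"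
  have "f \<in> I" if f: "f \<in> prol_proj n J" for f
  proof (rule ccontr)
    assume "f \<notin> I"
    with dense f obtain p where "p \<in> topspace (zariski (prol_vars \<D> n) J)" "f \<notin> prol_proj n p"
      unfolding zariski_dense_in_iff[OF irreducible_varietyD(2)[OF I]] by (auto simp: prol_proj_def)
    with f show False by (auto simp: prol_proj_def topspace_zariski)
  qed
  moreover have "f \<in> prol_proj n J" if "f \<in> I" for f
  proof -
    have "f \<in> mpols {..<n}" using that irreducible_varietyD(4)[OF I] by blast
    moreover have "prol_poly \<D> \<iota> \<Delta> n f 0 \<in> J"
      using sub that prol_ideal_subset_iff[OF primeideal_mpolD(1)[OF irreducible_varietyD(2)[OF J]] irreducible_varietyD(4)[OF I]]
      by auto
    ultimately show ?thesis by (simp add: prol_proj_def prol_poly_0)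
  qed
  ultimately show "prol_proj n J = I" by blast
next
  assume "prol_proj n J = I"
  moreover have "J \<in> topspace (zariski (prol_vars \<D> n) J)"
    using irreducible_varietyD(2)[OF J] by (simp add: topspace_zariski)
  ultimately show "zariski_dense_in {..<n} I (prol_proj n ` topspace (zariski (prol_vars \<D> n) J))"
    unfolding zariski_dense_in_iff[OF irreducible_varietyD(2)[OF I]] using irreducible_varietyD(2)[OF I] by blast
qed

definition dominant_in_prolongation :: "nat \<Rightarrow> (nat, 'a) mpol set \<Rightarrow> (nat \<times> nat, 'a) mpol set \<Rightarrow> bool" where
  "dominant_in_prolongation n I J \<longleftrightarrow> irreducible_variety {..<n} I \<and> irreducible_variety (prol_vars \<D> n) J \<and>
     prol_ideal \<D> \<iota> \<Delta> n I \<subseteq> J \<and> prol_proj n J = I"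

lemma UC_iff:
  "UC \<D> \<iota> \<Delta> \<longleftrightarrow> (\<forall>n I J q. dominant_in_prolongation n I J \<and> has_smooth_rational_point (prol_vars \<D> n) J \<and>
      q \<in> mpols (prol_vars \<D> n) - J \<longrightarrow>
      (\<exists>a\<in>rational_points {..<n} I. (\<forall>g\<in>J. mp_eval id (nabla \<D> \<Delta> n a) g = 0) \<and> mp_eval id (nabla \<D> \<Delta> n a) q \<noteq> 0))"
    (is "_ \<longleftrightarrow> (\<forall>n I J q. ?hyp n I J q \<longrightarrow> ?point n I J q)")
proof -
  have "(\<forall>U. openin (zariski (prol_vars \<D> n) J) U \<and> U \<noteq> {} \<longrightarrow>
        (\<exists>a\<in>rational_points {..<n} I. point_ideal (prol_vars \<D> n) (nabla \<D> \<Delta> n a) \<in> U)) \<longleftrightarrow>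
      (\<forall>q\<in>mpols (prol_vars \<D> n) - J. ?point n I J q)" (is "?open \<longleftrightarrow> ?points")
    if J: "irreducible_variety (prol_vars \<D> n) J" for n I J
  proof
    let ?V = "prol_vars \<D> n" and ?p = "\<lambda>a. point_ideal (prol_vars \<D> n) (nabla \<D> \<Delta> n a)"
    let ?U = "\<lambda>q. {p. primeideal p (mpol_ring ?V) \<and> J \<subseteq> p \<and> \<not> {q} \<subseteq> p}"
    have prime: "primeideal (?p a) (mpol_ring ?V)" for a
      unfolding point_ideal_eq by (rule primeideal_vanishing_ideal) simp
    note J_prime = irreducible_varietyD(2)[OF J] and J_mpols = irreducible_varietyD(4)[OF J]
    have in_open_iff: "?p a \<in> ?U q \<longleftrightarrow> (\<forall>g\<in>J. mp_eval id (nabla \<D> \<Delta> n a) g = 0) \<and> mp_eval id (nabla \<D> \<Delta> n a) q \<noteq> 0"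
      if "q \<in> mpols ?V" for a q
      using that prime[of a] J_mpols by (auto simp: point_ideal_def)
    show ?points if points_in_opens: ?open
    proof
      fix q assume q: "q \<in> mpols ?V - J"
      then have "openin (zariski ?V J) (?U q)" unfolding openin_zariski by (intro exI[of _ "{q}"]) auto
      moreover have "J \<in> ?U q" using J_prime q by simp
      ultimately obtain a where "a \<in> rational_points {..<n} I" "?p a \<in> ?U q" using points_in_opens by blast
      then show "?point n I J q" using in_open_iff q by blast
    qed
    show ?open if points: ?points
    proof (intro allI impI, elim conjE)
      fix U assume "openin (zariski ?V J) U" "U \<noteq> {}"
      then obtain Q q where Q: "Q \<subseteq> mpols ?V" "U = {p. primeideal p (mpol_ring ?V) \<and> J \<subseteq> p \<and> \<not> Q \<subseteq> p}"
        and q: "q \<in> Q" "q \<notin> J" unfolding openin_zariski by blast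
      have "q \<in> mpols ?V - J" using Q(1) q by blast
      from bspec[OF points this] obtain a where "a \<in> rational_points {..<n} I"
        "(\<forall>g\<in>J. mp_eval id (nabla \<D> \<Delta> n a) g = 0) \<and> mp_eval id (nabla \<D> \<Delta> n a) q \<noteq> 0" by blast
      then have a: "a \<in> rational_points {..<n} I" "?p a \<in> ?U q" using in_open_iff[of q a] Q(1) q(1) by auto
      then have "?p a \<in> U" using Q q by auto
      with a(1) show "\<exists>a\<in>rational_points {..<n} I. ?p a \<in> U" by blast
    qed
  qed
  then show ?thesis
    unfolding UC_def dominant_in_prolongation_def using D_field prol_proj_eq_of_dense by (auto 0 4)
qed

lemma D_variety_of_D_algebra:
  fixes R :: "'r ring"
  assumes alg: "D_algebra R c \<delta>" and a: "a \<in> {..<n} \<rightarrow> carrier R"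
    and irreducible: "irreducible_variety {..<n} (vanishing_ideal_in R c {..<n} a)"
    and s: "\<And>j i. (j, i) \<in> prol_vars \<D> n \<Longrightarrow> s (j, i) \<in> mpols {..<n} \<and> mp_eval_in R c a (s (j, i)) = \<delta> (a i) j"
    and s_0: "\<And>i. i < n \<Longrightarrow> s (0, i) = mvar i"
  shows "irreducible_D_variety \<D> \<iota> \<Delta> n (vanishing_ideal_in R c {..<n} a) s"
proof -
  let ?I = "vanishing_ideal_in R c {..<n} a"
  note R = D_algebraD(1)[OF alg] and hom = D_algebraD(2)[OF alg]
  have s_closed: "s \<in> prol_vars \<D> n \<rightarrow> mpols {..<n}" using s by auto
  have "mp_eval mconst s g \<in> ?I" if "g \<in> prol_ideal \<D> \<iota> \<Delta> n ?I" for g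
  proof -
    have g: "g \<in> mpols (prol_vars \<D> n)" "mp_eval_in R c (prol_point \<delta> a) g = \<zero>\<^bsub>R\<^esub>"
      using that prol_ideal_prol_point[OF alg a] by (auto simp: vanishing_ideal_in_def)
    have "mp_eval_in R c a (mp_eval mconst s g) = mp_eval_in R c (\<lambda>v. mp_eval_in R c a (s v)) g"
      by (rule mp_eval_in_subst[OF R hom a s_closed g(1)])
    also have "\<dots> = mp_eval_in R c (prol_point \<delta> a) g"
      by (rule mp_eval_in_cong[symmetric, OF _ g(1) R prol_point_closed[OF alg a] hom])
        (use s in \<open>auto simp: prol_point_def\<close>)
    finally show ?thesis
      using g mpols_subst[OF g(1), of s "{..<n}"] s_closed by (auto simp: vanishing_ideal_in_def)
  qed
  moreover have "\<forall>i<n. s (0, i) - mvar i \<in> ?I"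
    using s_0 ideal_mpolD(2)[OF ideal_vanishing_ideal_in[OF R hom a]] by simp
  ultimately show ?thesis
    using irreducible irreducible_varietyD(3)[OF irreducible] s_closed
    by (auto simp: irreducible_D_variety_def affine_D_variety_def)
qed

text \<open>On a basic open subset, embedded by means of the inverse of its equation, every function is a polynomial.\<close>

lemma D_variety_of_basic_open:
  fixes c :: "'a \<Rightarrow> 'f::field" and b :: "nat \<Rightarrow> 'f"
  assumes "D_localisation \<D> \<iota> \<Delta> c {..<m} b (range ((^) h))"
    and alg: "D_algebra (localisation.Loc c {..<m} b (range ((^) h))) c \<delta>" and b_m: "b m = inverse (mp_eval c b h)"
  obtains s where "irreducible_D_variety \<D> \<iota> \<Delta> (Suc m) (vanishing_ideal c {..<Suc m} b) s"
    "\<And>j i. (j, i) \<in> prol_vars \<D> (Suc m) \<Longrightarrow> s (j, i) \<in> mpols {..<Suc m} \<and> mp_eval c b (s (j, i)) = \<delta> (b i) j"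
proof -
  interpret L: D_localisation \<D> \<iota> \<Delta> c "{..<m}" b "range ((^) h)" by fact
  have h: "h \<in> range ((^) h)" by (rule range_eqI[of _ _ 1]) simp
  have b_Loc: "b i \<in> carrier L.Loc" if "i < Suc m" for i
    using L.coordinate_in_Loc[of i] L.inverse_in_Loc[OF h] that by (cases "i = m") (auto simp: b_m)
  have polynomial: "\<exists>f\<in>mpols {..<Suc m}. L.evb f = x" if x: "x \<in> carrier L.Loc" for x
  proof -
    obtain f k where f: "f \<in> mpols {..<m}" "x = L.evb f / L.evb (h ^ k)" using L.in_LocE[OF x] by blast
    have "f \<in> mpols {..<Suc m}" by (rule subsetD[OF mpols_mono f(1)]) auto
    then have "f * mvar m ^ k \<in> mpols {..<Suc m}" by (intro mpols_mult mpols_power mpols_var) auto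
    moreover have "L.evb (f * mvar m ^ k) = x" by (simp add: L.evb_simps f(2) b_m power_inverse divide_inverse)
    ultimately show ?thesis by blast
  qed
  have "\<exists>f\<in>mpols {..<Suc m}. L.evb f = \<delta> (b i) j \<and> (j = 0 \<longrightarrow> f = mvar i)" if "(j, i) \<in> prol_vars \<D> (Suc m)" for j i
  proof (cases "j = 0")
    case True
    then show ?thesis using D_algebraD(5)[OF alg b_Loc, of i] that
      by (intro bexI[of _ "mvar i"]) (auto simp: L.evb_simps prol_vars_def intro: mpols_var)
  next
    case False
    then show ?thesis using polynomial D_algebraD(7)[OF alg b_Loc, of i j] that by (auto simp: prol_vars_def)
  qed
  then have "\<forall>v. \<exists>f. v \<in> prol_vars \<D> (Suc m) \<longrightarrow>
      f \<in> mpols {..<Suc m} \<and> L.evb f = \<delta> (b (snd v)) (fst v) \<and> (fst v = 0 \<longrightarrow> f = mvar (snd v))" by fastforce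
  from choice[OF this] obtain s where s: "\<And>v. v \<in> prol_vars \<D> (Suc m) \<Longrightarrow>
      s v \<in> mpols {..<Suc m} \<and> L.evb (s v) = \<delta> (b (snd v)) (fst v) \<and> (fst v = 0 \<longrightarrow> s v = mvar (snd v))" by blast
  have b_closed: "b \<in> {..<Suc m} \<rightarrow> carrier L.Loc" using b_Loc by simp
  have "irreducible_D_variety \<D> \<iota> \<Delta> (Suc m) (vanishing_ideal_in L.Loc c {..<Suc m} b) s"
  proof (rule D_variety_of_D_algebra[OF alg b_closed])
    show "irreducible_variety {..<Suc m} (vanishing_ideal_in L.Loc c {..<Suc m} b)"
      unfolding L.vanishing_ideal_in_Loc[OF b_closed] by (rule irreducible_vanishing_ideal[OF finite_lessThan L.hom])
    show "s (j, i) \<in> mpols {..<Suc m} \<and> mp_eval_in L.Loc c b (s (j, i)) = \<delta> (b i) j"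
      if "(j, i) \<in> prol_vars \<D> (Suc m)" for j i
      using s[OF that] L.mp_eval_in_Loc[OF _ b_closed, of "s (j, i)"] by simp
    show "s (0, i) = mvar i" if "i < Suc m" for i using s[of "(0, i)"] that by (simp add: prol_vars_def)
  qed
  then show ?thesis using that[of s] s by (force simp: L.vanishing_ideal_in_Loc[OF b_closed])
qed

lemma exists_D_variety_over_prolongation:
  fixes c :: "'a \<Rightarrow> 'f::field" and b :: "nat \<Rightarrow> 'f"
  assumes hom: "type_hom c" and tri: "triangular {..<m} (vanishing_ideal c {..<m} b) ord S P h"
    and P: "\<And>v. v \<in> S \<Longrightarrow> P v \<in> mpols {..v}" and b_m: "b m = inverse (mp_eval c b h)" and "n \<le> m"
    and \<kappa>: "\<And>v. v \<in> prol_vars \<D> n \<Longrightarrow> \<kappa> v < m" "\<And>i. i < n \<Longrightarrow> \<kappa> (0, i) = i"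
    and zero: "\<And>f j. f \<in> mpols {..<n} \<Longrightarrow> mp_eval c b f = 0 \<Longrightarrow> j \<in> I\<^sub>\<D> \<Longrightarrow> mp_eval c (b \<circ> \<kappa>) (prol_poly \<D> \<iota> \<Delta> n f j) = 0"
  obtains s where "irreducible_D_variety \<D> \<iota> \<Delta> (Suc m) (vanishing_ideal c {..<Suc m} b) s"
    "\<And>v. v \<in> prol_vars \<D> n \<Longrightarrow> s v - mvar (\<kappa> v) \<in> vanishing_ideal c {..<Suc m} b"
proof -
  have h: "h \<in> mpols {..<m}" "mp_eval c b h \<noteq> 0" using triangularD(3,4)[OF tri] by (auto simp: vanishing_ideal_def)
  have loc: "D_localisation \<D> \<iota> \<Delta> c {..<m} b (range ((^) h))"
    by (intro D_localisation.intro localisation_powers[OF hom h] base_D_field_axioms)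
  interpret L: D_localisation \<D> \<iota> \<Delta> c "{..<m}" b "range ((^) h)" by (rule loc)
  let ?Y = "\<lambda>i. \<lambda>j\<in>I\<^sub>\<D>. (b \<circ> \<kappa>) (j, i)"
  have \<kappa>_Loc: "b \<circ> \<kappa> \<in> prol_vars \<D> n \<rightarrow> carrier L.Loc" using \<kappa>(1) L.coordinate_in_Loc by auto
  then have Y: "L.lifts {..<n} ?Y" using \<kappa>(2) by (auto simp: L.lifts_def base_change_sel prol_vars_def)
  have h_power: "h \<in> range ((^) h)" by (rule range_eqI[of _ _ 1]) simp
  have vars: "{..<m} = {..<n} \<union> set [n..<m]" "{..<n} \<inter> set [n..<m] = {}" using \<open>n \<le> m\<close> by auto
  obtain \<delta> where alg: "D_algebra L.Loc c \<delta>" and \<delta>: "\<And>i. i \<in> {..<n} \<Longrightarrow> \<delta> (b i) = ?Y i"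
  proof (rule L.lift_D_structure[OF tri h_power Y vars(1) distinct_upt vars(2)])
    show "P v \<in> mpols {..<n}" if "v \<in> S \<inter> {..<n}" for v
      by (rule subsetD[OF mpols_mono P]) (use that in auto)
    show "P v \<in> mpols (insert v ({..<n} \<union> predecessors [n..<m] v))" if "v \<in> S \<inter> set [n..<m]" for v
      by (rule subsetD[OF mpols_mono P]) (use that in \<open>auto simp: predecessors_upt\<close>)
    show "mp_eval_in L.LD (twist c) ?Y f = \<zero>\<^bsub>L.LD\<^esub>" if "f \<in> mpols {..<n}" "L.evb f = 0" for f
      by (rule L.eval_zero_of_prol_poly[OF \<kappa>_Loc that(1) zero[OF that]])
  qed (rule that)
  obtain s where V: "irreducible_D_variety \<D> \<iota> \<Delta> (Suc m) (vanishing_ideal c {..<Suc m} b) s"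
    and s: "\<And>j i. (j, i) \<in> prol_vars \<D> (Suc m) \<Longrightarrow> s (j, i) \<in> mpols {..<Suc m} \<and> mp_eval c b (s (j, i)) = \<delta> (b i) j"
    using D_variety_of_basic_open[OF loc alg b_m] by blast
  have "s (j, i) - mvar (\<kappa> (j, i)) \<in> vanishing_ideal c {..<Suc m} b" if ji: "(j, i) \<in> prol_vars \<D> n" for j i
  proof -
    have "(j, i) \<in> prol_vars \<D> (Suc m)" "\<kappa> (j, i) < Suc m" using ji \<open>n \<le> m\<close> \<kappa>(1)[OF ji] by (auto simp: prol_vars_def)
    then show ?thesis
      using s[of j i] \<delta>[of i] ji
      by (auto simp: vanishing_ideal_def mp_eval_ring_simps[OF hom] prol_vars_def intro!: mpols_minus mpols_var)
  qed
  with V show ?thesis using that by auto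
qed

lemma exists_smooth_D_variety:
  fixes c :: "'a \<Rightarrow> 'f::field" and b :: "nat \<Rightarrow> 'f"
  assumes large: "large_field TYPE('a)" and hom: "type_hom c"
    and smooth: "has_smooth_rational_point {..<m} (vanishing_ideal c {..<m} b)"
    and t: "t \<in> mpols {..<m}" "mp_eval c b t \<noteq> 0" and "n \<le> m"
    and \<kappa>: "\<And>v. v \<in> prol_vars \<D> n \<Longrightarrow> \<kappa> v < m" "\<And>i. i < n \<Longrightarrow> \<kappa> (0, i) = i"
    and zero: "\<And>f j. f \<in> mpols {..<n} \<Longrightarrow> mp_eval c b f = 0 \<Longrightarrow> j \<in> I\<^sub>\<D> \<Longrightarrow> mp_eval c (b \<circ> \<kappa>) (prol_poly \<D> \<iota> \<Delta> n f j) = 0"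
  obtains I s where "irreducible_D_variety \<D> \<iota> \<Delta> (Suc m) I s" "smooth_variety {..<Suc m} I"
    "rational_points {..<Suc m} I \<noteq> {}" "vanishing_ideal c {..<m} b \<subseteq> I"
    "\<And>v. v \<in> prol_vars \<D> n \<Longrightarrow> s v - mvar (\<kappa> v) \<in> I"
    "\<And>x. x \<in> rational_points {..<Suc m} I \<Longrightarrow> mp_eval id x t \<noteq> 0"
proof -
  let ?J = "vanishing_ideal c {..<m} b"
  have J: "irreducible_variety {..<m} ?J" by (rule irreducible_vanishing_ideal[OF finite_lessThan hom])
  have "t \<notin> ?J" using t by (simp add: vanishing_ideal_def)
  then obtain ord S P h where tri: "triangular {..<m} ?J ord S P (h * t)"
    and P: "\<And>v. v \<in> S \<Longrightarrow> P v \<in> mpols {..v}"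
    using exists_triangular_upt[OF irreducible_varietyD(2)[OF J] t(1)] by blast
  let ?h = "h * t"
  define b' where "b' = b(m := inverse (mp_eval c b ?h))"
  note h = triangularD(3,4)[OF tri]
  have eval_b: "mp_eval c b' f = mp_eval c b f" if "f \<in> mpols {..<m}" for f
    by (rule mp_eval_cong[OF hom that]) (simp add: b'_def)
  have J_b: "vanishing_ideal c {..<m} b' = ?J" by (rule vanishing_ideal_cong[OF hom]) (simp add: b'_def)
  note tri' = tri[folded J_b]
  have b_m: "b' m = inverse (mp_eval c b' ?h)" using eval_b[OF h(1)] by (simp add: b'_def)
  have "mp_eval c (b' \<circ> \<kappa>) (prol_poly \<D> \<iota> \<Delta> n f j) = 0"
    if f: "f \<in> mpols {..<n}" "mp_eval c b' f = 0" and j: "j \<in> I\<^sub>\<D>" for f j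
  proof -
    have "f \<in> mpols {..<m}" by (rule subsetD[OF mpols_mono f(1)]) (use \<open>n \<le> m\<close> in auto)
    then have "mp_eval c (b \<circ> \<kappa>) (prol_poly \<D> \<iota> \<Delta> n f j) = 0" using zero[OF f(1) _ j] f(2) eval_b by simp
    moreover have "mp_eval c (b' \<circ> \<kappa>) (prol_poly \<D> \<iota> \<Delta> n f j) = mp_eval c (b \<circ> \<kappa>) (prol_poly \<D> \<iota> \<Delta> n f j)"
      by (rule mp_eval_cong[OF hom prol_poly_closed[OF f(1) j]]) (use \<kappa>(1) in \<open>fastforce simp: b'_def\<close>)
    ultimately show ?thesis by simp
  qed
  then obtain s where s: "irreducible_D_variety \<D> \<iota> \<Delta> (Suc m) (vanishing_ideal c {..<Suc m} b') s"
    "\<And>v. v \<in> prol_vars \<D> n \<Longrightarrow> s v - mvar (\<kappa> v) \<in> vanishing_ideal c {..<Suc m} b'"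
    using exists_D_variety_over_prolongation[OF hom tri' P b_m \<open>n \<le> m\<close> \<kappa>] by blast
  obtain x where x: "x \<in> rational_points {..<m} ?J" "mp_eval id x ?h \<noteq> 0"
    using large_fieldD[OF large J smooth h] .
  have "m \<notin> {..<m}" by simp
  note localised = hom finite_lessThan this tri' b_m
  have "smooth_variety {..<Suc m} (vanishing_ideal c {..<Suc m} b')"
    unfolding lessThan_Suc by (rule smooth_variety_localise[OF localised])
  moreover have "rational_points {..<Suc m} (vanishing_ideal c {..<Suc m} b') \<noteq> {}"
    using rational_points_localise[OF localised, of x] x unfolding lessThan_Suc J_b by blast
  moreover have "?J \<subseteq> vanishing_ideal c {..<Suc m} b'"
    using eval_b mpols_mono[of "{..<m}" "{..<Suc m}"] by (auto simp: vanishing_ideal_def)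
  moreover have "mp_eval id x t \<noteq> 0" if "x \<in> rational_points {..<Suc m} (vanishing_ideal c {..<Suc m} b')" for x
    using localised_unit[OF localised type_hom_id(1), of x] rational_pointD[OF that] unfolding lessThan_Suc
    by (auto simp: mp_eval_ring_simps)
  ultimately show ?thesis using that[OF s(1)] s(2) by blast
qed

lemma eval_nabla_proj_pullback:
  assumes "f \<in> mpols {..<n}"
  shows "mp_eval id (nabla \<D> \<Delta> n a) (proj_pullback f) = mp_eval id a f"
  unfolding mp_eval_subst[OF type_hom_id(1)] mp_eval_var[OF type_hom_id(1)]
  by (rule mp_eval_cong[OF type_hom_id(1) assms]) (simp add: nabla_def prol_vars_def)

lemma sharp_pointD:
  assumes "a \<in> sharp_points \<D> \<Delta> n I s"
  shows "a \<in> rational_points {..<n} I" "\<And>v. v \<in> prol_vars \<D> n \<Longrightarrow> nabla \<D> \<Delta> n a v = mp_eval id a (s v)"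
  using assms by (auto simp: sharp_points_def)

lemma eval_nabla_sharp_point:
  assumes a: "a \<in> sharp_points \<D> \<Delta> m I s" and "n \<le> m"
    and s: "\<And>v. v \<in> prol_vars \<D> n \<Longrightarrow> s v - mvar (\<kappa> v) \<in> I"
    and g: "g \<in> mpols (prol_vars \<D> n)"
  shows "mp_eval id (nabla \<D> \<Delta> n (restrict a {..<n})) g = mp_eval id a (mp_eval mconst (\<lambda>v. mvar (\<kappa> v)) g)"
  unfolding mp_eval_subst[OF type_hom_id(1)] mp_eval_var[OF type_hom_id(1)]
proof (rule mp_eval_cong[OF type_hom_id(1) g])
  fix v assume v: "v \<in> prol_vars \<D> n"
  then have "v \<in> prol_vars \<D> m" using \<open>n \<le> m\<close> by (auto simp: prol_vars_def)
  from sharp_pointD(2)[OF a this] have "nabla \<D> \<Delta> m a v = a (\<kappa> v)"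
    using rational_pointD[OF sharp_pointD(1)[OF a] s[OF v]] by (simp add: mp_eval_ring_simps)
  then show "nabla \<D> \<Delta> n (restrict a {..<n}) v = a (\<kappa> v)"
    using v \<open>n \<le> m\<close> by (auto simp: nabla_def prol_vars_def split: if_splits)
qed

lemma prolongation_point_of_sharp_point:
  assumes a: "a \<in> sharp_points \<D> \<Delta> m I' s" and "n \<le> m"
    and s: "\<And>v. v \<in> prol_vars \<D> n \<Longrightarrow> s v - mvar (\<kappa> v) \<in> I'"
    and J: "J \<subseteq> mpols (prol_vars \<D> n)" "\<And>g. g \<in> J \<Longrightarrow> mp_eval mconst (\<lambda>v. mvar (\<kappa> v)) g \<in> I'"
    and proj: "prol_proj n J = I"
  defines "a' \<equiv> restrict a {..<n}"
  shows "a' \<in> rational_points {..<n} I" "\<And>g. g \<in> J \<Longrightarrow> mp_eval id (nabla \<D> \<Delta> n a') g = 0"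
    "\<And>g. g \<in> mpols (prol_vars \<D> n) \<Longrightarrow>
      mp_eval id (nabla \<D> \<Delta> n a') g = mp_eval id a (mp_eval mconst (\<lambda>v. mvar (\<kappa> v)) g)"
proof -
  show eval: "mp_eval id (nabla \<D> \<Delta> n a') g = mp_eval id a (mp_eval mconst (\<lambda>v. mvar (\<kappa> v)) g)"
    if "g \<in> mpols (prol_vars \<D> n)" for g
    unfolding a'_def by (rule eval_nabla_sharp_point[OF a \<open>n \<le> m\<close> s that])
  show zero: "mp_eval id (nabla \<D> \<Delta> n a') g = 0" if "g \<in> J" for g
    using eval[of g] rational_pointD[OF sharp_pointD(1)[OF a] J(2)] J(1) that by auto
  have "mp_eval id a' f = 0" if "f \<in> I" for f
    using that proj zero[of "proj_pullback f"] eval_nabla_proj_pullback[of f n a'] by (auto simp: prol_proj_def)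
  moreover have "I \<subseteq> mpols {..<n}" using proj by (auto simp: prol_proj_def)
  ultimately have "restrict a' {..<n} \<in> rational_points {..<n} I" by (intro restrict_rational_pointI)
  then show "a' \<in> rational_points {..<n} I" by (simp add: a'_def)
qed

lemma prol_poly_zero_of_dominant:
  fixes c :: "'a \<Rightarrow> 'f::field"
  assumes IJ: "dominant_in_prolongation n I J" and J: "J = vanishing_ideal c (prol_vars \<D> n) b" and hom: "type_hom c"
    and f: "f \<in> mpols {..<n}" "mp_eval c (\<lambda>i. b (0, i)) f = 0" and j: "j \<in> I\<^sub>\<D>"
  shows "mp_eval c b (prol_poly \<D> \<iota> \<Delta> n f j) = 0"
proof -
  have "f \<in> prol_proj n J"
    using f proj_pullback_closed[OF f(1)] by (simp add: prol_proj_def J vanishing_ideal_def mp_eval_subst[OF hom] mp_eval_var[OF hom])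
  moreover have I: "irreducible_variety {..<n} I" and "irreducible_variety (prol_vars \<D> n) J"
    and sub: "prol_ideal \<D> \<iota> \<Delta> n I \<subseteq> J" and "prol_proj n J = I" using IJ by (auto simp: dominant_in_prolongation_def)
  ultimately have "prol_poly \<D> \<iota> \<Delta> n f j \<in> J"
    using j prol_ideal_subset_iff[OF primeideal_mpolD(1)[OF irreducible_varietyD(2)] irreducible_varietyD(4)[OF I]] by blast
  then show ?thesis by (simp add: J vanishing_ideal_def)
qed

lemma exists_generic_point_renamed:
  assumes J: "irreducible_variety (prol_vars \<D> n) J" and smooth: "has_smooth_rational_point (prol_vars \<D> n) J"
  defines "m \<equiv> Suc (len \<D>) * n"
  obtains b :: "nat \<Rightarrow> 'a univ_dom" where "J = vanishing_ideal to_univ (prol_vars \<D> n) (b \<circ> prol_code n)"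
    "has_smooth_rational_point {..<m} (vanishing_ideal to_univ {..<m} b)"
proof -
  obtain b :: "nat \<times> nat \<Rightarrow> 'a univ_dom" where b: "J = vanishing_ideal to_univ (prol_vars \<D> n) b"
    using generic_point[OF irreducible_varietyD(2,1)[OF J]] .
  let ?b = "b \<circ> prol_decode n"
  have code: "prol_code n v < m" "?b (prol_code n v) = b v" if "v \<in> prol_vars \<D> n" for v
    using prol_code[OF that] by (auto simp: m_def)
  have "J = vanishing_ideal to_univ (prol_vars \<D> n) (?b \<circ> prol_code n)"
    unfolding b by (rule vanishing_ideal_cong) (use code(2) in auto)
  moreover have "interdefinable to_univ (prol_vars \<D> n) {..<m} b ?b (\<lambda>r. mvar (prol_decode n r)) (\<lambda>v. mvar (prol_code n v))"
    using prol_decode(1)[of _ n] code finite_prol_vars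
    by unfold_locales (auto simp: mp_eval_var m_def intro!: mpols_var)
  from interdefinable.has_smooth_rational_point_image[OF this]
  have "has_smooth_rational_point {..<m} (vanishing_ideal to_univ {..<m} ?b)" using smooth by (simp add: b)
  ultimately show ?thesis by (rule that)
qed

theorem UC_of_smooth_D_varieties:
  assumes large: "large_field TYPE('a)"
    and sharp: "\<And>n I s. irreducible_D_variety \<D> \<iota> \<Delta> n I s \<Longrightarrow> smooth_variety {..<n} I \<Longrightarrow>
      rational_points {..<n} I \<noteq> {} \<Longrightarrow> sharp_points \<D> \<Delta> n I s \<noteq> {}"
  shows "UC \<D> \<iota> \<Delta>"
  unfolding UC_iff
proof (intro allI impI, elim conjE)
  fix n I J q
  assume IJ: "dominant_in_prolongation n I J" and smooth: "has_smooth_rational_point (prol_vars \<D> n) J"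
    and q: "q \<in> mpols (prol_vars \<D> n) - J"
  let ?V = "prol_vars \<D> n" and ?c = "to_univ :: 'a \<Rightarrow> 'a univ_dom"
    and ?\<rho> = "mp_eval mconst (\<lambda>v. mvar (prol_code n v)) :: _ \<Rightarrow> (nat, 'a) mpol"
  define m where "m = Suc (len \<D>) * n"
  note hom = type_hom_to_univ[where 'a = 'a]
  have J: "irreducible_variety ?V J" and proj: "prol_proj n J = I"
    using IJ by (auto simp: dominant_in_prolongation_def)
  obtain b :: "nat \<Rightarrow> 'a univ_dom" where b: "J = vanishing_ideal ?c ?V (b \<circ> prol_code n)"
    and smooth': "has_smooth_rational_point {..<m} (vanishing_ideal ?c {..<m} b)"
    using exists_generic_point_renamed[OF J smooth] unfolding m_def .
  have code: "prol_code n v < m" if "v \<in> ?V" for v using prol_code(1)[OF that] by (simp add: m_def)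
  have code_0: "prol_code n (0, i) = i" for i by (simp add: prol_code_def)
  have \<rho>_closed: "?\<rho> g \<in> mpols {..<m}" if "g \<in> mpols ?V" for g
    by (rule mpols_subst[OF that]) (use code in \<open>auto intro!: mpols_var\<close>)
  have \<rho>_eval: "mp_eval ?c b (?\<rho> g) = mp_eval ?c (b \<circ> prol_code n) g" for g
    by (simp add: mp_eval_subst[OF hom] mp_eval_var[OF hom] comp_def)
  have zero: "mp_eval ?c (b \<circ> prol_code n) (prol_poly \<D> \<iota> \<Delta> n f j) = 0"
    if "f \<in> mpols {..<n}" "mp_eval ?c b f = 0" "j \<in> I\<^sub>\<D>" for f j
    by (rule prol_poly_zero_of_dominant[OF IJ b hom that(1) _ that(3)]) (use that(2) in \<open>simp add: code_0\<close>)
  have "n \<le> m" by (simp add: m_def)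
  have "mp_eval ?c b (?\<rho> q) \<noteq> 0" using q by (simp add: \<rho>_eval b vanishing_ideal_def)
  then obtain I' s where V: "irreducible_D_variety \<D> \<iota> \<Delta> (Suc m) I' s" "smooth_variety {..<Suc m} I'"
      "rational_points {..<Suc m} I' \<noteq> {}"
    and I': "vanishing_ideal ?c {..<m} b \<subseteq> I'" and s: "\<And>v. v \<in> ?V \<Longrightarrow> s v - mvar (prol_code n v) \<in> I'"
    and nonzero: "\<And>x. x \<in> rational_points {..<Suc m} I' \<Longrightarrow> mp_eval id x (?\<rho> q) \<noteq> 0"
    using exists_smooth_D_variety[OF large hom smooth' \<rho>_closed _ \<open>n \<le> m\<close> code code_0 zero] q by blast
  obtain a where a: "a \<in> sharp_points \<D> \<Delta> (Suc m) I' s" using sharp[OF V] by blast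
  have J_I': "?\<rho> g \<in> I'" if "g \<in> J" for g
  proof -
    have "g \<in> mpols ?V" using that irreducible_varietyD(4)[OF J] by blast
    then show ?thesis using that I' \<rho>_closed by (auto simp: b vanishing_ideal_def \<rho>_eval)
  qed
  have "n \<le> Suc m" using \<open>n \<le> m\<close> by simp
  note point = prolongation_point_of_sharp_point[OF a this s irreducible_varietyD(4)[OF J] J_I' proj]
  have "mp_eval id a (?\<rho> q) \<noteq> 0" by (rule nonzero[OF sharp_pointD(1)[OF a]])
  then show "\<exists>a\<in>rational_points {..<n} I.
      (\<forall>g\<in>J. mp_eval id (nabla \<D> \<Delta> n a) g = 0) \<and> mp_eval id (nabla \<D> \<Delta> n a) q \<noteq> 0"
    using point(1,2) point(3)[of q] q by (intro bexI[of _ "restrict a {..<n}"]) auto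
qed

end
section \<open>Sharp points from \<open>UC\<^sub>\<D>\<close>\<close>

lemma linear_functional_scalars:
  fixes c :: "'a::field \<Rightarrow> 'b::field"
  assumes hom: "type_hom c" and x: "x \<noteq> 0"
  obtains \<xi> :: "'b \<Rightarrow> 'a" where "\<And>y z. \<xi> (y + z) = \<xi> y + \<xi> z" "\<And>k y. \<xi> (c k * y) = k * \<xi> y" "\<xi> x = 1"
proof -
  interpret B: vector_space "\<lambda>k y. c k * y"
    by unfold_locales (auto simp: type_homD[OF hom] algebra_simps)
  interpret pair: vector_space_pair "\<lambda>k y. c k * y" "(*) :: 'a \<Rightarrow> 'a \<Rightarrow> 'a"
    by unfold_locales (auto simp: algebra_simps)
  have "B.independent {x}" using x by (simp add: B.dependent_single)
  from pair.linear_independent_extend[OF this, of "\<lambda>_. 1"]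
  obtain \<xi> where \<xi>: "Vector_Spaces.linear (\<lambda>k y. c k * y) (*) \<xi>" "\<xi> x = 1" by auto
  then show ?thesis using that pair.linear_add pair.linear_scale by blast
qed

lemma fun_vs_independent_extend_scalars:
  fixes c :: "'a::field \<Rightarrow> 'b::field" and B :: "('v \<Rightarrow> 'a) set"
  assumes hom: "type_hom c" and B: "finite B" "fun_vs.independent B"
  shows "inj_on (\<lambda>u. c \<circ> u) B" "fun_vs.independent ((\<lambda>u. c \<circ> u) ` B)"
proof -
  have trivial: "\<forall>u\<in>B. a u = 0" if relation: "\<And>v. (\<Sum>u\<in>B. a u * (c \<circ> u) v) = 0" for a
  proof (rule ccontr)
    assume "\<not> (\<forall>u\<in>B. a u = 0)"
    then obtain u0 where u0: "u0 \<in> B" "a u0 \<noteq> 0" by blast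
    obtain \<xi> where \<xi>: "\<And>y z. \<xi> (y + z) = \<xi> y + \<xi> z" "\<And>k y. \<xi> (c k * y) = k * \<xi> y" "\<xi> (a u0) = 1"
      using linear_functional_scalars[OF hom u0(2)] by metis
    have \<xi>_0: "\<xi> 0 = 0" using \<xi>(2)[of 0 0] by simp
    have "(\<Sum>u\<in>B. \<xi> (a u) * u v) = \<xi> (\<Sum>u\<in>B. a u * (c \<circ> u) v)" for v
      using sum_comp_morphism[of \<xi> "\<lambda>u. a u * (c \<circ> u) v" B, OF \<xi>_0 \<xi>(1)]
      by (simp add: comp_def mult.commute[of "a _"] \<xi>(2) mult.commute[of _ "\<xi> _"])
    then have "(\<Sum>u\<in>B. (\<lambda>v. \<xi> (a u) * u v)) = 0" using relation \<xi>_0 by (simp add: fun_eq_iff sum_fun_apply)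
    then have "fun_vs.dependent B"
      unfolding fun_vs.dependent_finite[OF B(1)] using u0(1) \<xi>(3)
      by (intro exI[of _ "\<lambda>u. \<xi> (a u)"] conjI bexI[of _ u0]) auto
    with B(2) show False by simp
  qed
  show "inj_on (\<lambda>u. c \<circ> u) B"
    by (rule fun_vs_independent_family(1)[OF B(1)]) (erule trivial)
  show "fun_vs.independent ((\<lambda>u. c \<circ> u) ` B)"
    by (rule fun_vs_independent_family(2)[OF B(1)]) (erule trivial)
qed

lemma smooth_at_extend_scalars:
  fixes I :: "('v, 'a::field) mpol set" and c :: "'a \<Rightarrow> 'b::field"
  assumes hom: "type_hom c" and N: "finite N" and I: "I \<subseteq> mpols N"
  shows "smooth_at c N I (c \<circ> x) \<longleftrightarrow> smooth_at id N I x"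
proof -
  have gradient_c: "gradient c (c \<circ> x) f = c \<circ> gradient id x f" for f
    using mp_eval_compose[OF type_hom_id(1) hom, of x] by (simp add: gradient_def fun_eq_iff)
  obtain B where B: "B \<subseteq> gradient id x ` I" "fun_vs.independent B" "gradient id x ` I \<subseteq> fun_vs.span B"
    "card B = fun_vs.dim (gradient id x ` I)"
    using fun_vs.basis_exists[of "gradient id x ` I"] by metis
  have "B \<subseteq> supported N" using B(1) I gradient_supported[OF type_hom_id(1)] by fastforce
  then have finite: "finite B" using finite_independent_supported[OF N _ B(2)] by blast
  note extended = fun_vs_independent_extend_scalars[OF hom finite B(2)]
  have "fun_vs.dim (gradient c (c \<circ> x) ` I) = card B"
  proof (rule fun_vs.dim_unique[of "(\<lambda>u. c \<circ> u) ` B"])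
    show "(\<lambda>u. c \<circ> u) ` B \<subseteq> gradient c (c \<circ> x) ` I" using B(1) by (auto simp: gradient_c)
    show "card ((\<lambda>u. c \<circ> u) ` B) = card B" by (rule card_image[OF extended(1)])
    show "gradient c (c \<circ> x) ` I \<subseteq> fun_vs.span ((\<lambda>u. c \<circ> u) ` B)"
    proof safe
      fix f assume "f \<in> I"
      then have "gradient id x f \<in> fun_vs.span B" using B(3) by blast
      then obtain a where "gradient id x f = (\<Sum>u\<in>B. (\<lambda>v. a u * u v))"
        unfolding fun_vs.span_finite[OF finite] by auto
      then have "gradient c (c \<circ> x) f = (\<lambda>v. \<Sum>u\<in>B. c (a u) * (c \<circ> u) v)"
        by (simp add: gradient_c fun_eq_iff sum_fun_apply type_hom_sum[OF hom] type_homD[OF hom])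
      then show "gradient c (c \<circ> x) f \<in> fun_vs.span ((\<lambda>u. c \<circ> u) ` B)"
        using fun_vs_span_family[where S = B and a = "\<lambda>u. c (a u)" and g = "\<lambda>u. c \<circ> u"] by simp
    qed
  qed (rule extended(2))
  then show ?thesis unfolding smooth_at_iff using B(4) by simp
qed

lemma smooth_variety_rational_point:
  fixes I :: "('v, 'a::field) mpol set"
  assumes N: "finite N" and I: "I \<subseteq> mpols N" and smooth: "smooth_variety N I" and x: "x \<in> rational_points N I"
  shows "has_smooth_rational_point N I"
proof -
  define y where "y = restrict (to_ac \<circ> x) N"
  have eval: "mp_eval to_ac y f = mp_eval to_ac (to_ac \<circ> x) f" if "f \<in> mpols N" for f
    by (rule mp_eval_cong[OF type_hom_to_ac that]) (simp add: y_def)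
  have "mp_eval to_ac (to_ac \<circ> x) f = to_ac (mp_eval id x f)" for f
    using mp_eval_compose[OF type_hom_id(1) type_hom_to_ac, of x f] by (simp add: comp_def)
  then have "y \<in> points to_ac N I"
    using x I eval by (auto simp: points_def rational_points_def y_def)
  then have "smooth_at to_ac N I y" using smooth by (auto simp: smooth_variety_def)
  moreover have "gradient to_ac y f = gradient to_ac (to_ac \<circ> x) f" if "f \<in> I" for f
    using eval mpols_deriv[of f N] that I by (auto simp: gradient_def fun_eq_iff)
  ultimately have "smooth_at to_ac N I (to_ac \<circ> x)"
    unfolding smooth_at_iff by (simp cong: image_cong)
  then have "smooth_at id N I x" using smooth_at_extend_scalars[OF type_hom_to_ac N I] by blast
  with x show ?thesis by (auto simp: has_smooth_rational_point_def)
qed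

context base_D_field
begin

lemma irreducible_D_varietyD:
  assumes "irreducible_D_variety \<D> \<iota> \<Delta> n I s"
  shows "irreducible_variety {..<n} I" "s \<in> prol_vars \<D> n \<rightarrow> mpols {..<n}"
    "g \<in> prol_ideal \<D> \<iota> \<Delta> n I \<Longrightarrow> mp_eval mconst s g \<in> I" "i < n \<Longrightarrow> s (0, i) - mvar i \<in> I"
  using assms by (auto simp: irreducible_D_variety_def affine_D_variety_def)

abbreviation section_image :: "nat \<Rightarrow> (nat \<times> nat \<Rightarrow> (nat, 'a) mpol) \<Rightarrow> ('a \<Rightarrow> 'f::field) \<Rightarrow> (nat \<Rightarrow> 'f) \<Rightarrow> (nat \<times> nat, 'a) mpol set" where
  "section_image n s c b \<equiv> vanishing_ideal c (prol_vars \<D> n) (\<lambda>v. mp_eval c b (s v))"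

context
  fixes n I s and c :: "'a \<Rightarrow> 'f::field" and b
  assumes V: "irreducible_D_variety \<D> \<iota> \<Delta> n I s"
    and hom: "type_hom c" and b: "I = vanishing_ideal c {..<n} b"
begin

lemma section_point_0: "i < n \<Longrightarrow> mp_eval c b (s (0, i)) = b i"
  using irreducible_D_varietyD(4)[OF V] by (simp add: b vanishing_ideal_def mp_eval_ring_simps[OF hom])

lemma eval_section_proj_pullback:
  assumes f: "f \<in> mpols {..<n}"
  shows "mp_eval c (\<lambda>v. mp_eval c b (s v)) (proj_pullback f) = mp_eval c b f"
  unfolding mp_eval_subst[OF hom] mp_eval_var[OF hom] by (rule mp_eval_cong[OF hom f]) (simp add: section_point_0)

lemma section_image_iff:
  "g \<in> section_image n s c b \<longleftrightarrow> g \<in> mpols (prol_vars \<D> n) \<and> mp_eval mconst s g \<in> I"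
  using mpols_subst[of g _ s] irreducible_D_varietyD(2)[OF V] by (auto simp: b vanishing_ideal_def mp_eval_subst[OF hom] Pi_iff)

lemma dominant_section_image: "dominant_in_prolongation n I (section_image n s c b)"
  unfolding dominant_in_prolongation_def
proof (intro conjI)
  note I = irreducible_D_varietyD(1)[OF V]
  show "irreducible_variety {..<n} I" by (rule I)
  show "irreducible_variety (prol_vars \<D> n) (section_image n s c b)" by (rule irreducible_vanishing_ideal[OF finite_prol_vars hom])
  show "prol_ideal \<D> \<iota> \<Delta> n I \<subseteq> section_image n s c b"
    using irreducible_D_varietyD(3)[OF V] prol_ideal_mpols[OF irreducible_varietyD(4)[OF I]]
    unfolding section_image_iff subset_iff by blast
  show "prol_proj n (section_image n s c b) = I"
    using eval_section_proj_pullback proj_pullback_closed by (auto simp: prol_proj_def b vanishing_ideal_def)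
qed

lemma has_smooth_rational_point_section_image:
  assumes "has_smooth_rational_point {..<n} I"
  shows "has_smooth_rational_point (prol_vars \<D> n) (section_image n s c b)"
proof (rule interdefinable.has_smooth_rational_point_image)
  show "interdefinable c {..<n} (prol_vars \<D> n) b (\<lambda>v. mp_eval c b (s v)) s (\<lambda>i. mvar (0, i))"
    using irreducible_D_varietyD(2)[OF V] section_point_0 finite_prol_vars
    by unfold_locales (auto simp: hom mp_eval_var[OF hom] prol_vars_def intro!: mpols_var)
qed (use assms in \<open>simp add: b\<close>)

lemma sharp_of_nabla_in_section_image:
  assumes a: "a \<in> rational_points {..<n} I"
    and zero: "\<And>g. g \<in> section_image n s c b \<Longrightarrow> mp_eval id (nabla \<D> \<Delta> n a) g = 0"
  shows "a \<in> sharp_points \<D> \<Delta> n I s"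
proof -
  have "nabla \<D> \<Delta> n a v = mp_eval id a (s v)" if v: "v \<in> prol_vars \<D> n" for v
  proof -
    have s_v: "s v \<in> mpols {..<n}" using irreducible_D_varietyD(2)[OF V] v by blast
    then have "mvar v - proj_pullback (s v) \<in> section_image n s c b"
      using v proj_pullback_closed eval_section_proj_pullback
      by (auto simp: vanishing_ideal_def mp_eval_ring_simps[OF hom] intro!: mpols_minus mpols_var)
    from zero[OF this] show ?thesis using eval_nabla_proj_pullback[OF s_v] by (simp add: mp_eval_ring_simps)
  qed
  then have "restrict (nabla \<D> \<Delta> n a) (prol_vars \<D> n) = (\<lambda>v\<in>prol_vars \<D> n. mp_eval id a (s v))"
    by (rule restrict_ext)
  then have "nabla \<D> \<Delta> n a = (\<lambda>v\<in>prol_vars \<D> n. mp_eval id a (s v))" by (simp add: nabla_def)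
  then show ?thesis using a by (simp add: sharp_points_def)
qed

end

theorem sharp_points_dense_of_UC:
  assumes UC: "UC \<D> \<iota> \<Delta>" and V: "irreducible_D_variety \<D> \<iota> \<Delta> n I s"
    and smooth: "has_smooth_rational_point {..<n} I"
  shows "zariski_dense_in {..<n} I (point_ideal {..<n} ` sharp_points \<D> \<Delta> n I s)"
proof -
  note I = irreducible_varietyD(2,1)[OF irreducible_D_varietyD(1)[OF V]]
  obtain b :: "nat \<Rightarrow> 'a univ_dom" where b: "I = vanishing_ideal to_univ {..<n} b"
    using generic_point[OF I] .
  note generic = V type_hom_to_univ b
  have "\<exists>a\<in>sharp_points \<D> \<Delta> n I s. mp_eval id a f \<noteq> 0" if f: "f \<in> mpols {..<n}" "f \<notin> I" for f
  proof -
    have "proj_pullback f \<in> mpols (prol_vars \<D> n) - section_image n s to_univ b"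
      using f proj_pullback_closed eval_section_proj_pullback[OF generic f(1)] by (auto simp: b vanishing_ideal_def)
    then obtain a where a: "a \<in> rational_points {..<n} I"
      "\<And>g. g \<in> section_image n s to_univ b \<Longrightarrow> mp_eval id (nabla \<D> \<Delta> n a) g = 0"
      "mp_eval id (nabla \<D> \<Delta> n a) (proj_pullback f) \<noteq> 0"
      using UC dominant_section_image[OF generic] has_smooth_rational_point_section_image[OF generic smooth]
      unfolding UC_iff by blast
    then show ?thesis
      using sharp_of_nabla_in_section_image[OF generic a(1,2)] eval_nabla_proj_pullback[OF f(1)] by auto
  qed
  moreover have "sharp_points \<D> \<Delta> n I s \<subseteq> rational_points {..<n} I" by (auto simp: sharp_points_def)
  ultimately show ?thesis using rational_points_dense_iff[OF I(1)] by blast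
qed

lemma dense_nonempty:
  assumes "irreducible_variety {..<n} (I :: (nat, 'a) mpol set)" "zariski_dense_in {..<n} I (point_ideal {..<n} ` A)"
  shows "A \<noteq> {}"
  using assms(2) primeideal_mpolD(2)[OF irreducible_varietyD(2)[OF assms(1)]] mpols_1[of "{..<n}", where 'a = 'a]
  unfolding zariski_dense_in_iff[OF irreducible_varietyD(2)[OF assms(1)]] by blast

end

section \<open>Systems of equations as formulas\<close>

text \<open>\<open>term_rep vs cs t f\<close>: the term \<open>t\<close> represents the polynomial \<open>f\<close> in the variables \<open>vs\<close>; variable number \<open>i\<close> of \<open>t\<close>
  is \<open>vs ! i\<close>, and variable number \<open>length vs + i\<close> is the parameter \<open>cs ! i\<close>.\<close>

inductive term_rep :: "'v list \<Rightarrow> 'a::comm_ring_1 list \<Rightarrow> ('k, 'o) rterm \<Rightarrow> ('v, 'a) mpol \<Rightarrow> bool"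
  for vs cs where
  var: "i < length vs \<Longrightarrow> term_rep vs cs (TVar i) (mvar (vs ! i))"
| param: "i < length cs \<Longrightarrow> term_rep vs cs (TVar (length vs + i)) (mconst (cs ! i))"
| zero: "term_rep vs cs TZero 0"
| one: "term_rep vs cs TOne 1"
| plus: "term_rep vs cs s f \<Longrightarrow> term_rep vs cs t g \<Longrightarrow> term_rep vs cs (TPlus s t) (f + g)"
| times: "term_rep vs cs s f \<Longrightarrow> term_rep vs cs t g \<Longrightarrow> term_rep vs cs (TTimes s t) (f * g)"

lemma term_rep_mpols: "term_rep vs cs t f \<Longrightarrow> f \<in> mpols (set vs)"
  by (induction rule: term_rep.induct) (auto intro: mpols_var mpols_add mpols_mult)

lemma term_rep_sets: "term_rep vs cs t f \<Longrightarrow> set1_rterm t = {} \<and> set2_rterm t = {}"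
  by (induction rule: term_rep.induct) auto

lemma term_rep_val:
  fixes e :: "'a::comm_ring_1 \<Rightarrow> 'r" and R :: "'r ring"
  assumes rep: "term_rep vs cs t f" and R: "cring R" and e: "e \<in> ring_hom ring_of_type_algebra R"
    and y: "y \<in> set vs \<rightarrow> carrier R"
    and \<sigma>: "\<And>i. i < length vs \<Longrightarrow> \<sigma> i = y (vs ! i)" "\<And>i. i < length cs \<Longrightarrow> \<sigma> (length vs + i) = e (cs ! i)"
  shows "term_val R \<kappa> F \<sigma> t = mp_eval_in R e y f"
proof -
  interpret mp_evaluation R e y "set vs" by (rule mp_evaluationI[OF R e y])
  show ?thesis using rep by (induction rule: term_rep.induct) (simp_all add: \<sigma> ev_add ev_mult term_rep_mpols)
qed

lemma term_rep_exists:
  fixes f :: "('v, 'a::comm_ring_1) mpol"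
  assumes f: "f \<in> mpols (set vs)" and cs: "\<And>m. m \<in> keys f \<Longrightarrow> lookup f m \<in> set cs"
  shows "\<exists>t :: ('k, 'o) rterm. term_rep vs cs t f"
proof -
  let ?rep = "\<lambda>g. \<exists>t :: ('k, 'o) rterm. term_rep vs cs t g"
  have sum: "?rep (\<Sum>a\<in>A. g a)" if "finite A" "\<And>a. a \<in> A \<Longrightarrow> ?rep (g a)" for g :: "('v \<Rightarrow>\<^sub>0 nat) \<Rightarrow> ('v, 'a) mpol" and A
    using that by (induction A rule: finite_induct) (auto intro: term_rep.zero, metis term_rep.plus)
  have prod: "?rep (\<Prod>a\<in>A. g a)" if "finite A" "\<And>a. a \<in> A \<Longrightarrow> ?rep (g a)" for g :: "'v \<Rightarrow> ('v, 'a) mpol" and A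
    using that by (induction A rule: finite_induct) (auto intro: term_rep.one, metis term_rep.times)
  have power: "?rep (mvar v ^ k)" if "v \<in> set vs" for v k
  proof (induction k)
    case (Suc k)
    then show ?case using that by (metis in_set_conv_nth power_Suc term_rep.times term_rep.var)
  qed (auto intro: term_rep.one)
  have "?rep (single m (lookup f m))" if m: "m \<in> keys f" for m
  proof -
    have "?rep (mconst (lookup f m))"
      using cs[OF m] by (metis in_set_conv_nth term_rep.param)
    moreover have "keys m \<subseteq> set vs" using f m by (auto simp: mpols_def)
    then have "?rep (\<Prod>v\<in>keys m. mvar v ^ lookup m v)"
      by (intro prod) (auto intro!: power)
    ultimately show ?thesis unfolding single_eq_prod by (metis term_rep.times)
  qed
  then have "?rep (\<Sum>m\<in>keys f. single m (lookup f m))" by (intro sum) auto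
  then show ?thesis using poly_mapping_sum_singles[of f] by simp
qed

lemma term_rep_exists_finite:
  fixes B :: "('v, 'a::comm_ring_1) mpol set"
  assumes "finite B" "B \<subseteq> mpols (set vs)"
  obtains cs and tm :: "('v, 'a) mpol \<Rightarrow> ('k, 'o) rterm" where "\<And>f. f \<in> B \<Longrightarrow> term_rep vs cs (tm f) f"
proof -
  have finite: "finite (\<Union>f\<in>B. lookup f ` keys f)" using assms(1) by auto
  obtain cs where "set cs = (\<Union>f\<in>B. lookup f ` keys f)" using finite_list[OF finite] by blast
  then have "\<exists>t :: ('k, 'o) rterm. term_rep vs cs t f" if "f \<in> B" for f
    using that assms(2) by (intro term_rep_exists) auto
  then show ?thesis using that by metis
qed

primrec qconj :: "('k, 'o) qf_formula list \<Rightarrow> ('k, 'o) qf_formula" where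
  "qconj [] = QEq TZero TZero"
| "qconj (\<phi> # \<phi>s) = QAnd \<phi> (qconj \<phi>s)"

lemma qf_sat_qconj: "qf_sat R \<iota> F \<rho> (qconj \<phi>s) \<longleftrightarrow> (\<forall>\<phi>\<in>set \<phi>s. qf_sat R \<iota> F \<rho> \<phi>)"
  by (induction \<phi>s) auto

lemma qconj_sets:
  "qf_consts (qconj \<phi>s) = (\<Union>\<phi>\<in>set \<phi>s. qf_consts \<phi>)" "qf_ops (qconj \<phi>s) = (\<Union>\<phi>\<in>set \<phi>s. qf_ops \<phi>)"
  by (induction \<phi>s) auto

lemma ex_closedD:
  assumes "ex_closed A Q R \<kappa> F L \<kappa>' G e" "qf_consts \<phi> \<subseteq> A" "qf_ops \<phi> \<subseteq> Q" "finite V" "range \<rho> \<subseteq> carrier R"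
    and "range \<sigma> \<subseteq> carrier L" "\<And>v. v \<notin> V \<Longrightarrow> \<sigma> v = e (\<rho> v)" "qf_sat L \<kappa>' G \<sigma> \<phi>"
  shows "\<exists>\<tau>. range \<tau> \<subseteq> carrier R \<and> (\<forall>v. v \<notin> V \<longrightarrow> \<tau> v = \<rho> v) \<and> qf_sat R \<kappa> F \<tau> \<phi>"
  using assms unfolding ex_closed_def by blast

lemma ex_closed_solve:
  fixes e :: "'a::field \<Rightarrow> 'r" and L :: "'r ring" and A :: "'k set" and Q :: "'o set" and N :: "'v set"
  assumes ec: "ex_closed A Q ring_of_type_algebra \<kappa> F L \<kappa>' G e"
    and L: "cring L" and e: "e \<in> ring_hom ring_of_type_algebra L" and N: "finite N"
    and P: "finite P" "P \<subseteq> mpols N" and h: "h \<in> mpols N"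
    and W: "finite W" "W \<subseteq> Q \<times> N" and g: "g \<in> W \<rightarrow> mpols N"
    and y: "y \<in> N \<rightarrow> carrier L"
    and y_P: "\<And>f. f \<in> P \<Longrightarrow> mp_eval_in L e y f = \<zero>\<^bsub>L\<^esub>" and y_h: "mp_eval_in L e y h \<noteq> \<zero>\<^bsub>L\<^esub>"
    and y_W: "\<And>j v. (j, v) \<in> W \<Longrightarrow> G j (y v) = mp_eval_in L e y (g (j, v))"
  obtains x where "\<And>f. f \<in> P \<Longrightarrow> mp_eval id x f = 0" "mp_eval id x h \<noteq> 0"
    "\<And>j v. (j, v) \<in> W \<Longrightarrow> F j (x v) = mp_eval id x (g (j, v))"
proof -
  obtain vs where vs: "set vs = N" "distinct vs" using finite_distinct_list[OF N] by blast
  let ?all = "insert h (P \<union> g ` W)" and ?n = "length vs"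
  have "finite ?all" "?all \<subseteq> mpols (set vs)" using P h W g by (auto simp: vs(1))
  then obtain cs and tm :: "('v, 'a) mpol \<Rightarrow> ('k, 'o) rterm"
    where tm: "\<And>f. f \<in> ?all \<Longrightarrow> term_rep vs cs (tm f) f" by (rule term_rep_exists_finite) (rule that)
  obtain Ps where Ps: "set Ps = P" using finite_list[OF P(1)] by blast
  obtain Ws where Ws: "set Ws = W" using finite_list[OF W(1)] by blast
  have "\<forall>v\<in>N. \<exists>i. i < ?n \<and> vs ! i = v" using vs(1) by (auto simp: in_set_conv_nth)
  from bchoice[OF this] obtain num where num: "\<And>v. v \<in> N \<Longrightarrow> num v < ?n \<and> vs ! num v = v" by blast
  define \<phi> where "\<phi> = qconj (QNot (QEq (tm h) TZero) # map (\<lambda>f. QEq (tm f) TZero) Ps @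
      map (\<lambda>(j, v). QEq (TOp j (TVar (num v))) (tm (g (j, v)))) Ws)"
  define \<rho> where "\<rho> i = (if i < ?n then 0 else if i < ?n + length cs then cs ! (i - ?n) else 0)" for i
  define \<sigma> where "\<sigma> i = (if i < ?n then y (vs ! i) else e (\<rho> i))" for i
  have "e a \<in> carrier L" for a using e by (auto simp: ring_hom_def)
  then have \<sigma>_closed: "\<sigma> i \<in> carrier L" for i using y vs(1) by (auto simp: \<sigma>_def Pi_iff)
  have val: "term_val L \<kappa>' G \<sigma> (tm f) = mp_eval_in L e y f" if "f \<in> ?all" for f
    by (rule term_rep_val[OF tm[OF that] L e]) (use y vs(1) in \<open>auto simp: \<sigma>_def \<rho>_def\<close>)
  have "qf_sat L \<kappa>' G \<sigma> \<phi>"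
    unfolding \<phi>_def qf_sat_qconj using y_h y_P y_W W(2) Ps Ws val num by (auto simp: \<sigma>_def)
  moreover have "qf_consts \<phi> \<subseteq> A" "qf_ops \<phi> \<subseteq> Q"
    unfolding \<phi>_def qconj_sets using term_rep_sets[OF tm] W(2) Ps Ws by auto
  moreover have "range \<sigma> \<subseteq> carrier L" using \<sigma>_closed by blast
  moreover have "\<sigma> i = e (\<rho> i)" if "i \<notin> {..<?n}" for i using that by (simp add: \<sigma>_def)
  ultimately obtain \<tau> where \<tau>: "\<And>i. i \<notin> {..<?n} \<Longrightarrow> \<tau> i = \<rho> i" and sat: "qf_sat ring_of_type_algebra \<kappa> F \<tau> \<phi>"
    using ex_closedD[OF ec, of \<phi> "{..<?n}" \<rho> \<sigma>] by auto
  have "num (vs ! i) = i" if "i < ?n" for i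
    using num[of "vs ! i"] that vs by (metis nth_eq_iff_index_eq nth_mem)
  then have val': "term_val ring_of_type_algebra \<kappa> F \<tau> (tm f) = mp_eval id (\<tau> \<circ> num) f" if "f \<in> ?all" for f
    unfolding mp_eval_eq_in
    by (intro term_rep_val[OF tm[OF that] cring_from_type_algebra type_hom_id(1)]) (use \<tau> in \<open>auto simp: \<rho>_def\<close>)
  show ?thesis
    by (rule that[of "\<tau> \<circ> num"]) (use sat Ps Ws val' in \<open>auto simp: \<phi>_def qf_sat_qconj ball_Un\<close>)
qed

lemma ex_closed_field_solve:
  fixes e :: "'a::field \<Rightarrow> 'r" and L :: "'r ring"
  assumes ec: "ex_closed_field ring_of_type_algebra L e"
    and L: "cring L" and e: "e \<in> ring_hom ring_of_type_algebra L" and N: "finite N"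
    and P: "finite P" "P \<subseteq> mpols N" and h: "h \<in> mpols N"
    and y: "y \<in> N \<rightarrow> carrier L"
    and y_P: "\<And>f. f \<in> P \<Longrightarrow> mp_eval_in L e y f = \<zero>\<^bsub>L\<^esub>" and y_h: "mp_eval_in L e y h \<noteq> \<zero>\<^bsub>L\<^esub>"
  obtains x where "\<And>f. f \<in> P \<Longrightarrow> mp_eval id x f = 0" "mp_eval id x h \<noteq> 0"
  using ex_closed_solve[OF ec[unfolded ex_closed_field_def] L e N P h finite.emptyI empty_subsetI _ y y_P y_h] by auto

definition smooth_equations ::
    "'v set \<Rightarrow> ('v, 'a::field) mpol set \<Rightarrow> ('v, 'a) mpol set \<Rightarrow> ('v, 'a) mpol \<Rightarrow> bool" where
  "smooth_equations N J P h \<longleftrightarrow> finite P \<and> P \<subseteq> J \<and> h \<in> mpols N \<and> h \<notin> J \<and>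
     (\<forall>x. (\<forall>g\<in>P. mp_eval id x g = 0) \<and> mp_eval id x h \<noteq> 0 \<longrightarrow>
       (\<forall>f\<in>J. mp_eval id x f = 0) \<and> smooth_at id N J x)"

lemma smooth_equationsD:
  assumes "smooth_equations N J P h"
  shows "finite P" "P \<subseteq> J" "h \<in> mpols N" "h \<notin> J"
    "(\<And>g. g \<in> P \<Longrightarrow> mp_eval id x g = 0) \<Longrightarrow> mp_eval id x h \<noteq> 0 \<Longrightarrow> f \<in> J \<Longrightarrow> mp_eval id x f = 0"
    "(\<And>g. g \<in> P \<Longrightarrow> mp_eval id x g = 0) \<Longrightarrow> mp_eval id x h \<noteq> 0 \<Longrightarrow> smooth_at id N J x"
  using assms unfolding smooth_equations_def by blast+

lemma exists_smooth_equations: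
  fixes J :: "('v, 'a::field_char_0) mpol set"
  assumes J: "primeideal J (mpol_ring N)" and N: "finite N"
  obtains P h where "smooth_equations N J P h"
proof -
  obtain ord S P h where tri: "triangular N J ord S P h" using exists_triangular[OF J N] .
  have zero: "mp_eval id x f = 0" if "\<forall>g\<in>P ` S. mp_eval id x g = 0" "mp_eval id x h \<noteq> 0" "f \<in> J" for x f
    by (rule triangular_zero[OF tri type_hom_id(1) that(2) _ that(3)]) (use that(1) in blast)
  have "smooth_equations N J (P ` S) h"
    unfolding smooth_equations_def
  proof (intro conjI allI impI ballI; (elim conjE)?)
    show "finite (P ` S)" using finite_subset[OF triangularD(1)[OF tri] N] by simp
    show "P ` S \<subseteq> J" using triangularD(5)[OF tri] by blast
    fix x assume x: "\<forall>g\<in>P ` S. mp_eval id x g = 0" "mp_eval id x h \<noteq> 0"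
    show "mp_eval id x f = 0" if "f \<in> J" for f by (rule zero[OF x that])
    show "smooth_at id N J x" by (rule triangular_smooth_at[OF tri J N type_hom_id(1) zero[OF x] x(2)])
  qed (use triangularD(3,4)[OF tri] in auto)
  then show ?thesis by (rule that)
qed

lemma smooth_rational_point_of_ex_closed_field:
  fixes L :: "'r ring" and e :: "'a::field_char_0 \<Rightarrow> 'r"
  assumes ec: "ex_closed_field ring_of_type_algebra L e"
    and L: "field L" and e: "e \<in> ring_hom ring_of_type_algebra L" and N: "finite N" and y: "y \<in> N \<rightarrow> carrier L"
  shows "has_smooth_rational_point N (vanishing_ideal_in L e N y)"
proof -
  interpret L: field L by fact
  let ?J = "vanishing_ideal_in L e N y"
  obtain P h where "smooth_equations N ?J P h"
    using exists_smooth_equations[OF primeideal_vanishing_ideal_in[OF L.domain_axioms e y] N] .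
  note equations = smooth_equationsD[OF this]
  have J_mpols: "?J \<subseteq> mpols N" by (auto simp: vanishing_ideal_in_def)
  obtain x where x: "\<And>g. g \<in> P \<Longrightarrow> mp_eval id x g = 0" "mp_eval id x h \<noteq> 0"
    by (rule ex_closed_field_solve[OF ec L.is_cring e N equations(1) _ equations(3) y])
      (use equations(2-4) in \<open>auto simp: vanishing_ideal_in_def\<close>)
  have "mp_eval id (restrict x N) f = mp_eval id x f" if "f \<in> mpols N" for f
    by (rule mp_eval_cong[OF type_hom_id(1) that]) simp
  then have "smooth_at id N ?J (restrict x N)" using x equations(2,3) J_mpols by (intro equations(6)) auto
  moreover have "restrict x N \<in> rational_points N ?J"
    by (rule restrict_rational_pointI[OF J_mpols]) (rule equations(5)[OF x])
  ultimately show ?thesis by (auto simp: has_smooth_rational_point_def)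
qed

section \<open>Existential closedness from partial embeddings\<close>

lemma minus_of_type: "x \<ominus>\<^bsub>ring_of_type_algebra\<^esub> y = (x - y :: 'a::comm_ring_1)"
proof -
  interpret R: cring "ring_of_type_algebra :: 'a ring" by (rule cring_from_type_algebra)
  have "\<ominus>\<^bsub>ring_of_type_algebra\<^esub> y = - y" by (rule R.minus_equality) auto
  then show ?thesis by (simp add: a_minus_def)
qed

primrec subterms :: "('k, 'o) rterm \<Rightarrow> ('k, 'o) rterm set" where
  "subterms (TVar v) = {TVar v}"
| "subterms TZero = {TZero}"
| "subterms TOne = {TOne}"
| "subterms (TConst a) = {TConst a}"
| "subterms (TPlus s t) = insert (TPlus s t) (subterms s \<union> subterms t)"
| "subterms (TMinus s t) = insert (TMinus s t) (subterms s \<union> subterms t)"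
| "subterms (TTimes s t) = insert (TTimes s t) (subterms s \<union> subterms t)"
| "subterms (TOp f t) = insert (TOp f t) (subterms t)"

primrec qf_subterms :: "('k, 'o) qf_formula \<Rightarrow> ('k, 'o) rterm set" where
  "qf_subterms (QEq s t) = subterms s \<union> subterms t"
| "qf_subterms (QNot \<phi>) = qf_subterms \<phi>"
| "qf_subterms (QAnd \<phi> \<psi>) = qf_subterms \<phi> \<union> qf_subterms \<psi>"

lemma finite_subterms: "finite (subterms t)"
  by (induction t) auto

lemma finite_qf_subterms: "finite (qf_subterms \<phi>)"
  by (induction \<phi>) (auto simp: finite_subterms)

lemma subterms_refl: "t \<in> subterms t"
  by (cases t) auto

definition partial_embedding ::
    "'o set \<Rightarrow> ('o \<Rightarrow> 'a::comm_ring_1 \<Rightarrow> 'a) \<Rightarrow> 'r ring \<Rightarrow> ('o \<Rightarrow> 'r \<Rightarrow> 'r) \<Rightarrow> ('a \<Rightarrow> 'r) \<Rightarrow> 'r set \<Rightarrow> ('r \<Rightarrow> 'a) \<Rightarrow> bool" where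
  "partial_embedding Q F L G e B \<theta> \<longleftrightarrow> inj_on \<theta> B \<and> (\<forall>a. e a \<in> B \<longrightarrow> \<theta> (e a) = a) \<and>
     (\<forall>x\<in>B. \<forall>y\<in>B. (x \<oplus>\<^bsub>L\<^esub> y \<in> B \<longrightarrow> \<theta> (x \<oplus>\<^bsub>L\<^esub> y) = \<theta> x + \<theta> y) \<and> (x \<otimes>\<^bsub>L\<^esub> y \<in> B \<longrightarrow> \<theta> (x \<otimes>\<^bsub>L\<^esub> y) = \<theta> x * \<theta> y)) \<and>
     (\<forall>j\<in>Q. \<forall>x\<in>B. G j x \<in> B \<longrightarrow> \<theta> (G j x) = F j (\<theta> x))"

lemma partial_embeddingD:
  assumes "partial_embedding Q F L G e B \<theta>"
  shows "inj_on \<theta> B" "e a \<in> B \<Longrightarrow> \<theta> (e a) = a"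
    "x \<in> B \<Longrightarrow> y \<in> B \<Longrightarrow> x \<oplus>\<^bsub>L\<^esub> y \<in> B \<Longrightarrow> \<theta> (x \<oplus>\<^bsub>L\<^esub> y) = \<theta> x + \<theta> y"
    "x \<in> B \<Longrightarrow> y \<in> B \<Longrightarrow> x \<otimes>\<^bsub>L\<^esub> y \<in> B \<Longrightarrow> \<theta> (x \<otimes>\<^bsub>L\<^esub> y) = \<theta> x * \<theta> y"
    "j \<in> Q \<Longrightarrow> x \<in> B \<Longrightarrow> G j x \<in> B \<Longrightarrow> \<theta> (G j x) = F j (\<theta> x)"
  using assms by (auto simp: partial_embedding_def)

context
  fixes L :: "'r ring" and e :: "'a::comm_ring_1 \<Rightarrow> 'r" and A :: "'k set" and Q :: "'o set"
    and \<kappa> :: "'k \<Rightarrow> 'a" and \<kappa>' :: "'k \<Rightarrow> 'r" and F :: "'o \<Rightarrow> 'a \<Rightarrow> 'a" and G :: "'o \<Rightarrow> 'r \<Rightarrow> 'r" and \<sigma> :: "nat \<Rightarrow> 'r"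
  assumes L: "cring L" and e: "e \<in> ring_hom ring_of_type_algebra L" and \<kappa>: "\<And>a. a \<in> A \<Longrightarrow> \<kappa>' a = e (\<kappa> a)"
    and G: "\<And>j x. j \<in> Q \<Longrightarrow> x \<in> carrier L \<Longrightarrow> G j x \<in> carrier L" and \<sigma>_closed: "range \<sigma> \<subseteq> carrier L"
begin

interpretation L: cring L by (rule L)

lemma term_val_closed:
  assumes "set1_rterm t \<subseteq> A" "set2_rterm t \<subseteq> Q"
  shows "term_val L \<kappa>' G \<sigma> t \<in> carrier L"
proof -
  have "e a \<in> carrier L" for a using e by (auto simp: ring_hom_def)
  with assms show ?thesis using \<sigma>_closed by (induction t) (auto simp: \<kappa> intro!: G)
qed

lemma term_val_subterms_closed:
  "set1_rterm t \<subseteq> A \<Longrightarrow> set2_rterm t \<subseteq> Q \<Longrightarrow> term_val L \<kappa>' G \<sigma> ` subterms t \<subseteq> carrier L"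
proof (induction t)
  case (TVar v)
  then show ?case using term_val_closed[of "TVar v"] by simp
next
  case (TConst a)
  then show ?case using term_val_closed[of "TConst a"] by simp
qed (auto simp: term_val_closed intro!: G)

lemma term_val_qf_subterms_closed:
  "qf_consts \<phi> \<subseteq> A \<Longrightarrow> qf_ops \<phi> \<subseteq> Q \<Longrightarrow> term_val L \<kappa>' G \<sigma> ` qf_subterms \<phi> \<subseteq> carrier L"
  by (induction \<phi>) (simp_all add: image_Un term_val_subterms_closed)

lemma term_val_partial_embedding:
  assumes "partial_embedding Q F L G e B \<theta>" and \<sigma>: "\<forall>v. v \<notin> V \<longrightarrow> \<sigma> v = e (\<rho> v)"
    and "term_val L \<kappa>' G \<sigma> ` subterms t \<subseteq> B" "set1_rterm t \<subseteq> A" "set2_rterm t \<subseteq> Q"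
  shows "term_val ring_of_type_algebra \<kappa> F (\<lambda>v. if v \<in> V then \<theta> (\<sigma> v) else \<rho> v) t = \<theta> (term_val L \<kappa>' G \<sigma> t)"
proof -
  let ?val = "term_val L \<kappa>' G \<sigma>"
  note \<theta> = partial_embeddingD[OF assms(1)]
  show ?thesis using assms(3-5)
  proof (induction t)
    case (TVar v)
    then show ?case using \<theta>(2)[of "\<rho> v"] \<sigma> by auto
  next
    case TZero
    then show ?case using \<theta>(2)[of 0] ring_hom_zero_of_type[OF L.ring_axioms e] by simp
  next
    case TOne
    then show ?case using \<theta>(2)[of 1] ring_hom_one[OF e] by simp
  next
    case (TConst a)
    then show ?case using \<theta>(2)[of "\<kappa> a"] \<kappa>[of a] by simp
  next
    case (TPlus s t)
    then show ?case
      using \<theta>(3)[of "?val s" "?val t"] subterms_refl[of s] subterms_refl[of t] by (simp add: image_Un image_subset_iff)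
  next
    case (TMinus s t)
    then have in_B: "?val s \<in> B" "?val t \<in> B" "?val s \<ominus>\<^bsub>L\<^esub> ?val t \<in> B"
      using subterms_refl[of s] subterms_refl[of t] by (auto simp: image_Un image_subset_iff)
    have "?val s \<in> carrier L" "?val t \<in> carrier L" using term_val_closed TMinus.prems by auto
    then have "(?val s \<ominus>\<^bsub>L\<^esub> ?val t) \<oplus>\<^bsub>L\<^esub> ?val t = ?val s" by (simp add: L.minus_eq L.a_assoc L.l_neg)
    then have "\<theta> (?val s) = \<theta> (?val s \<ominus>\<^bsub>L\<^esub> ?val t) + \<theta> (?val t)" using \<theta>(3)[OF in_B(3,2)] in_B(1) by simp
    then show ?case using TMinus by (simp add: image_Un minus_of_type)
  next
    case (TTimes s t)
    then show ?case
      using \<theta>(4)[of "?val s" "?val t"] subterms_refl[of s] subterms_refl[of t] by (simp add: image_Un image_subset_iff)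
  next
    case (TOp j t)
    then show ?case using \<theta>(5)[of j "?val t"] subterms_refl[of t] by (simp add: image_subset_iff)
  qed
qed

lemma qf_sat_partial_embedding:
  assumes embedding: "partial_embedding Q F L G e B \<theta>" and \<sigma>: "\<forall>v. v \<notin> V \<longrightarrow> \<sigma> v = e (\<rho> v)"
    and "term_val L \<kappa>' G \<sigma> ` qf_subterms \<phi> \<subseteq> B" "qf_consts \<phi> \<subseteq> A" "qf_ops \<phi> \<subseteq> Q"
  shows "qf_sat ring_of_type_algebra \<kappa> F (\<lambda>v. if v \<in> V then \<theta> (\<sigma> v) else \<rho> v) \<phi> \<longleftrightarrow> qf_sat L \<kappa>' G \<sigma> \<phi>"
  using assms(3-5)
proof (induction \<phi>)
  case (QEq s t)
  then have "term_val L \<kappa>' G \<sigma> s \<in> B" "term_val L \<kappa>' G \<sigma> t \<in> B" using subterms_refl[of s] subterms_refl[of t] by auto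
  then show ?case
    using QEq term_val_partial_embedding[OF embedding \<sigma>] inj_on_eq_iff[OF partial_embeddingD(1)[OF embedding]]
    by (simp add: image_Un)
qed (auto simp: image_Un)

end

theorem ex_closedI_partial_embedding:
  fixes L :: "'r ring" and e :: "'a::comm_ring_1 \<Rightarrow> 'r" and A :: "'k set" and Q :: "'o set"
  assumes L: "cring L" and e: "e \<in> ring_hom ring_of_type_algebra L" and \<kappa>: "\<And>a. a \<in> A \<Longrightarrow> \<kappa>' a = e (\<kappa> a)"
    and G: "\<And>j x. j \<in> Q \<Longrightarrow> x \<in> carrier L \<Longrightarrow> G j x \<in> carrier L"
    and embed: "\<And>B. finite B \<Longrightarrow> B \<subseteq> carrier L \<Longrightarrow> \<exists>\<theta>. partial_embedding Q F L G e B \<theta>"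
  shows "ex_closed A Q ring_of_type_algebra \<kappa> F L \<kappa>' G e"
  unfolding ex_closed_def
proof (intro allI impI, elim conjE exE)
  fix \<phi> :: "('k, 'o) qf_formula" and V :: "nat set" and \<rho> \<sigma>
  assume \<phi>: "qf_consts \<phi> \<subseteq> A" "qf_ops \<phi> \<subseteq> Q" and \<sigma>_closed: "range \<sigma> \<subseteq> carrier L"
    and \<sigma>: "\<forall>v. v \<notin> V \<longrightarrow> \<sigma> v = e (\<rho> v)" and sat: "qf_sat L \<kappa>' G \<sigma> \<phi>"
  define B where "B = term_val L \<kappa>' G \<sigma> ` qf_subterms \<phi>"
  have "finite B" unfolding B_def by (rule finite_imageI[OF finite_qf_subterms])
  moreover have "B \<subseteq> carrier L" unfolding B_def by (rule term_val_qf_subterms_closed[OF L e \<kappa> G \<sigma>_closed \<phi>])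
  ultimately obtain \<theta> where \<theta>: "partial_embedding Q F L G e B \<theta>" using embed by blast
  let ?\<tau> = "\<lambda>v. if v \<in> V then \<theta> (\<sigma> v) else \<rho> v"
  have "qf_sat ring_of_type_algebra \<kappa> F ?\<tau> \<phi>"
    using qf_sat_partial_embedding[OF L e \<kappa> G \<sigma>_closed \<theta> \<sigma> _ \<phi>] sat by (simp add: B_def)
  then show "\<exists>\<tau>. range \<tau> \<subseteq> carrier (ring_of_type_algebra :: 'a ring) \<and> (\<forall>v. v \<notin> V \<longrightarrow> \<tau> v = \<rho> v) \<and>
      qf_sat ring_of_type_algebra \<kappa> F \<tau> \<phi>"
    by (intro exI[of _ ?\<tau>]) simp
qed

lemma (in mp_evaluation) ev_minus_eq_zero:
  assumes "f \<in> mpols N" "g \<in> mpols N" "ev f = ev g"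
  shows "ev (f - g) = \<zero>"
proof -
  have "ev (f - g) \<oplus> ev g = \<zero> \<oplus> ev g"
    using ev_add[of "f - g" g] assms ev_closed by (simp add: mpols_minus)
  then show ?thesis using assms by (simp only: add.r_cancel ev_closed mpols_minus zero_closed)
qed

context base_D_field
begin

lemma UC_locus_point:
  fixes L :: "'r ring"
  assumes UC: "UC \<D> \<iota> \<Delta>" and L: "field L" and alg: "D_algebra L e \<delta>"
    and ec: "ex_closed_field ring_of_type_algebra L e" and a: "a \<in> {..<n} \<rightarrow> carrier L"
    and q: "q \<in> mpols {..<n}" "mp_eval_in L e a q \<noteq> \<zero>\<^bsub>L\<^esub>"
  obtains x where "mp_eval id x q \<noteq> 0" "\<And>f. f \<in> mpols {..<n} \<Longrightarrow> mp_eval_in L e a f = \<zero>\<^bsub>L\<^esub> \<Longrightarrow> mp_eval id x f = 0"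
    "\<And>g. g \<in> mpols (prol_vars \<D> n) \<Longrightarrow> mp_eval_in L e (prol_point \<delta> a) g = \<zero>\<^bsub>L\<^esub> \<Longrightarrow> mp_eval id (nabla \<D> \<Delta> n x) g = 0"
proof -
  let ?V = "prol_vars \<D> n" and ?I = "vanishing_ideal_in L e {..<n} a"
    and ?J = "vanishing_ideal_in L e (prol_vars \<D> n) (prol_point \<delta> a)"
  interpret L: field L by fact
  note e = D_algebraD(2)[OF alg] and y = prol_point_closed[OF alg a]
  have I: "irreducible_variety {..<n} ?I" and J: "irreducible_variety ?V ?J"
    using primeideal_vanishing_ideal_in[OF L.domain_axioms e] a y finite_prol_vars
    by (auto simp: irreducible_variety_iff_prime)
  have "dominant_in_prolongation n ?I ?J"
    unfolding dominant_in_prolongation_def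
    using I J prol_ideal_prol_point[OF alg a] prol_proj_prol_point[OF alg a] by blast
  moreover have "has_smooth_rational_point ?V ?J"
    by (rule smooth_rational_point_of_ex_closed_field[OF ec L e finite_prol_vars y])
  moreover have "proj_pullback q \<in> mpols ?V - ?J"
    using q proj_pullback_closed prol_proj_prol_point[OF alg a] by (auto simp: prol_proj_def vanishing_ideal_in_def)
  ultimately obtain x where x: "x \<in> rational_points {..<n} ?I" "\<And>g. g \<in> ?J \<Longrightarrow> mp_eval id (nabla \<D> \<Delta> n x) g = 0"
    "mp_eval id (nabla \<D> \<Delta> n x) (proj_pullback q) \<noteq> 0"
    using UC unfolding UC_iff by blast
  show ?thesis
    using that[of x] x rational_pointD[OF x(1)] eval_nabla_proj_pullback[OF q(1)] by (simp add: vanishing_ideal_in_def)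
qed

lemma distinct_coordinates_polynomial:
  fixes L :: "'r ring"
  assumes L: "field L" and e: "e \<in> ring_hom ring_of_type_algebra L" and a: "a \<in> {..<n} \<rightarrow> carrier L" "inj_on a {..<n}"
  obtains q :: "(nat, 'a) mpol" where "q \<in> mpols {..<n}" "mp_eval_in L e a q \<noteq> \<zero>\<^bsub>L\<^esub>"
    "\<And>x. mp_eval id x q \<noteq> 0 \<Longrightarrow> inj_on x {..<n}"
proof -
  interpret L: field L by fact
  interpret A: mp_evaluation L e a "{..<n}" by (rule mp_evaluationI[OF L.is_cring e a(1)])
  define D where "D = {(i, k). i < n \<and> k < n \<and> i \<noteq> k}"
  define d where "d = (\<lambda>(i, k). mvar i - mvar k :: (nat, 'a) mpol)"
  have "finite D" by (rule finite_subset[of _ "{..<n} \<times> {..<n}"]) (auto simp: D_def)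
  have d_closed: "d p \<in> mpols {..<n}" if "p \<in> D" for p
    using that by (auto simp: D_def d_def intro!: mpols_minus mpols_var)
  have d_nonzero: "A.ev (d p) \<noteq> \<zero>\<^bsub>L\<^esub>" if p: "p \<in> D" for p
  proof
    assume zero: "A.ev (d p) = \<zero>\<^bsub>L\<^esub>"
    obtain i k where ik: "p = (i, k)" "i < n" "k < n" "i \<noteq> k" using p by (auto simp: D_def)
    then have "A.ev (mvar i) = A.ev (mvar k)"
      using A.ev_add[OF d_closed[OF p], of "mvar k"] mpols_var[of k "{..<n}"] A.ev_closed[of "mvar k"]
      unfolding zero by (simp add: d_def)
    then have "a i = a k" using ik by simp
    with a(2) ik show False by (auto dest: inj_onD)
  qed
  have "prod d D \<in> mpols {..<n} - vanishing_ideal_in L e {..<n} a"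
    by (rule primeideal_prod_notin[OF primeideal_vanishing_ideal_in[OF L.domain_axioms e a(1)] \<open>finite D\<close>])
      (use d_closed d_nonzero in \<open>auto simp: vanishing_ideal_in_def\<close>)
  then have "prod d D \<in> mpols {..<n}" "A.ev (prod d D) \<noteq> \<zero>\<^bsub>L\<^esub>" by (auto simp: vanishing_ideal_in_def)
  moreover have "inj_on x {..<n}" if nonzero: "mp_eval id x (prod d D) \<noteq> 0" for x
  proof (rule inj_onI, rule ccontr)
    fix i k assume "i \<in> {..<n}" "k \<in> {..<n}" "x i = x k" "i \<noteq> k"
    then have "(i, k) \<in> D" "mp_eval id x (d (i, k)) = 0" by (auto simp: D_def d_def mp_eval_ring_simps)
    then have "mp_eval id x (prod d D) = 0"
      unfolding mp_eval_prod[OF type_hom_id(1)] using \<open>finite D\<close> by (auto intro: prod_zero)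
    with nonzero show False by contradiction
  qed
  ultimately show ?thesis by (rule that)
qed

lemma specialisation_D_operator:
  fixes L :: "'r ring"
  assumes L: "cring L" and alg: "D_algebra L e \<delta>" and a: "a \<in> {..<n} \<rightarrow> carrier L"
    and nabla: "\<And>g. g \<in> mpols (prol_vars \<D> n) \<Longrightarrow> mp_eval_in L e (prol_point \<delta> a) g = \<zero>\<^bsub>L\<^esub> \<Longrightarrow>
      mp_eval id (nabla \<D> \<Delta> n x) g = 0"
    and ik: "i < n" "k < n" and j: "j \<in> {1..len \<D>}" and "\<delta> (a i) j = a k"
  shows "\<Delta> (x i) j = x k"
proof -
  interpret Y: mp_evaluation L e "prol_point \<delta> a" "prol_vars \<D> n"
    by (rule mp_evaluationI[OF L D_algebraD(2)[OF alg] prol_point_closed[OF alg a]])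
  have vars: "(j, i) \<in> prol_vars \<D> n" "(0, k) \<in> prol_vars \<D> n" using ik j by (auto simp: prol_vars_def)
  then have "Y.ev (mvar (j, i)) = Y.ev (mvar (0, k))"
    using ik assms(8) D_algebraD(5)[OF alg, of "a k"] a
    unfolding Y.ev_var[OF vars(1)] Y.ev_var[OF vars(2)] by (auto simp: prol_point_def Pi_iff)
  then have "Y.ev (mvar (j, i) - mvar (0, k)) = \<zero>\<^bsub>L\<^esub>" by (intro Y.ev_minus_eq_zero mpols_var vars)
  from nabla[OF _ this] have "nabla \<D> \<Delta> n x (j, i) = nabla \<D> \<Delta> n x (0, k)"
    using vars by (auto simp: mp_eval_ring_simps intro: mpols_minus mpols_var)
  then show ?thesis using vars j by (simp add: nabla_def)
qed

lemma partial_embedding_of_specialisation: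
  fixes L :: "'r ring"
  assumes L: "cring L" and alg: "D_algebra L e \<delta>" and a: "a \<in> {..<n} \<rightarrow> carrier L" and inj: "inj_on a {..<n}"
    and x_inj: "inj_on x {..<n}" and x: "\<And>f. f \<in> mpols {..<n} \<Longrightarrow> mp_eval_in L e a f = \<zero>\<^bsub>L\<^esub> \<Longrightarrow> mp_eval id x f = 0"
    and nabla: "\<And>g. g \<in> mpols (prol_vars \<D> n) \<Longrightarrow> mp_eval_in L e (prol_point \<delta> a) g = \<zero>\<^bsub>L\<^esub> \<Longrightarrow>
      mp_eval id (nabla \<D> \<Delta> n x) g = 0"
  shows "\<exists>\<theta>. partial_embedding {1..len \<D>} (\<lambda>j r. \<Delta> r j) L (\<lambda>j r. \<delta> r j) e (a ` {..<n}) \<theta>"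
proof -
  interpret A: mp_evaluation L e a "{..<n}" by (rule mp_evaluationI[OF L D_algebraD(2)[OF alg] a])
  let ?B = "a ` {..<n}"
  have x_eq: "mp_eval id x f = mp_eval id x g"
    if "f \<in> mpols {..<n}" "g \<in> mpols {..<n}" "A.ev f = A.ev g" for f g
    using x[OF mpols_minus[OF that(1,2)] A.ev_minus_eq_zero[OF that]] by (simp add: mp_eval_ring_simps)
  define \<theta> where "\<theta> r = x (the_inv_into {..<n} a r)" for r
  have \<theta>: "\<theta> (a i) = x i" "mvar i \<in> (mpols {..<n} :: (nat, 'a) mpol set)" if "i < n" for i
    using that the_inv_into_f_f[OF inj, of i] by (auto simp: \<theta>_def intro: mpols_var)
  have \<theta>_eq: "\<theta> r = mp_eval id x f" if r: "r \<in> ?B" and f: "f \<in> mpols {..<n}" "A.ev f = r" for r f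
  proof -
    obtain i where "i < n" "r = a i" using r by auto
    then show ?thesis using x_eq[of "mvar i" f] \<theta>[of i] f by (simp add: mp_eval_ring_simps)
  qed
  have "partial_embedding {1..len \<D>} (\<lambda>j r. \<Delta> r j) L (\<lambda>j r. \<delta> r j) e ?B \<theta>"
    unfolding partial_embedding_def
  proof (intro conjI ballI allI impI)
    show "inj_on \<theta> ?B"
      using x_inj \<theta>(1) by (auto simp: inj_on_def)
    show "\<theta> (e c) = c" if "e c \<in> ?B" for c using \<theta>_eq[OF that, of "mconst c"] by (simp add: mp_eval_ring_simps)
    fix r s assume "r \<in> ?B" "s \<in> ?B"
    then obtain i k where ik: "i < n" "r = a i" "k < n" "s = a k" by auto
    show "\<theta> (r \<oplus>\<^bsub>L\<^esub> s) = \<theta> r + \<theta> s" if "r \<oplus>\<^bsub>L\<^esub> s \<in> ?B"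
      using \<theta>_eq[OF that, of "mvar i + mvar k"] ik \<theta> by (simp add: A.ev_add mp_eval_ring_simps mpols_add)
    show "\<theta> (r \<otimes>\<^bsub>L\<^esub> s) = \<theta> r * \<theta> s" if "r \<otimes>\<^bsub>L\<^esub> s \<in> ?B"
      using \<theta>_eq[OF that, of "mvar i * mvar k"] ik \<theta> by (simp add: A.ev_mult mp_eval_ring_simps mpols_mult)
  next
    fix j r assume j: "j \<in> {1..len \<D>}" and "r \<in> ?B" and "\<delta> r j \<in> ?B"
    then obtain i k where ik: "i < n" "r = a i" "k < n" "\<delta> r j = a k" by auto
    then show "\<theta> (\<delta> r j) = \<Delta> (\<theta> r) j"
      using specialisation_D_operator[OF L alg a nabla ik(1,3) j] \<theta>(1) by simp
  qed
  then show ?thesis by (rule exI[of _ \<theta>])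
qed

lemma partial_embedding_of_UC:
  fixes L :: "'r ring"
  assumes UC: "UC \<D> \<iota> \<Delta>" and L: "field L" and alg: "D_algebra L e \<delta>"
    and ec: "ex_closed_field ring_of_type_algebra L e" and B: "finite B" "B \<subseteq> carrier L"
  shows "\<exists>\<theta>. partial_embedding {1..len \<D>} (\<lambda>j r. \<Delta> r j) L (\<lambda>j r. \<delta> r j) e B \<theta>"
proof -
  obtain as where as: "set as = B" "distinct as" using finite_distinct_list[OF B(1)] by blast
  define n where "n = length as"
  define a where "a = (!) as"
  have a_B: "a ` {..<n} = B" and inj: "inj_on a {..<n}"
    using as by (auto simp: a_def n_def in_set_conv_nth nth_eq_iff_index_eq intro!: inj_onI)
  then have a: "a \<in> {..<n} \<rightarrow> carrier L" using B(2) by auto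
  obtain q :: "(nat, 'a) mpol" where q: "q \<in> mpols {..<n}" "mp_eval_in L e a q \<noteq> \<zero>\<^bsub>L\<^esub>"
    and distinct: "\<And>x. mp_eval id x q \<noteq> 0 \<Longrightarrow> inj_on x {..<n}"
    using distinct_coordinates_polynomial[OF L D_algebraD(2)[OF alg] a inj] by blast
  obtain x where "mp_eval id x q \<noteq> 0" "\<And>f. f \<in> mpols {..<n} \<Longrightarrow> mp_eval_in L e a f = \<zero>\<^bsub>L\<^esub> \<Longrightarrow> mp_eval id x f = 0"
    "\<And>g. g \<in> mpols (prol_vars \<D> n) \<Longrightarrow> mp_eval_in L e (prol_point \<delta> a) g = \<zero>\<^bsub>L\<^esub> \<Longrightarrow> mp_eval id (nabla \<D> \<Delta> n x) g = 0"
    using UC_locus_point[OF UC L alg ec a q] by blast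
  then show ?thesis
    using partial_embedding_of_specialisation[OF fieldE(1)[OF L] alg a inj distinct] unfolding a_B by blast
qed

theorem ex_closed_of_UC:
  fixes L :: "'r ring"
  assumes UC: "UC \<D> \<iota> \<Delta>" and ext: "D_field_extension \<D> ring_of_type_algebra \<iota> \<Delta> L \<delta> e"
    and ec: "ex_closed_field ring_of_type_algebra L e"
  shows "ex_closed_D_field \<D> ring_of_type_algebra \<iota> \<Delta> L \<delta> e"
proof -
  have L: "field L" and alg: "D_algebra L e \<delta>" using ext by (auto simp: D_field_extension_iff)
  show ?thesis
    unfolding ex_closed_D_field_def
    using partial_embedding_of_UC[OF UC L alg ec] D_algebraD[OF alg]
    by (intro ex_closedI_partial_embedding) auto
qed

end
section \<open>The function field of a D-variety\<close>

no_notation iso_incl (infixl "\<lesssim>" 65)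

lemma poly_mapping_lepoll:
  assumes C: "infinite (UNIV :: 'c set)"
    and "(UNIV :: 'a set) \<lesssim> (UNIV :: 'c set)" "(UNIV :: 'b set) \<lesssim> (UNIV :: 'c set)"
  shows "(UNIV :: ('a \<Rightarrow>\<^sub>0 'b::zero) set) \<lesssim> (UNIV :: 'c set)"
proof -
  have "(UNIV :: ('a \<times> 'b) set) \<lesssim> (UNIV :: ('c \<times> 'c) set)"
    using times_lepoll_mono[OF assms(2,3)] by simp
  also have "(UNIV :: ('c \<times> 'c) set) \<approx> (UNIV :: 'c set)"
    using card_of_Times_same_infinite[OF C] by (simp add: eqpoll_iff_card_of_ordIso)
  finally obtain g :: "'a \<times> 'b \<Rightarrow> 'c" where g: "inj g" by (auto simp: lepoll_def)
  let ?graph = "\<lambda>f :: 'a \<Rightarrow>\<^sub>0 'b. (\<lambda>a. g (a, lookup f a)) ` keys f"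
  have "inj ?graph"
  proof (rule injI)
    fix f f' :: "'a \<Rightarrow>\<^sub>0 'b" assume eq: "?graph f = ?graph f'"
    have "lookup f a = b \<longleftrightarrow> lookup f' a = b" if "b \<noteq> 0" for a b
    proof -
      have in_graph: "g (a, b) \<in> ?graph h \<longleftrightarrow> lookup h a = b" for h
        using that inj_eq[OF g] by (auto simp: in_keys_iff)
      show ?thesis using eq in_graph[of f] in_graph[of f'] by simp
    qed
    then show "f = f'" by (metis poly_mapping_eqI)
  qed
  moreover have "range ?graph \<subseteq> Fpow UNIV" by (auto simp: Fpow_def)
  ultimately have "(UNIV :: ('a \<Rightarrow>\<^sub>0 'b) set) \<lesssim> Fpow (UNIV :: 'c set)" by (auto simp: lepoll_def)
  also have "\<dots> \<approx> (UNIV :: 'c set)" by (rule eqpoll_Fpow[OF C])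
  finally show ?thesis .
qed

lemma Loc_lepoll:
  fixes c :: "'a::field_char_0 \<Rightarrow> 'f::field" and b :: "nat \<Rightarrow> 'f"
  assumes "localisation c N b M"
  shows "carrier (localisation.Loc c N b M) \<lesssim> (UNIV :: 'a set)"
proof -
  interpret L: localisation c N b M by fact
  note infinite = infinite_UNIV_char_0[where 'a = 'a]
  have nat: "(UNIV :: nat set) \<lesssim> (UNIV :: 'a set)" using infinite infinite_le_lepoll by blast
  have mpol: "(UNIV :: (nat, 'a) mpol set) \<lesssim> (UNIV :: 'a set)"
    by (intro poly_mapping_lepoll infinite nat lepoll_refl)
  have "carrier L.Loc \<subseteq> (\<lambda>(f, g). L.evb f / L.evb g) ` UNIV" by (auto simp: L.Loc_def)
  then have "carrier L.Loc \<lesssim> (UNIV :: ((nat, 'a) mpol \<times> (nat, 'a) mpol) set)" by (rule subset_image_lepoll)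
  also have "\<dots> \<lesssim> (UNIV :: ('a \<times> 'a) set)" using times_lepoll_mono[OF mpol mpol] by simp
  also have "\<dots> \<approx> (UNIV :: 'a set)"
    using card_of_Times_same_infinite[OF infinite] by (simp add: eqpoll_iff_card_of_ordIso)
  finally show ?thesis .
qed

context
  fixes R :: "'r ring" and c :: "'a::comm_ring_1 \<Rightarrow> 'r" and x :: "'v \<Rightarrow> 'r" and N and h :: "'r \<Rightarrow> 's"
  assumes R: "cring R" and hom: "c \<in> ring_hom ring_of_type_algebra R" and x: "x \<in> N \<rightarrow> carrier R"
    and inj: "inj_on h (carrier R)"
begin

lemma mp_eval_in_image_ring:
  assumes f: "f \<in> mpols N"
  shows "mp_eval_in (image_ring h R) (h \<circ> c) (h \<circ> x) f = h (mp_eval_in R c x f)"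
proof -
  interpret R: cring R by (rule R)
  have "cring (image_ring h R)"
    using R.ring_iso_imp_img_cring[OF inj_imp_image_ring_iso[OF inj]]
    by (simp add: image_ring_def image_group_def monoid.defs)
  moreover have "h \<in> ring_hom R (image_ring h R)"
    using inj_imp_image_ring_iso[OF inj] by (simp add: ring_iso_def)
  ultimately show ?thesis by (rule mp_eval_in_compose_hom[OF mp_evaluationI[OF R hom x] _ _ f, symmetric])
qed

lemma vanishing_ideal_in_image_ring:
  "vanishing_ideal_in (image_ring h R) (h \<circ> c) N (h \<circ> x) = vanishing_ideal_in R c N x"
proof -
  interpret R: cring R by (rule R)
  interpret X: mp_evaluation R c x N by (rule mp_evaluationI[OF R hom x])
  have "h r = h \<zero>\<^bsub>R\<^esub> \<longleftrightarrow> r = \<zero>\<^bsub>R\<^esub>" if "r \<in> carrier R" for r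
    using inj_on_eq_iff[OF inj that R.zero_closed] .
  then show ?thesis
    by (auto simp: vanishing_ideal_in_def mp_eval_in_image_ring image_ring_zero X.ev_closed)
qed

end

lemma partial_embedding_of_fractions:
  fixes c :: "'a::field \<Rightarrow> 'f::field" and S :: "'s ring"
  assumes hom: "type_hom c" and p: "p \<in> rational_points N (vanishing_ideal c N b)"
    and dec: "dec \<in> ring_hom S ring_of_type_algebra" "\<And>a. dec (e a) = c a" and B: "B \<subseteq> carrier S"
    and num: "\<And>x. x \<in> B \<Longrightarrow> num x \<in> mpols N" and den: "\<And>x. x \<in> B \<Longrightarrow> den x \<in> mpols N"
    and dec_eq: "\<And>x. x \<in> B \<Longrightarrow> dec x = mp_eval c b (num x) / mp_eval c b (den x)"
    and den_b: "\<And>x. x \<in> B \<Longrightarrow> mp_eval c b (den x) \<noteq> 0" and den_p: "\<And>x. x \<in> B \<Longrightarrow> mp_eval id p (den x) \<noteq> 0"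
    and cross_p: "\<And>x y. x \<in> B \<Longrightarrow> y \<in> B \<Longrightarrow> x \<noteq> y \<Longrightarrow> mp_eval id p (num x * den y - num y * den x) \<noteq> 0"
  shows "partial_embedding {} F S G e B (\<lambda>x. mp_eval id p (num x) / mp_eval id p (den x))" (is "partial_embedding _ _ _ _ _ _ ?\<theta>")
proof -
  note eval = mp_eval_ring_simps[OF hom] mp_eval_ring_simps[OF type_hom_id(1)]
  have \<theta>_eq: "?\<theta> x = mp_eval id p f / mp_eval id p g"
    if x: "x \<in> B" and fg: "f \<in> mpols N" "g \<in> mpols N" and g: "mp_eval c b g \<noteq> 0" "mp_eval id p g \<noteq> 0"
      and eq: "dec x = mp_eval c b f / mp_eval c b g" for x f g
  proof -
    have "mp_eval c b (num x * g - f * den x) = 0"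
      using eq den_b[OF x] g(1) by (simp add: dec_eq[OF x] eval frac_eq_eq)
    then have "num x * g - f * den x \<in> vanishing_ideal c N b"
      using num[OF x] den[OF x] fg by (auto simp: vanishing_ideal_def intro: mpols_minus mpols_mult)
    from rational_pointD[OF p this] show ?thesis using den_p[OF x] g(2) by (simp add: eval frac_eq_eq)
  qed
  show ?thesis
    unfolding partial_embedding_def
  proof (intro conjI ballI allI impI)
    show "inj_on ?\<theta> B"
    proof (rule inj_onI, rule ccontr)
      fix x y assume "x \<in> B" "y \<in> B" "?\<theta> x = ?\<theta> y" "x \<noteq> y"
      then show False using cross_p[of x y] den_p by (simp add: eval frac_eq_eq)
    qed
    show "?\<theta> (e a) = a" if "e a \<in> B" for a using \<theta>_eq[OF that, of "mconst a" 1] dec(2) by (simp add: eval)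
    fix x y assume x: "x \<in> B" and y: "y \<in> B"
    then have closed: "x \<in> carrier S" "y \<in> carrier S" using B by auto
    note xy = num[OF x] num[OF y] den[OF x] den[OF y] den_b[OF x] den_b[OF y] den_p[OF x] den_p[OF y] dec_eq[OF x] dec_eq[OF y]
    show "?\<theta> (x \<oplus>\<^bsub>S\<^esub> y) = ?\<theta> x + ?\<theta> y" if "x \<oplus>\<^bsub>S\<^esub> y \<in> B"
      using \<theta>_eq[OF that, of "num x * den y + num y * den x" "den x * den y"] ring_hom_add[OF dec(1) closed] xy
      by (simp add: eval add_frac_eq mpols_add mpols_mult)
    show "?\<theta> (x \<otimes>\<^bsub>S\<^esub> y) = ?\<theta> x * ?\<theta> y" if "x \<otimes>\<^bsub>S\<^esub> y \<in> B"
      using \<theta>_eq[OF that, of "num x * num y" "den x * den y"] ring_hom_mult[OF dec(1) closed] xy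
      by (simp add: eval mpols_mult)
  qed simp
qed

lemma partial_embedding_function_field:
  fixes c :: "'a::field \<Rightarrow> 'f::field" and b :: "nat \<Rightarrow> 'f" and S :: "'s ring"
  assumes large: "large_field TYPE('a)" and hom: "type_hom c"
    and smooth: "has_smooth_rational_point {..<n} (vanishing_ideal c {..<n} b)"
    and dec: "dec \<in> ring_hom S ring_of_type_algebra" "inj_on dec (carrier S)" "\<And>a. dec (e a) = c a"
    and fraction: "\<And>x. x \<in> carrier S \<Longrightarrow>
      \<exists>f\<in>mpols {..<n}. \<exists>g\<in>mpols {..<n}. mp_eval c b g \<noteq> 0 \<and> dec x = mp_eval c b f / mp_eval c b g"
    and B: "finite B" "B \<subseteq> carrier S"
  shows "\<exists>\<theta>. partial_embedding {} F S G e B \<theta>"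
proof -
  let ?frac = "\<lambda>x (f, g). f \<in> mpols {..<n} \<and> g \<in> mpols {..<n} \<and> mp_eval c b g \<noteq> 0 \<and> dec x = mp_eval c b f / mp_eval c b g"
  have "\<forall>x\<in>B. \<exists>p. ?frac x p" using fraction B(2) by fast
  from bchoice[OF this] obtain frac where frac: "\<forall>x\<in>B. ?frac x (frac x)" by blast
  define num where "num = fst \<circ> frac"
  define den where "den = snd \<circ> frac"
  have num_den: "num x \<in> mpols {..<n}" "den x \<in> mpols {..<n}" "mp_eval c b (den x) \<noteq> 0"
    "dec x = mp_eval c b (num x) / mp_eval c b (den x)" if "x \<in> B" for x
    using bspec[OF frac that] by (simp_all add: num_def den_def split_beta)
  define cross where "cross x y = num x * den y - num y * den x" for x y
  define D where "D = {p \<in> B \<times> B. fst p \<noteq> snd p}"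
  have cross: "cross x y \<in> mpols {..<n} - vanishing_ideal c {..<n} b" if xy: "x \<in> B" "y \<in> B" "x \<noteq> y" for x y
  proof -
    have "dec x \<noteq> dec y" using xy B(2) dec(2) by (auto dest: inj_onD)
    then have "mp_eval c b (cross x y) \<noteq> 0"
      using xy num_den(3) by (simp add: cross_def num_den(4) mp_eval_ring_simps[OF hom] frac_eq_eq)
    then show ?thesis
      using xy num_den(1,2) by (auto simp: cross_def vanishing_ideal_def intro: mpols_minus mpols_mult)
  qed
  have avoid: "den ` B \<union> case_prod cross ` D \<subseteq> mpols {..<n} - vanishing_ideal c {..<n} b"
    using num_den(2,3) cross by (auto simp: vanishing_ideal_def D_def)
  have finite: "finite (den ` B \<union> case_prod cross ` D)" using B(1) by (simp add: D_def)
  obtain p where p: "p \<in> rational_points {..<n} (vanishing_ideal c {..<n} b)"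
    and nonzero: "\<And>f. f \<in> den ` B \<union> case_prod cross ` D \<Longrightarrow> mp_eval id p f \<noteq> 0"
    by (rule large_field_avoid[OF large irreducible_vanishing_ideal[OF finite_lessThan hom] smooth finite avoid]) (rule that)
  have cross_p: "mp_eval id p (num x * den y - num y * den x) \<noteq> 0" if "x \<in> B" "y \<in> B" "x \<noteq> y" for x y
    using nonzero[of "cross x y"] that by (force simp: cross_def D_def)
  have "partial_embedding {} F S G e B (\<lambda>x. mp_eval id p (num x) / mp_eval id p (den x))"
    by (rule partial_embedding_of_fractions[OF hom p dec(1,3) B(2) num_den(1,2,4,3) _ cross_p]) (simp_all add: nonzero)
  then show ?thesis by blast
qed

lemma ex_closed_function_field:
  fixes c :: "'a::field \<Rightarrow> 'f::field" and b :: "nat \<Rightarrow> 'f" and enc :: "'f \<Rightarrow> 's"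
  assumes large: "large_field TYPE('a)" and smooth: "has_smooth_rational_point {..<n} (vanishing_ideal c {..<n} b)"
    and "localisation c {..<n} b M" and inj: "inj_on enc (carrier (localisation.Loc c {..<n} b M))"
  shows "ex_closed_field ring_of_type_algebra (image_ring enc (localisation.Loc c {..<n} b M)) (enc \<circ> c)"
proof -
  interpret F: localisation c "{..<n}" b M by fact
  let ?S = "image_ring enc F.Loc" and ?dec = "inv_into (carrier F.Loc) enc"
  have iso: "enc \<in> ring_iso F.Loc ?S" by (rule inj_imp_image_ring_iso[OF inj])
  have S: "cring ?S"
    using F.Loc.ring_iso_imp_img_cring[OF iso] by (simp add: image_ring_def image_group_def monoid.defs)
  have dec_enc: "?dec (enc x) = x" if "x \<in> carrier F.Loc" for x by (rule inv_into_f_f[OF inj that])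
  have "enc \<in> ring_hom F.Loc ?S" using iso by (simp add: ring_iso_def)
  then have e: "enc \<circ> c \<in> ring_hom ring_of_type_algebra ?S" by (rule ring_hom_trans[OF F.hom_Loc])
  have "\<exists>\<theta>. partial_embedding {} (\<lambda>_ r. r) ?S (\<lambda>_ r. r) (enc \<circ> c) B \<theta>"
    if B: "finite B" "B \<subseteq> carrier ?S" for B
  proof (rule partial_embedding_function_field[OF large F.hom smooth _ _ _ _ B])
    show "?dec \<in> ring_hom ?S ring_of_type_algebra"
      using ring_iso_set_sym[OF F.Loc.ring_axioms iso] by (auto simp: ring_iso_def ring_hom_def)
    show "inj_on ?dec (carrier ?S)" by (simp add: image_ring_carrier inj_on_inv_into)
    show "?dec ((enc \<circ> c) a) = c a" for a using F.hom_Loc dec_enc by (auto simp: ring_hom_def)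
    fix x assume "x \<in> carrier ?S"
    then have "?dec x \<in> carrier F.Loc" using dec_enc by (auto simp: image_ring_carrier)
    then show "\<exists>f\<in>mpols {..<n}. \<exists>g\<in>mpols {..<n}. F.evb g \<noteq> 0 \<and> ?dec x = F.evb f / F.evb g"
      by (elim F.in_LocE) blast
  qed
  then show ?thesis unfolding ex_closed_field_def by (intro ex_closedI_partial_embedding[OF S e]) auto
qed

context base_D_field
begin

lemma exists_D_structure_of_section:
  fixes c :: "'a \<Rightarrow> 'f::field" and b :: "nat \<Rightarrow> 'f"
  assumes "D_localisation \<D> \<iota> \<Delta> c {..<n} b M"
    and V: "irreducible_D_variety \<D> \<iota> \<Delta> n I s" and b: "I = vanishing_ideal c {..<n} b"
  obtains \<delta> where "D_algebra (localisation.Loc c {..<n} b M) c \<delta>"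
    "\<And>i j. i < n \<Longrightarrow> j \<in> I\<^sub>\<D> \<Longrightarrow> \<delta> (b i) j = mp_eval c b (s (j, i))"
proof -
  interpret L: D_localisation \<D> \<iota> \<Delta> c "{..<n}" b M by fact
  note s = irreducible_D_varietyD(2)[OF V] and I = irreducible_varietyD(4)[OF irreducible_D_varietyD(1)[OF V]]
  let ?w = "\<lambda>v. L.evb (s v)" and ?Y = "\<lambda>i. \<lambda>j\<in>I\<^sub>\<D>. L.evb (s (j, i))"
  have w: "?w \<in> prol_vars \<D> n \<rightarrow> carrier L.Loc" using s L.eval_in_Loc by auto
  have Y: "L.lifts {..<n} ?Y"
    using w section_point_0[OF V L.hom b] by (auto simp: L.lifts_def base_change_sel prol_vars_def)
  have "mp_eval c ?w (prol_poly \<D> \<iota> \<Delta> n f j) = 0" if "f \<in> mpols {..<n}" "L.evb f = 0" "j \<in> I\<^sub>\<D>" for f j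
  proof -
    have "f \<in> I" using that by (simp add: b vanishing_ideal_def)
    then have "mp_eval mconst s (prol_poly \<D> \<iota> \<Delta> n f j) \<in> I"
      using irreducible_D_varietyD(3)[OF V] prol_poly_in_prol_ideal[OF I] that(3) by blast
    then show ?thesis by (simp add: b vanishing_ideal_def mp_eval_subst[OF L.hom])
  qed
  then have "mp_eval_in L.LD (twist c) ?Y f = \<zero>\<^bsub>L.LD\<^esub>" if "f \<in> mpols {..<n}" "L.evb f = 0" for f
    using L.eval_zero_of_prol_poly[OF w] that by blast
  from L.extend_D_structure[OF Y this]
  obtain \<delta> where "D_algebra L.Loc c \<delta>" "\<And>i. i \<in> {..<n} \<Longrightarrow> \<delta> (b i) = ?Y i" by blast
  then show ?thesis using that by simp
qed

lemma sharp_point_of_generic_sharp_point: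
  fixes L :: "'r ring"
  assumes L: "field L" and alg: "D_algebra L e \<delta>" and ec: "ex_closed_D_field \<D> ring_of_type_algebra \<iota> \<Delta> L \<delta> e"
    and V: "irreducible_D_variety \<D> \<iota> \<Delta> n I s"
    and a: "a \<in> {..<n} \<rightarrow> carrier L" and I: "I = vanishing_ideal_in L e {..<n} a"
    and sharp: "\<And>i j. i < n \<Longrightarrow> j \<in> I\<^sub>\<D> \<Longrightarrow> \<delta> (a i) j = mp_eval_in L e a (s (j, i))"
  shows "sharp_points \<D> \<Delta> n I s \<noteq> {}"
proof -
  let ?W = "{1..len \<D>} \<times> {..<n}"
  note irreducible = irreducible_D_varietyD(1)[OF V]
  obtain P h where "smooth_equations {..<n} I P h"
    using exists_smooth_equations[OF irreducible_varietyD(2,1)[OF irreducible]] .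
  note equations = smooth_equationsD[OF this]
  have s: "s \<in> ?W \<rightarrow> mpols {..<n}" using irreducible_D_varietyD(2)[OF V] by (auto simp: prol_vars_def)
  obtain x where x: "\<And>f. f \<in> P \<Longrightarrow> mp_eval id x f = 0" "mp_eval id x h \<noteq> 0"
    and x_sharp: "\<And>j i. (j, i) \<in> ?W \<Longrightarrow> \<Delta> (x i) j = mp_eval id x (s (j, i))"
    by (rule ex_closed_solve[OF ec[unfolded ex_closed_D_field_def] D_algebraD(1,2)[OF alg] finite_lessThan
          equations(1) _ equations(3) _ _ s a])
      (use equations(2-4) sharp in \<open>auto simp: I vanishing_ideal_in_def\<close>)
  have zero: "mp_eval id x f = 0" if "f \<in> I" for f by (rule equations(5)[OF x that])
  let ?x = "restrict x {..<n}"
  have eval: "mp_eval id ?x f = mp_eval id x f" if "f \<in> mpols {..<n}" for f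
    by (rule mp_eval_cong[OF type_hom_id(1) that]) simp
  have "nabla \<D> \<Delta> n ?x v = mp_eval id ?x (s v)" if v: "v \<in> prol_vars \<D> n" for v
  proof -
    obtain j i where ji: "v = (j, i)" "j \<in> I\<^sub>\<D>" "i < n" using v by (auto simp: prol_vars_def)
    have "mp_eval id ?x (s v) = mp_eval id x (s v)" using eval irreducible_D_varietyD(2)[OF V] v by blast
    moreover have "mp_eval id x (s (0, i)) = x i"
      using zero[OF irreducible_D_varietyD(4)[OF V ji(3)]] by (simp add: mp_eval_ring_simps)
    ultimately show ?thesis using ji v x_sharp[of j i] by (cases "j = 0") (simp_all add: nabla_def)
  qed
  then have "restrict (nabla \<D> \<Delta> n ?x) (prol_vars \<D> n) = (\<lambda>v\<in>prol_vars \<D> n. mp_eval id ?x (s v))"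
    by (rule restrict_ext)
  then have "nabla \<D> \<Delta> n ?x = (\<lambda>v\<in>prol_vars \<D> n. mp_eval id ?x (s v))" by (simp add: nabla_def)
  moreover have "?x \<in> rational_points {..<n} I"
    by (rule restrict_rational_pointI[OF irreducible_varietyD(4)[OF irreducible] zero])
  ultimately have "?x \<in> sharp_points \<D> \<Delta> n I s" by (simp add: sharp_points_def)
  then show ?thesis by blast
qed

theorem sharp_point_of_ex_closed:
  fixes I :: "(nat, 'a) mpol set"
  assumes large: "large_field TYPE('a)"
    and ec: "\<And>(L :: ('a + 'l) ring) \<delta> e. D_field_extension \<D> ring_of_type_algebra \<iota> \<Delta> L \<delta> e \<Longrightarrow>
      ex_closed_field ring_of_type_algebra L e \<Longrightarrow> ex_closed_D_field \<D> ring_of_type_algebra \<iota> \<Delta> L \<delta> e"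
    and V: "irreducible_D_variety \<D> \<iota> \<Delta> n I s" and smooth: "has_smooth_rational_point {..<n} I"
  shows "sharp_points \<D> \<Delta> n I s \<noteq> {}"
proof -
  define c where "c = (to_univ :: 'a \<Rightarrow> 'a univ_dom)"
  have hom: "type_hom c" by (simp add: c_def)
  obtain b :: "nat \<Rightarrow> 'a univ_dom" where b: "I = vanishing_ideal c {..<n} b"
    using generic_point[OF irreducible_varietyD(2,1)[OF irreducible_D_varietyD(1)[OF V]]] unfolding c_def .
  define M where "M = {g \<in> mpols {..<n}. mp_eval c b g \<noteq> 0}"
  have loc: "D_localisation \<D> \<iota> \<Delta> c {..<n} b M"
    unfolding M_def by (intro D_localisation.intro localisation_function_field[OF hom] base_D_field_axioms)
  interpret F: D_localisation \<D> \<iota> \<Delta> c "{..<n}" b M by (rule loc)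
  have field: "field F.Loc" by (rule F.field_Loc) (simp add: M_def)
  obtain \<delta> where alg: "D_algebra F.Loc c \<delta>" and \<delta>: "\<And>i j. i < n \<Longrightarrow> j \<in> I\<^sub>\<D> \<Longrightarrow> \<delta> (b i) j = F.evb (s (j, i))"
    using exists_D_structure_of_section[OF loc V b] by blast
  obtain code :: "'a univ_dom \<Rightarrow> 'a" where "inj_on code (carrier F.Loc)"
    using Loc_lepoll[OF F.localisation_axioms] by (auto simp: lepoll_def)
  then have "inj_on (Inl \<circ> code :: _ \<Rightarrow> 'a + 'l) (carrier F.Loc)" by (auto simp: inj_on_def)
  then obtain enc :: "'a univ_dom \<Rightarrow> 'a + 'l" where inj: "inj_on enc (carrier F.Loc)" by blast
  let ?S = "image_ring enc F.Loc"
  have S: "field ?S" by (rule field.inj_imp_image_ring_is_field[OF field inj])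
  define \<delta>' where "\<delta>' = (\<lambda>x. base_change_map enc (\<delta> (inv_into (carrier F.Loc) enc x)))"
  have alg': "D_algebra ?S (enc \<circ> c) \<delta>'" unfolding \<delta>'_def by (rule D_algebra_image[OF alg inj])
  have ec_field: "ex_closed_field ring_of_type_algebra ?S (enc \<circ> c)"
    by (rule ex_closed_function_field[OF large smooth[unfolded b] F.localisation_axioms inj])
  have b_closed: "b \<in> {..<n} \<rightarrow> carrier F.Loc" using F.coordinate_in_Loc by blast
  show ?thesis
  proof (rule sharp_point_of_generic_sharp_point[OF S alg' ec[OF _ ec_field] V])
    show "D_field_extension \<D> ring_of_type_algebra \<iota> \<Delta> ?S \<delta>' (enc \<circ> c)" using S alg' by (simp add: D_field_extension_iff)
    show "enc \<circ> b \<in> {..<n} \<rightarrow> carrier ?S" using b_closed by (auto simp: image_ring_carrier)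
    show "I = vanishing_ideal_in ?S (enc \<circ> c) {..<n} (enc \<circ> b)"
      by (simp only: b vanishing_ideal_in_image_ring[OF F.cring_Loc F.hom_Loc b_closed inj] F.vanishing_ideal_in_Loc[OF b_closed])
    fix i j assume ij: "i < n" "j \<in> I\<^sub>\<D>"
    then have s: "s (j, i) \<in> mpols {..<n}" using irreducible_D_varietyD(2)[OF V] by (auto simp: prol_vars_def)
    have "\<delta>' ((enc \<circ> b) i) j = enc (F.evb (s (j, i)))"
      using ij inv_into_f_f[OF inj F.coordinate_in_Loc] \<delta> by (simp add: \<delta>'_def base_change_map_def)
    then show "\<delta>' ((enc \<circ> b) i) j = mp_eval_in ?S (enc \<circ> c) (enc \<circ> b) (s (j, i))"
      using mp_eval_in_image_ring[OF F.cring_Loc F.hom_Loc b_closed inj s] F.mp_eval_in_Loc[OF s b_closed] by simp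
  qed
qed

end

theorem theorem4p6:
  fixes \<D> :: "('k::field_char_0, 'd::comm_ring_1) based_algebra"
    and \<iota> :: "'k \<Rightarrow> 'a::field_char_0"
    and \<Delta> :: "'a \<Rightarrow> nat \<Rightarrow> 'a"
  assumes "finite_local_algebra \<D>"
    and "D_field \<D> ring_of_type_algebra \<iota> \<Delta>"
    and "large_field TYPE('a)"
  shows "(UC \<D> \<iota> \<Delta> \<longleftrightarrow>
           (\<forall>n I s. irreducible_D_variety \<D> \<iota> \<Delta> n I s \<and> has_smooth_rational_point {..<n} I \<longrightarrow>
              zariski_dense_in {..<n} I (point_ideal {..<n} ` sharp_points \<D> \<Delta> n I s))) \<and>
         (UC \<D> \<iota> \<Delta> \<longleftrightarrow>
           (\<forall>n I s. irreducible_D_variety \<D> \<iota> \<Delta> n I s \<and> has_smooth_rational_point {..<n} I \<longrightarrow>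
              sharp_points \<D> \<Delta> n I s \<noteq> {})) \<and>
         (UC \<D> \<iota> \<Delta> \<longleftrightarrow>
           (\<forall>n I s. irreducible_D_variety \<D> \<iota> \<Delta> n I s \<and> smooth_variety {..<n} I \<and>
              rational_points {..<n} I \<noteq> {} \<longrightarrow>
              sharp_points \<D> \<Delta> n I s \<noteq> {})) \<and>
         (UC \<D> \<iota> \<Delta> \<longleftrightarrow>
           (\<forall>(L :: ('a + 'l) ring) \<delta> e.
              D_field_extension \<D> ring_of_type_algebra \<iota> \<Delta> L \<delta> e \<and>
              ex_closed_field ring_of_type_algebra L e \<longrightarrow>
              ex_closed_D_field \<D> ring_of_type_algebra \<iota> \<Delta> L \<delta> e))"
proof -
  interpret base_D_field \<D> \<iota> \<Delta> by unfold_locales (fact assms)+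
  show ?thesis (is "(?UC \<longleftrightarrow> ?dense) \<and> (?UC \<longleftrightarrow> ?sharp) \<and> (?UC \<longleftrightarrow> ?smooth_sharp) \<and> (?UC \<longleftrightarrow> ?ex_closed)")
  proof -
    have UC_dense: "?UC \<longrightarrow> ?dense" using sharp_points_dense_of_UC by blast
    have dense_sharp: "?dense \<longrightarrow> ?sharp" using dense_nonempty irreducible_D_varietyD(1) by blast
    have sharp_smooth: "?sharp \<longrightarrow> ?smooth_sharp"
      using smooth_variety_rational_point[OF irreducible_varietyD(1,4)] irreducible_D_varietyD(1) by (meson ex_in_conv)
    have smooth_UC: "?smooth_sharp \<longrightarrow> ?UC" using UC_of_smooth_D_varieties[OF assms(3)] by blast
    have UC_ex_closed: "?UC \<longrightarrow> ?ex_closed" using ex_closed_of_UC by blast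
    have ex_closed_sharp: "?ex_closed \<longrightarrow> ?sharp" using sharp_point_of_ex_closed[OF assms(3)] by blast
    show ?thesis using UC_dense dense_sharp sharp_smooth smooth_UC UC_ex_closed ex_closed_sharp by argo
  qed
qed

end
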